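(* The $2$-functor $\Gamma \colon \mathbf{PARFL} \to \mathbf{LexProf}\text{-}\mathbf{CAT}$ is an equivalence on hom-categories, and its biessential image (the objects equivalent in $\mathbf{LexProf}\text{-}\mathbf{CAT}$ to one in the image of $\Gamma$) comprises the absolute-tensored $\mathbf{LexProf}$-categories. Thus $\Gamma$ exhibits $\mathbf{PARFL}$ as biequivalent to the full and locally full sub-$2$-category of $\mathbf{LexProf}\text{-}\mathbf{CAT}$ on the absolute-tensored $\mathbf{LexProf}$-categories.
   Context: **$\mathbf{LexProf}$.** $\mathbf{FL}(\mathbb A,\mathbb B)$ is the category of finite-limit-preserving functors. The bicategory $\mathbf{LexProf}$ has as objects small categories with finite limits; $\mathbf{LexProf}(\mathbb A,\mathbb B) = [\mathbb A^{\mathrm{op}}, \mathbf{FL}(\mathbb B,\mathbf{Set})]$, i.e. functors $\mathbb A^{\mathrm{op}}\times\mathbb B\to\mathbf{Set}$ preserving finite limits in the second variable; identities $I_{\mathbb A}(a',a)=\mathbb A(a',a)$; composition $(N\otimes M)(a,c)=\int^{b} N(b,c)\times M(a,b)$. **$\mathbf{LexProf}$-categories.** A $\mathbf{LexProf}$-category $\mathcal C$ has a (possibly large) set of objects; for each object $X$ an extent $\epsilon X\in\mathbf{LexProf}$; hom-objects $\mathcal C(X,Y)\in\mathbf{LexProf}(\epsilon X,\epsilon Y)$; and composition $2$-cells $\mathcal C(Y,Z)\otimes\mathcal C(X,Y)\to\mathcal C(X,Z)$ and identity $2$-cells $\iota_X\colon I_{\epsilon X}\to\mathcal C(X,X)$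 satisfying associativity and unit axioms. So composition amounts to functions $\mathcal C(Y,Z)(j,k)\times\mathcal C(X,Y)(i,j)\to\mathcal C(X,Z)(i,k)$ natural in $i,k$ and dinatural in $j$. A $\mathbf{LexProf}$-functor $F\colon\mathcal C\to\mathcal D$ is an extent-preserving map on objects with $2$-cells $\mathcal C(X,Y)\to\mathcal D(FX,FY)$ compatible with composition and identities. A $\mathbf{LexProf}$-transformation $F\Rightarrow G$ is a family of $2$-cells $I_{\epsilon X}\to\mathcal D(FX,GX)$ satisfying the usual naturality axiom. These form a $2$-category $\mathbf{LexProf}\text{-}\mathbf{CAT}$. $\mathcal C_{\mathbb A}$ denotes the objects of extent $\mathbb A$. **Tensors.** A tensor of $X\in\mathcal C_{\mathbb A}$ by $W\in\mathbf{LexProf}(\mathbb A,\mathbb B)$ is $W\cdot X\in\mathcal C_{\mathbb B}$ with $u\colon W\to\mathcal C(X,W\cdot X)$ such that, for all $U\in\mathbf{LexProf}(\mathbb B,\mathbb D)$ and $Z\in\mathcal C_{\mathbb D}$, sending $f\colon U\to\mathcal C(W\cdot X,Z)$ to $U\otimes W\xrightarrow{f\otimes u}\mathcal C(W\cdot X,Z)\otimes\mathcal C(X,W\cdot X)\to\mathcal C(X,Z)$ is a bijection onto $2$-cells $U\otimes W\to\mathcal C(X,Z)$. It is preserved by a $\mathbf{LexProf}$-functor $F\colon\mathcal C\to\mathcal D$ if $W\to\mathcal C(X,W\cdot X)\to\mathcal D(FX,F(W\cdot X))$ exhibits $F(W\cdot X)$ as $W\cdot FX$. Tensors by $W$ are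 absolute if preserved by every $\mathbf{LexProf}$-functor; $\mathcal C$ is absolute-tensored if it admits all absolute tensors, i.e. all tensors by such $W$. **$\mathbf{PARFL}$.** A left-exact sieve on a category $\mathcal C$ is a collection $\mathcal S$ of finite-limit-preserving functors $\mathbb A\to\mathcal C$ with small finitely complete domain ($\mathcal S[\mathbb A]$ being those with domain $\mathbb A$) such that: (i) $X\in\mathcal S[\mathbb B]$ and $G\in\mathbf{FL}(\mathbb A,\mathbb B)$ imply $XG\in\mathcal S[\mathbb A]$; (ii) $X\in\mathcal S[\mathbb A]$ and $X\cong Y\colon\mathbb A\to\mathcal C$ imply $Y\in\mathcal S[\mathbb A]$; (iii) each object of $\mathcal C$ is in the image of some functor in $\mathcal S$. A partially finitely complete category is a category $\mathcal C$ with a left-exact sieve $\mathcal S_{\mathcal C}$. A partially finite-limit-preserving functor is a functor $F\colon\mathcal C\to\mathcal D$ with $FX\in\mathcal S_{\mathcal D}$ for all $X\in\mathcal S_{\mathcal C}$. With all natural transformations these form the $2$-category $\mathbf{PARFL}$. **$\Gamma$.** For $\mathcal C\in\mathbf{PARFL}$, $\Gamma(\mathcal C)$ has as objects of extent $\mathbb A$ the elements of $\mathcal S_{\mathcal C}[\mathbb A]$; hom-objects $\Gamma(\mathcal C)(X,Y)(i,j)=\mathcal C(Xi,Yj)$; composition given by that of $\mathcal C$; identities $\mathbb A(i,j)\to\mathcal C(Xi,Xj)$ given by the action of $X$ on morphisms. For a $1$-cell $F\colon\mathcal C\to\mathcal D$, $\Gamma(F)$ sends $X$ to $FX$ and acts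 on homs $\mathcal C(Xi,Yj)\to\mathcal D(FXi,FYj)$ as $F$ does. For a $2$-cell $\alpha\colon F\Rightarrow G$, the component of $\Gamma(\alpha)$ at $X\in\mathcal S_{\mathcal C}[\mathbb A]$ is the $2$-cell $I_{\mathbb A}\to\Gamma(\mathcal D)(FX,GX)$ corresponding to the dinatural family $\alpha_{Xi}\in\mathcal D(FXi,GXi)$. *)

theory Defs
  imports Main "HOL-Library.FuncSet"
begin

section \<open>Universes\<close>

text \<open>
  A Grothendieck universe, presented as a type. An element \<open>x\<close> is a small set with elements
  \<open>elts x\<close>; an arbitrary set of type \<open>'v set\<close> is a class, i.e. a possibly large set. As in SGA 4,
  neither infinity nor foundation is required, so the hereditarily finite sets are a model.
\<close>

class universe =
  fixes elts :: "'a \<Rightarrow> 'a set"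
  assumes elts_inject: "elts x = elts y \<Longrightarrow> x = y"
    and elts_subset: "B \<subseteq> elts x \<Longrightarrow> \<exists>y. elts y = B"
    and elts_replacement: "\<exists>y. elts y = f ` elts x"
    and elts_Union: "\<exists>y. elts y = (\<Union>z\<in>elts x. elts z)"
    and elts_Pow: "\<exists>y. elts y = {z. elts z \<subseteq> elts x}"

definition small :: "'v::universe set \<Rightarrow> bool" where
  "small S \<longleftrightarrow> (\<exists>x. elts x = S)"

text \<open>The element of the universe coding a small set (unspecified on proper classes).\<close>

definition vset :: "'v::universe set \<Rightarrow> 'v" where
  "vset S = (SOME x. elts x = S)"

definition vpair :: "'v::universe \<Rightarrow> 'v \<Rightarrow> 'v" where
  "vpair x y = vset {vset {x}, vset {x, y}}"

text \<open>The graph of the restriction of \<open>f\<close> to the small set \<open>S\<close>.\<close>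

definition vgraph :: "'v::universe set \<Rightarrow> ('v \<Rightarrow> 'v) \<Rightarrow> 'v" where
  "vgraph S f = vset ((\<lambda>x. vpair x (f x)) ` S)"

lemma small_subset: "small S \<Longrightarrow> T \<subseteq> S \<Longrightarrow> small T"
  unfolding small_def using elts_subset by blast

lemma small_image: "small S \<Longrightarrow> small (f ` S)" for f :: "'v::universe \<Rightarrow> 'v"
  unfolding small_def using elts_replacement by blast

lemma small_empty: "small {}"
  using small_subset[of "elts undefined"] unfolding small_def by blast

lemma small_Pow: "small S \<Longrightarrow> small {z. elts z \<subseteq> S}"
  unfolding small_def using elts_Pow by blast

lemma small_doubleton: "small {x, y}"
proof -
  obtain e where e: "elts e = ({}::'a set)" using small_empty small_def by metis
  have "small {z::'a. elts z \<subseteq> {}}" by (rule small_Pow[OF small_empty])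
  moreover have "elts z \<subseteq> {} \<longleftrightarrow> z = e" for z :: 'a
    using e elts_inject[of z e] by blast
  ultimately have s1: "small {e}" by simp
  then obtain o' where o: "elts o' = {e}" using small_def by metis
  have "small {z. elts z \<subseteq> {e}}" by (rule small_Pow[OF s1])
  then have "small {e, o'}" by (rule small_subset) (use e o in auto)
  then have "small ((\<lambda>z. if z = e then x else y) ` {e, o'})" by (rule small_image)
  moreover have "o' \<noteq> e" using e o by blast
  then have "(\<lambda>z. if z = e then x else y) ` {e, o'} = {x, y}" by (simp add: insert_commute)
  ultimately show ?thesis by (simp only:)
qed

lemma elts_vset: "small S \<Longrightarrow> elts (vset S) = S"
  unfolding small_def vset_def by (rule someI_ex)

lemma vset_inject: "small S \<Longrightarrow> small T \<Longrightarrow> vset S = vset T \<longleftrightarrow> S = T"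
  by (metis elts_vset)

lemma vpair_inject: "vpair x y = vpair x' y' \<longleftrightarrow> x = x' \<and> y = y'"
proof -
  have s: "small {a}" for a :: 'a using small_doubleton[of a a] by simp
  have i: "vset {a} = vset {b} \<longleftrightarrow> {a} = {b}" "vset {a} = vset {b, c} \<longleftrightarrow> {a} = {b, c}"
    "vset {a, b} = vset {c, d} \<longleftrightarrow> {a, b} = {c, d}" for a b c d :: 'a
    by (intro vset_inject s small_doubleton)+
  have j: "vset {a, b} = vset {c} \<longleftrightarrow> {a, b} = {c}" for a b c :: 'a
    using i(2)[of c a b] by (simp only: eq_commute)
  have "{a, b} = {c} \<longleftrightarrow> a = c \<and> b = c" "{c} = {a, b} \<longleftrightarrow> a = c \<and> b = c" for a b c :: 'a
    by blast+
  then show ?thesis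
    unfolding vpair_def i j doubleton_eq_iff by blast
qed

lemma vgraph_inject:
  assumes "small S" "small T" "vgraph S f = vgraph T g"
  shows "S = T \<and> (\<forall>x\<in>S. f x = g x)"
proof -
  have "(\<lambda>x. vpair x (f x)) ` S = (\<lambda>x. vpair x (g x)) ` T"
    using assms unfolding vgraph_def by (simp add: vset_inject small_image)
  then have *: "(\<exists>x\<in>S. z = vpair x (f x)) \<longleftrightarrow> (\<exists>x\<in>T. z = vpair x (g x))" for z
    unfolding set_eq_iff image_iff by blast
  have "x \<in> T \<and> f x = g x" if "x \<in> S" for x
    using iffD1[OF *, OF bexI[OF refl that]] unfolding vpair_inject by blast
  moreover have "x \<in> S" if "x \<in> T" for x
    using iffD2[OF *, OF bexI[OF refl that]] unfolding vpair_inject by blast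
  ultimately show ?thesis by blast
qed


section \<open>Categories, functors and natural transformations\<close>

text \<open>
  Hom-sets need not be disjoint, so composition is indexed by the three objects involved:
  \<open>cmp A a b c g f\<close> is the composite of \<open>f : a \<rightarrow> b\<close> followed by \<open>g : b \<rightarrow> c\<close>. All structure is
  normalised outside its proper domain, so that equality of records is equality of categories,
  functors and transformations; \<open>mk_cat\<close> and \<open>mk_func\<close> perform the normalisation.
\<close>

record ('o, 'm) cat =
  obj :: "'o set"
  hom :: "'o \<Rightarrow> 'o \<Rightarrow> 'm set"
  idm :: "'o \<Rightarrow> 'm"
  cmp :: "'o \<Rightarrow> 'o \<Rightarrow> 'o \<Rightarrow> 'm \<Rightarrow> 'm \<Rightarrow> 'm"

definition mk_cat ::
  "'o set \<Rightarrow> ('o \<Rightarrow> 'o \<Rightarrow> 'm set) \<Rightarrow> ('o \<Rightarrow> 'm) \<Rightarrow> ('o \<Rightarrow> 'o \<Rightarrow> 'o \<Rightarrow> 'm \<Rightarrow> 'm \<Rightarrow> 'm) \<Rightarrow> ('o, 'm) cat"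
  where
  "mk_cat O' H I K = \<lparr>obj = O',
     hom = (\<lambda>a b. if a \<in> O' \<and> b \<in> O' then H a b else {}),
     idm = restrict I O',
     cmp = (\<lambda>a b c g f. if a \<in> O' \<and> b \<in> O' \<and> c \<in> O' \<and> g \<in> H b c \<and> f \<in> H a b
              then K a b c g f else undefined)\<rparr>"

definition category :: "('o, 'm) cat \<Rightarrow> bool" where
  "category A \<longleftrightarrow>
     mk_cat (obj A) (hom A) (idm A) (cmp A) = A \<and>
     (\<forall>a\<in>obj A. idm A a \<in> hom A a a) \<and>
     (\<forall>a\<in>obj A. \<forall>b\<in>obj A. \<forall>c\<in>obj A. \<forall>g\<in>hom A b c. \<forall>f\<in>hom A a b. cmp A a b c g f \<in> hom A a c) \<and>
     (\<forall>a\<in>obj A. \<forall>b\<in>obj A. \<forall>f\<in>hom A a b.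
        cmp A a a b f (idm A a) = f \<and> cmp A a b b (idm A b) f = f) \<and>
     (\<forall>a\<in>obj A. \<forall>b\<in>obj A. \<forall>c\<in>obj A. \<forall>d\<in>obj A.
        \<forall>h\<in>hom A c d. \<forall>g\<in>hom A b c. \<forall>f\<in>hom A a b.
        cmp A a b d (cmp A b c d h g) f = cmp A a c d h (cmp A a b c g f))"

record ('o, 'm, 'p, 'n) func =
  omap :: "'o \<Rightarrow> 'p"
  mmap :: "'o \<Rightarrow> 'o \<Rightarrow> 'm \<Rightarrow> 'n"

definition mk_func ::
  "('o, 'm) cat \<Rightarrow> ('o \<Rightarrow> 'p) \<Rightarrow> ('o \<Rightarrow> 'o \<Rightarrow> 'm \<Rightarrow> 'n) \<Rightarrow> ('o, 'm, 'p, 'n) func" where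
  "mk_func A P Q = \<lparr>omap = restrict P (obj A),
     mmap = (\<lambda>a b f. if a \<in> obj A \<and> b \<in> obj A \<and> f \<in> hom A a b then Q a b f else undefined)\<rparr>"

definition is_functor :: "('o, 'm) cat \<Rightarrow> ('p, 'n) cat \<Rightarrow> ('o, 'm, 'p, 'n) func \<Rightarrow> bool" where
  "is_functor A B F \<longleftrightarrow>
     category A \<and> category B \<and>
     mk_func A (omap F) (mmap F) = F \<and>
     (\<forall>a\<in>obj A. omap F a \<in> obj B) \<and>
     (\<forall>a\<in>obj A. \<forall>b\<in>obj A. \<forall>f\<in>hom A a b. mmap F a b f \<in> hom B (omap F a) (omap F b)) \<and>
     (\<forall>a\<in>obj A. mmap F a a (idm A a) = idm B (omap F a)) \<and>
     (\<forall>a\<in>obj A. \<forall>b\<in>obj A. \<forall>c\<in>obj A. \<forall>g\<in>hom A b c. \<forall>f\<in>hom A a b.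
        mmap F a c (cmp A a b c g f) =
        cmp B (omap F a) (omap F b) (omap F c) (mmap F b c g) (mmap F a b f))"

definition id_func :: "('o, 'm) cat \<Rightarrow> ('o, 'm, 'o, 'm) func" where
  "id_func A = mk_func A (\<lambda>a. a) (\<lambda>a b f. f)"

text \<open>The composite of \<open>F\<close>, with domain \<open>A\<close>, followed by \<open>G\<close>.\<close>

definition comp_func ::
  "('o, 'm) cat \<Rightarrow> ('p, 'n, 'q, 'k) func \<Rightarrow> ('o, 'm, 'p, 'n) func \<Rightarrow> ('o, 'm, 'q, 'k) func" where
  "comp_func A G F = mk_func A (\<lambda>a. omap G (omap F a))
     (\<lambda>a b f. mmap G (omap F a) (omap F b) (mmap F a b f))"

definition nat_trans ::
  "('o, 'm) cat \<Rightarrow> ('p, 'n) cat \<Rightarrow> ('o, 'm, 'p, 'n) func \<Rightarrow> ('o, 'm, 'p, 'n) func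
   \<Rightarrow> ('o \<Rightarrow> 'n) \<Rightarrow> bool" where
  "nat_trans A B F G \<alpha> \<longleftrightarrow>
     is_functor A B F \<and> is_functor A B G \<and>
     \<alpha> \<in> extensional (obj A) \<and>
     (\<forall>a\<in>obj A. \<alpha> a \<in> hom B (omap F a) (omap G a)) \<and>
     (\<forall>a\<in>obj A. \<forall>b\<in>obj A. \<forall>f\<in>hom A a b.
        cmp B (omap F a) (omap F b) (omap G b) (\<alpha> b) (mmap F a b f) =
        cmp B (omap F a) (omap G a) (omap G b) (mmap G a b f) (\<alpha> a))"

definition id_trans ::
  "('o, 'm) cat \<Rightarrow> ('p, 'n) cat \<Rightarrow> ('o, 'm, 'p, 'n) func \<Rightarrow> ('o \<Rightarrow> 'n)" where
  "id_trans A B F = restrict (\<lambda>a. idm B (omap F a)) (obj A)"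

text \<open>The vertical composite of \<open>\<alpha> : F \<Rightarrow> G\<close> followed by \<open>\<beta> : G \<Rightarrow> H\<close>.\<close>

definition comp_trans ::
  "('o, 'm) cat \<Rightarrow> ('p, 'n) cat \<Rightarrow> ('o, 'm, 'p, 'n) func \<Rightarrow> ('o, 'm, 'p, 'n) func
   \<Rightarrow> ('o, 'm, 'p, 'n) func \<Rightarrow> ('o \<Rightarrow> 'n) \<Rightarrow> ('o \<Rightarrow> 'n) \<Rightarrow> ('o \<Rightarrow> 'n)" where
  "comp_trans A B F G H \<beta> \<alpha> =
     restrict (\<lambda>a. cmp B (omap F a) (omap G a) (omap H a) (\<beta> a) (\<alpha> a)) (obj A)"

definition is_iso :: "('o, 'm) cat \<Rightarrow> 'o \<Rightarrow> 'o \<Rightarrow> 'm \<Rightarrow> bool" where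
  "is_iso A a b f \<longleftrightarrow> a \<in> obj A \<and> b \<in> obj A \<and> f \<in> hom A a b \<and>
     (\<exists>g\<in>hom A b a. cmp A a b a g f = idm A a \<and> cmp A b a b f g = idm A b)"

definition naturally_isomorphic ::
  "('o, 'm) cat \<Rightarrow> ('p, 'n) cat \<Rightarrow> ('o, 'm, 'p, 'n) func \<Rightarrow> ('o, 'm, 'p, 'n) func \<Rightarrow> bool" where
  "naturally_isomorphic A B F G \<longleftrightarrow>
     (\<exists>\<alpha>. nat_trans A B F G \<alpha> \<and> (\<forall>a\<in>obj A. is_iso B (omap F a) (omap G a) (\<alpha> a)))"

definition is_equivalence :: "('o, 'm) cat \<Rightarrow> ('p, 'n) cat \<Rightarrow> ('o, 'm, 'p, 'n) func \<Rightarrow> bool" where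
  "is_equivalence A B F \<longleftrightarrow> is_functor A B F \<and>
     (\<exists>G. is_functor B A G \<and>
        naturally_isomorphic A A (comp_func A G F) (id_func A) \<and>
        naturally_isomorphic B B (comp_func B F G) (id_func B))"

definition op_cat :: "('o, 'm) cat \<Rightarrow> ('o, 'm) cat" where
  "op_cat A = mk_cat (obj A) (\<lambda>a b. hom A b a) (idm A) (\<lambda>a b c g f. cmp A c b a f g)"

definition prod_cat :: "('o, 'm) cat \<Rightarrow> ('p, 'n) cat \<Rightarrow> ('o \<times> 'p, 'm \<times> 'n) cat" where
  "prod_cat A B = mk_cat (obj A \<times> obj B)
     (\<lambda>(a, b) (a', b'). hom A a a' \<times> hom B b b')
     (\<lambda>(a, b). (idm A a, idm B b))
     (\<lambda>(a, b) (a', b') (a'', b'') (g, k) (f, h). (cmp A a a' a'' g f, cmp B b b' b'' k h))"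

definition set_cat :: "('v::universe set, 'v \<Rightarrow> 'v) cat" where
  "set_cat = mk_cat {S. small S} (\<lambda>S T. S \<rightarrow>\<^sub>E T) (\<lambda>S. restrict (\<lambda>x. x) S)
     (\<lambda>S T R g f. compose S g f)"


section \<open>Finite limits\<close>

text \<open>
  Every finite category is isomorphic to one whose objects and morphisms are natural numbers,
  so these suffice as shapes of finite diagrams.
\<close>

definition finite_cat :: "(nat, nat) cat \<Rightarrow> bool" where
  "finite_cat J \<longleftrightarrow> category J \<and> finite (obj J) \<and> (\<forall>i\<in>obj J. \<forall>j\<in>obj J. finite (hom J i j))"

definition is_cone ::
  "('j, 'k) cat \<Rightarrow> ('o, 'm) cat \<Rightarrow> ('j, 'k, 'o, 'm) func \<Rightarrow> 'o \<Rightarrow> ('j \<Rightarrow> 'm) \<Rightarrow> bool" where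
  "is_cone J A D l p \<longleftrightarrow> l \<in> obj A \<and> (\<forall>j\<in>obj J. p j \<in> hom A l (omap D j)) \<and>
     (\<forall>i\<in>obj J. \<forall>j\<in>obj J. \<forall>f\<in>hom J i j. cmp A l (omap D i) (omap D j) (mmap D i j f) (p i) = p j)"

definition is_limit ::
  "('j, 'k) cat \<Rightarrow> ('o, 'm) cat \<Rightarrow> ('j, 'k, 'o, 'm) func \<Rightarrow> 'o \<Rightarrow> ('j \<Rightarrow> 'm) \<Rightarrow> bool" where
  "is_limit J A D l p \<longleftrightarrow> is_cone J A D l p \<and>
     (\<forall>x q. is_cone J A D x q \<longrightarrow>
        (\<exists>!h. h \<in> hom A x l \<and> (\<forall>j\<in>obj J. cmp A x l (omap D j) (p j) h = q j)))"

definition has_finite_limits :: "('o, 'm) cat \<Rightarrow> bool" where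
  "has_finite_limits A \<longleftrightarrow>
     (\<forall>(J :: (nat, nat) cat) D. finite_cat J \<and> is_functor J A D \<longrightarrow> (\<exists>l p. is_limit J A D l p))"

definition preserves_finite_limits ::
  "('o, 'm) cat \<Rightarrow> ('p, 'n) cat \<Rightarrow> ('o, 'm, 'p, 'n) func \<Rightarrow> bool" where
  "preserves_finite_limits A B F \<longleftrightarrow>
     (\<forall>(J :: (nat, nat) cat) D l p. finite_cat J \<and> is_functor J A D \<and> is_limit J A D l p \<longrightarrow>
        is_limit J B (comp_func J F D) (omap F l) (\<lambda>j. mmap F l (omap D j) (p j)))"

definition lex_functor :: "('o, 'm) cat \<Rightarrow> ('p, 'n) cat \<Rightarrow> ('o, 'm, 'p, 'n) func \<Rightarrow> bool" where
  "lex_functor A B F \<longleftrightarrow> is_functor A B F \<and> preserves_finite_limits A B F"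

type_synonym 'v vcat = "('v, 'v) cat"
type_synonym 'v vfunc = "('v, 'v, 'v, 'v) func"

definition locally_small :: "'v::universe vcat \<Rightarrow> bool" where
  "locally_small A \<longleftrightarrow> (\<forall>a\<in>obj A. \<forall>b\<in>obj A. small (hom A a b))"

definition small_lex_cat :: "'v::universe vcat \<Rightarrow> bool" where
  "small_lex_cat A \<longleftrightarrow> category A \<and> small (obj A) \<and> locally_small A \<and> has_finite_limits A"


section \<open>The bicategory \<open>LexProf\<close>\<close>

text \<open>
  A profunctor \<open>M\<close> from \<open>A\<close> to \<open>B\<close> is a functor \<open>A\<^sup>o\<^sup>p \<times> B \<rightarrow> Set\<close>; thus \<open>omap M (a, b)\<close> is the set
  \<open>M(a,b)\<close>, and \<open>mmap M (a, b) (a', b') (f, g)\<close> is the action of \<open>f : a' \<rightarrow> a\<close> and \<open>g : b \<rightarrow> b'\<close>.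
  A 2-cell is a natural transformation.
\<close>

type_synonym 'v prof = "('v \<times> 'v, 'v \<times> 'v, 'v set, 'v \<Rightarrow> 'v) func"
type_synonym 'v cell = "'v \<times> 'v \<Rightarrow> 'v \<Rightarrow> 'v"

abbreviation prof_dom :: "'v vcat \<Rightarrow> 'v vcat \<Rightarrow> ('v \<times> 'v, 'v \<times> 'v) cat" where
  "prof_dom A B \<equiv> prod_cat (op_cat A) B"

definition fix_first :: "'v vcat \<Rightarrow> 'v vcat \<Rightarrow> 'v prof \<Rightarrow> 'v \<Rightarrow> ('v, 'v, 'v set, 'v \<Rightarrow> 'v) func" where
  "fix_first A B M a = mk_func B (\<lambda>b. omap M (a, b)) (\<lambda>b b' g. mmap M (a, b) (a, b') (idm A a, g))"

definition lex_prof :: "'v::universe vcat \<Rightarrow> 'v vcat \<Rightarrow> 'v prof \<Rightarrow> bool" where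
  "lex_prof A B M \<longleftrightarrow> small_lex_cat A \<and> small_lex_cat B \<and>
     is_functor (prof_dom A B) set_cat M \<and>
     (\<forall>a\<in>obj A. lex_functor B set_cat (fix_first A B M a))"

definition two_cell :: "'v::universe vcat \<Rightarrow> 'v vcat \<Rightarrow> 'v prof \<Rightarrow> 'v prof \<Rightarrow> 'v cell \<Rightarrow> bool" where
  "two_cell A B M N \<sigma> \<longleftrightarrow> nat_trans (prof_dom A B) set_cat M N \<sigma>"

definition vcomp ::
  "'v::universe vcat \<Rightarrow> 'v vcat \<Rightarrow> 'v prof \<Rightarrow> 'v prof \<Rightarrow> 'v prof \<Rightarrow> 'v cell \<Rightarrow> 'v cell \<Rightarrow> 'v cell" where
  "vcomp A B M N P \<tau> \<sigma> = comp_trans (prof_dom A B) set_cat M N P \<tau> \<sigma>"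

text \<open>Builds a 2-cell with domain \<open>M\<close> from its action on elements.\<close>

definition mk_cell :: "'v vcat \<Rightarrow> 'v vcat \<Rightarrow> 'v prof \<Rightarrow> ('v \<Rightarrow> 'v \<Rightarrow> 'v \<Rightarrow> 'v) \<Rightarrow> 'v cell" where
  "mk_cell A B M s = restrict (\<lambda>(a, b). restrict (s a b) (omap M (a, b))) (obj (prof_dom A B))"

definition id_prof :: "'v::universe vcat \<Rightarrow> 'v prof" where
  "id_prof A = mk_func (prof_dom A A) (\<lambda>(a', a). hom A a' a)
     (\<lambda>(a', a) (b', b) (f, g). restrict (\<lambda>h. cmp A b' a b g (cmp A b' a' a h f)) (hom A a' a))"

text \<open>
  The coend \<open>\<integral>\<^sup>b N(b,c) \<times> M(a,b)\<close> is the quotient of the set of triples \<open>(b, n, m)\<close> by the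
  equivalence relation generated by \<open>(b, n \<sqdot> g, m) \<sim> (b', n, g \<sqdot> m)\<close> for \<open>g : b \<rightarrow> b'\<close>. Equivalence
  classes are coded as elements of the universe.
\<close>

definition coend_triples ::
  "'v vcat \<Rightarrow> 'v prof \<Rightarrow> 'v prof \<Rightarrow> 'v \<Rightarrow> 'v \<Rightarrow> ('v \<times> 'v \<times> 'v) set" where
  "coend_triples B N M a c = {(b, n, m). b \<in> obj B \<and> n \<in> omap N (b, c) \<and> m \<in> omap M (a, b)}"

definition coend_step ::
  "'v vcat \<Rightarrow> 'v vcat \<Rightarrow> 'v vcat \<Rightarrow> 'v prof \<Rightarrow> 'v prof \<Rightarrow> 'v \<Rightarrow> 'v
   \<Rightarrow> (('v \<times> 'v \<times> 'v) \<times> ('v \<times> 'v \<times> 'v)) set" where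
  "coend_step A B C N M a c =
     {((b, mmap N (b', c) (b, c) (g, idm C c) n, m), (b', n, mmap M (a, b) (a, b') (idm A a, g) m))
      | b b' g n m. b \<in> obj B \<and> b' \<in> obj B \<and> g \<in> hom B b b' \<and>
          n \<in> omap N (b', c) \<and> m \<in> omap M (a, b)}"

definition coend_class ::
  "'v::universe vcat \<Rightarrow> 'v vcat \<Rightarrow> 'v vcat \<Rightarrow> 'v prof \<Rightarrow> 'v prof \<Rightarrow> 'v \<Rightarrow> 'v
   \<Rightarrow> 'v \<times> 'v \<times> 'v \<Rightarrow> 'v" where
  "coend_class A B C N M a c t =
     vset ((\<lambda>(b, n, m). vpair b (vpair n m)) `
       ((coend_step A B C N M a c \<union> (coend_step A B C N M a c)\<inverse>)\<^sup>* `` {t}))"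

definition coend_rep ::
  "'v::universe vcat \<Rightarrow> 'v vcat \<Rightarrow> 'v vcat \<Rightarrow> 'v prof \<Rightarrow> 'v prof \<Rightarrow> 'v \<Rightarrow> 'v \<Rightarrow> 'v
   \<Rightarrow> 'v \<times> 'v \<times> 'v" where
  "coend_rep A B C N M a c z =
     (SOME t. t \<in> coend_triples B N M a c \<and> coend_class A B C N M a c t = z)"

text \<open>The composite \<open>N \<otimes> M\<close> of \<open>M\<close> from \<open>A\<close> to \<open>B\<close> and \<open>N\<close> from \<open>B\<close> to \<open>C\<close>.\<close>

definition tensor ::
  "'v::universe vcat \<Rightarrow> 'v vcat \<Rightarrow> 'v vcat \<Rightarrow> 'v prof \<Rightarrow> 'v prof \<Rightarrow> 'v prof" where
  "tensor A B C N M = mk_func (prof_dom A C)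
     (\<lambda>(a, c). coend_class A B C N M a c ` coend_triples B N M a c)
     (\<lambda>(a, c) (a', c') (f, g).
        restrict (\<lambda>z. case coend_rep A B C N M a c z of (b, n, m) \<Rightarrow>
            coend_class A B C N M a' c'
              (b, mmap N (b, c) (b, c') (idm B b, g) n, mmap M (a, b) (a', b) (f, idm B b) m))
          (coend_class A B C N M a c ` coend_triples B N M a c))"

text \<open>The horizontal composite \<open>\<tau> \<otimes> \<sigma> : N \<otimes> M \<rightarrow> N' \<otimes> M'\<close> of \<open>\<sigma> : M \<rightarrow> M'\<close> and \<open>\<tau> : N \<rightarrow> N'\<close>.\<close>

definition hcomp ::
  "'v::universe vcat \<Rightarrow> 'v vcat \<Rightarrow> 'v vcat \<Rightarrow> 'v prof \<Rightarrow> 'v prof \<Rightarrow> 'v prof \<Rightarrow> 'v prof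
   \<Rightarrow> 'v cell \<Rightarrow> 'v cell \<Rightarrow> 'v cell" where
  "hcomp A B C N M N' M' \<tau> \<sigma> = mk_cell A C (tensor A B C N M)
     (\<lambda>a c z. case coend_rep A B C N M a c z of (b, n, m) \<Rightarrow>
        coend_class A B C N' M' a c (b, \<tau> (b, c) n, \<sigma> (a, b) m))"


section \<open>\<open>LexProf\<close>-categories\<close>

record 'v lpcat =
  lobj :: "'v set"
  ext :: "'v \<Rightarrow> 'v vcat"
  lhom :: "'v \<Rightarrow> 'v \<Rightarrow> 'v prof"
  lcmp :: "'v \<Rightarrow> 'v \<Rightarrow> 'v \<Rightarrow> 'v cell"
  lidm :: "'v \<Rightarrow> 'v cell"

text \<open>
  \<open>lcmp C X Y Z\<close> is the composition 2-cell \<open>C(Y,Z) \<otimes> C(X,Y) \<rightarrow> C(X,Z)\<close>. The following is the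
  associated operation on elements \<open>g\<close> of \<open>C(Y,Z)(j,k)\<close> and \<open>f\<close> of \<open>C(X,Y)(i,j)\<close>.
\<close>

definition lapp ::
  "'v::universe lpcat \<Rightarrow> 'v \<Rightarrow> 'v \<Rightarrow> 'v \<Rightarrow> 'v \<Rightarrow> 'v \<Rightarrow> 'v \<Rightarrow> 'v \<Rightarrow> 'v \<Rightarrow> 'v" where
  "lapp C X Y Z i j k g f = lcmp C X Y Z (i, k)
     (coend_class (ext C X) (ext C Y) (ext C Z) (lhom C Y Z) (lhom C X Y) i k (j, g, f))"

text \<open>
  The associativity and unit axioms are equalities of 2-cells out of triple and unary tensor
  products; they are stated here on elements.
\<close>

definition lp_category :: "'v::universe lpcat \<Rightarrow> bool" where
  "lp_category C \<longleftrightarrow>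
     (\<forall>X\<in>lobj C. small_lex_cat (ext C X)) \<and>
     (\<forall>X\<in>lobj C. \<forall>Y\<in>lobj C. lex_prof (ext C X) (ext C Y) (lhom C X Y)) \<and>
     (\<forall>X\<in>lobj C. \<forall>Y\<in>lobj C. \<forall>Z\<in>lobj C.
        two_cell (ext C X) (ext C Z)
          (tensor (ext C X) (ext C Y) (ext C Z) (lhom C Y Z) (lhom C X Y)) (lhom C X Z)
          (lcmp C X Y Z)) \<and>
     (\<forall>X\<in>lobj C. two_cell (ext C X) (ext C X) (id_prof (ext C X)) (lhom C X X) (lidm C X)) \<and>
     (\<forall>X\<in>lobj C. \<forall>Y\<in>lobj C. \<forall>Z\<in>lobj C. \<forall>W\<in>lobj C.
        \<forall>i\<in>obj (ext C X). \<forall>j\<in>obj (ext C Y). \<forall>k\<in>obj (ext C Z). \<forall>l\<in>obj (ext C W).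
        \<forall>h\<in>omap (lhom C Z W) (k, l). \<forall>g\<in>omap (lhom C Y Z) (j, k). \<forall>f\<in>omap (lhom C X Y) (i, j).
          lapp C X Y W i j l (lapp C Y Z W j k l h g) f =
          lapp C X Z W i k l h (lapp C X Y Z i j k g f)) \<and>
     (\<forall>X\<in>lobj C. \<forall>Y\<in>lobj C. \<forall>i'\<in>obj (ext C X). \<forall>i\<in>obj (ext C X). \<forall>j\<in>obj (ext C Y).
        \<forall>p\<in>hom (ext C X) i' i. \<forall>f\<in>omap (lhom C X Y) (i, j).
          lapp C X X Y i' i j f (lidm C X (i', i) p) =
          mmap (lhom C X Y) (i, j) (i', j) (p, idm (ext C Y) j) f) \<and>
     (\<forall>X\<in>lobj C. \<forall>Y\<in>lobj C. \<forall>i\<in>obj (ext C X). \<forall>j\<in>obj (ext C Y). \<forall>j'\<in>obj (ext C Y).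
        \<forall>q\<in>hom (ext C Y) j j'. \<forall>f\<in>omap (lhom C X Y) (i, j).
          lapp C X Y Y i j j' (lidm C Y (j, j') q) f =
          mmap (lhom C X Y) (i, j) (i, j') (idm (ext C X) i, q) f) \<and>
     ext C \<in> extensional (lobj C) \<and>
     lidm C \<in> extensional (lobj C) \<and>
     (\<forall>X Y. \<not> (X \<in> lobj C \<and> Y \<in> lobj C) \<longrightarrow> lhom C X Y = undefined) \<and>
     (\<forall>X Y Z. \<not> (X \<in> lobj C \<and> Y \<in> lobj C \<and> Z \<in> lobj C) \<longrightarrow> lcmp C X Y Z = undefined)"

record 'v lpfunc =
  lpo :: "'v \<Rightarrow> 'v"
  lpm :: "'v \<Rightarrow> 'v \<Rightarrow> 'v cell"

definition lp_functor :: "'v::universe lpcat \<Rightarrow> 'v lpcat \<Rightarrow> 'v lpfunc \<Rightarrow> bool" where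
  "lp_functor C D F \<longleftrightarrow>
     lp_category C \<and> lp_category D \<and>
     lpo F \<in> extensional (lobj C) \<and>
     (\<forall>X Y. \<not> (X \<in> lobj C \<and> Y \<in> lobj C) \<longrightarrow> lpm F X Y = undefined) \<and>
     (\<forall>X\<in>lobj C. lpo F X \<in> lobj D \<and> ext D (lpo F X) = ext C X) \<and>
     (\<forall>X\<in>lobj C. \<forall>Y\<in>lobj C.
        two_cell (ext C X) (ext C Y) (lhom C X Y) (lhom D (lpo F X) (lpo F Y)) (lpm F X Y)) \<and>
     (\<forall>X\<in>lobj C. \<forall>Y\<in>lobj C. \<forall>Z\<in>lobj C.
        \<forall>i\<in>obj (ext C X). \<forall>j\<in>obj (ext C Y). \<forall>k\<in>obj (ext C Z).
        \<forall>g\<in>omap (lhom C Y Z) (j, k). \<forall>f\<in>omap (lhom C X Y) (i, j).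
          lpm F X Z (i, k) (lapp C X Y Z i j k g f) =
          lapp D (lpo F X) (lpo F Y) (lpo F Z) i j k (lpm F Y Z (j, k) g) (lpm F X Y (i, j) f)) \<and>
     (\<forall>X\<in>lobj C. \<forall>i\<in>obj (ext C X). \<forall>j\<in>obj (ext C X). \<forall>p\<in>hom (ext C X) i j.
        lpm F X X (i, j) (lidm C X (i, j) p) = lidm D (lpo F X) (i, j) p)"

definition lp_id_functor :: "'v lpcat \<Rightarrow> 'v lpfunc" where
  "lp_id_functor C = \<lparr>lpo = restrict (\<lambda>X. X) (lobj C),
     lpm = (\<lambda>X Y. if X \<in> lobj C \<and> Y \<in> lobj C
              then mk_cell (ext C X) (ext C Y) (lhom C X Y) (\<lambda>i j f. f) else undefined)\<rparr>"

definition lp_comp_functor :: "'v lpcat \<Rightarrow> 'v lpfunc \<Rightarrow> 'v lpfunc \<Rightarrow> 'v lpfunc" where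
  "lp_comp_functor C G F = \<lparr>lpo = restrict (\<lambda>X. lpo G (lpo F X)) (lobj C),
     lpm = (\<lambda>X Y. if X \<in> lobj C \<and> Y \<in> lobj C
              then mk_cell (ext C X) (ext C Y) (lhom C X Y)
                     (\<lambda>i j f. lpm G (lpo F X) (lpo F Y) (i, j) (lpm F X Y (i, j) f))
              else undefined)\<rparr>"

text \<open>
  Naturality says that the two composites \<open>C(X,Y) \<cong> I \<otimes> C(X,Y) \<rightarrow> D(FY,GY) \<otimes> D(FX,FY) \<rightarrow> D(FX,GY)\<close>
  and \<open>C(X,Y) \<cong> C(X,Y) \<otimes> I \<rightarrow> D(GX,GY) \<otimes> D(FX,GX) \<rightarrow> D(FX,GY)\<close> agree; the isomorphisms send \<open>f\<close>
  in \<open>C(X,Y)(i,j)\<close> to the class of \<open>(j, 1, f)\<close>, respectively \<open>(i, f, 1)\<close>.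
\<close>

definition lp_trans ::
  "'v::universe lpcat \<Rightarrow> 'v lpcat \<Rightarrow> 'v lpfunc \<Rightarrow> 'v lpfunc \<Rightarrow> ('v \<Rightarrow> 'v cell) \<Rightarrow> bool" where
  "lp_trans C D F G \<theta> \<longleftrightarrow>
     lp_functor C D F \<and> lp_functor C D G \<and>
     \<theta> \<in> extensional (lobj C) \<and>
     (\<forall>X\<in>lobj C.
        two_cell (ext C X) (ext C X) (id_prof (ext C X)) (lhom D (lpo F X) (lpo G X)) (\<theta> X)) \<and>
     (\<forall>X\<in>lobj C. \<forall>Y\<in>lobj C. \<forall>i\<in>obj (ext C X). \<forall>j\<in>obj (ext C Y). \<forall>f\<in>omap (lhom C X Y) (i, j).
        lapp D (lpo F X) (lpo F Y) (lpo G Y) i j j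
          (\<theta> Y (j, j) (idm (ext C Y) j)) (lpm F X Y (i, j) f) =
        lapp D (lpo F X) (lpo G X) (lpo G Y) i i j
          (lpm G X Y (i, j) f) (\<theta> X (i, i) (idm (ext C X) i)))"

text \<open>
  For \<open>X, Y, Z\<close> of the same extent, the composite
  \<open>I \<cong> I \<otimes> I \<rightarrow> D(Y,Z) \<otimes> D(X,Y) \<rightarrow> D(X,Z)\<close> of \<open>\<phi> : I \<rightarrow> D(Y,Z)\<close> and \<open>\<theta> : I \<rightarrow> D(X,Y)\<close>.
\<close>

definition lp_paste ::
  "'v::universe lpcat \<Rightarrow> 'v \<Rightarrow> 'v \<Rightarrow> 'v \<Rightarrow> 'v cell \<Rightarrow> 'v cell \<Rightarrow> 'v cell" where
  "lp_paste D X Y Z \<phi> \<theta> = mk_cell (ext D X) (ext D X) (id_prof (ext D X))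
     (\<lambda>i j p. lapp D X Y Z i i j (\<phi> (i, j) p) (\<theta> (i, i) (idm (ext D X) i)))"

definition lp_hom_cat ::
  "'v::universe lpcat \<Rightarrow> 'v lpcat \<Rightarrow> ('v lpfunc, 'v \<Rightarrow> 'v cell) cat" where
  "lp_hom_cat C D = mk_cat {F. lp_functor C D F} (\<lambda>F G. {\<theta>. lp_trans C D F G \<theta>})
     (\<lambda>F. restrict (\<lambda>X. lidm D (lpo F X)) (lobj C))
     (\<lambda>F G H \<phi> \<theta>. restrict (\<lambda>X. lp_paste D (lpo F X) (lpo G X) (lpo H X) (\<phi> X) (\<theta> X)) (lobj C))"


section \<open>Tensors\<close>

definition is_tensor ::
  "'v::universe lpcat \<Rightarrow> 'v vcat \<Rightarrow> 'v vcat \<Rightarrow> 'v prof \<Rightarrow> 'v \<Rightarrow> 'v \<Rightarrow> 'v cell \<Rightarrow> bool" where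
  "is_tensor C A B W X T u \<longleftrightarrow>
     lex_prof A B W \<and> X \<in> lobj C \<and> ext C X = A \<and> T \<in> lobj C \<and> ext C T = B \<and>
     two_cell A B W (lhom C X T) u \<and>
     (\<forall>D U Z. lex_prof B D U \<and> Z \<in> lobj C \<and> ext C Z = D \<longrightarrow>
        bij_betw
          (\<lambda>f. vcomp A D (tensor A B D U W) (tensor A B D (lhom C T Z) (lhom C X T)) (lhom C X Z)
                 (lcmp C X T Z) (hcomp A B D U W (lhom C T Z) (lhom C X T) f u))
          {f. two_cell B D U (lhom C T Z) f}
          {h. two_cell A D (tensor A B D U W) (lhom C X Z) h})"

definition absolute_weight :: "'v::universe vcat \<Rightarrow> 'v vcat \<Rightarrow> 'v prof \<Rightarrow> bool" where
  "absolute_weight A B W \<longleftrightarrow> lex_prof A B W \<and>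
     (\<forall>C D F X T u. lp_functor C D F \<and> is_tensor C A B W X T u \<longrightarrow>
        is_tensor D A B W (lpo F X) (lpo F T)
          (vcomp A B W (lhom C X T) (lhom D (lpo F X) (lpo F T)) (lpm F X T) u))"

definition absolute_tensored :: "'v::universe lpcat \<Rightarrow> bool" where
  "absolute_tensored C \<longleftrightarrow>
     (\<forall>A B W X. absolute_weight A B W \<and> X \<in> lobj C \<and> ext C X = A \<longrightarrow>
        (\<exists>T u. is_tensor C A B W X T u))"


section \<open>2-categories, 2-functors and biequivalences\<close>

text \<open>
  A strict 2-category is given by its objects, hom-categories, identity 1-cells and composition
  functors. \<open>tcmp K A B C\<close> acts on pairs (second factor, first factor) of 1-cells and 2-cells.
\<close>

record ('a, 'f, 't) twocat =
  tobj :: "'a set"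
  thom :: "'a \<Rightarrow> 'a \<Rightarrow> ('f, 't) cat"
  tid :: "'a \<Rightarrow> 'f"
  tcmp :: "'a \<Rightarrow> 'a \<Rightarrow> 'a \<Rightarrow> ('f \<times> 'f, 't \<times> 't, 'f, 't) func"

abbreviation tid2 :: "('a, 'f, 't) twocat \<Rightarrow> 'a \<Rightarrow> 't" where
  "tid2 K A \<equiv> idm (thom K A A) (tid K A)"

definition two_category :: "('a, 'f, 't) twocat \<Rightarrow> bool" where
  "two_category K \<longleftrightarrow>
     (\<forall>A\<in>tobj K. \<forall>B\<in>tobj K. category (thom K A B)) \<and>
     (\<forall>A\<in>tobj K. tid K A \<in> obj (thom K A A)) \<and>
     (\<forall>A\<in>tobj K. \<forall>B\<in>tobj K. \<forall>C\<in>tobj K.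
        is_functor (prod_cat (thom K B C) (thom K A B)) (thom K A C) (tcmp K A B C)) \<and>
     (\<forall>A\<in>tobj K. \<forall>B\<in>tobj K. \<forall>f\<in>obj (thom K A B).
        omap (tcmp K A A B) (f, tid K A) = f \<and> omap (tcmp K A B B) (tid K B, f) = f) \<and>
     (\<forall>A\<in>tobj K. \<forall>B\<in>tobj K. \<forall>f\<in>obj (thom K A B). \<forall>f'\<in>obj (thom K A B).
        \<forall>\<alpha>\<in>hom (thom K A B) f f'.
          mmap (tcmp K A A B) (f, tid K A) (f', tid K A) (\<alpha>, tid2 K A) = \<alpha> \<and>
          mmap (tcmp K A B B) (tid K B, f) (tid K B, f') (tid2 K B, \<alpha>) = \<alpha>) \<and>
     (\<forall>A\<in>tobj K. \<forall>B\<in>tobj K. \<forall>C\<in>tobj K. \<forall>D\<in>tobj K.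
        \<forall>h\<in>obj (thom K C D). \<forall>g\<in>obj (thom K B C). \<forall>f\<in>obj (thom K A B).
          omap (tcmp K A B D) (omap (tcmp K B C D) (h, g), f) =
          omap (tcmp K A C D) (h, omap (tcmp K A B C) (g, f))) \<and>
     (\<forall>A\<in>tobj K. \<forall>B\<in>tobj K. \<forall>C\<in>tobj K. \<forall>D\<in>tobj K.
        \<forall>h\<in>obj (thom K C D). \<forall>h'\<in>obj (thom K C D). \<forall>\<gamma>\<in>hom (thom K C D) h h'.
        \<forall>g\<in>obj (thom K B C). \<forall>g'\<in>obj (thom K B C). \<forall>\<beta>\<in>hom (thom K B C) g g'.
        \<forall>f\<in>obj (thom K A B). \<forall>f'\<in>obj (thom K A B). \<forall>\<alpha>\<in>hom (thom K A B) f f'.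
          mmap (tcmp K A B D)
            (omap (tcmp K B C D) (h, g), f) (omap (tcmp K B C D) (h', g'), f')
            (mmap (tcmp K B C D) (h, g) (h', g') (\<gamma>, \<beta>), \<alpha>) =
          mmap (tcmp K A C D)
            (h, omap (tcmp K A B C) (g, f)) (h', omap (tcmp K A B C) (g', f'))
            (\<gamma>, mmap (tcmp K A B C) (g, f) (g', f') (\<beta>, \<alpha>)))"

record ('a, 'f, 't, 'b, 'g, 's) twofunc =
  tfo :: "'a \<Rightarrow> 'b"
  tfm :: "'a \<Rightarrow> 'a \<Rightarrow> ('f, 't, 'g, 's) func"

definition two_functor ::
  "('a, 'f, 't) twocat \<Rightarrow> ('b, 'g, 's) twocat \<Rightarrow> ('a, 'f, 't, 'b, 'g, 's) twofunc \<Rightarrow> bool" where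
  "two_functor K L P \<longleftrightarrow>
     two_category K \<and> two_category L \<and>
     (\<forall>A\<in>tobj K. tfo P A \<in> tobj L) \<and>
     (\<forall>A\<in>tobj K. \<forall>B\<in>tobj K. is_functor (thom K A B) (thom L (tfo P A) (tfo P B)) (tfm P A B)) \<and>
     (\<forall>A\<in>tobj K. omap (tfm P A A) (tid K A) = tid L (tfo P A)) \<and>
     (\<forall>A\<in>tobj K. \<forall>B\<in>tobj K. \<forall>C\<in>tobj K. \<forall>g\<in>obj (thom K B C). \<forall>f\<in>obj (thom K A B).
        omap (tfm P A C) (omap (tcmp K A B C) (g, f)) =
        omap (tcmp L (tfo P A) (tfo P B) (tfo P C)) (omap (tfm P B C) g, omap (tfm P A B) f)) \<and>
     (\<forall>A\<in>tobj K. \<forall>B\<in>tobj K. \<forall>C\<in>tobj K.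
        \<forall>g\<in>obj (thom K B C). \<forall>g'\<in>obj (thom K B C). \<forall>\<beta>\<in>hom (thom K B C) g g'.
        \<forall>f\<in>obj (thom K A B). \<forall>f'\<in>obj (thom K A B). \<forall>\<alpha>\<in>hom (thom K A B) f f'.
        mmap (tfm P A C) (omap (tcmp K A B C) (g, f)) (omap (tcmp K A B C) (g', f'))
          (mmap (tcmp K A B C) (g, f) (g', f') (\<beta>, \<alpha>)) =
        mmap (tcmp L (tfo P A) (tfo P B) (tfo P C))
          (omap (tfm P B C) g, omap (tfm P A B) f) (omap (tfm P B C) g', omap (tfm P A B) f')
          (mmap (tfm P B C) g g' \<beta>, mmap (tfm P A B) f f' \<alpha>))"

definition local_equivalence ::
  "('a, 'f, 't) twocat \<Rightarrow> ('b, 'g, 's) twocat \<Rightarrow> ('a, 'f, 't, 'b, 'g, 's) twofunc \<Rightarrow> bool" where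
  "local_equivalence K L P \<longleftrightarrow>
     (\<forall>A\<in>tobj K. \<forall>B\<in>tobj K. is_equivalence (thom K A B) (thom L (tfo P A) (tfo P B)) (tfm P A B))"

definition equivalent_in :: "('a, 'f, 't) twocat \<Rightarrow> 'a \<Rightarrow> 'a \<Rightarrow> bool" where
  "equivalent_in K A B \<longleftrightarrow> A \<in> tobj K \<and> B \<in> tobj K \<and>
     (\<exists>f\<in>obj (thom K A B). \<exists>g\<in>obj (thom K B A).
        (\<exists>\<eta>. is_iso (thom K A A) (tid K A) (omap (tcmp K A B A) (g, f)) \<eta>) \<and>
        (\<exists>\<epsilon>. is_iso (thom K B B) (omap (tcmp K B A B) (f, g)) (tid K B) \<epsilon>))"

definition biessential_image ::
  "('a, 'f, 't) twocat \<Rightarrow> ('b, 'g, 's) twocat \<Rightarrow> ('a, 'f, 't, 'b, 'g, 's) twofunc \<Rightarrow> 'b set" where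
  "biessential_image K L P = {B \<in> tobj L. \<exists>A\<in>tobj K. equivalent_in L B (tfo P A)}"

definition biequivalence ::
  "('a, 'f, 't) twocat \<Rightarrow> ('b, 'g, 's) twocat \<Rightarrow> ('a, 'f, 't, 'b, 'g, 's) twofunc \<Rightarrow> bool" where
  "biequivalence K L P \<longleftrightarrow>
     two_functor K L P \<and> local_equivalence K L P \<and> biessential_image K L P = tobj L"

text \<open>The full and locally full sub-2-category on a class of objects.\<close>

definition full_sub :: "('a, 'f, 't) twocat \<Rightarrow> 'a set \<Rightarrow> ('a, 'f, 't) twocat" where
  "full_sub K S = K\<lparr>tobj := tobj K \<inter> S\<rparr>"


section \<open>The 2-category \<open>LexProf-CAT\<close>\<close>

text \<open>
  The horizontal composite of \<open>\<theta> : F \<Rightarrow> F'\<close> and \<open>\<phi> : G \<Rightarrow> G'\<close> has component at \<open>X\<close> the composite of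
  \<open>\<phi>\<close> at \<open>F'X\<close> with the image ucat \<open>G\<close> of \<open>\<theta>\<close> at \<open>X\<close>.
\<close>

definition LexProf_CAT :: "('v::universe lpcat, 'v lpfunc, 'v \<Rightarrow> 'v cell) twocat" where
  "LexProf_CAT = \<lparr>
     tobj = {C. lp_category C},
     thom = lp_hom_cat,
     tid = lp_id_functor,
     tcmp = (\<lambda>C D E. mk_func (prod_cat (lp_hom_cat D E) (lp_hom_cat C D))
       (\<lambda>(G, F). lp_comp_functor C G F)
       (\<lambda>(G, F) (G', F') (\<phi>, \<theta>). restrict
          (\<lambda>X. lp_paste E (lpo G (lpo F X)) (lpo G (lpo F' X)) (lpo G' (lpo F' X))
             (\<phi> (lpo F' X))
             (vcomp (ext C X) (ext C X) (id_prof (ext C X))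
                (lhom D (lpo F X) (lpo F' X)) (lhom E (lpo G (lpo F X)) (lpo G (lpo F' X)))
                (lpm G (lpo F X) (lpo F' X)) (\<theta> X)))
          (lobj C)))\<rparr>"


section \<open>The 2-category \<open>PARFL\<close>\<close>

text \<open>A sieve is a class of pairs \<open>(A, X)\<close> consisting of a category and a functor with that domain.\<close>

type_synonym 'v sieve = "('v vcat \<times> 'v vfunc) set"

definition left_exact_sieve :: "'v::universe vcat \<Rightarrow> 'v sieve \<Rightarrow> bool" where
  "left_exact_sieve C S \<longleftrightarrow>
     (\<forall>(A, X)\<in>S. small_lex_cat A \<and> lex_functor A C X) \<and>
     (\<forall>A B X G. (B, X) \<in> S \<and> small_lex_cat A \<and> lex_functor A B G \<longrightarrow> (A, comp_func A X G) \<in> S) \<and>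
     (\<forall>A X Y. (A, X) \<in> S \<and> naturally_isomorphic A C X Y \<longrightarrow> (A, Y) \<in> S) \<and>
     (\<forall>c\<in>obj C. \<exists>(A, X)\<in>S. \<exists>a\<in>obj A. omap X a = c)"

record 'v parfl =
  ucat :: "'v vcat"
  sieve :: "'v sieve"

definition partially_lex_cat :: "'v::universe parfl \<Rightarrow> bool" where
  "partially_lex_cat C \<longleftrightarrow>
     category (ucat C) \<and> locally_small (ucat C) \<and> left_exact_sieve (ucat C) (sieve C)"

definition partially_lex_functor :: "'v::universe parfl \<Rightarrow> 'v parfl \<Rightarrow> 'v vfunc \<Rightarrow> bool" where
  "partially_lex_functor C D F \<longleftrightarrow>
     is_functor (ucat C) (ucat D) F \<and> (\<forall>(A, X)\<in>sieve C. (A, comp_func A F X) \<in> sieve D)"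

definition parfl_hom_cat :: "'v::universe parfl \<Rightarrow> 'v parfl \<Rightarrow> ('v vfunc, 'v \<Rightarrow> 'v) cat" where
  "parfl_hom_cat C D = mk_cat {F. partially_lex_functor C D F}
     (\<lambda>F G. {\<alpha>. nat_trans (ucat C) (ucat D) F G \<alpha>})
     (id_trans (ucat C) (ucat D))
     (comp_trans (ucat C) (ucat D))"

definition PARFL :: "('v::universe parfl, 'v vfunc, 'v \<Rightarrow> 'v) twocat" where
  "PARFL = \<lparr>
     tobj = {C. partially_lex_cat C},
     thom = parfl_hom_cat,
     tid = (\<lambda>C. id_func (ucat C)),
     tcmp = (\<lambda>C D E. mk_func (prod_cat (parfl_hom_cat D E) (parfl_hom_cat C D))
       (\<lambda>(G, F). comp_func (ucat C) G F)
       (\<lambda>(G, F) (G', F') (\<beta>, \<alpha>). restrict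
          (\<lambda>c. cmp (ucat E) (omap G (omap F c)) (omap G (omap F' c)) (omap G' (omap F' c))
             (\<beta> (omap F' c)) (mmap G (omap F c) (omap F' c) (\<alpha> c)))
          (obj (ucat C))))\<rparr>"


section \<open>The 2-functor \<open>\<Gamma>\<close>\<close>

text \<open>
  Objects of \<open>LexProf\<close>-categories are elements of the universe, so a pair of a small category and
  a functor out of it is coded as such, injectively.
\<close>

definition code_cat :: "'v::universe vcat \<Rightarrow> 'v" where
  "code_cat A = vpair
     (vgraph (obj A) (\<lambda>a. vgraph (obj A) (\<lambda>b. vset (hom A a b))))
     (vpair (vgraph (obj A) (idm A))
       (vgraph (obj A) (\<lambda>a. vgraph (obj A) (\<lambda>b. vgraph (obj A) (\<lambda>c.
          vgraph (hom A b c) (\<lambda>g. vgraph (hom A a b) (\<lambda>f. cmp A a b c g f)))))))"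

definition code :: "'v::universe vcat \<times> 'v vfunc \<Rightarrow> 'v" where
  "code = (\<lambda>(A, X). vpair (code_cat A)
     (vpair (vgraph (obj A) (omap X))
       (vgraph (obj A) (\<lambda>a. vgraph (obj A) (\<lambda>b. vgraph (hom A a b) (mmap X a b))))))"

lemma code_cat_inject:
  assumes A: "small_lex_cat A" and B: "small_lex_cat B" and e: "code_cat A = code_cat B"
  shows "A = B"
proof -
  have sA: "small (obj A)" "\<And>a b. a \<in> obj A \<Longrightarrow> b \<in> obj A \<Longrightarrow> small (hom A a b)"
    using A unfolding small_lex_cat_def locally_small_def by auto
  have sB: "small (obj B)" "\<And>a b. a \<in> obj B \<Longrightarrow> b \<in> obj B \<Longrightarrow> small (hom B a b)"
    using B unfolding small_lex_cat_def locally_small_def by auto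
  note e1 = e[unfolded code_cat_def vpair_inject, THEN conjunct1]
    and e2 = e[unfolded code_cat_def vpair_inject, THEN conjunct2, THEN conjunct1]
    and e3 = e[unfolded code_cat_def vpair_inject, THEN conjunct2, THEN conjunct2]
  note vg = vgraph_inject[OF sA(1) sB(1), THEN conjunct2, rule_format]
  have o: "obj A = obj B" by (rule vgraph_inject[OF sA(1) sB(1) e2, THEN conjunct1])
  have i: "idm A a = idm B a" if "a \<in> obj A" for a by (rule vg[OF e2 that])
  have h: "hom A a b = hom B a b" if a: "a \<in> obj A" and b: "b \<in> obj A" for a b
    using vg[OF vg[OF e1 a] b] vset_inject[OF sA(2)[OF a b] sB(2)[OF a[unfolded o] b[unfolded o]]]
    by (rule iffD1[rotated])
  have c: "cmp A a b c g f = cmp B a b c g f"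
    if a: "a \<in> obj A" and b: "b \<in> obj A" and c: "c \<in> obj A"
      and g: "g \<in> hom A b c" and f: "f \<in> hom A a b" for a b c g f
  proof -
    note 1 = vg[OF vg[OF vg[OF e3 a] b] c]
    note 2 = vgraph_inject[OF sA(2)[OF b c] sB(2)[OF b[unfolded o] c[unfolded o]] 1,
        THEN conjunct2, rule_format, OF g]
    show ?thesis
      by (rule vgraph_inject[OF sA(2)[OF a b] sB(2)[OF a[unfolded o] b[unfolded o]] 2,
          THEN conjunct2, rule_format, OF f])
  qed
  have "mk_cat (obj A) (hom A) (idm A) (cmp A) = mk_cat (obj B) (hom B) (idm B) (cmp B)"
    unfolding mk_cat_def o[symmetric] cat.ext_inject
    by (intro conjI ext refl TrueI) (simp_all add: i h c restrict_def cong: conj_cong if_cong)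
  moreover have "mk_cat (obj A) (hom A) (idm A) (cmp A) = A"
    "mk_cat (obj B) (hom B) (idm B) (cmp B) = B"
    using A B unfolding small_lex_cat_def category_def by blast+
  ultimately show ?thesis by metis
qed

lemma code_inject:
  assumes A: "small_lex_cat A" "is_functor A C X" and B: "small_lex_cat B" "is_functor B C Y"
    and e: "code (A, X) = code (B, Y)"
  shows "A = B \<and> X = Y"
proof -
  have AB: "A = B"
    by (rule code_cat_inject[OF A(1) B(1) e[unfolded code_def prod.case vpair_inject, THEN conjunct1]])
  have s: "small (obj A)" "\<And>a b. a \<in> obj A \<Longrightarrow> b \<in> obj A \<Longrightarrow> small (hom A a b)"
    using A unfolding small_lex_cat_def locally_small_def by auto
  note e' = e[unfolded code_def prod.case vpair_inject AB[symmetric], THEN conjunct2]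
  note vg = vgraph_inject[OF s(1) s(1), THEN conjunct2, rule_format]
  have o: "omap X a = omap Y a" if "a \<in> obj A" for a by (rule vg[OF e'[THEN conjunct1] that])
  have m: "mmap X a b f = mmap Y a b f"
    if a: "a \<in> obj A" and b: "b \<in> obj A" and f: "f \<in> hom A a b" for a b f
    by (rule vgraph_inject[OF s(2)[OF a b] s(2)[OF a b] vg[OF vg[OF e'[THEN conjunct2] a] b],
        THEN conjunct2, rule_format, OF f])
  have "mk_func A (omap X) (mmap X) = mk_func A (omap Y) (mmap Y)"
    unfolding mk_func_def func.ext_inject
    by (intro conjI ext refl TrueI) (simp_all add: o m restrict_def)
  moreover have "mk_func A (omap X) (mmap X) = X" "mk_func B (omap Y) (mmap Y) = Y"
    using A(2) B(2) unfolding is_functor_def by blast+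
  ultimately show ?thesis using AB by metis
qed

lemma code_inj_on_sieve:
  assumes "partially_lex_cat C"
  shows "inj_on code (sieve C)"
proof (rule inj_onI)
  fix s t assume s: "s \<in> sieve C" and t: "t \<in> sieve C" and e: "code s = code t"
  obtain A X B Y where [simp]: "s = (A, X)" "t = (B, Y)" by (metis surj_pair)
  have "\<forall>(A, X)\<in>sieve C. small_lex_cat A \<and> lex_functor A (ucat C) X"
    using assms unfolding partially_lex_cat_def left_exact_sieve_def by blast
  then have "small_lex_cat A" "is_functor A (ucat C) X" "small_lex_cat B" "is_functor B (ucat C) Y"
    using s t unfolding lex_functor_def by auto
  from code_inject[OF this] e show "s = t" by simp
qed

definition decode :: "'v::universe parfl \<Rightarrow> 'v \<Rightarrow> 'v vcat \<times> 'v vfunc" where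
  "decode C = inv_into (sieve C) code"

abbreviation gdom :: "'v::universe parfl \<Rightarrow> 'v \<Rightarrow> 'v vcat" where
  "gdom C x \<equiv> fst (decode C x)"

abbreviation gfun :: "'v::universe parfl \<Rightarrow> 'v \<Rightarrow> 'v vfunc" where
  "gfun C x \<equiv> snd (decode C x)"

definition Gamma_hom :: "'v::universe parfl \<Rightarrow> 'v \<Rightarrow> 'v \<Rightarrow> 'v prof" where
  "Gamma_hom C x y = (let K = ucat C; X = gfun C x; Y = gfun C y in
     mk_func (prof_dom (gdom C x) (gdom C y))
       (\<lambda>(i, j). hom K (omap X i) (omap Y j))
       (\<lambda>(i, j) (i', j') (f, g). restrict
          (\<lambda>h. cmp K (omap X i') (omap Y j) (omap Y j') (mmap Y j j' g)
                 (cmp K (omap X i') (omap X i) (omap Y j) h (mmap X i' i f)))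
          (hom K (omap X i) (omap Y j))))"

definition Gamma_cmp :: "'v::universe parfl \<Rightarrow> 'v \<Rightarrow> 'v \<Rightarrow> 'v \<Rightarrow> 'v cell" where
  "Gamma_cmp C x y z =
     mk_cell (gdom C x) (gdom C z)
       (tensor (gdom C x) (gdom C y) (gdom C z) (Gamma_hom C y z) (Gamma_hom C x y))
       (\<lambda>i k w. case coend_rep (gdom C x) (gdom C y) (gdom C z)
                       (Gamma_hom C y z) (Gamma_hom C x y) i k w of (j, g, f) \<Rightarrow>
          cmp (ucat C) (omap (gfun C x) i) (omap (gfun C y) j) (omap (gfun C z) k) g f)"

definition Gamma_obj :: "'v::universe parfl \<Rightarrow> 'v lpcat" where
  "Gamma_obj C = (let S = code ` sieve C in \<lparr>
     lobj = S,
     ext = restrict (gdom C) S,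
     lhom = (\<lambda>x y. if x \<in> S \<and> y \<in> S then Gamma_hom C x y else undefined),
     lcmp = (\<lambda>x y z. if x \<in> S \<and> y \<in> S \<and> z \<in> S then Gamma_cmp C x y z else undefined),
     lidm = restrict (\<lambda>x. mk_cell (gdom C x) (gdom C x) (id_prof (gdom C x)) (mmap (gfun C x))) S\<rparr>)"

definition Gamma_fun :: "'v::universe parfl \<Rightarrow> 'v vfunc \<Rightarrow> 'v lpfunc" where
  "Gamma_fun C F = (let S = code ` sieve C in \<lparr>
     lpo = restrict (\<lambda>x. code (gdom C x, comp_func (gdom C x) F (gfun C x))) S,
     lpm = (\<lambda>x y. if x \<in> S \<and> y \<in> S
              then mk_cell (gdom C x) (gdom C y) (Gamma_hom C x y)
                     (\<lambda>i j. mmap F (omap (gfun C x) i) (omap (gfun C y) j))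
              else undefined)\<rparr>)"

text \<open>
  The 2-cell \<open>I \<rightarrow> \<Gamma>(D)(FX,GX)\<close> with \<open>1\<^sub>i \<mapsto> \<alpha>\<^bsub>Xi\<^esub>\<close> sends \<open>p : i \<rightarrow> j\<close> to the composite of
  \<open>\<alpha>\<^bsub>Xi\<^esub> : FXi \<rightarrow> GXi\<close> with \<open>GXp : GXi \<rightarrow> GXj\<close>.
\<close>

definition Gamma_trans ::
  "'v::universe parfl \<Rightarrow> 'v parfl \<Rightarrow> 'v vfunc \<Rightarrow> 'v vfunc \<Rightarrow> ('v \<Rightarrow> 'v) \<Rightarrow> 'v \<Rightarrow> 'v cell" where
  "Gamma_trans C D F G \<alpha> = restrict
     (\<lambda>x. let X = gfun C x in
        mk_cell (gdom C x) (gdom C x) (id_prof (gdom C x))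
          (\<lambda>i j p. cmp (ucat D) (omap F (omap X i)) (omap G (omap X i)) (omap G (omap X j))
             (mmap G (omap X i) (omap X j) (mmap X i j p)) (\<alpha> (omap X i))))
     (code ` sieve C)"

definition Gamma ::
  "('v::universe parfl, 'v vfunc, 'v \<Rightarrow> 'v, 'v lpcat, 'v lpfunc, 'v \<Rightarrow> 'v cell) twofunc" where
  "Gamma = \<lparr>
     tfo = Gamma_obj,
     tfm = (\<lambda>C D. mk_func (parfl_hom_cat C D) (Gamma_fun C) (Gamma_trans C D))\<rparr>"

end

(* For a LexProf-category C, the pairs (X, i) with i in the extent of X form a category tot C, with homs
C(X,Y)(i,j); this embeds LexProf-CAT in CAT. Evaluation at i identifies tot (Gamma C) with C up to repetition of
objects, whence Gamma is locally an equivalence.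

Absolute weights W : A -|-> B are the represented ones, W = A(-,G-) with G lex. Tensors by these are
restrictions of X along G, which any functor preserves. Conversely let T be the tensor by W of the Yoneda
embedding X in presheaves on A, spanning with X a category K, and map into LexProf via K(T b, -) for fixed b. Preservation of T
compares K(Tb, Tb') with the coend of W(a,b') x K(Tb, Xa) over a, which is again lex in b' since the coend is
filtered. So the identity of Tb factors through some Xa; splitting the resulting idempotent in A represents W(-,b).

Hence C is absolute-tensored iff it is closed under restriction along lex functors. In that case the inclusions
of the extents generate a left-exact sieve on tot C, whose image under Gamma is equivalent to C. *)
theory Submission
 imports Defs
begin

section \<open>Categories and functors\<close>

text \<open>Three obstacles shape the development. 2-cells out of a composite profunctor live on
  quotients, so the axioms of a 2-category are not checked there: LexProf-functors and
  transformations are determined by their effect on total categories, and equations are pulled back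
  from CAT. For 1-cells this needs nonempty extents, which terminal objects provide. Next, objects
  must be elements of the universe, whereas presheaves are functions; K is therefore a coded
  category whose objects are tagged objects of A and B. Adding no further presheaves also matters
  because condition (iii) wants each object of K to be a value of a finite-limit-preserving functor
  on a small category, which is clear for the representables and the W(-,b). The same condition
  fixes the target of K(T b, -): Gamma of a category of sets, but only of sets that are such values.
  Finally, the preserved tensor is exploited through weights D(H-,-): there the Yoneda lemma turns a
  universal property quantified over all weights into one about natural families, used once for
  existence and once for uniqueness.\<close>

lemmas conj2 = conjunct2[THEN conjunct2] and conj4 = conjunct2[THEN conjunct2, THEN conjunct2, THEN conjunct2]

lemma mk_cat_simps [simp]:
 "obj (mk_cat O' H I K) = O'"
 "hom (mk_cat O' H I K) a b = (if a \<in> O' & b \<in> O' then H a b else {})"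
 "a \<in> O' ==> idm (mk_cat O' H I K) a = I a"
 "a \<in> O' ==> b \<in> O' ==> c \<in> O' ==> g \<in> H b c ==> f \<in> H a b ==> cmp (mk_cat O' H I K) a b c g f = K a b c g f"
 by (auto simp: mk_cat_def)

lemma mk_cat_idem:
 "mk_cat (obj (mk_cat O' H I K)) (hom (mk_cat O' H I K)) (idm (mk_cat O' H I K)) (cmp (mk_cat O' H I K))
  = mk_cat O' H I K"
 unfolding mk_cat_def by (auto simp: restrict_def fun_eq_iff)

lemma categoryI:
 assumes "!!a. a \<in> O' ==> I a \<in> H a a"
  and "!!a b c g f. a \<in> O' ==> b \<in> O' ==> c \<in> O' ==> g \<in> H b c ==> f \<in> H a b ==> K a b c g f \<in> H a c"
  and "!!a b f. a \<in> O' ==> b \<in> O' ==> f \<in> H a b ==> K a a b f (I a) = f"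
  and "!!a b f. a \<in> O' ==> b \<in> O' ==> f \<in> H a b ==> K a b b (I b) f = f"
  and "!!a b c d h g f. a \<in> O' ==> b \<in> O' ==> c \<in> O' ==> d \<in> O' ==> h \<in> H c d ==> g \<in> H b c ==> f \<in> H a b ==>
   K a b d (K b c d h g) f = K a c d h (K a b c g f)"
 shows "category (mk_cat O' H I K)"
 unfolding category_def using assms mk_cat_idem[of O' H I K] by simp

text \<open>Normalisation empties hom-sets between non-objects, so a morphism already certifies its
  endpoints; hence many lemmas below assume a morphism and not its objects.\<close>

lemma hom_obj: "category A ==> f \<in> hom A a b ==> a \<in> obj A & b \<in> obj A"
proof -
 assume A: "category A" and f: "f \<in> hom A a b"
 from A have "mk_cat (obj A) (hom A) (idm A) (cmp A) = A" unfolding category_def by blast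
 then have "hom A a b = hom (mk_cat (obj A) (hom A) (idm A) (cmp A)) a b" by simp
 then show ?thesis using f by (auto split: if_splits)
qed

lemma hom_dom: "category A ==> f \<in> hom A a b ==> a \<in> obj A"
 and hom_cod: "category A ==> f \<in> hom A a b ==> b \<in> obj A"
 by (auto dest: hom_obj)

lemma cat_id: "category A ==> a \<in> obj A ==> idm A a \<in> hom A a a"
 unfolding category_def by blast

lemma cat_cmp: "category A ==> g \<in> hom A b c ==> f \<in> hom A a b ==> cmp A a b c g f \<in> hom A a c"
 using hom_obj[of A] unfolding category_def by blast

lemma cat_id_right: "category A ==> f \<in> hom A a b ==> cmp A a a b f (idm A a) = f"
 and cat_id_left: "category A ==> f \<in> hom A a b ==> cmp A a b b (idm A b) f = f"
 using hom_obj[of A] unfolding category_def by blast+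

lemma cat_assoc: "category A ==> f \<in> hom A a b ==> g \<in> hom A b c ==> h \<in> hom A c d ==>
  cmp A a b d (cmp A b c d h g) f = cmp A a c d h (cmp A a b c g f)"
 using hom_obj[of A] unfolding category_def by blast

lemma mk_func_simps [simp]:
 "a \<in> obj A ==> omap (mk_func A P Q) a = P a"
 "a \<in> obj A ==> b \<in> obj A ==> f \<in> hom A a b ==> mmap (mk_func A P Q) a b f = Q a b f"
 by (auto simp: mk_func_def)

lemma mk_func_idem [simp]: "mk_func A (omap (mk_func A P Q)) (mmap (mk_func A P Q)) = mk_func A P Q"
 unfolding mk_func_def func.simps by (auto intro!: ext simp: restrict_def)

lemma mk_func_cong:
 assumes "!!a. a \<in> obj A ==> P a = P' a"
  and "!!a b f. a \<in> obj A ==> b \<in> obj A ==> f \<in> hom A a b ==> Q a b f = Q' a b f"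
 shows "mk_func A P Q = mk_func A P' Q'"
 unfolding mk_func_def using assms by (auto intro!: ext simp: restrict_def)

lemma functorI:
 assumes A: "category A" and "category B"
  and "!!a. a \<in> obj A ==> P a \<in> obj B"
  and "!!a b f. a \<in> obj A ==> b \<in> obj A ==> f \<in> hom A a b ==> Q a b f \<in> hom B (P a) (P b)"
  and "!!a. a \<in> obj A ==> Q a a (idm A a) = idm B (P a)"
  and "!!a b c g f. a \<in> obj A ==> b \<in> obj A ==> c \<in> obj A ==> g \<in> hom A b c ==> f \<in> hom A a b ==>
    Q a c (cmp A a b c g f) = cmp B (P a) (P b) (P c) (Q b c g) (Q a b f)"
 shows "is_functor A B (mk_func A P Q)"
 unfolding is_functor_def using assms cat_id[OF A] cat_cmp[OF A] by simp

lemma functor_cats: "is_functor A B F ==> category A" "is_functor A B F ==> category B"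
 unfolding is_functor_def by blast+

lemma functor_obj: "is_functor A B F ==> a \<in> obj A ==> omap F a \<in> obj B"
 unfolding is_functor_def by blast

lemma functor_hom: "is_functor A B F ==> f \<in> hom A a b ==> mmap F a b f \<in> hom B (omap F a) (omap F b)"
 using hom_obj[of A] unfolding is_functor_def by blast

lemma functor_id: "is_functor A B F ==> a \<in> obj A ==> mmap F a a (idm A a) = idm B (omap F a)"
 unfolding is_functor_def by blast

lemma functor_cmp: "is_functor A B F ==> g \<in> hom A b c ==> f \<in> hom A a b ==>
  mmap F a c (cmp A a b c g f) = cmp B (omap F a) (omap F b) (omap F c) (mmap F b c g) (mmap F a b f)"
 using hom_obj[of A] unfolding is_functor_def by blast

lemma functor_mk: "is_functor A B F ==> mk_func A (omap F) (mmap F) = F"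
 unfolding is_functor_def by blast

lemma functor_eqI:
 assumes "is_functor A B F" "is_functor A B' G"
  and "!!a. a \<in> obj A ==> omap F a = omap G a"
  and "!!a b f. a \<in> obj A ==> b \<in> obj A ==> f \<in> hom A a b ==> mmap F a b f = mmap G a b f"
 shows "F = G"
 using mk_func_cong[of A "omap F" "omap G" "mmap F" "mmap G"] functor_mk[OF assms(1)] functor_mk[OF assms(2)]
  assms(3,4) by metis

lemma id_func_simps [simp]:
 "a \<in> obj A ==> omap (id_func A) a = a"
 "a \<in> obj A ==> b \<in> obj A ==> f \<in> hom A a b ==> mmap (id_func A) a b f = f"
 by (simp_all add: id_func_def)

lemma comp_func_simps [simp]:
 "a \<in> obj A ==> omap (comp_func A G F) a = omap G (omap F a)"
 "a \<in> obj A ==> b \<in> obj A ==> f \<in> hom A a b ==>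
   mmap (comp_func A G F) a b f = mmap G (omap F a) (omap F b) (mmap F a b f)"
 by (simp_all add: comp_func_def)

lemma id_functor: "category A ==> is_functor A A (id_func A)"
 unfolding id_func_def by (rule functorI) auto

lemma comp_functor: "is_functor A B F ==> is_functor B C G ==> is_functor A C (comp_func A G F)"
 unfolding comp_func_def
 by (rule functorI) (auto simp: functor_cats functor_obj functor_hom functor_id functor_cmp)

lemma nat_functors: "nat_trans A B F G \<alpha> ==> is_functor A B F" "nat_trans A B F G \<alpha> ==> is_functor A B G"
 unfolding nat_trans_def by blast+

lemma nat_hom: "nat_trans A B F G \<alpha> ==> a \<in> obj A ==> \<alpha> a \<in> hom B (omap F a) (omap G a)"
 unfolding nat_trans_def by blast

lemma nat_nat:
 assumes n: "nat_trans A B F G \<alpha>" and f: "f \<in> hom A a b"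
 shows "cmp B (omap F a) (omap F b) (omap G b) (\<alpha> b) (mmap F a b f) =
  cmp B (omap F a) (omap G a) (omap G b) (mmap G a b f) (\<alpha> a)"
 using n hom_obj[OF functor_cats(1)[OF nat_functors(1)[OF n]] f] f unfolding nat_trans_def by blast

lemma nat_ext: "nat_trans A B F G \<alpha> ==> \<alpha> \<in> extensional (obj A)"
 unfolding nat_trans_def by blast

lemma natI:
 assumes "is_functor A B F" "is_functor A B G"
  and "!!a. a \<in> obj A ==> \<alpha> a \<in> hom B (omap F a) (omap G a)"
  and "!!a b f. a \<in> obj A ==> b \<in> obj A ==> f \<in> hom A a b ==>
   cmp B (omap F a) (omap F b) (omap G b) (\<alpha> b) (mmap F a b f) =
   cmp B (omap F a) (omap G a) (omap G b) (mmap G a b f) (\<alpha> a)"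
 shows "nat_trans A B F G (restrict \<alpha> (obj A))"
 unfolding nat_trans_def using assms by auto

lemma nat_eqI:
 assumes "nat_trans A B F G \<alpha>" "nat_trans A' B' F' G' \<beta>" "obj A' = obj A" "!!a. a \<in> obj A ==> \<alpha> a = \<beta> a"
 shows "\<alpha> = \<beta>"
 using assms nat_ext by (metis extensionalityI)

lemma id_nat: "is_functor A B F ==> nat_trans A B F F (id_trans A B F)"
 unfolding id_trans_def
 by (rule natI) (auto simp: functor_cats cat_id functor_obj functor_hom cat_id_left cat_id_right)

lemma comp_nat:
 assumes a: "nat_trans A B F G \<alpha>" and b: "nat_trans A B G H \<beta>"
 shows "nat_trans A B F H (comp_trans A B F G H \<beta> \<alpha>)"
 unfolding comp_trans_def
proof (rule natI)
 note [simp] = functor_cats[OF nat_functors(1)[OF a]]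
 note i = nat_functors(1)[OF a] nat_functors(2)[OF a] nat_functors(2)[OF b]
 show "is_functor A B F" "is_functor A B H" by (fact i)+
 fix x assume "x \<in> obj A"
 then show "cmp B (omap F x) (omap G x) (omap H x) (\<beta> x) (\<alpha> x) \<in> hom B (omap F x) (omap H x)"
  by (simp add: cat_cmp nat_hom[OF a] nat_hom[OF b])
next
 note [simp] = functor_cats[OF nat_functors(1)[OF a]]
 note i = nat_functors(1)[OF a] nat_functors(2)[OF a] nat_functors(2)[OF b]
 fix x y f assume xy: "x \<in> obj A" "y \<in> obj A" and f: "f \<in> hom A x y"
 note m = functor_hom[OF i(1) f] functor_hom[OF i(2) f] functor_hom[OF i(3) f]
  nat_hom[OF a xy(1)] nat_hom[OF b xy(1)] nat_hom[OF a xy(2)] nat_hom[OF b xy(2)]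
 show "cmp B (omap F x) (omap F y) (omap H y) (cmp B (omap F y) (omap G y) (omap H y) (\<beta> y) (\<alpha> y)) (mmap F x y f) =
  cmp B (omap F x) (omap H x) (omap H y) (mmap H x y f) (cmp B (omap F x) (omap G x) (omap H x) (\<beta> x) (\<alpha> x))"
  using m nat_nat[OF a f] nat_nat[OF b f] by (simp add: cat_assoc) (metis cat_assoc functor_cats(2) i(1))
qed

section \<open>Opposite and product categories, and the category of small sets\<close>

lemma op_cat_simps [simp]:
 "obj (op_cat A) = obj A"
 "category A ==> hom (op_cat A) a b = hom A b a"
 "a \<in> obj A ==> idm (op_cat A) a = idm A a"
 "category A ==> g \<in> hom A c b ==> f \<in> hom A b a ==> cmp (op_cat A) a b c g f = cmp A c b a f g"
   apply (auto simp: op_cat_def dest: hom_obj)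
 apply (subst mk_cat_simps) apply (auto dest: hom_obj)
 done

lemma op_category: "category A ==> category (op_cat A)"
 unfolding op_cat_def
 by (rule categoryI) (auto simp: cat_id cat_cmp cat_id_left cat_id_right cat_assoc)

lemma prod_cat_simps [simp]:
 "obj (prod_cat A B) = obj A \<times> obj B"
 "category A ==> category B ==> hom (prod_cat A B) (a, b) (a', b') = hom A a a' \<times> hom B b b'"
 "a \<in> obj A ==> b \<in> obj B ==> idm (prod_cat A B) (a, b) = (idm A a, idm B b)"
 "category A ==> category B ==> f \<in> hom A a a' ==> g \<in> hom A a' a'' ==> h \<in> hom B b b' ==> k \<in> hom B b' b'' ==>
   cmp (prod_cat A B) (a, b) (a', b') (a'', b'') (g, k) (f, h) = (cmp A a a' a'' g f, cmp B b b' b'' k h)"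
   apply (auto simp: prod_cat_def dest: hom_obj)
 apply (subst mk_cat_simps) apply (auto dest: hom_obj)
 done

lemma prod_category: "category A ==> category B ==> category (prod_cat A B)"
 unfolding prod_cat_def
 by (rule categoryI) (auto simp: cat_id cat_cmp cat_id_left cat_id_right cat_assoc)

lemma obj_set_cat [simp]: "obj set_cat = {S. small S}"
 by (simp add: set_cat_def)

lemma set_cat_simps:
 "small S ==> small T ==> hom set_cat S T = (S \<rightarrow>\<^sub>E T)"
 "small S ==> small T ==> small R ==> f \<in> S \<rightarrow>\<^sub>E T ==> g \<in> T \<rightarrow>\<^sub>E R ==> cmp set_cat S T R g f = compose S g f"
 by (simp_all add: set_cat_def)

lemma idm_set_cat [simp]: "small S ==> idm set_cat S = restrict (\<lambda>x. x) S"
 by (simp add: set_cat_def)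

lemma set_hom: "f \<in> hom set_cat S T \<longleftrightarrow> small S & small T & f \<in> S \<rightarrow>\<^sub>E T"
 by (auto simp: set_cat_def)

lemma set_category: "category set_cat"
 unfolding set_cat_def
 by (rule categoryI) (auto simp: compose_def PiE_iff extensional_def restrict_def fun_eq_iff)

lemma set_cmp: "f \<in> hom set_cat S T ==> g \<in> hom set_cat T R ==> x \<in> S ==> cmp set_cat S T R g f x = g (f x)"
 by (auto simp: set_hom compose_def set_cat_simps)

lemma set_cmp_eq: "f \<in> hom set_cat S T ==> g \<in> hom set_cat T R ==> cmp set_cat S T R g f = restrict (\<lambda>x. g (f x)) S"
 by (auto simp: set_hom compose_def set_cat_simps)

lemma set_hom_eqI: "f \<in> hom set_cat S T ==> g \<in> hom set_cat S T' ==> (!!x. x \<in> S ==> f x = g x) ==> f = g"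
 unfolding set_hom by (auto simp: PiE_iff intro: extensionalityI)

lemma set_hom_in: "f \<in> hom set_cat S T ==> x \<in> S ==> f x \<in> T"
 unfolding set_hom by auto

lemma set_homI: "small S ==> small T ==> (!!x. x \<in> S ==> f x \<in> T) ==> restrict f S \<in> hom set_cat S T"
 unfolding set_hom by auto

text \<open>The actions \<open>x \<mapsto> g \<cdot> x\<close> and \<open>x \<mapsto> x \<cdot> f\<close> of \<open>g : b \<rightarrow> b'\<close> and of \<open>f : a' \<rightarrow> a\<close> on elements of a profunctor \<open>M\<close>.\<close>

abbreviation ract :: "'v vcat => 'v::universe prof => 'v => 'v => 'v => 'v => 'v => 'v" where
 "ract A M a b b' g \<equiv> mmap M (a, b) (a, b') (idm A a, g)"

abbreviation lact :: "'v vcat => 'v::universe prof => 'v => 'v => 'v => 'v => 'v => 'v" where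
 "lact B M b a a' f \<equiv> mmap M (a, b) (a', b) (f, idm B b)"

section \<open>Finite limits and set-valued actions\<close>

text \<open>An element of the limit, in sets, of the values of \<open>P\<close> along
  \<open>D\<close>. Working with bare values and an action lets \<open>P\<close> take values in sets
  of any type, which a functor into \<open>set_cat\<close> could not.\<close>

definition matching ::
 "('j, 'k) cat => ('j, 'k, 'o, 'm) func => ('o => 'x set) => ('o => 'o => 'm => 'x => 'x) => ('j => 'x) => bool" where
 "matching J D P Q z \<longleftrightarrow> (\<forall>j\<in>obj J. z j \<in> P (omap D j)) &
   (\<forall>i\<in>obj J. \<forall>j\<in>obj J. \<forall>f\<in>hom J i j. Q (omap D i) (omap D j) (mmap D i j f) (z i) = z j)"

text \<open>The set-valued functor with values \<open>P\<close> and action \<open>Q\<close> preserves finite limits.\<close>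

definition lex_action :: "('o, 'm) cat => ('o => 'x set) => ('o => 'o => 'm => 'x => 'x) => bool" where
 "lex_action B P Q \<longleftrightarrow> (\<forall>(J :: (nat, nat) cat) D l p z.
   finite_cat J & is_functor J B D & is_limit J B D l p & matching J D P Q z \<longrightarrow>
   (\<exists>!x. x \<in> P l & (\<forall>j\<in>obj J. Q l (omap D j) (p j) x = z j)))"

lemma lex_actionD:
 assumes "lex_action B P Q" "finite_cat (J :: (nat, nat) cat)" "is_functor J B D" "is_limit J B D l p"
  "matching J D P Q z"
 shows "\<exists>!x. x \<in> P l & (\<forall>j\<in>obj J. Q l (omap D j) (p j) x = z j)"
 using assms unfolding lex_action_def by blast

lemma limit_cone: "is_limit J A D l p ==> is_cone J A D l p"
 unfolding is_limit_def by blast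

lemma cone_obj: "is_cone J A D l p ==> l \<in> obj A"
 and cone_hom: "is_cone J A D l p ==> j \<in> obj J ==> p j \<in> hom A l (omap D j)"
 and cone_cmp: "is_cone J A D l p ==> i \<in> obj J ==> j \<in> obj J ==> f \<in> hom J i j ==>
  cmp A l (omap D i) (omap D j) (mmap D i j f) (p i) = p j"
 unfolding is_cone_def by blast+

text \<open>Preservation of finite limits transports along a natural bijection: a matching family is
  pulled back along \<phi>, solved there, and the solution pushed forward. Most exactness proofs
  below reduce to this, directly or through \<open>lex_action_cong\<close>.\<close>

lemma lex_action_iso:
 assumes lx: "lex_action B P Q"
  and \<phi>: "!!b. b \<in> obj B ==> bij_betw (\<phi> b) (P b) (P' b)"
  and nat: "!!b b' g x. b \<in> obj B ==> b' \<in> obj B ==> g \<in> hom B b b' ==> x \<in> P b ==> Q' b b' g (\<phi> b x) = \<phi> b' (Q b b' g x)"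
  and Q: "!!b b' g x. b \<in> obj B ==> b' \<in> obj B ==> g \<in> hom B b b' ==> x \<in> P b ==> Q b b' g x \<in> P b'"
 shows "lex_action B P' Q'"
 unfolding lex_action_def
proof (intro allI impI, elim conjE)
 fix J :: "(nat, nat) cat" and D l p z
 assume J: "finite_cat J" and D: "is_functor J B D" and l: "is_limit J B D l p" and z: "matching J D P' Q' z"
 define y where "y j = inv_into (P (omap D j)) (\<phi> (omap D j)) (z j)" for j
 have d: "omap D j \<in> obj B" if "j \<in> obj J" for j by (rule functor_obj[OF D that])
 have zj: "z j \<in> P' (omap D j)" if "j \<in> obj J" for j using z that unfolding matching_def by blast
 have y: "y j \<in> P (omap D j)" "\<phi> (omap D j) (y j) = z j" if "j \<in> obj J" for j
  using zj[OF that] \<phi>[OF d[OF that]] unfolding y_def bij_betw_def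
  by (auto intro: inv_into_into f_inv_into_f)
 have inj: "x = x'" if "\<phi> b x = \<phi> b x'" "b \<in> obj B" "x \<in> P b" "x' \<in> P b" for b x x'
  using \<phi>[OF that(2)] that unfolding bij_betw_def inj_on_def by blast
 have "matching J D P Q y" unfolding matching_def
 proof (intro conjI ballI)
  fix i j f assume i: "i \<in> obj J" and j: "j \<in> obj J" and f: "f \<in> hom J i j"
  have e: "Q' (omap D i) (omap D j) (mmap D i j f) (z i) = z j" using z i j f unfolding matching_def by blast
  note Df = functor_hom[OF D f]
  show "Q (omap D i) (omap D j) (mmap D i j f) (y i) = y j"
   using nat[OF d[OF i] d[OF j] Df y(1)[OF i]] e y(2)[OF i] y[OF j] Q[OF d[OF i] d[OF j] Df y(1)[OF i]]
   by (intro inj[OF _ d[OF j]]) auto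
 qed (use y in blast)
 from lex_actionD[OF lx J D l this] obtain x where x: "x \<in> P l" "!!j. j \<in> obj J ==> Q l (omap D j) (p j) x = y j"
  and u: "!!x'. x' \<in> P l ==> (!!j. j \<in> obj J ==> Q l (omap D j) (p j) x' = y j) ==> x' = x" by metis
 note cn = limit_cone[OF l]
 note lo = cone_obj[OF cn]
 show "\<exists>!x. x \<in> P' l & (\<forall>j\<in>obj J. Q' l (omap D j) (p j) x = z j)"
 proof (intro ex1I[of _ "\<phi> l x"] conjI ballI)
  show "\<phi> l x \<in> P' l" using \<phi>[OF lo] x(1) bij_betwE by blast
  show "Q' l (omap D j) (p j) (\<phi> l x) = z j" if j: "j \<in> obj J" for j
   using nat[OF lo d[OF j] cone_hom[OF cn j] x(1)] x(2)[OF j] y(2)[OF j] by simp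
  fix w assume w: "w \<in> P' l & (\<forall>j\<in>obj J. Q' l (omap D j) (p j) w = z j)"
  then have "w \<in> \<phi> l ` P l" using \<phi>[OF lo] unfolding bij_betw_def by simp
  then obtain v where v: "v \<in> P l" "\<phi> l v = w" by blast
  have "v = x"
  proof (rule u[OF v(1)])
   fix j assume j: "j \<in> obj J"
   note pj = cone_hom[OF cn j]
   show "Q l (omap D j) (p j) v = y j"
    by (rule inj[OF _ d[OF j] Q[OF lo d[OF j] pj v(1)] y(1)[OF j]])
     (use nat[OF lo d[OF j] pj v(1)] v(2) w j y(2)[OF j] in auto)
  qed
  then show "w = \<phi> l x" using v by simp
 qed
qed

lemma lex_action_cong:
 assumes "lex_action B P Q" "!!b. b \<in> obj B ==> P b = P' b"
  and "!!b b' g x. b \<in> obj B ==> b' \<in> obj B ==> g \<in> hom B b b' ==> x \<in> P b ==> Q b b' g x = Q' b b' g x"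
  and "!!b b' g x. b \<in> obj B ==> b' \<in> obj B ==> g \<in> hom B b b' ==> x \<in> P b ==> Q b b' g x \<in> P b'"
 shows "lex_action B P' Q'"
 by (rule lex_action_iso[OF assms(1), where \<phi> = "\<lambda>b x. x"]) (use assms in \<open>auto simp: bij_betw_def\<close>)

text \<open>Limits are detected by covariant hom-functors: a cone with apex c over the image diagram
  is exactly a matching family for K(c, Y-).\<close>

lemma lex_functor_iff_hom:
 assumes Y: "is_functor B K Y"
 shows "lex_functor B K Y \<longleftrightarrow> (\<forall>c\<in>obj K. lex_action B (\<lambda>b. hom K c (omap Y b))
  (\<lambda>b b' g h. cmp K c (omap Y b) (omap Y b') (mmap Y b b' g) h))" (is "_ = (\<forall>c\<in>obj K. ?lex c)")
proof -
 note [simp] = functor_cats[OF Y]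
 let ?M = "\<lambda>c. \<lambda>J :: (nat, nat) cat. \<lambda>D. matching J D (\<lambda>b. hom K c (omap Y b)) (\<lambda>b b' g h. cmp K c (omap Y b) (omap Y b') (mmap Y b b' g) h)" and ?L = "\<lambda>J :: (nat, nat) cat. \<lambda>D l p. is_limit J K (comp_func J Y D) (omap Y l) (\<lambda>j. mmap Y l (omap D j) (p j))" and ?E = "\<lambda>c. \<lambda>J :: (nat, nat) cat. \<lambda>D l p z. \<exists>!x. x \<in> hom K c (omap Y l) & (\<forall>j\<in>obj J. cmp K c (omap Y l) (omap Y (omap D j)) (mmap Y l (omap D j) (p j)) x = z j)"
 \<comment> \<open>The image of a limit cone is always a cone, so being a limit is only the
   factorisation property, which splits over the apex c.\<close>
 have eq: "?L J D l p \<longleftrightarrow>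
   (\<forall>c\<in>obj K. \<forall>z. ?M c J D z
   \<longrightarrow> (?E c J D l p z))"
  if J: "finite_cat J" and D: "is_functor J B D" and l: "is_limit J B D l p" for J :: "(nat, nat) cat" and D l p
 proof -
  note cn = limit_cone[OF l]
  have "is_cone J K (comp_func J Y D) (omap Y l) (\<lambda>j. mmap Y l (omap D j) (p j))"
   unfolding is_cone_def
  proof (intro conjI ballI)
   fix i j f assume ij: "i \<in> obj J" "j \<in> obj J" "f \<in> hom J i j"
   show "cmp K (omap Y l) (omap (comp_func J Y D) i) (omap (comp_func J Y D) j) (mmap (comp_func J Y D) i j f)
    (mmap Y l (omap D i) (p i)) = mmap Y l (omap D j) (p j)"
    using functor_cmp[OF Y functor_hom[OF D ij(3)] cone_hom[OF cn ij(1)]] cone_cmp[OF cn ij] ij by simp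
  qed (auto simp: functor_obj[OF Y] cone_obj[OF cn] functor_hom[OF Y] cone_hom[OF cn])
  note A = this
  have B: "is_cone J K (comp_func J Y D) c z \<longleftrightarrow> c \<in> obj K &
   ?M c J D z" for c z
   unfolding is_cone_def matching_def by auto
  have C: "(\<forall>j\<in>obj J. cmp K x (omap Y l) (omap (comp_func J Y D) j) (mmap Y l (omap D j) (p j)) h = q j) \<longleftrightarrow>
   (\<forall>j\<in>obj J. cmp K x (omap Y l) (omap Y (omap D j)) (mmap Y l (omap D j) (p j)) h = q j)" for x q h
   by simp
  show ?thesis unfolding is_limit_def B C using A[unfolded B] by blast
 qed
 show ?thesis
  unfolding lex_functor_def preserves_finite_limits_def lex_action_def
 proof (intro iffI conjI ballI allI impI)
  fix c J D l p z
  assume L: "is_functor B K Y & (\<forall>(J :: (nat, nat) cat) D l p. finite_cat J & is_functor J B D & is_limit J B D l p \<longrightarrow>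
      ?L J D l p)"
   and c: "c \<in> obj K" and h: "finite_cat (J :: (nat, nat) cat) & is_functor J B D & is_limit J B D l p &
      ?M c J D z"
  from L h have "?L J D l p" by blast
  from iffD1[OF eq this, rule_format, OF _ _ _ c] h
  show "?E c J D l p z" by blast
 next
  fix J :: "(nat, nat) cat" and D l p
  assume R: "\<forall>c\<in>obj K. \<forall>(J :: (nat, nat) cat) D l p z. finite_cat J & is_functor J B D & is_limit J B D l p &
      ?M c J D z \<longrightarrow>
      (?E c J D l p z)"
   and h: "finite_cat J & is_functor J B D & is_limit J B D l p"
  show "?L J D l p"
   by (rule iffD2[OF eq]) (use R h in blast)+
 qed (rule Y)
qed

text \<open>In sets the one-point set already detects limits. Conversely, a mediating map out of S
  is found one element of S at a time.\<close>

lemma lex_set_iff: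
 fixes M :: "('o, 'm, 'v::universe set, 'v => 'v) func"
 assumes M: "is_functor B set_cat M"
 shows "lex_functor B set_cat M \<longleftrightarrow> lex_action B (omap M) (mmap M)"
proof -
 note [simp] = functor_cats[OF M]
 have sm: "small (omap M b)" if "b \<in> obj B" for b using functor_obj[OF M that] by simp
 have ac: "mmap M b b' g x \<in> omap M b'" if "g \<in> hom B b b'" "x \<in> omap M b" for b b' g x
  by (rule set_hom_in[OF functor_hom[OF M that(1)] that(2)])
 show ?thesis
 proof
  assume L: "lex_functor B set_cat M"
  \<comment> \<open>Any element of the universe will do: maps out of the singleton
    \<open>{o'}\<close> are elements of their codomain.\<close>
  obtain o' :: 'v where True by blast
  have s1: "small {o'}" using small_doubleton[of o' o'] by simp
  then have "{o'} \<in> obj set_cat" by simp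
  from L[unfolded lex_functor_iff_hom[OF M], rule_format, OF this]
  show "lex_action B (omap M) (mmap M)"
  proof (rule lex_action_iso[where \<phi> = "\<lambda>b h. h o'"])
   fix b assume b: "b \<in> obj B"
   show "bij_betw (\<lambda>h. h o') (hom set_cat {o'} (omap M b)) (omap M b)"
    by (rule bij_betw_byWitness[where f' = "\<lambda>x. restrict (\<lambda>_. x) {o'}"])
     (auto simp: set_hom s1 sm[OF b] PiE_iff extensional_def fun_eq_iff split: if_splits)
  qed (auto simp: set_cmp[OF _ functor_hom[OF M]] intro: cat_cmp[OF set_category] functor_hom[OF M])
 next
  assume A: "lex_action B (omap M) (mmap M)"
  show "lex_functor B set_cat M" unfolding lex_functor_iff_hom[OF M]
  proof
   fix S :: "'v set" assume "S \<in> obj set_cat"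
   then have S: "small S" by simp
   show "lex_action B (\<lambda>b. hom set_cat S (omap M b)) (\<lambda>b b' g h. cmp set_cat S (omap M b) (omap M b') (mmap M b b' g) h)"
    unfolding lex_action_def
   proof (intro allI impI, elim conjE)
    fix J :: "(nat, nat) cat" and D l p z
    assume J: "finite_cat J" and D: "is_functor J B D" and l: "is_limit J B D l p"
     and z: "matching J D (\<lambda>b. hom set_cat S (omap M b)) (\<lambda>b b' g h. cmp set_cat S (omap M b) (omap M b') (mmap M b b' g) h) z"
    note cn = limit_cone[OF l]
    have zh: "z j \<in> hom set_cat S (omap M (omap D j))" if "j \<in> obj J" for j using z that unfolding matching_def by blast
    have zc: "cmp set_cat S (omap M (omap D i)) (omap M (omap D j)) (mmap M (omap D i) (omap D j) (mmap D i j f)) (z i) = z j"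
     if "i \<in> obj J" "j \<in> obj J" "f \<in> hom J i j" for i j f using z that unfolding matching_def by blast
    have "matching J D (omap M) (mmap M) (\<lambda>j. z j s)" if s: "s \<in> S" for s unfolding matching_def
    proof (intro conjI ballI)
     fix i j f assume i: "i \<in> obj J" and j: "j \<in> obj J" and f: "f \<in> hom J i j"
     show "mmap M (omap D i) (omap D j) (mmap D i j f) (z i s) = z j s"
      using set_cmp[OF zh[OF i] functor_hom[OF M functor_hom[OF D f]] s] zc[OF i j f] by simp
    qed (rule set_hom_in[OF zh s])
    from lex_actionD[OF A J D l this]
    have "\<exists>!x. x \<in> omap M l & (\<forall>j\<in>obj J. mmap M l (omap D j) (p j) x = z j s)" if "s \<in> S" for s using that .
    then obtain x where x: "!!s. s \<in> S ==> x s \<in> omap M l"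
      "!!s j. s \<in> S ==> j \<in> obj J ==> mmap M l (omap D j) (p j) (x s) = z j s"
      and u: "!!s x'. s \<in> S ==> x' \<in> omap M l ==> (!!j. j \<in> obj J ==> mmap M l (omap D j) (p j) x' = z j s) ==> x' = x s"
     by metis
    note lo = cone_obj[OF cn]
    have xh: "restrict x S \<in> hom set_cat S (omap M l)" by (rule set_homI[OF S sm[OF lo] x(1)])
    note ph = functor_hom[OF M cone_hom[OF cn]]
    show "\<exists>!h. h \<in> hom set_cat S (omap M l) & (\<forall>j\<in>obj J. cmp set_cat S (omap M l) (omap M (omap D j)) (mmap M l (omap D j) (p j)) h = z j)"
    proof (intro ex1I[of _ "restrict x S"] conjI ballI xh)
     fix j assume j: "j \<in> obj J"
     show "cmp set_cat S (omap M l) (omap M (omap D j)) (mmap M l (omap D j) (p j)) (restrict x S) = z j"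
      by (rule set_hom_eqI[OF cat_cmp[OF set_category ph[OF j] xh] zh[OF j]])
       (simp add: set_cmp[OF xh ph[OF j]] x j)
    next
     fix h assume h: "h \<in> hom set_cat S (omap M l) & (\<forall>j\<in>obj J. cmp set_cat S (omap M l) (omap M (omap D j)) (mmap M l (omap D j) (p j)) h = z j)"
     then have hh: "h \<in> hom set_cat S (omap M l)" by blast
     show "h = restrict x S"
     proof (rule set_hom_eqI[OF hh xh])
      fix s assume s: "s \<in> S"
      have "h s = x s"
       by (rule u[OF s set_hom_in[OF hh s]]) (use h set_cmp[OF hh ph s] in auto)
      then show "h s = restrict x S s" using s by simp
     qed
    qed
   qed
  qed
 qed
qed

lemma lex_functorD: "lex_functor A B F ==> is_functor A B F"
 unfolding lex_functor_def by blast

lemma lex_functor_hom: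
 "lex_functor B K Y ==> c \<in> obj K ==> lex_action B (\<lambda>b. hom K c (omap Y b)) (\<lambda>b b' g h. cmp K c (omap Y b) (omap Y b') (mmap Y b b' g) h)"
 using lex_functor_iff_hom lex_functorD by blast

lemma lex_comp:
 assumes F: "lex_functor A B F" and G: "lex_functor B C G"
 shows "lex_functor A C (comp_func A G F)"
 unfolding lex_functor_def preserves_finite_limits_def
proof (intro conjI allI impI)
 note Ff = lex_functorD[OF F] and Gf = lex_functorD[OF G]
 show "is_functor A C (comp_func A G F)" by (rule comp_functor[OF Ff Gf])
 fix J :: "(nat, nat) cat" and D l p
 assume "finite_cat J & is_functor J A D & is_limit J A D l p"
 then have J: "finite_cat J" and D: "is_functor J A D" and l: "is_limit J A D l p" by blast+
 have 1: "is_limit J B (comp_func J F D) (omap F l) (\<lambda>j. mmap F l (omap D j) (p j))"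
  using F J D l unfolding lex_functor_def preserves_finite_limits_def by blast
 have 2: "is_limit J C (comp_func J G (comp_func J F D)) (omap G (omap F l))
   (\<lambda>j. mmap G (omap F l) (omap (comp_func J F D) j) (mmap F l (omap D j) (p j)))"
  using G J 1 comp_functor[OF D Ff] unfolding lex_functor_def preserves_finite_limits_def by blast
 note cn = limit_cone[OF l]
 show "is_limit J C (comp_func J (comp_func A G F) D) (omap (comp_func A G F) l)
   (\<lambda>j. mmap (comp_func A G F) l (omap D j) (p j))"
 proof -
  have "comp_func J (comp_func A G F) D = comp_func J G (comp_func J F D)"
   unfolding comp_func_def[of J] by (rule mk_func_cong) (auto simp: functor_obj[OF D] functor_hom[OF D])
  moreover have "omap (comp_func A G F) l = omap G (omap F l)" using cone_obj[OF cn] by simp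
  moreover have "mmap (comp_func A G F) l (omap D j) (p j) =
    mmap G (omap F l) (omap (comp_func J F D) j) (mmap F l (omap D j) (p j))" if "j \<in> obj J" for j
   using cone_obj[OF cn] cone_hom[OF cn that] functor_obj[OF D that] that by simp
  ultimately show ?thesis using 2 unfolding is_limit_def is_cone_def by simp
 qed
qed

lemma is_isoD:
 assumes "is_iso A a b f"
 obtains g where "g \<in> hom A b a" "cmp A a b a g f = idm A a" "cmp A b a b f g = idm A b"
 using assms unfolding is_iso_def by blast

lemma iso_post_bij:
 assumes A: "category A" and i: "is_iso A a b f"
 shows "bij_betw (\<lambda>h. cmp A c a b f h) (hom A c a) (hom A c b)"
proof -
 from i obtain g where g: "g \<in> hom A b a" "cmp A a b a g f = idm A a" "cmp A b a b f g = idm A b" by (rule is_isoD)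
 have f: "f \<in> hom A a b" using i unfolding is_iso_def by blast
 show ?thesis
  by (rule bij_betw_byWitness[where f' = "\<lambda>h. cmp A c b a g h"])
   (auto simp: cat_assoc[OF A, symmetric] f g cat_id_left[OF A] intro: cat_cmp[OF A] f g)
qed

text \<open>Postcomposition with the components is a natural bijection of hom-actions. This is what
  allows sieves to be closed under isomorphism.\<close>

lemma lex_iso:
 assumes F: "lex_functor A B F" and i: "naturally_isomorphic A B F G"
 shows "lex_functor A B G"
proof -
 from i obtain \<alpha> where n: "nat_trans A B F G \<alpha>" and \<alpha>: "!!a. a \<in> obj A ==> is_iso B (omap F a) (omap G a) (\<alpha> a)"
  unfolding naturally_isomorphic_def by blast
 note Ff = nat_functors(1)[OF n] and Gf = nat_functors(2)[OF n]
 note B = functor_cats(2)[OF Ff]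
 show ?thesis unfolding lex_functor_iff_hom[OF Gf]
 proof
  fix c assume c: "c \<in> obj B"
  show "lex_action A (\<lambda>b. hom B c (omap G b)) (\<lambda>b b' g h. cmp B c (omap G b) (omap G b') (mmap G b b' g) h)"
  proof (rule lex_action_iso[OF lex_functor_hom[OF F c], where \<phi> = "\<lambda>b h. cmp B c (omap F b) (omap G b) (\<alpha> b) h"])
   fix b b' g x assume b: "b \<in> obj A" "b' \<in> obj A" and g: "g \<in> hom A b b'" and x: "x \<in> hom B c (omap F b)"
   show "cmp B c (omap G b) (omap G b') (mmap G b b' g) (cmp B c (omap F b) (omap G b) (\<alpha> b) x) =
    cmp B c (omap F b') (omap G b') (\<alpha> b') (cmp B c (omap F b) (omap F b') (mmap F b b' g) x)"
    using nat_nat[OF n g]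
    by (simp add: cat_assoc[OF B x, symmetric] nat_hom[OF n] b functor_hom[OF Ff g] functor_hom[OF Gf g])
  qed (auto intro: iso_post_bij[OF B \<alpha>] cat_cmp[OF B] functor_hom[OF Ff])
 qed
qed

section \<open>Profunctors and 2-cells on elements\<close>

text \<open>Profunctors before exactness: a composite is first built as one of these, and shown to
  preserve finite limits only much later.\<close>

definition is_prof :: "'v::universe vcat => 'v vcat => 'v prof => bool" where
 "is_prof A B M \<longleftrightarrow> category A & category B & is_functor (prof_dom A B) set_cat M"

definition mk_prof :: "'v::universe vcat => 'v vcat => ('v => 'v => 'v set) =>
  ('v => 'v => 'v => 'v => 'v => 'v => 'v => 'v) => 'v prof" where
 "mk_prof A B P Q = mk_func (prof_dom A B) (\<lambda>(a, b). P a b)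
   (\<lambda>(a, b) (a', b') (f, g). restrict (Q a b a' b' f g) (P a b))"

lemma prof_cats: "is_prof A B M ==> category A" "is_prof A B M ==> category B"
 unfolding is_prof_def by blast+

lemma prof_dom_hom: "category A ==> category B ==>
  hom (prof_dom A B) (a, b) (a', b') = hom A a' a \<times> hom B b b'"
 by (simp add: op_category)

lemma prof_small: "is_prof A B M ==> a \<in> obj A ==> b \<in> obj B ==> small (omap M (a, b))"
 unfolding is_prof_def using functor_obj[of "prof_dom A B" set_cat M "(a, b)"] by simp

lemma prof_hom: "is_prof A B M ==> f \<in> hom A a' a ==> g \<in> hom B b b' ==>
  mmap M (a, b) (a', b') (f, g) \<in> hom set_cat (omap M (a, b)) (omap M (a', b'))"
 unfolding is_prof_def by (auto intro!: functor_hom simp: prof_dom_hom)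

lemma prof_act: "is_prof A B M ==> x \<in> omap M (a, b) ==> f \<in> hom A a' a ==> g \<in> hom B b b' ==>
  mmap M (a, b) (a', b') (f, g) x \<in> omap M (a', b')"
 by (rule set_hom_in[OF prof_hom])

lemma prof_id: "is_prof A B M ==> a \<in> obj A ==> b \<in> obj B ==> x \<in> omap M (a, b) ==>
  mmap M (a, b) (a, b) (idm A a, idm B b) x = x"
 unfolding is_prof_def using functor_id[of "prof_dom A B" set_cat M "(a, b)"]
  functor_obj[of "prof_dom A B" set_cat M "(a, b)"] by simp

lemma prof_cmp:
 assumes M: "is_prof A B M" and x: "x \<in> omap M (a, b)" and f: "f \<in> hom A a' a" "f' \<in> hom A a'' a'"
  and g: "g \<in> hom B b b'" "g' \<in> hom B b' b''"
 shows "mmap M (a', b') (a'', b'') (f', g') (mmap M (a, b) (a', b') (f, g) x) =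
  mmap M (a, b) (a'', b'') (cmp A a'' a' a f f', cmp B b b' b'' g' g) x"
proof -
 note [simp] = prof_cats[OF M] op_category
 have F: "is_functor (prof_dom A B) set_cat M" using M unfolding is_prof_def by blast
 have h: "(f, g) \<in> hom (prof_dom A B) (a, b) (a', b')" "(f', g') \<in> hom (prof_dom A B) (a', b') (a'', b'')"
  using f g by simp_all
 have e: "cmp (prof_dom A B) (a, b) (a', b') (a'', b'') (f', g') (f, g) = (cmp A a'' a' a f f', cmp B b b' b'' g' g)"
  using f g by simp
 show ?thesis
  using functor_cmp[OF F h(2,1)] set_cmp[OF functor_hom[OF F h(1)] functor_hom[OF F h(2)] x] unfolding e by simp
qed

text \<open>The joint action can be performed one variable at a time in either order; comparing the
  two right-hand sides shows that left and right actions commute.\<close>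

lemma prof_split:
 assumes M: "is_prof A B M" and x: "x \<in> omap M (a, b)" and f: "f \<in> hom A a' a" and g: "g \<in> hom B b b'"
 shows "mmap M (a, b) (a', b') (f, g) x =
   ract A M a' b b' g (lact B M b a a' f x)"
  and "mmap M (a, b) (a', b') (f, g) x =
   lact B M b' a a' f (ract A M a b b' g x)"
proof -
 note c = prof_cats[OF M]
 have o: "a \<in> obj A" "a' \<in> obj A" "b \<in> obj B" "b' \<in> obj B" using f g hom_obj c by metis+
 show "mmap M (a, b) (a', b') (f, g) x =
   ract A M a' b b' g (lact B M b a a' f x)"
  using prof_cmp[OF M x f cat_id[OF c(1) o(2)] cat_id[OF c(2) o(3)] g]
  by (simp add: cat_id_right[OF c(1) f] cat_id_right[OF c(2) g])
 show "mmap M (a, b) (a', b') (f, g) x =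
   lact B M b' a a' f (ract A M a b b' g x)"
  using prof_cmp[OF M x cat_id[OF c(1) o(1)] f g cat_id[OF c(2) o(4)]]
  by (simp add: cat_id_left[OF c(1) f] cat_id_left[OF c(2) g])
qed

lemma mk_prof_omap [simp]: "a \<in> obj A ==> b \<in> obj B ==> omap (mk_prof A B P Q) (a, b) = P a b"
 by (simp add: mk_prof_def)

lemma mk_prof_mmap [simp]: "category A ==> category B ==> f \<in> hom A a' a ==> g \<in> hom B b b' ==> x \<in> P a b ==>
  mmap (mk_prof A B P Q) (a, b) (a', b') (f, g) x = Q a b a' b' f g x"
 using hom_obj[of A f a' a] hom_obj[of B g b b'] by (simp add: mk_prof_def op_category)

lemma profI:
 assumes A: "category A" and B: "category B"
  and small: "!!a b. a \<in> obj A ==> b \<in> obj B ==> small (P a b)"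
  and act: "!!a b a' b' f g x. f \<in> hom A a' a ==> g \<in> hom B b b' ==> x \<in> P a b ==> Q a b a' b' f g x \<in> P a' b'"
  and id: "!!a b x. a \<in> obj A ==> b \<in> obj B ==> x \<in> P a b ==> Q a b a b (idm A a) (idm B b) x = x"
  and cmp: "!!a b a' b' a'' b'' f g f' g' x. f \<in> hom A a' a ==> g \<in> hom B b b' ==> f' \<in> hom A a'' a' ==> g' \<in> hom B b' b'' ==>
   x \<in> P a b ==> Q a b a'' b'' (cmp A a'' a' a f f') (cmp B b b' b'' g' g) x = Q a' b' a'' b'' f' g' (Q a b a' b' f g x)"
 shows "is_prof A B (mk_prof A B P Q)"
proof -
 note [simp] = A B op_category set_category prod_category
 have h: "restrict (Q a b a' b' f g) (P a b) \<in> hom set_cat (P a b) (P a' b')"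
  if "f \<in> hom A a' a" "g \<in> hom B b b'" for a b a' b' f g
  using hom_obj[OF A that(1)] hom_obj[OF B that(2)] by (intro set_homI small act that) auto
 show ?thesis unfolding is_prof_def mk_prof_def
 proof (intro conjI A B functorI, goal_cases)
  case (3 p) then show ?case by (auto simp: small)
 next
  case (4 p q f) then show ?case using h by (cases p; cases q; cases f; simp)
 next
  case (5 p)
  then obtain a b where [simp]: "p = (a, b)" "a \<in> obj A" "b \<in> obj B" by auto
  show ?case by (auto simp: small id restrict_def)
 next
  case (6 p q r g f)
  obtain a b a' b' a'' b'' u v u' v' where [simp]: "p = (a, b)" "q = (a', b')" "r = (a'', b'')" "f = (u, v)" "g = (u', v')"
   by (metis surj_pair)
  have m: "u \<in> hom A a' a" "u' \<in> hom A a'' a'" "v \<in> hom B b b'" "v' \<in> hom B b' b''" using 6 by auto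
  show ?case using m by (simp add: set_cmp_eq[OF h h]) (rule restrict_ext, simp add: cmp act)
 qed simp_all
qed

lemma prof_lex_iff:
 assumes M: "is_prof A B M" and a: "a \<in> obj A"
 shows "lex_functor B set_cat (fix_first A B M a) \<longleftrightarrow>
  lex_action B (\<lambda>b. omap M (a, b)) (ract A M a)"
proof -
 note [simp] = prof_cats[OF M] set_category
 note ia = cat_id[OF prof_cats(1)[OF M] a]
 have F: "is_functor B set_cat (fix_first A B M a)" unfolding fix_first_def
 proof (rule functorI)
  fix b b' c g f assume h: "g \<in> hom B b' c" "f \<in> hom B b b'"
  show "ract A M a b c (cmp B b b' c g f) = cmp set_cat (omap M (a, b)) (omap M (a, b'))
    (omap M (a, c)) (ract A M a b' c g) (ract A M a b b' f)"
   by (rule set_hom_eqI[OF prof_hom[OF M ia cat_cmp[OF _ h]] cat_cmp[OF set_category prof_hom[OF M ia h(1)] prof_hom[OF M ia h(2)]]])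
    (simp_all add: set_cmp[OF prof_hom[OF M ia h(2)] prof_hom[OF M ia h(1)]] prof_cmp[OF M _ ia ia h(2,1)] cat_id_left[OF _ ia])
 next
  fix b assume b: "b \<in> obj B"
  show "mmap M (a, b) (a, b) (idm A a, idm B b) = idm set_cat (omap M (a, b))"
   by (rule set_hom_eqI[OF prof_hom[OF M ia cat_id[OF _ b]] cat_id])
    (simp_all add: prof_id[OF M a b] prof_small[OF M a b])
 qed (use prof_small[OF M a] prof_hom[OF M ia] in auto)
 show ?thesis unfolding lex_set_iff[OF F]
 proof
  assume "lex_action B (omap (fix_first A B M a)) (mmap (fix_first A B M a))"
  then show "lex_action B (\<lambda>b. omap M (a, b)) (ract A M a)"
   by (rule lex_action_cong) (auto simp: fix_first_def intro!: prof_act[OF M _ ia])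
 next
  assume "lex_action B (\<lambda>b. omap M (a, b)) (ract A M a)"
  then show "lex_action B (omap (fix_first A B M a)) (mmap (fix_first A B M a))"
   by (rule lex_action_cong) (auto simp: fix_first_def intro!: prof_act[OF M _ ia])
 qed
qed

lemma small_lex_catD:
 "small_lex_cat A ==> category A" "small_lex_cat A ==> small (obj A)"
 "small_lex_cat A ==> small (hom A a b)" "small_lex_cat A ==> has_finite_limits A"
proof -
 assume A: "small_lex_cat A"
 then show c: "category A" "small (obj A)" "has_finite_limits A" unfolding small_lex_cat_def by blast+
 show "small (hom A a b)"
 proof (cases "a \<in> obj A & b \<in> obj A")
  case True then show ?thesis using A unfolding small_lex_cat_def locally_small_def by blast
 next
  case False
  then have "hom A a b = {}" using hom_obj[OF c(1)] by blast
  then show ?thesis using small_empty by simp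
 qed
qed

lemma lex_profD:
 "lex_prof A B M ==> small_lex_cat A" "lex_prof A B M ==> small_lex_cat B" "lex_prof A B M ==> is_prof A B M"
 unfolding lex_prof_def is_prof_def using small_lex_catD(1) by blast+

lemma lex_prof_action: "lex_prof A B M ==> a \<in> obj A ==>
  lex_action B (\<lambda>b. omap M (a, b)) (ract A M a)"
 using prof_lex_iff[OF lex_profD(3)] unfolding lex_prof_def by blast

lemma lex_profI:
 assumes "small_lex_cat A" "small_lex_cat B" and M: "is_prof A B M"
  and "!!a. a \<in> obj A ==> lex_action B (\<lambda>b. omap M (a, b)) (ract A M a)"
 shows "lex_prof A B M"
 unfolding lex_prof_def using assms prof_lex_iff[OF M] unfolding is_prof_def by blast

lemma cell_hom: "two_cell A B M N \<sigma> ==> a \<in> obj A ==> b \<in> obj B ==> \<sigma> (a, b) \<in> hom set_cat (omap M (a, b)) (omap N (a, b))"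
 unfolding two_cell_def by (rule nat_hom) auto

lemma cell_in: "two_cell A B M N \<sigma> ==> a \<in> obj A ==> b \<in> obj B ==> x \<in> omap M (a, b) ==> \<sigma> (a, b) x \<in> omap N (a, b)"
 by (rule set_hom_in[OF cell_hom])

lemma cell_profs:
 assumes "two_cell A B M N \<sigma>" "category A" "category B"
 shows "is_prof A B M" "is_prof A B N"
 using assms unfolding two_cell_def is_prof_def by (auto dest: nat_functors)

lemma cell_nat:
 assumes s: "two_cell A B M N \<sigma>" and c: "category A" "category B"
  and x: "x \<in> omap M (a, b)" and f: "f \<in> hom A a' a" and g: "g \<in> hom B b b'"
 shows "\<sigma> (a', b') (mmap M (a, b) (a', b') (f, g) x) = mmap N (a, b) (a', b') (f, g) (\<sigma> (a, b) x)"
proof -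
 have h: "(f, g) \<in> hom (prof_dom A B) (a, b) (a', b')" using f g c by (simp add: op_category)
 have o: "a \<in> obj A" "a' \<in> obj A" "b \<in> obj B" "b' \<in> obj B" using f g hom_obj c by metis+
 note p = cell_profs[OF s c]
 show ?thesis
  using nat_nat[OF s[unfolded two_cell_def] h] set_cmp[OF prof_hom[OF p(1) f g] cell_hom[OF s o(2,4)] x]
   set_cmp[OF cell_hom[OF s o(1,3)] prof_hom[OF p(2) f g] x] by simp
qed

lemma mk_cell_simp [simp]: "a \<in> obj A ==> b \<in> obj B ==> x \<in> omap M (a, b) ==> mk_cell A B M s (a, b) x = s a b x"
 by (simp add: mk_cell_def)

lemma mk_cell_cong:
 assumes "!!a b x. a \<in> obj A ==> b \<in> obj B ==> x \<in> omap M (a, b) ==> s a b x = s' a b x"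
 shows "mk_cell A B M s = mk_cell A B M s'"
 unfolding mk_cell_def using assms by (auto intro!: ext simp: restrict_def)

lemma cell_mk: "two_cell A B M N \<sigma> ==> mk_cell A B M (\<lambda>a b. \<sigma> (a, b)) = \<sigma>"
proof -
 assume s: "two_cell A B M N \<sigma>"
 have e: "\<sigma> \<in> extensional (obj (prof_dom A B))" using s unfolding two_cell_def by (rule nat_ext)
 have x: "restrict (\<sigma> (a, b)) (omap M (a, b)) = \<sigma> (a, b)" if "a \<in> obj A" "b \<in> obj B" for a b
  using cell_hom[OF s that] unfolding set_hom by (auto simp: PiE_iff extensional_restrict)
 show ?thesis unfolding mk_cell_def using x by (intro extensionalityI[OF _ e]) auto
qed

lemma cell_eqI:
 assumes "two_cell A B M N \<sigma>" "two_cell A B M N' \<tau>"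
  and "!!a b x. a \<in> obj A ==> b \<in> obj B ==> x \<in> omap M (a, b) ==> \<sigma> (a, b) x = \<tau> (a, b) x"
 shows "\<sigma> = \<tau>"
 using mk_cell_cong[of A B M "\<lambda>a b. \<sigma> (a, b)" "\<lambda>a b. \<tau> (a, b)"] cell_mk[OF assms(1)] cell_mk[OF assms(2)] assms(3) by simp

lemma cellI:
 assumes M: "is_prof A B M" and N: "is_prof A B N"
  and i: "!!a b x. a \<in> obj A ==> b \<in> obj B ==> x \<in> omap M (a, b) ==> s a b x \<in> omap N (a, b)"
  and n: "!!a b a' b' f g x. f \<in> hom A a' a ==> g \<in> hom B b b' ==> x \<in> omap M (a, b) ==>
   s a' b' (mmap M (a, b) (a', b') (f, g) x) = mmap N (a, b) (a', b') (f, g) (s a b x)"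
 shows "two_cell A B M N (mk_cell A B M s)"
proof -
 note c = prof_cats[OF M]
 note [simp] = c op_category
 have h: "restrict (s a b) (omap M (a, b)) \<in> hom set_cat (omap M (a, b)) (omap N (a, b))" if "a \<in> obj A" "b \<in> obj B" for a b
  by (intro set_homI prof_small[OF M] prof_small[OF N] i that)
 show ?thesis unfolding two_cell_def mk_cell_def
 proof (rule natI)
  show "is_functor (prof_dom A B) set_cat M" "is_functor (prof_dom A B) set_cat N"
   using M N unfolding is_prof_def by blast+
  fix p assume "p \<in> obj (prof_dom A B)"
  then show "(case p of (a, b) => restrict (s a b) (omap M (a, b))) \<in> hom set_cat (omap M p) (omap N p)"
   using h by auto
 next
  fix p q w assume "w \<in> hom (prof_dom A B) p q"
  then obtain a b a' b' f g where [simp]: "p = (a, b)" "q = (a', b')" "w = (f, g)" and f: "f \<in> hom A a' a" and g: "g \<in> hom B b b'"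
   by (cases p; cases q; cases w) auto
  have o: "a \<in> obj A" "a' \<in> obj A" "b \<in> obj B" "b' \<in> obj B" using f g hom_obj c by metis+
  note hs = prof_hom[OF M f g] h[OF o(2,4)] h[OF o(1,3)] prof_hom[OF N f g]
  have "cmp set_cat (omap M (a, b)) (omap M (a', b')) (omap N (a', b')) (restrict (s a' b') (omap M (a', b'))) (mmap M (a, b) (a', b') (f, g)) =
   cmp set_cat (omap M (a, b)) (omap N (a, b)) (omap N (a', b')) (mmap N (a, b) (a', b') (f, g)) (restrict (s a b) (omap M (a, b)))"
   by (rule set_hom_eqI[OF cat_cmp[OF set_category hs(2,1)] cat_cmp[OF set_category hs(4,3)]])
    (simp add: set_cmp[OF hs(1,2)] set_cmp[OF hs(3,4)] n f g prof_act[OF M])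
  then show "cmp set_cat (omap M p) (omap M q) (omap N q) (case q of (a, b) => restrict (s a b) (omap M (a, b))) (mmap M p q w) =
   cmp set_cat (omap M p) (omap N p) (omap N q) (mmap N p q w) (case p of (a, b) => restrict (s a b) (omap M (a, b)))"
   by simp
 qed
qed

lemma vcomp_simp:
 assumes s: "two_cell A B M N \<sigma>" and t: "two_cell A B N P \<tau>" and ab: "a \<in> obj A" "b \<in> obj B" and x: "x \<in> omap M (a, b)"
 shows "vcomp A B M N P \<tau> \<sigma> (a, b) x = \<tau> (a, b) (\<sigma> (a, b) x)"
 using ab x by (simp add: vcomp_def comp_trans_def set_cmp[OF cell_hom[OF s ab] cell_hom[OF t ab]])

lemma vcomp_cell: "two_cell A B M N \<sigma> ==> two_cell A B N P \<tau> ==> two_cell A B M P (vcomp A B M N P \<tau> \<sigma>)"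
 unfolding two_cell_def vcomp_def by (rule comp_nat)

section \<open>Identity profunctors and hom-profunctors\<close>

lemma id_prof_mk: "id_prof A = mk_prof A A (\<lambda>a' a. hom A a' a)
   (\<lambda>a' a b' b f g h. cmp A b' a b g (cmp A b' a' a h f))"
 by (simp add: id_prof_def mk_prof_def)

lemma id_prof_simps [simp]:
 "a \<in> obj A ==> b \<in> obj A ==> omap (id_prof A) (a, b) = hom A a b"
 "category A ==> f \<in> hom A a' a ==> g \<in> hom A b b' ==> h \<in> hom A a b ==>
  mmap (id_prof A) (a, b) (a', b') (f, g) h = cmp A a' b b' g (cmp A a' a b h f)"
 unfolding id_prof_mk by auto

text \<open>The representable-type profunctor \<open>K(X-, Y-)\<close>; all hom-profunctors are of this form.\<close>

definition hom_prof :: "'v::universe vcat => 'v vcat => 'v vcat => 'v vfunc => 'v vfunc => 'v prof" where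
 "hom_prof A B K X Y = mk_prof A B (\<lambda>i j. hom K (omap X i) (omap Y j))
   (\<lambda>i j i' j' f g h. cmp K (omap X i') (omap Y j) (omap Y j') (mmap Y j j' g)
         (cmp K (omap X i') (omap X i) (omap Y j) h (mmap X i' i f)))"

lemma hom_prof_is_prof:
 assumes X: "is_functor A K X" and Y: "is_functor B K Y" and K: "locally_small K"
 shows "is_prof A B (hom_prof A B K X Y)"
 unfolding hom_prof_def
proof (rule profI)
 note [simp] = functor_cats[OF X] functor_cats[OF Y]
 show "category A" "category B" by simp_all
 show "small (hom K (omap X a) (omap Y b))" if "a \<in> obj A" "b \<in> obj B" for a b
  using K functor_obj[OF X that(1)] functor_obj[OF Y that(2)] unfolding locally_small_def by blast
 show "cmp K (omap X a') (omap Y b) (omap Y b') (mmap Y b b' g) (cmp K (omap X a') (omap X a) (omap Y b) x (mmap X a' a f))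
    \<in> hom K (omap X a') (omap Y b')" if "f \<in> hom A a' a" "g \<in> hom B b b'" "x \<in> hom K (omap X a) (omap Y b)" for a b a' b' f g x
  using that by (auto intro!: cat_cmp functor_hom[OF X] functor_hom[OF Y])
 show "cmp K (omap X a) (omap Y b) (omap Y b) (mmap Y b b (idm B b)) (cmp K (omap X a) (omap X a) (omap Y b) x (mmap X a a (idm A a))) = x"
  if "a \<in> obj A" "b \<in> obj B" "x \<in> hom K (omap X a) (omap Y b)" for a b x
  using that by (simp add: functor_id[OF X] functor_id[OF Y] cat_id_left cat_id_right)
 fix a b a' b' a'' b'' f g f' g' x
 assume h: "f \<in> hom A a' a" "g \<in> hom B b b'" "f' \<in> hom A a'' a'" "g' \<in> hom B b' b''" "x \<in> hom K (omap X a) (omap Y b)"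
 show "cmp K (omap X a'') (omap Y b) (omap Y b'') (mmap Y b b'' (cmp B b b' b'' g' g))
      (cmp K (omap X a'') (omap X a) (omap Y b) x (mmap X a'' a (cmp A a'' a' a f f'))) =
  cmp K (omap X a'') (omap Y b') (omap Y b'') (mmap Y b' b'' g') (cmp K (omap X a'') (omap X a') (omap Y b')
    (cmp K (omap X a') (omap Y b) (omap Y b') (mmap Y b b' g) (cmp K (omap X a') (omap X a) (omap Y b) x (mmap X a' a f))) (mmap X a'' a' f'))"
  using h functor_hom[OF X h(1)] functor_hom[OF X h(3)] functor_hom[OF Y h(2)] functor_hom[OF Y h(4)]
  by (simp add: functor_cmp[OF X h(1,3)] functor_cmp[OF Y h(4,2)] cat_assoc cat_cmp)
qed

lemma hom_prof_simps [simp]: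
 "a \<in> obj A ==> b \<in> obj B ==> omap (hom_prof A B K X Y) (a, b) = hom K (omap X a) (omap Y b)"
 "category A ==> category B ==> f \<in> hom A a' a ==> g \<in> hom B b b' ==> h \<in> hom K (omap X a) (omap Y b) ==>
  mmap (hom_prof A B K X Y) (a, b) (a', b') (f, g) h =
  cmp K (omap X a') (omap Y b) (omap Y b') (mmap Y b b' g) (cmp K (omap X a') (omap X a) (omap Y b) h (mmap X a' a f))"
 unfolding hom_prof_def by auto

lemma hom_prof_lex:
 assumes X: "is_functor A K X" and Y: "lex_functor B K Y" and K: "locally_small K"
  and A: "small_lex_cat A" and B: "small_lex_cat B"
 shows "lex_prof A B (hom_prof A B K X Y)"
proof (rule lex_profI[OF A B hom_prof_is_prof[OF X lex_functorD[OF Y] K]])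
 note lexD = lex_functorD[OF Y]
 note c = functor_cats[OF X] small_lex_catD(1)[OF A] small_lex_catD(1)[OF B]
 fix a assume a: "a \<in> obj A"
 show "lex_action B (\<lambda>b. omap (hom_prof A B K X Y) (a, b)) (\<lambda>b b' g. ract A (hom_prof A B K X Y) a b b' g)"
  by (rule lex_action_cong[OF lex_functor_hom[OF Y functor_obj[OF X a]]])
   (auto simp: a c cat_id functor_id[OF X] cat_id_right intro!: cat_cmp functor_hom[OF lexD])
qed

text \<open>Reduces exactness of the identity profunctor to that of the identity functor.\<close>

lemma id_prof_hom: "category A ==> id_prof A = hom_prof A A A (id_func A) (id_func A)"
 unfolding id_prof_mk hom_prof_def mk_prof_def
 by (rule mk_func_cong) (auto simp: op_category dest: hom_obj intro!: restrict_ext)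

text \<open>Cones with apex c are the matching families for A(c,-), so the universal property of a
  limit is the claim itself.\<close>

lemma id_lex: "category A ==> lex_functor A A (id_func A)"
 unfolding lex_functor_iff_hom[OF id_functor]
 unfolding lex_action_def
proof (intro ballI allI impI, elim conjE)
 fix c J D l p z
 assume A: "category A" and c: "c \<in> obj A" and J: "finite_cat (J :: (nat, nat) cat)" and D: "is_functor J A D" and l: "is_limit J A D l p"
  and z: "matching J D (\<lambda>b. hom A c (omap (id_func A) b)) (\<lambda>b b' g. cmp A c (omap (id_func A) b) (omap (id_func A) b') (mmap (id_func A) b b' g)) z"
 note cn = limit_cone[OF l]
 have "is_cone J A D c z" unfolding is_cone_def
  using z c functor_obj[OF D] functor_hom[OF D] unfolding matching_def by simp
 then have "\<exists>!h. h \<in> hom A c l & (\<forall>j\<in>obj J. cmp A c l (omap D j) (p j) h = z j)" using l unfolding is_limit_def by blast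
 then show "\<exists>!x. x \<in> hom A c (omap (id_func A) l) & (\<forall>j\<in>obj J. cmp A c (omap (id_func A) l) (omap (id_func A) (omap D j))
   (mmap (id_func A) l (omap D j) (p j)) x = z j)"
  using cone_obj[OF cn] cone_hom[OF cn] functor_obj[OF D] by simp
qed

lemma id_prof_lex: "small_lex_cat A ==> lex_prof A A (id_prof A)"
 by (subst id_prof_hom, rule small_lex_catD(1), assumption)
  (auto intro!: hom_prof_lex id_functor id_lex simp: small_lex_cat_def)

lemma id_prof_prof: "small_lex_cat A ==> is_prof A A (id_prof A)"
 by (rule lex_profD(3)[OF id_prof_lex])

section \<open>Small sets and coends\<close>

text \<open>Replacement applies only to maps inside the universe, so each \<open>F x\<close> is
  first replaced by its code \<open>vset (F x)\<close>; the union axiom then applies to the set of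
  codes.\<close>

lemma small_Union:
 fixes F :: "'v::universe => 'v set"
 assumes S: "small S" and F: "!!x. x \<in> S ==> small (F x)"
 shows "small (\<Union>x\<in>S. F x)"
proof -
 from small_image[OF S, of "\<lambda>x. vset (F x)"] obtain y where y: "elts y = (\<lambda>x. vset (F x)) ` S" unfolding small_def by blast
 obtain z where "elts z = (\<Union>w\<in>elts y. elts w)" using elts_Union by blast
 also have "\<dots> = (\<Union>x\<in>S. F x)" unfolding y by (auto simp: elts_vset[OF F])
 finally show ?thesis unfolding small_def by blast
qed

lemma small_pairs:
 assumes "small S" "!!x. x \<in> S ==> small (F x)"
 shows "small {vpair x y |x y. x \<in> S & y \<in> F x}"
proof -
 have "small (\<Union>x\<in>S. vpair x ` F x)" by (intro small_Union small_image assms)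
 moreover have "(\<Union>x\<in>S. vpair x ` F x) = {vpair x y |x y. x \<in> S & y \<in> F x}" by auto
 ultimately show ?thesis by simp
qed

text \<open>A coded graph has its elements among the coded pairs, so all these graphs lie in one
  power set. This bounds the hom-sets of the coded categories below.\<close>

lemma small_graphs:
 assumes S: "small S" and T: "small T"
 shows "small (vgraph S ` (S \<rightarrow> T))"
proof (rule small_subset)
 show "small {z. elts z \<subseteq> {vpair x y |x y. x \<in> S & y \<in> T}}" by (intro small_Pow small_pairs S T)
 show "vgraph S ` (S \<rightarrow> T) \<subseteq> {z. elts z \<subseteq> {vpair x y |x y. x \<in> S & y \<in> T}}"
 proof safe
  fix f z assume f: "f \<in> S \<rightarrow> T" and z: "z \<in> elts (vgraph S f)"
  have "z \<in> (\<lambda>x. vpair x (f x)) ` S" using z unfolding vgraph_def elts_vset[OF small_image[OF S]] .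
  then show "\<exists>x y. z = vpair x y & x \<in> S & y \<in> T" using f by auto
 qed
qed

section \<open>Coends as quotients of sets of triples\<close>

locale composable =
 fixes A B C :: "'v::universe vcat" and N M :: "'v prof"
 assumes M: "is_prof A B M" and N: "is_prof B C N" and small_mid: "small (obj B)"
begin

abbreviation "step \<equiv> coend_step A B C N M"
abbreviation "triples \<equiv> coend_triples B N M"
abbreviation "cls \<equiv> coend_class A B C N M"
abbreviation "rep \<equiv> coend_rep A B C N M"
abbreviation "NM \<equiv> tensor A B C N M"

lemma cats: "category A" "category B" "category C"
 using prof_cats[OF M] prof_cats[OF N] by auto

lemma triples_iff: "(b, n, m) \<in> triples a c \<longleftrightarrow> b \<in> obj B & n \<in> omap N (b, c) & m \<in> omap M (a, b)"
 by (simp add: coend_triples_def)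

lemma stepI: "g \<in> hom B b b' ==> n \<in> omap N (b', c) ==> m \<in> omap M (a, b) ==>
  ((b, lact C N c b' b g n, m), (b', n, ract A M a b b' g m)) \<in> step a c"
 using hom_obj[OF cats(2)] unfolding coend_step_def by blast

lemma stepE:
 assumes "(t, t') \<in> step a c"
 obtains b b' g n m where "g \<in> hom B b b'" "n \<in> omap N (b', c)" "m \<in> omap M (a, b)"
  "t = (b, lact C N c b' b g n, m)" "t' = (b', n, ract A M a b b' g m)"
 using assms unfolding coend_step_def by blast

lemma step_triples:
 assumes s: "(t, t') \<in> step a c" and a: "a \<in> obj A" and c: "c \<in> obj C"
 shows "t \<in> triples a c & t' \<in> triples a c"
 using s by (rule stepE)
  (auto simp: triples_iff hom_obj[OF cats(2)] intro: prof_act[OF N] prof_act[OF M] cat_id[OF cats(1) a] cat_id[OF cats(3) c]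
    hom_dom[OF cats(2)] hom_cod[OF cats(2)])

abbreviation "conv a c \<equiv> (step a c \<union> (step a c)\<inverse>)\<^sup>*"

lemma conv_sym: "(t, t') \<in> conv a c ==> (t', t) \<in> conv a c"
 by (rule symD[OF sym_rtrancl]) (auto simp: sym_def)

lemma conv_triples:
 assumes "(t, t') \<in> conv a c" "a \<in> obj A" "c \<in> obj C" "t \<in> triples a c"
 shows "t' \<in> triples a c"
 using assms(1,4) by (induction rule: rtrancl_induct) (auto dest: step_triples[OF _ assms(2,3)])

lemma inj_code: "inj (\<lambda>(b, n, m). vpair b (vpair n m))"
 by (auto simp: inj_def vpair_inject)

lemma small_triples:
 assumes a: "a \<in> obj A" and c: "c \<in> obj C"
 shows "small ((\<lambda>(b, n, m). vpair b (vpair n m)) ` triples a c)"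
proof (rule small_subset)
 show "small {vpair b p |b p. b \<in> obj B & p \<in> {vpair n m |n m. n \<in> omap N (b, c) & m \<in> omap M (a, b)}}"
  by (intro small_pairs small_mid prof_small[OF N] prof_small[OF M] a c)
qed (auto simp: coend_triples_def)

text \<open>The class of a triple stays inside the set of triples, which is small because the middle
  category is; on small sets \<open>vset\<close> is injective, so equality of codes is equality of
  classes.\<close>

lemma cls_eq:
 assumes a: "a \<in> obj A" and c: "c \<in> obj C" and t: "t \<in> triples a c" and t': "t' \<in> triples a c"
 shows "cls a c t = cls a c t' \<longleftrightarrow> (t, t') \<in> conv a c"
proof -
 let ?k = "\<lambda>(b, n, m). vpair b (vpair n m)"
 have s: "small (?k ` (conv a c `` {u}))" if "u \<in> triples a c" for u
  by (rule small_subset[OF small_triples[OF a c]]) (use conv_triples[OF _ a c that] in blast)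
 have "cls a c t = cls a c t' \<longleftrightarrow> ?k ` (conv a c `` {t}) = ?k ` (conv a c `` {t'})"
  unfolding coend_class_def by (rule vset_inject[OF s[OF t] s[OF t']])
 also have "\<dots> \<longleftrightarrow> conv a c `` {t} = conv a c `` {t'}" by (rule inj_image_eq_iff[OF inj_code])
 also have "\<dots> \<longleftrightarrow> (t, t') \<in> conv a c" using conv_sym by (blast intro: rtrancl_trans)
 finally show ?thesis .
qed

lemma cls_step:
 assumes "a \<in> obj A" "c \<in> obj C" "g \<in> hom B b b'" "n \<in> omap N (b', c)" "m \<in> omap M (a, b)"
 shows "cls a c (b, lact C N c b' b g n, m) = cls a c (b', n, ract A M a b b' g m)"
 using stepI[OF assms(3-5)] step_triples[OF stepI[OF assms(3-5)] assms(1,2)] cls_eq[OF assms(1,2)] by blast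

lemma rep_cls:
 assumes "a \<in> obj A" "c \<in> obj C" "t \<in> triples a c"
 shows "rep a c (cls a c t) \<in> triples a c" "(rep a c (cls a c t), t) \<in> conv a c"
proof -
 have "rep a c (cls a c t) \<in> triples a c & cls a c (rep a c (cls a c t)) = cls a c t"
  unfolding coend_rep_def[of A B C N M a c "cls a c t"] by (rule someI) (use assms(3) in blast)
 then show "rep a c (cls a c t) \<in> triples a c" "(rep a c (cls a c t), t) \<in> conv a c"
  using cls_eq[OF assms(1,2)] assms(3) by blast+
qed

lemma lift_conv:
 assumes "(t, t') \<in> conv a c" "!!t t'. (t, t') \<in> step a c ==> s t = s t'"
 shows "s t = s t'"
 using assms(1) by (induction rule: rtrancl_induct) (auto dest: assms(2))

text \<open>A function that does not change along one step is constant along the zigzag from the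
  chosen representative to the given triple, so the choice made by \<open>coend_rep\<close> is
  invisible.\<close>

lemma lift_rep:
 assumes a: "a \<in> obj A" and c: "c \<in> obj C" and t: "b \<in> obj B" "n \<in> omap N (b, c)" "m \<in> omap M (a, b)"
  and d: "!!b b' g n m. g \<in> hom B b b' ==> n \<in> omap N (b', c) ==> m \<in> omap M (a, b) ==>
   s b (lact C N c b' b g n) m = s b' n (ract A M a b b' g m)"
 shows "(case rep a c (cls a c (b, n, m)) of (b, n, m) => s b n m) = s b n m"
proof -
 have "(case rep a c (cls a c (b, n, m)) of (b, n, m) => s b n m) = (case (b, n, m) of (b, n, m) => s b n m)"
 proof (rule lift_conv[where s = "\<lambda>(b, n, m). s b n m"])
  show "(rep a c (cls a c (b, n, m)), (b, n, m)) \<in> conv a c" by (rule rep_cls(2)[OF a c]) (simp add: triples_iff t)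
  fix t t' assume "(t, t') \<in> step a c"
  then show "(case t of (b, n, m) => s b n m) = (case t' of (b, n, m) => s b n m)"
   by (rule stepE) (simp add: d)
 qed
 then show ?thesis by simp
qed

lemma tensor_mk: "NM = mk_prof A C (\<lambda>a c. cls a c ` triples a c)
  (\<lambda>a c a' c' f g z. case rep a c z of (b, n, m) =>
   cls a' c' (b, ract B N b c c' g n, lact B M b a a' f m))"
 by (simp add: tensor_def mk_prof_def)

lemma tensor_omap: "a \<in> obj A ==> c \<in> obj C ==> omap NM (a, c) = cls a c ` triples a c"
 by (simp add: tensor_mk)

lemma tensor_in: "a \<in> obj A ==> c \<in> obj C ==> b \<in> obj B ==> n \<in> omap N (b, c) ==> m \<in> omap M (a, b) ==>
  cls a c (b, n, m) \<in> omap NM (a, c)"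
 by (simp add: tensor_omap triples_iff)

lemma tensor_cases:
 assumes "z \<in> omap NM (a, c)" "a \<in> obj A" "c \<in> obj C"
 obtains b n m where "b \<in> obj B" "n \<in> omap N (b, c)" "m \<in> omap M (a, b)" "z = cls a c (b, n, m)"
 using assms by (auto simp: tensor_omap triples_iff)

lemma acts_commute:
 assumes n: "n \<in> omap N (b', c)" and g: "g \<in> hom B b b'" and k: "k \<in> hom C c c'"
 shows "ract B N b c c' k (lact C N c b' b g n) =
  lact C N c' b' b g (ract B N b' c c' k n)"
 using prof_split[OF N n g k] by simp

lemma acts_commute':
 assumes m: "m \<in> omap M (a, b)" and g: "g \<in> hom B b b'" and f: "f \<in> hom A a' a"
 shows "lact B M b' a a' f (ract A M a b b' g m) =
  ract A M a' b b' g (lact B M b a a' f m)"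
 using prof_split[OF M m f g] by simp

lemma rep_act:
 assumes f: "f \<in> hom A a' a" and g: "g \<in> hom C c c'" and t: "b \<in> obj B" "n \<in> omap N (b, c)" "m \<in> omap M (a, b)"
 shows "(case rep a c (cls a c (b, n, m)) of (b, n, m) =>
   cls a' c' (b, ract B N b c c' g n, lact B M b a a' f m)) =
  cls a' c' (b, ract B N b c c' g n, lact B M b a a' f m)"
proof (rule lift_rep[OF hom_cod[OF cats(1) f] hom_dom[OF cats(3) g] t])
 fix b b' h n m assume h: "h \<in> hom B b b'" and n: "n \<in> omap N (b', c)" and m: "m \<in> omap M (a, b)"
 note o = hom_obj[OF cats(2) h]
 show "cls a' c' (b, ract B N b c c' g (lact C N c b' b h n), lact B M b a a' f m) =
   cls a' c' (b', ract B N b' c c' g n, lact B M b' a a' f (ract A M a b b' h m))"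
  unfolding acts_commute[OF n h g] acts_commute'[OF m h f]
  by (rule cls_step[OF hom_dom[OF cats(1) f] hom_cod[OF cats(3) g] h])
   (auto intro!: prof_act[OF N n] prof_act[OF M m] cat_id cats f g simp: o)
qed

lemma tensor_prof: "is_prof A C NM"
 unfolding tensor_mk
proof (rule profI)
 fix a c assume ac: "a \<in> obj A" "c \<in> obj C"
 \<comment> \<open>Triples are HOL tuples, out of reach of replacement; the quotient map is
   rewritten as a map on coded triples through an inverse of the coding.\<close>
 have "cls a c ` triples a c = (\<lambda>z. cls a c (vfst' z)) ` ((\<lambda>(b, n, m). vpair b (vpair n m)) ` triples a c)"
  if "!!t. vfst' ((\<lambda>(b, n, m). vpair b (vpair n m)) t) = t" for vfst'
  by (simp add: image_image that)
 from this[OF inv_f_f[OF inj_code]] show "small (cls a c ` triples a c)"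
  by (simp only:) (rule small_image[OF small_triples[OF ac]])
next
 fix a c a' c' f g z assume f: "f \<in> hom A a' a" and g: "g \<in> hom C c c'" and z: "z \<in> cls a c ` triples a c"
 note o = hom_obj[OF cats(1) f] hom_obj[OF cats(3) g]
 from z obtain b n m where t: "b \<in> obj B" "n \<in> omap N (b, c)" "m \<in> omap M (a, b)" and [simp]: "z = cls a c (b, n, m)"
  by (auto simp: triples_iff)
 show "(case rep a c z of (b, n, m) => cls a' c' (b, ract B N b c c' g n, lact B M b a a' f m))
   \<in> cls a' c' ` triples a' c'"
  using rep_act[OF f g t] t
  by (auto intro!: imageI prof_act[OF N] prof_act[OF M] cat_id cats f g simp: triples_iff o)
next
 fix a c z assume ac: "a \<in> obj A" "c \<in> obj C" and z: "z \<in> cls a c ` triples a c"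
 from z obtain b n m where t: "b \<in> obj B" "n \<in> omap N (b, c)" "m \<in> omap M (a, b)" and [simp]: "z = cls a c (b, n, m)"
  by (auto simp: triples_iff)
 show "(case rep a c z of (b, n, m) => cls a c (b, mmap N (b, c) (b, c) (idm B b, idm C c) n, mmap M (a, b) (a, b) (idm A a, idm B b) m)) = z"
  using rep_act[OF cat_id[OF cats(1) ac(1)] cat_id[OF cats(3) ac(2)] t] by (simp add: prof_id[OF N] prof_id[OF M] t ac)
next
 fix a c a' c' a'' c'' f g f' g' z
 assume f: "f \<in> hom A a' a" "f' \<in> hom A a'' a'" and g: "g \<in> hom C c c'" "g' \<in> hom C c' c''" and z: "z \<in> cls a c ` triples a c"
 from z obtain b n m where t: "b \<in> obj B" "n \<in> omap N (b, c)" "m \<in> omap M (a, b)" and [simp]: "z = cls a c (b, n, m)"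
  by (auto simp: triples_iff)
 note ib = cat_id[OF cats(2) t(1)]
 note t' = t(1) prof_act[OF N t(2) ib g(1)] prof_act[OF M t(3) f(1) ib]
 show "(case rep a c z of (b, n, m) => cls a'' c'' (b, ract B N b c c'' (cmp C c c' c'' g' g) n,
     lact B M b a a'' (cmp A a'' a' a f f') m)) =
  (case rep a' c' (case rep a c z of (b, n, m) => cls a' c' (b, ract B N b c c' g n, lact B M b a a' f m)) of
   (b, n, m) => cls a'' c'' (b, ract B N b c' c'' g' n, lact B M b a' a'' f' m))"
  using rep_act[OF cat_cmp[OF cats(1) f] cat_cmp[OF cats(3) g(2,1)] t]
   rep_act[OF f(1) g(1) t] rep_act[OF f(2) g(2) t']
   prof_cmp[OF N t(2) ib ib g] prof_cmp[OF M t(3) f ib ib] by (simp add: cat_id_left[OF cats(2) ib])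
qed (rule cats)+

lemma tensor_act:
 assumes f: "f \<in> hom A a' a" and g: "g \<in> hom C c c'" and t: "b \<in> obj B" "n \<in> omap N (b, c)" "m \<in> omap M (a, b)"
 shows "mmap NM (a, c) (a', c') (f, g) (cls a c (b, n, m)) =
  cls a' c' (b, ract B N b c c' g n, lact B M b a a' f m)"
 unfolding tensor_mk using mk_prof_mmap[OF cats(1,3) f g] rep_act[OF f g t] t by (simp add: triples_iff)

text \<open>The universal property of the coend: a family dinatural in b and natural in a and c
  descends to a 2-cell out of the tensor, with the expected values on classes.\<close>

lemma tensor_cellI:
 assumes P: "is_prof A C P"
  and i: "!!a b c n m. a \<in> obj A ==> b \<in> obj B ==> c \<in> obj C ==> n \<in> omap N (b, c) ==> m \<in> omap M (a, b) ==>
   s a b c n m \<in> omap P (a, c)"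
  and d: "!!a b b' c g n m. a \<in> obj A ==> c \<in> obj C ==> g \<in> hom B b b' ==> n \<in> omap N (b', c) ==> m \<in> omap M (a, b) ==>
   s a b c (lact C N c b' b g n) m = s a b' c n (ract A M a b b' g m)"
  and nat: "!!a a' b c c' f g n m. f \<in> hom A a' a ==> g \<in> hom C c c' ==> b \<in> obj B ==> n \<in> omap N (b, c) ==> m \<in> omap M (a, b) ==>
   s a' b c' (ract B N b c c' g n) (lact B M b a a' f m) =
   mmap P (a, c) (a', c') (f, g) (s a b c n m)"
 defines "\<sigma> \<equiv> mk_cell A C NM (\<lambda>a c z. case rep a c z of (b, n, m) => s a b c n m)"
 shows "two_cell A C NM P \<sigma>"
  and "!!a b c n m. a \<in> obj A ==> b \<in> obj B ==> c \<in> obj C ==> n \<in> omap N (b, c) ==> m \<in> omap M (a, b) ==>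
   \<sigma> (a, c) (cls a c (b, n, m)) = s a b c n m"
proof -
 have e: "(case rep a c (cls a c (b, n, m)) of (b, n, m) => s a b c n m) = s a b c n m"
  if "a \<in> obj A" "b \<in> obj B" "c \<in> obj C" "n \<in> omap N (b, c)" "m \<in> omap M (a, b)" for a b c n m
  by (rule lift_rep[where s = "\<lambda>b n m. s a b c n m"]) (use that d in auto)
 show "\<sigma> (a, c) (cls a c (b, n, m)) = s a b c n m"
  if "a \<in> obj A" "b \<in> obj B" "c \<in> obj C" "n \<in> omap N (b, c)" "m \<in> omap M (a, b)" for a b c n m
  unfolding \<sigma>_def using e[OF that] tensor_in[OF that(1,3,2,4,5)] that by simp
 show "two_cell A C NM P \<sigma>"
  unfolding \<sigma>_def
 proof (rule cellI[OF tensor_prof P])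
  fix a c z assume ac: "a \<in> obj A" "c \<in> obj C" and z: "z \<in> omap NM (a, c)"
  show "(case rep a c z of (b, n, m) => s a b c n m) \<in> omap P (a, c)"
   by (rule tensor_cases[OF z ac]) (simp add: e i ac)
 next
  fix a c a' c' f g z assume f: "f \<in> hom A a' a" and g: "g \<in> hom C c c'" and z: "z \<in> omap NM (a, c)"
  have o: "a \<in> obj A" "a' \<in> obj A" "c \<in> obj C" "c' \<in> obj C" using f g hom_obj cats by metis+
  from z o obtain b n m where t: "b \<in> obj B" "n \<in> omap N (b, c)" "m \<in> omap M (a, b)" and [simp]: "z = cls a c (b, n, m)"
   by (auto elim: tensor_cases)
  note ib = cat_id[OF cats(2) t(1)]
  show "(case rep a' c' (mmap NM (a, c) (a', c') (f, g) z) of (b, n, m) => s a' b c' n m) =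
    mmap P (a, c) (a', c') (f, g) (case rep a c z of (b, n, m) => s a b c n m)"
   using e[OF o(1) t(1) o(3) t(2,3)] e[OF o(2) t(1) o(4) prof_act[OF N t(2) ib g] prof_act[OF M t(3) f ib]]
    nat[OF f g t] by (simp add: tensor_act[OF f g t])
 qed
qed

lemma tensor_cell_eqI:
 assumes "two_cell A C NM P \<sigma>" "two_cell A C NM P' \<tau>"
  and "!!a b c n m. a \<in> obj A ==> b \<in> obj B ==> c \<in> obj C ==> n \<in> omap N (b, c) ==> m \<in> omap M (a, b) ==>
   \<sigma> (a, c) (cls a c (b, n, m)) = \<tau> (a, c) (cls a c (b, n, m))"
 shows "\<sigma> = \<tau>"
 by (rule cell_eqI[OF assms(1,2)]) (auto elim!: tensor_cases simp: assms(3))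

lemma tensor_cell_nat:
 assumes "two_cell A C NM P \<sigma>" and f: "f \<in> hom A a' a" and g: "g \<in> hom C c c'"
  and t: "b \<in> obj B" "n \<in> omap N (b, c)" "m \<in> omap M (a, b)"
 shows "\<sigma> (a', c') (cls a' c' (b, ract B N b c c' g n, lact B M b a a' f m)) =
  mmap P (a, c) (a', c') (f, g) (\<sigma> (a, c) (cls a c (b, n, m)))"
 using cell_nat[OF assms(1) cats(1,3) tensor_in[OF _ _ t] f g] tensor_act[OF f g t]
  hom_cod[OF cats(1) f] hom_dom[OF cats(3) g] by simp

lemma hcomp_cell:
 assumes c': "composable A B C N' M'" and t: "two_cell B C N N' \<tau>" and s: "two_cell A B M M' \<sigma>"
 shows "two_cell A C NM (tensor A B C N' M') (hcomp A B C N M N' M' \<tau> \<sigma>)"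
  and "!!a b c n m. a \<in> obj A ==> b \<in> obj B ==> c \<in> obj C ==> n \<in> omap N (b, c) ==> m \<in> omap M (a, b) ==>
   hcomp A B C N M N' M' \<tau> \<sigma> (a, c) (cls a c (b, n, m)) = coend_class A B C N' M' a c (b, \<tau> (b, c) n, \<sigma> (a, b) m)"
proof -
 interpret c': composable A B C N' M' by (rule c')
 note * = tensor_cellI[of "tensor A B C N' M'" "\<lambda>a b c n m. c'.cls a c (b, \<tau> (b, c) n, \<sigma> (a, b) m)"]
 have P: "is_prof A C c'.NM" by (rule c'.tensor_prof)
 have 1: "c'.cls a c (b, \<tau> (b, c) n, \<sigma> (a, b) m) \<in> omap c'.NM (a, c)"
  if "a \<in> obj A" "b \<in> obj B" "c \<in> obj C" "n \<in> omap N (b, c)" "m \<in> omap M (a, b)" for a b c n m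
  using that by (intro c'.tensor_in cell_in[OF t] cell_in[OF s])
 have 2: "c'.cls a c (b, \<tau> (b, c) (lact C N c b' b g n), \<sigma> (a, b) m) =
   c'.cls a c (b', \<tau> (b', c) n, \<sigma> (a, b') (ract A M a b b' g m))"
  if h: "a \<in> obj A" "c \<in> obj C" "g \<in> hom B b b'" "n \<in> omap N (b', c)" "m \<in> omap M (a, b)" for a b b' c g n m
 proof -
  note o = hom_obj[OF cats(2) h(3)]
  show ?thesis
   using c'.cls_step[OF h(1-3) cell_in[OF t _ h(2,4)] cell_in[OF s h(1) _ h(5)]] o
   by (simp add: cell_nat[OF t cats(2,3) h(4,3) cat_id[OF cats(3) h(2)]] cell_nat[OF s cats(1,2) h(5) cat_id[OF cats(1) h(1)] h(3)])
 qed
 have 3: "c'.cls a' c' (b, \<tau> (b, c') (ract B N b c c' g n), \<sigma> (a', b) (lact B M b a a' f m)) =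
   mmap c'.NM (a, c) (a', c') (f, g) (c'.cls a c (b, \<tau> (b, c) n, \<sigma> (a, b) m))"
  if h: "f \<in> hom A a' a" "g \<in> hom C c c'" "b \<in> obj B" "n \<in> omap N (b, c)" "m \<in> omap M (a, b)" for a a' b c c' f g n m
 proof -
  note ib = cat_id[OF cats(2) h(3)]
  show ?thesis
   using c'.tensor_act[OF h(1,2,3) cell_in[OF t h(3) _ h(4)] cell_in[OF s _ h(3,5)]] hom_cod[OF cats(1) h(1)] hom_dom[OF cats(3) h(2)]
   by (simp add: cell_nat[OF t cats(2,3) h(4) ib h(2)] cell_nat[OF s cats(1,2) h(5,1) ib])
 qed
 note * = tensor_cellI[of "tensor A B C N' M'" "\<lambda>a b c n m. c'.cls a c (b, \<tau> (b, c) n, \<sigma> (a, b) m)", OF P 1 2 3]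
 show "two_cell A C NM (tensor A B C N' M') (hcomp A B C N M N' M' \<tau> \<sigma>)"
  unfolding hcomp_def by (rule *(1))
 show "hcomp A B C N M N' M' \<tau> \<sigma> (a, c) (cls a c (b, n, m)) = c'.cls a c (b, \<tau> (b, c) n, \<sigma> (a, b) m)"
  if "a \<in> obj A" "b \<in> obj B" "c \<in> obj C" "n \<in> omap N (b, c)" "m \<in> omap M (a, b)" for a b c n m
  unfolding hcomp_def by (rule *(2)) (use that in auto)
qed

end

lemma composable_lex: "lex_prof A B M ==> lex_prof B C N ==> composable A B C N M"
 by unfold_locales (auto dest: lex_profD small_lex_catD)

section \<open>The total category of a \<open>LexProf\<close>-category\<close>

definition vfst :: "'v::universe => 'v" where "vfst p = (SOME x. \<exists>y. p = vpair x y)"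
definition vsnd :: "'v::universe => 'v" where "vsnd p = (SOME y. \<exists>x. p = vpair x y)"

lemma vfst_vpair [simp]: "vfst (vpair x y) = x" and vsnd_vpair [simp]: "vsnd (vpair x y) = y"
 by (auto simp: vfst_def vsnd_def vpair_inject)

declare vpair_inject [simp]

text \<open>Pairs are coded so that the result is again a \<open>vcat\<close> and can underlie an
  object of \<open>PARFL\<close>. Composition evaluates \<open>lcmp\<close> on a class, so coends
  disappear from whatever is phrased in \<open>tot C\<close>.\<close>

definition tot :: "'v::universe lpcat => 'v vcat" where
 "tot C = mk_cat {vpair X i |X i. X \<in> lobj C & i \<in> obj (ext C X)}
   (\<lambda>p q. omap (lhom C (vfst p) (vfst q)) (vsnd p, vsnd q))
   (\<lambda>p. lidm C (vfst p) (vsnd p, vsnd p) (idm (ext C (vfst p)) (vsnd p)))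
   (\<lambda>p q r g f. lapp C (vfst p) (vfst q) (vfst r) (vsnd p) (vsnd q) (vsnd r) g f)"

abbreviation homv :: "'v vcat => 'v::universe => 'v => 'v => 'v => 'v set" where
 "homv K X i Y j \<equiv> hom K (vpair X i) (vpair Y j)"

abbreviation cmpv :: "'v vcat => 'v::universe => 'v => 'v => 'v => 'v => 'v => 'v => 'v => 'v" where
 "cmpv K X i Y j Z k \<equiv> cmp K (vpair X i) (vpair Y j) (vpair Z k)"

text \<open>On morphisms this is the identity 2-cell of X, which is how the extent acts inside
  \<open>tot C\<close>.\<close>

definition inc :: "'v::universe lpcat => 'v => 'v vfunc" where
 "inc C X = mk_func (ext C X) (vpair X) (\<lambda>i j p. lidm C X (i, j) p)"

lemma tot_obj [simp]: "vpair X i \<in> obj (tot C) \<longleftrightarrow> X \<in> lobj C & i \<in> obj (ext C X)"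
 by (simp add: tot_def)

lemma tot_objE:
 assumes "p \<in> obj (tot C)"
 obtains X i where "p = vpair X i" "X \<in> lobj C" "i \<in> obj (ext C X)"
 using assms by (auto simp: tot_def)

lemma tot_hom [simp]:
 "X \<in> lobj C ==> i \<in> obj (ext C X) ==> Y \<in> lobj C ==> j \<in> obj (ext C Y) ==>
  homv (tot C) X i Y j = omap (lhom C X Y) (i, j)"
 by (simp add: tot_def)

lemma tot_idm [simp]:
 "X \<in> lobj C ==> i \<in> obj (ext C X) ==> idm (tot C) (vpair X i) = lidm C X (i, i) (idm (ext C X) i)"
 by (simp add: tot_def)

lemma tot_cmp:
 "X \<in> lobj C ==> i \<in> obj (ext C X) ==> Y \<in> lobj C ==> j \<in> obj (ext C Y) ==> Z \<in> lobj C ==> k \<in> obj (ext C Z) ==>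
  g \<in> omap (lhom C Y Z) (j, k) ==> f \<in> omap (lhom C X Y) (i, j) ==>
  cmpv (tot C) X i Y j Z k g f = lapp C X Y Z i j k g f"
 by (simp add: tot_def)

locale lpcategory =
 fixes C :: "'v::universe lpcat"
 assumes lp: "lp_category C"
begin

lemma ext_lex: "X \<in> lobj C ==> small_lex_cat (ext C X)"
 by (rule lp[unfolded lp_category_def, THEN conjunct1, rule_format])

lemma ext_cat: "X \<in> lobj C ==> category (ext C X)"
 by (rule small_lex_catD(1)[OF ext_lex])

lemma hom_lex: "X \<in> lobj C ==> Y \<in> lobj C ==> lex_prof (ext C X) (ext C Y) (lhom C X Y)"
 by (rule lp[unfolded lp_category_def, THEN conjunct2, THEN conjunct1, rule_format])

lemma hom_is_prof: "X \<in> lobj C ==> Y \<in> lobj C ==> is_prof (ext C X) (ext C Y) (lhom C X Y)"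
 by (rule lex_profD(3)[OF hom_lex])

lemma hom_composable: "X \<in> lobj C ==> Y \<in> lobj C ==> Z \<in> lobj C ==>
  composable (ext C X) (ext C Y) (ext C Z) (lhom C Y Z) (lhom C X Y)"
 by (intro composable_lex hom_lex)

lemma cmp_cell: "X \<in> lobj C ==> Y \<in> lobj C ==> Z \<in> lobj C ==>
  two_cell (ext C X) (ext C Z) (tensor (ext C X) (ext C Y) (ext C Z) (lhom C Y Z) (lhom C X Y)) (lhom C X Z) (lcmp C X Y Z)"
 by (rule lp[unfolded lp_category_def, THEN conj2, THEN conjunct1, rule_format])

lemma idm_cell: "X \<in> lobj C ==> two_cell (ext C X) (ext C X) (id_prof (ext C X)) (lhom C X X) (lidm C X)"
 by (rule lp[unfolded lp_category_def, THEN conj2, THEN conjunct2, THEN conjunct1, rule_format])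

lemma lp_assoc: "X \<in> lobj C ==> Y \<in> lobj C ==> Z \<in> lobj C ==> W \<in> lobj C ==>
  i \<in> obj (ext C X) ==> j \<in> obj (ext C Y) ==> k \<in> obj (ext C Z) ==> l \<in> obj (ext C W) ==>
  h \<in> omap (lhom C Z W) (k, l) ==> g \<in> omap (lhom C Y Z) (j, k) ==> f \<in> omap (lhom C X Y) (i, j) ==>
  lapp C X Y W i j l (lapp C Y Z W j k l h g) f = lapp C X Z W i k l h (lapp C X Y Z i j k g f)"
 by (rule lp[unfolded lp_category_def, THEN conj4, THEN conjunct1, rule_format])

lemma lp_unit_right: "X \<in> lobj C ==> Y \<in> lobj C ==> j \<in> obj (ext C Y) ==> p \<in> hom (ext C X) i' i ==>
  f \<in> omap (lhom C X Y) (i, j) ==>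
  lapp C X X Y i' i j f (lidm C X (i', i) p) = lact (ext C Y) (lhom C X Y) j i i' p f"
 by (rule lp[unfolded lp_category_def, THEN conj4, THEN conjunct2, THEN conjunct1, rule_format])
  (auto dest: hom_obj[OF ext_cat])

lemma lp_unit_left: "X \<in> lobj C ==> Y \<in> lobj C ==> i \<in> obj (ext C X) ==> q \<in> hom (ext C Y) j j' ==>
  f \<in> omap (lhom C X Y) (i, j) ==>
  lapp C X Y Y i j j' (lidm C Y (j, j') q) f = ract (ext C X) (lhom C X Y) i j j' q f"
 by (rule lp[unfolded lp_category_def, THEN conj4, THEN conj2, THEN conjunct1, rule_format])
  (auto dest: hom_obj[OF ext_cat])

lemma lapp_in:
 assumes "X \<in> lobj C" "Y \<in> lobj C" "Z \<in> lobj C" "i \<in> obj (ext C X)" "j \<in> obj (ext C Y)" "k \<in> obj (ext C Z)"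
  "g \<in> omap (lhom C Y Z) (j, k)" "f \<in> omap (lhom C X Y) (i, j)"
 shows "lapp C X Y Z i j k g f \<in> omap (lhom C X Z) (i, k)"
proof -
 interpret composable "ext C X" "ext C Y" "ext C Z" "lhom C Y Z" "lhom C X Y"
  by (rule hom_composable[OF assms(1-3)])
 show ?thesis unfolding lapp_def by (intro cell_in[OF cmp_cell] tensor_in assms)
qed

lemma idm_in: "X \<in> lobj C ==> p \<in> hom (ext C X) i j ==> lidm C X (i, j) p \<in> omap (lhom C X X) (i, j)"
 using hom_obj[OF ext_cat] by (intro cell_in[OF idm_cell]) auto

lemma tot_category: "category (tot C)"
 unfolding tot_def
proof (rule categoryI, goal_cases)
 case (1 a) then show ?case by (auto intro!: idm_in cat_id ext_cat)
next
 case (2 a b c g f) then show ?case by (auto intro: lapp_in)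
next
 case (3 a b f) then show ?case by (auto simp: lp_unit_right cat_id ext_cat prof_id[OF hom_is_prof])
next
 case (4 a b f) then show ?case by (auto simp: lp_unit_left cat_id ext_cat prof_id[OF hom_is_prof])
next
 case (5 a b c d h g f) then show ?case by (auto intro!: lp_assoc)
qed

text \<open>By the unit law, composing with the identity 2-cell is the action of the extent on
  C(X,X); as that 2-cell is natural, it carries composites to composites.\<close>

lemma inc_functor:
 assumes X: "X \<in> lobj C"
 shows "is_functor (ext C X) (tot C) (inc C X)"
 unfolding inc_def
proof (rule functorI[OF ext_cat[OF X] tot_category])
 fix i j k q p assume o: "i \<in> obj (ext C X)" "j \<in> obj (ext C X)" "k \<in> obj (ext C X)" and q: "q \<in> hom (ext C X) j k" and p: "p \<in> hom (ext C X) i j"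
 have "lapp C X X X i j k (lidm C X (j, k) q) (lidm C X (i, j) p) =
  ract (ext C X) (lhom C X X) i j k q (lidm C X (i, j) p)"
  by (rule lp_unit_left[OF X X o(1) q idm_in[OF X p]])
 also have "\<dots> = lidm C X (i, k) (ract (ext C X) (id_prof (ext C X)) i j k q p)"
  by (rule cell_nat[OF idm_cell, symmetric]) (use X o q p in \<open>auto intro: ext_cat cat_id\<close>)
 also have "ract (ext C X) (id_prof (ext C X)) i j k q p = cmp (ext C X) i j k q p"
  using X o q p by (simp add: ext_cat cat_id cat_id_right)
 finally show "lidm C X (i, k) (cmp (ext C X) i j k q p) =
   cmpv (tot C) X i X j X k (lidm C X (j, k) q) (lidm C X (i, j) p)"
  using X o q p by (simp add: tot_cmp idm_in)
qed (use X in \<open>auto intro: idm_in\<close>)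

lemma inc_simps [simp]:
 "i \<in> obj (ext C X) ==> omap (inc C X) i = vpair X i"
 "X \<in> lobj C ==> p \<in> hom (ext C X) i j ==> mmap (inc C X) i j p = lidm C X (i, j) p"
 using hom_obj[OF ext_cat] by (simp_all add: inc_def)

lemma tot_locally_small: "locally_small (tot C)"
 unfolding locally_small_def by (auto elim!: tot_objE intro!: prof_small[OF hom_is_prof])

text \<open>Identifies C(X,Y) with the hom-profunctor of \<open>tot C\<close> along the inclusions
  of X and Y. Profunctor actions can then be handled as composites in an ordinary category.\<close>

lemma act_eq:
 assumes XY: "X \<in> lobj C" "Y \<in> lobj C" and p: "p \<in> hom (ext C X) i' i" and q: "q \<in> hom (ext C Y) j j'" and f: "f \<in> omap (lhom C X Y) (i, j)"
 shows "mmap (lhom C X Y) (i, j) (i', j') (p, q) f =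
  cmpv (tot C) X i' Y j Y j' (lidm C Y (j, j') q)
   (cmpv (tot C) X i' X i Y j f (lidm C X (i', i) p))"
proof -
 have o: "i \<in> obj (ext C X)" "i' \<in> obj (ext C X)" "j \<in> obj (ext C Y)" "j' \<in> obj (ext C Y)"
  using p q hom_obj ext_cat XY by metis+
 note hp = hom_is_prof[OF XY]
 note fp = prof_act[OF hp f p cat_id[OF ext_cat[OF XY(2)] o(3)]]
 have e1: "cmpv (tot C) X i' X i Y j f (lidm C X (i', i) p) =
   lact (ext C Y) (lhom C X Y) j i i' p f"
  using XY o f p by (simp add: tot_cmp idm_in lp_unit_right)
 show ?thesis unfolding e1 prof_split(1)[OF hp f p q]
  using XY o fp q by (simp add: tot_cmp idm_in lp_unit_left)
qed

text \<open>Exactness of C(Y,X) in its second variable, for all Y and i, is the criterion of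
  \<open>lex_functor_iff_hom\<close> at the objects of \<open>tot C\<close>.\<close>

lemma inc_lex: "X \<in> lobj C ==> lex_functor (ext C X) (tot C) (inc C X)"
 unfolding lex_functor_iff_hom[OF inc_functor]
proof
 fix p assume X: "X \<in> lobj C" and "p \<in> obj (tot C)"
 then obtain Y i where [simp]: "p = vpair Y i" and Y: "Y \<in> lobj C" and i: "i \<in> obj (ext C Y)" by (auto elim: tot_objE)
 have "lex_action (ext C X) (\<lambda>b. omap (lhom C Y X) (i, b)) (\<lambda>b b' g. ract (ext C Y) (lhom C Y X) i b b' g)"
  by (rule lex_prof_action[OF hom_lex[OF Y X] i])
 then show "lex_action (ext C X) (\<lambda>b. hom (tot C) p (omap (inc C X) b))
   (\<lambda>b b' g. cmp (tot C) p (omap (inc C X) b) (omap (inc C X) b') (mmap (inc C X) b b' g))"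
  by (rule lex_action_cong)
   (use X Y i in \<open>auto simp: tot_cmp idm_in lp_unit_left intro: prof_act[OF hom_is_prof] cat_id ext_cat\<close>)
qed

end

section \<open>The 2-category of categories\<close>

text \<open>Serves twice: as hom-category of CAT and, with codomain \<open>set_cat\<close>, as a
  presheaf category.\<close>

definition fun_cat :: "('o, 'm) cat => ('p, 'n) cat => (('o, 'm, 'p, 'n) func, 'o => 'n) cat" where
 "fun_cat C D = mk_cat {F. is_functor C D F} (\<lambda>F G. {\<alpha>. nat_trans C D F G \<alpha>}) (id_trans C D) (comp_trans C D)"

definition hcomp_trans :: "('o, 'm) cat => ('q, 'k) cat => ('p, 'n, 'q, 'k) func => ('p, 'n, 'q, 'k) func =>
  ('o, 'm, 'p, 'n) func => ('o, 'm, 'p, 'n) func => ('p => 'k) => ('o => 'n) => ('o => 'k)" where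
 "hcomp_trans C E G G' F F' \<beta> \<alpha> = restrict
   (\<lambda>c. cmp E (omap G (omap F c)) (omap G (omap F' c)) (omap G' (omap F' c))
    (\<beta> (omap F' c)) (mmap G (omap F c) (omap F' c) (\<alpha> c))) (obj C)"

definition CAT :: "(('o, 'm) cat, ('o, 'm, 'o, 'm) func, 'o => 'm) twocat" where
 "CAT = \<lparr>tobj = {C. category C}, thom = fun_cat, tid = id_func,
   tcmp = (\<lambda>C D E. mk_func (prod_cat (fun_cat D E) (fun_cat C D))
    (\<lambda>(G, F). comp_func C G F) (\<lambda>(G, F) (G', F') (\<beta>, \<alpha>). hcomp_trans C E G G' F F' \<beta> \<alpha>))\<rparr>"

lemma fun_cat_simps [simp]:
 "obj (fun_cat C D) = {F. is_functor C D F}"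
 "hom (fun_cat C D) F G = {\<alpha>. nat_trans C D F G \<alpha>}"
 "is_functor C D F ==> idm (fun_cat C D) F = id_trans C D F"
 "nat_trans C D F G \<alpha> ==> nat_trans C D G H \<beta> ==> cmp (fun_cat C D) F G H \<beta> \<alpha> = comp_trans C D F G H \<beta> \<alpha>"
 unfolding fun_cat_def by (simp_all, auto dest: nat_functors, subst mk_cat_simps, auto dest: nat_functors)

lemma comp_trans_app [simp]: "a \<in> obj A ==> comp_trans A B F G H \<beta> \<alpha> a = cmp B (omap F a) (omap G a) (omap H a) (\<beta> a) (\<alpha> a)"
 by (simp add: comp_trans_def)

lemma id_trans_app [simp]: "a \<in> obj A ==> id_trans A B F a = idm B (omap F a)"
 by (simp add: id_trans_def)

lemma hcomp_trans_app [simp]: "c \<in> obj C ==> hcomp_trans C E G G' F F' \<beta> \<alpha> c =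
  cmp E (omap G (omap F c)) (omap G (omap F' c)) (omap G' (omap F' c)) (\<beta> (omap F' c)) (mmap G (omap F c) (omap F' c) (\<alpha> c))"
 by (simp add: hcomp_trans_def)

lemma fun_cat_category: "category (fun_cat C D)"
 unfolding fun_cat_def
proof (rule categoryI, goal_cases)
 case (3 F G \<alpha>)
 then have a: "nat_trans C D F G \<alpha>" by simp
 note f = nat_functors[OF a]
 show ?case
  by (rule nat_eqI[OF comp_nat[OF id_nat[OF f(1)] a] a refl])
   (simp add: cat_id_right[OF functor_cats(2)[OF f(1)] nat_hom[OF a]])
next
 case (4 F G \<alpha>)
 then have a: "nat_trans C D F G \<alpha>" by simp
 note f = nat_functors[OF a]
 show ?case
  by (rule nat_eqI[OF comp_nat[OF a id_nat[OF f(2)]] a refl])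
   (simp add: cat_id_left[OF functor_cats(2)[OF f(1)] nat_hom[OF a]])
next
 case (5 F G H K \<gamma> \<beta> \<alpha>)
 then have a: "nat_trans C D F G \<alpha>" and b: "nat_trans C D G H \<beta>" and c: "nat_trans C D H K \<gamma>" by simp_all
 note D = functor_cats(2)[OF nat_functors(1)[OF a]]
 show ?case
  by (rule nat_eqI[OF comp_nat[OF a comp_nat[OF b c]] comp_nat[OF comp_nat[OF a b] c] refl])
   (simp add: cat_assoc[OF D nat_hom[OF a] nat_hom[OF b] nat_hom[OF c]])
qed (auto intro: id_nat comp_nat)

lemma hcomp_nat:
 assumes a: "nat_trans C D F F' \<alpha>" and b: "nat_trans D E G G' \<beta>"
 shows "nat_trans C E (comp_func C G F) (comp_func C G' F') (hcomp_trans C E G G' F F' \<beta> \<alpha>)"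
 unfolding hcomp_trans_def
proof (rule natI)
 note fa = nat_functors[OF a] and fb = nat_functors[OF b]
 note E = functor_cats(2)[OF fb(1)]
 show "is_functor C E (comp_func C G F)" "is_functor C E (comp_func C G' F')"
  by (rule comp_functor[OF fa(1) fb(1)], rule comp_functor[OF fa(2) fb(2)])
 fix x assume x: "x \<in> obj C"
 show "cmp E (omap G (omap F x)) (omap G (omap F' x)) (omap G' (omap F' x)) (\<beta> (omap F' x)) (mmap G (omap F x) (omap F' x) (\<alpha> x))
   \<in> hom E (omap (comp_func C G F) x) (omap (comp_func C G' F') x)"
  using x by (auto intro!: cat_cmp[OF E] nat_hom[OF b] functor_hom[OF fb(1)] nat_hom[OF a] functor_obj[OF fa(2)])
next
 note fa = nat_functors[OF a] and fb = nat_functors[OF b]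
 note E = functor_cats(2)[OF fb(1)]
 fix x y f assume x: "x \<in> obj C" and y: "y \<in> obj C" and f: "f \<in> hom C x y"
 note n = nat_hom[OF a x] nat_hom[OF a y] functor_hom[OF fa(1) f] functor_hom[OF fa(2) f]
 note m = functor_hom[OF fb(1) n(1)] functor_hom[OF fb(1) n(2)] functor_hom[OF fb(1) n(3)] functor_hom[OF fb(1) n(4)]
  functor_hom[OF fb(2) n(4)] nat_hom[OF b functor_obj[OF fa(2) x]] nat_hom[OF b functor_obj[OF fa(2) y]]
 have e1: "cmp E (omap G (omap F x)) (omap G (omap F y)) (omap G (omap F' y)) (mmap G (omap F y) (omap F' y) (\<alpha> y)) (mmap G (omap F x) (omap F y) (mmap F x y f))
  = cmp E (omap G (omap F x)) (omap G (omap F' x)) (omap G (omap F' y)) (mmap G (omap F' x) (omap F' y) (mmap F' x y f)) (mmap G (omap F x) (omap F' x) (\<alpha> x))"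
  using nat_nat[OF a f] functor_cmp[OF fb(1) n(2,3)] functor_cmp[OF fb(1) n(4,1)] by simp
 note e2 = nat_nat[OF b n(4)]
 show "cmp E (omap (comp_func C G F) x) (omap (comp_func C G F) y) (omap (comp_func C G' F') y)
   (cmp E (omap G (omap F y)) (omap G (omap F' y)) (omap G' (omap F' y)) (\<beta> (omap F' y)) (mmap G (omap F y) (omap F' y) (\<alpha> y)))
   (mmap (comp_func C G F) x y f) =
  cmp E (omap (comp_func C G F) x) (omap (comp_func C G' F') x) (omap (comp_func C G' F') y) (mmap (comp_func C G' F') x y f)
   (cmp E (omap G (omap F x)) (omap G (omap F' x)) (omap G' (omap F' x)) (\<beta> (omap F' x)) (mmap G (omap F x) (omap F' x) (\<alpha> x)))"
  using x y f
  by (simp add: cat_assoc[OF E m(3,2,7)] e1 cat_assoc[OF E m(1,4,7), symmetric] e2 cat_assoc[OF E m(1,6,5)])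
qed

lemma CAT_tcmp_simps:
 assumes a: "nat_trans C D F F' \<alpha>" and b: "nat_trans D E G G' \<beta>"
 shows "mmap (tcmp CAT C D E) (G, F) (G', F') (\<beta>, \<alpha>) = hcomp_trans C E G G' F F' \<beta> \<alpha>"
 using nat_functors[OF a] nat_functors[OF b] a b by (simp add: CAT_def fun_cat_category)

lemma CAT_simps [simp]:
 "tobj CAT = {C. category C}" "thom CAT = fun_cat" "tid CAT = id_func"
 "is_functor C D F ==> is_functor D E G ==> omap (tcmp CAT C D E) (G, F) = comp_func C G F"
 by (simp_all add: CAT_def)

lemma comp_func_id [simp]:
 "is_functor A B F ==> comp_func A F (id_func A) = F" "is_functor A B F ==> comp_func A (id_func B) F = F"
 by (auto intro!: functor_eqI[where B = B and B' = B] comp_functor id_functor simp: functor_cats functor_obj functor_hom)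

lemma comp_func_assoc:
 "is_functor A B F ==> is_functor B C G ==> is_functor C D H ==>
  comp_func A (comp_func B H G) F = comp_func A H (comp_func A G F)"
 by (rule functor_eqI[where B = D and B' = D]) (auto intro: comp_functor simp: functor_obj functor_hom)

lemma CAT_comp_functor: "category C ==> category D ==> category E ==>
  is_functor (prod_cat (fun_cat D E) (fun_cat C D)) (fun_cat C E) (tcmp CAT C D E)"
 unfolding CAT_def twocat.simps
proof (rule functorI, goal_cases)
 case (4 p q w) then show ?case by (auto simp: fun_cat_category intro: hcomp_nat comp_functor dest: nat_functors)
next
 case (5 p)
 then obtain G F where [simp]: "p = (G, F)" and G: "is_functor D E G" and F: "is_functor C D F" by auto
 show ?case
  using F G by (simp add: comp_functor[OF F G]) (rule nat_eqI[OF hcomp_nat[OF id_nat id_nat] id_nat[OF comp_functor] refl],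
   auto simp: functor_obj functor_id cat_id cat_id_left functor_cats)
next
 case (6 p q r w v)
 obtain F G F' G' F'' G'' \<alpha> \<beta> \<alpha>' \<beta>' where [simp]: "p = (G, F)" "q = (G', F')" "r = (G'', F'')" "v = (\<beta>, \<alpha>)" "w = (\<beta>', \<alpha>')"
  by (metis surj_pair)
 have a: "nat_trans C D F F' \<alpha>" and a': "nat_trans C D F' F'' \<alpha>'" and b: "nat_trans D E G G' \<beta>" and b': "nat_trans D E G' G'' \<beta>'"
  using 6 by (simp_all add: fun_cat_category)
 note f = nat_functors[OF a] nat_functors(2)[OF a'] and g = nat_functors[OF b] nat_functors(2)[OF b']
 note E = functor_cats(2)[OF g(1)]
 have "hcomp_trans C E G G'' F F'' (comp_trans D E G G' G'' \<beta>' \<beta>) (comp_trans C D F F' F'' \<alpha>' \<alpha>) =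
  comp_trans C E (comp_func C G F) (comp_func C G' F') (comp_func C G'' F'') (hcomp_trans C E G' G'' F' F'' \<beta>' \<alpha>') (hcomp_trans C E G G' F F' \<beta> \<alpha>)"
 proof (rule nat_eqI[OF hcomp_nat[OF comp_nat[OF a a'] comp_nat[OF b b']] comp_nat[OF hcomp_nat[OF a b] hcomp_nat[OF a' b']] refl])
  fix x assume x: "x \<in> obj C"
  note n = nat_hom[OF a x] nat_hom[OF a' x]
  note m = functor_hom[OF g(1) n(1)] functor_hom[OF g(1) n(2)] functor_hom[OF g(2) n(2)]
   nat_hom[OF b functor_obj[OF f(2) x]] nat_hom[OF b functor_obj[OF f(3) x]] nat_hom[OF b' functor_obj[OF f(3) x]]
  show "hcomp_trans C E G G'' F F'' (comp_trans D E G G' G'' \<beta>' \<beta>) (comp_trans C D F F' F'' \<alpha>' \<alpha>) x =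
   comp_trans C E (comp_func C G F) (comp_func C G' F') (comp_func C G'' F'') (hcomp_trans C E G' G'' F' F'' \<beta>' \<alpha>') (hcomp_trans C E G G' F F' \<beta> \<alpha>) x"
   using x functor_obj[OF f(3) x] m
   by (simp add: functor_cmp[OF g(1) n(2,1)] cat_assoc[OF E] cat_cmp[OF E])
    (simp add: cat_assoc[OF E, symmetric] nat_nat[OF b n(2)])
 qed
 then show ?case using a a' b b' f g by (simp add: hcomp_nat fun_cat_category)
qed (auto intro: prod_category fun_cat_category comp_functor)

text \<open>\<open>PARFL\<close> and \<open>LexProf_CAT\<close> inherit their axioms from here, so
  units and associativity of horizontal composition are calculated only for ordinary
  categories.\<close>

lemma two_category_CAT: "two_category CAT"
 unfolding two_category_def
proof (intro conjI ballI, goal_cases)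
 case 3 then show ?case using CAT_comp_functor by simp
next
 case (6 A B f f' \<alpha>)
 then have a: "nat_trans A B f f' \<alpha>" and [simp]: "category A" "category B" by simp_all
 note i = id_nat[OF id_functor]
 note F = nat_functors[OF a]
 show ?case using F
  by (simp add: CAT_tcmp_simps[OF i a] id_functor)
   (rule nat_eqI[OF hcomp_nat[OF i a] a], auto simp: functor_obj functor_id cat_id_right[OF _ nat_hom[OF a]])
next
 case (7 A B f f' \<alpha>)
 then have a: "nat_trans A B f f' \<alpha>" and [simp]: "category A" "category B" by simp_all
 note i = id_nat[OF id_functor]
 note F = nat_functors[OF a]
 show ?case using F
  by (simp add: CAT_tcmp_simps[OF a i] id_functor)
   (rule nat_eqI[OF hcomp_nat[OF a i] a], auto simp: functor_obj functor_id nat_hom[OF a] cat_id_left[OF _ nat_hom[OF a]])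
next
 case (9 A B C D h h' \<gamma> g g' \<beta> f f' \<alpha>)
 then have a: "nat_trans A B f f' \<alpha>" and b: "nat_trans B C g g' \<beta>" and c: "nat_trans C D h h' \<gamma>"
  and [simp]: "category A" "category B" "category C" "category D" by simp_all
 note F = nat_functors[OF a] nat_functors[OF b] nat_functors[OF c]
 have "hcomp_trans A D (comp_func B h g) (comp_func B h' g') f f' (hcomp_trans B D h h' g g' \<gamma> \<beta>) \<alpha> =
  hcomp_trans A D h h' (comp_func A g f) (comp_func A g' f') \<gamma> (hcomp_trans A C g g' f f' \<beta> \<alpha>)"
 proof (rule nat_eqI[OF hcomp_nat[OF a hcomp_nat[OF b c]] hcomp_nat[OF hcomp_nat[OF a b] c] refl])
  fix x assume x: "x \<in> obj A"
  note o = functor_obj[OF F(2) x] functor_obj[OF F(1) x]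
  note n = nat_hom[OF a x] nat_hom[OF b o(1)] nat_hom[OF c functor_obj[OF F(4) o(1)]]
  note m = functor_hom[OF F(3) n(1)] functor_hom[OF F(5) n(2)] functor_hom[OF F(5) functor_hom[OF F(3) n(1)]]
  show "hcomp_trans A D (comp_func B h g) (comp_func B h' g') f f' (hcomp_trans B D h h' g g' \<gamma> \<beta>) \<alpha> x =
   hcomp_trans A D h h' (comp_func A g f) (comp_func A g' f') \<gamma> (hcomp_trans A C g g' f f' \<beta> \<alpha>) x"
   using x o n m by (simp add: functor_cmp[OF F(5) n(2) m(1)] cat_assoc[OF functor_cats(2)[OF F(5)]])
 qed
 then show ?case using F
  by (simp add: CAT_tcmp_simps[OF a b] CAT_tcmp_simps[OF b c] CAT_tcmp_simps[OF a hcomp_nat[OF b c]] CAT_tcmp_simps[OF hcomp_nat[OF a b] c])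
next
 case 8 then show ?case by (auto intro!: comp_functor comp_func_assoc simp: comp_functor)
qed (auto simp: fun_cat_category id_functor)

text \<open>The axioms of a 2-category are inherited along maps that are injective on 1-cells and on 2-cells.\<close>

lemma two_category_embed:
 assumes L: "two_category L"
  and ob: "!!A. A \<in> tobj K ==> P A \<in> tobj L"
  and cat: "!!A B. A \<in> tobj K ==> B \<in> tobj K ==> category (thom K A B)"
  and F1: "!!A B f. A \<in> tobj K ==> B \<in> tobj K ==> f \<in> obj (thom K A B) ==> F A f \<in> obj (thom L (P A) (P B))"
  and F2: "!!A B f g. A \<in> tobj K ==> B \<in> tobj K ==> f \<in> obj (thom K A B) ==> g \<in> obj (thom K A B) ==> F A f = F A g ==> f = g"
  and T1: "!!A B f g \<alpha>. A \<in> tobj K ==> B \<in> tobj K ==> \<alpha> \<in> hom (thom K A B) f g ==> T A \<alpha> \<in> hom (thom L (P A) (P B)) (F A f) (F A g)"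
  and T2: "!!A B f g \<alpha> \<beta>. A \<in> tobj K ==> B \<in> tobj K ==> \<alpha> \<in> hom (thom K A B) f g ==> \<beta> \<in> hom (thom K A B) f g ==> T A \<alpha> = T A \<beta> ==> \<alpha> = \<beta>"
  and I: "!!A B f. A \<in> tobj K ==> B \<in> tobj K ==> f \<in> obj (thom K A B) ==> T A (idm (thom K A B) f) = idm (thom L (P A) (P B)) (F A f)"
  and M: "!!A B f g h \<beta> \<alpha>. A \<in> tobj K ==> B \<in> tobj K ==> \<alpha> \<in> hom (thom K A B) f g ==> \<beta> \<in> hom (thom K A B) g h ==>
   T A (cmp (thom K A B) f g h \<beta> \<alpha>) = cmp (thom L (P A) (P B)) (F A f) (F A g) (F A h) (T A \<beta>) (T A \<alpha>)"
  and N: "!!A. A \<in> tobj K ==> tid K A \<in> obj (thom K A A) & F A (tid K A) = tid L (P A)"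
  and H0: "!!A B C. A \<in> tobj K ==> B \<in> tobj K ==> C \<in> tobj K ==>
   mk_func (prod_cat (thom K B C) (thom K A B)) (omap (tcmp K A B C)) (mmap (tcmp K A B C)) = tcmp K A B C"
  and H1: "!!A B C f g. A \<in> tobj K ==> B \<in> tobj K ==> C \<in> tobj K ==> f \<in> obj (thom K A B) ==> g \<in> obj (thom K B C) ==>
   omap (tcmp K A B C) (g, f) \<in> obj (thom K A C) & F A (omap (tcmp K A B C) (g, f)) = omap (tcmp L (P A) (P B) (P C)) (F B g, F A f)"
  and H2: "!!A B C f f' g g' \<alpha> \<beta>. A \<in> tobj K ==> B \<in> tobj K ==> C \<in> tobj K ==> \<alpha> \<in> hom (thom K A B) f f' ==> \<beta> \<in> hom (thom K B C) g g' ==>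
   mmap (tcmp K A B C) (g, f) (g', f') (\<beta>, \<alpha>) \<in> hom (thom K A C) (omap (tcmp K A B C) (g, f)) (omap (tcmp K A B C) (g', f')) &
   T A (mmap (tcmp K A B C) (g, f) (g', f') (\<beta>, \<alpha>)) = mmap (tcmp L (P A) (P B) (P C)) (F B g, F A f) (F B g', F A f') (T B \<beta>, T A \<alpha>)"
 shows "two_category K"
proof -
 note Lx = L[unfolded two_category_def]
 note L1 = Lx[THEN conjunct1, rule_format]
 note L' = Lx[THEN conj2]
 note L3 = L'[THEN conjunct1, rule_format] and L4 = L'[THEN conjunct2, THEN conjunct1, rule_format]
 note L'' = L'[THEN conj2]
 note L5 = L''[THEN conjunct1, rule_format] and L6 = L''[THEN conjunct2, THEN conjunct1, rule_format] and L7 = L''[THEN conj2, rule_format]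
 let ?H = "thom K" and ?L = "\<lambda>A B. thom L (P A) (P B)" and ?o = "\<lambda>A B C. omap (tcmp K A B C)" and ?m = "\<lambda>A B C. mmap (tcmp K A B C)"
  and ?O = "\<lambda>A B C. omap (tcmp L (P A) (P B) (P C))" and ?M = "\<lambda>A B C. mmap (tcmp L (P A) (P B) (P C))"
 note o1 = H1[THEN conjunct1] and o2 = H1[THEN conjunct2] and m1 = H2[THEN conjunct1] and m2 = H2[THEN conjunct2]
 have ho: "f \<in> obj (?H A B)" "g \<in> obj (?H A B)" if "A \<in> tobj K" "B \<in> tobj K" "\<alpha> \<in> hom (?H A B) f g" for A B f g \<alpha>
  using hom_obj[OF cat[OF that(1,2)] that(3)] by auto
 have assoc: "?o A B D (?o B C D (h, g), f) = ?o A C D (h, ?o A B C (g, f))"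
  if s: "A \<in> tobj K" "B \<in> tobj K" "C \<in> tobj K" "D \<in> tobj K" and h: "h \<in> obj (?H C D)" "g \<in> obj (?H B C)" "f \<in> obj (?H A B)" for A B C D h g f
 proof -
  note x = o1[OF s(2,3,4) h(2,1)] and y = o1[OF s(1,2,3) h(3,2)]
  show ?thesis
   by (rule F2[OF s(1,4) o1[OF s(1,2,4) h(3) x] o1[OF s(1,3,4) y h(1)]])
    (simp add: o2[OF s(1,2,4) h(3) x] o2[OF s(1,3,4) y h(1)] o2[OF s(2,3,4) h(2,1)] o2[OF s(1,2,3) h(3,2)]
     L6[OF ob[OF s(1)] ob[OF s(2)] ob[OF s(3)] ob[OF s(4)] F1[OF s(3,4) h(1)] F1[OF s(2,3) h(2)] F1[OF s(1,2) h(3)]])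
 qed
 have unit: "?o A A B (f, tid K A) = f" "?o A B B (tid K B, f) = f" if s: "A \<in> tobj K" "B \<in> tobj K" and f: "f \<in> obj (?H A B)" for A B f
  using H1[OF s(1,1,2) N[OF s(1), THEN conjunct1] f] H1[OF s(1,2,2) f N[OF s(2), THEN conjunct1]] L4[OF ob[OF s(1)] ob[OF s(2)] F1[OF s f]] N[OF s(1)] N[OF s(2)] f
  by (auto intro!: F2[OF s])
 show ?thesis unfolding two_category_def
 proof (intro conjI ballI)
  fix A B C assume s: "A \<in> tobj K" "B \<in> tobj K" "C \<in> tobj K"
  note cs = cat[OF s(1,2)] cat[OF s(2,3)] cat[OF s(1,3)]
  note LF = L3[OF ob[OF s(1)] ob[OF s(2)] ob[OF s(3)]] and LCs = L1[OF ob[OF s(1)] ob[OF s(2)]] L1[OF ob[OF s(2)] ob[OF s(3)]]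
  have "is_functor (prod_cat (?H B C) (?H A B)) (?H A C) (mk_func (prod_cat (?H B C) (?H A B)) (?o A B C) (?m A B C))"
  proof (rule functorI[OF prod_category[OF cs(2,1)] cs(3)], goal_cases)
   case (1 a) then show ?case using o1[OF s] by auto
  next
   case (2 a b w) then show ?case using m1[OF s] by (auto simp: cs)
  next
   case (3 p)
   then obtain g f where [simp]: "p = (g, f)" and g: "g \<in> obj (?H B C)" and f: "f \<in> obj (?H A B)" by auto
   note i = cat_id[OF cs(1) f] cat_id[OF cs(2) g] and gf = o1[OF s f g]
   have "?M A B C (F B g, F A f) (F B g, F A f) (idm (?L B C) (F B g), idm (?L A B) (F A f)) = idm (?L A C) (?O A B C (F B g, F A f))"
    using functor_id[OF LF, of "(F B g, F A f)"] F1[OF s(1,2) f] F1[OF s(2,3) g] by simp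
   then have "?m A B C (g, f) (g, f) (idm (?H B C) g, idm (?H A B) f) = idm (?H A C) (?o A B C (g, f))"
    by (intro T2[OF s(1,3) m1[OF s i] cat_id[OF cs(3) gf]]) (simp add: m2[OF s i] I[OF s(1,3) gf] I[OF s(1,2) f] I[OF s(2,3) g] o2[OF s f g])
   then show ?case using f g by simp
  next
   case (4 p q r w v)
   obtain f g f' g' f'' g'' \<alpha> \<beta> \<alpha>' \<beta>' where [simp]: "p = (g, f)" "q = (g', f')" "r = (g'', f'')" "v = (\<beta>, \<alpha>)" "w = (\<beta>', \<alpha>')"
    by (metis surj_pair)
   have h: "\<alpha> \<in> hom (?H A B) f f'" "\<alpha>' \<in> hom (?H A B) f' f''" "\<beta> \<in> hom (?H B C) g g'" "\<beta>' \<in> hom (?H B C) g' g''"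
    using 4 by (simp_all add: cs)
   note o = ho[OF s(1,2) h(1)] ho[OF s(1,2) h(2)] ho[OF s(2,3) h(3)] ho[OF s(2,3) h(4)]
   note a = cat_cmp[OF cs(1) h(2,1)] and b = cat_cmp[OF cs(2) h(4,3)]
   note x = m1[OF s h(1,3)] and y = m1[OF s h(2,4)]
   have "?M A B C (F B g, F A f) (F B g'', F A f'') (cmp (?L B C) (F B g) (F B g') (F B g'') (T B \<beta>') (T B \<beta>), cmp (?L A B) (F A f) (F A f') (F A f'') (T A \<alpha>') (T A \<alpha>)) =
    cmp (?L A C) (?O A B C (F B g, F A f)) (?O A B C (F B g', F A f')) (?O A B C (F B g'', F A f''))
     (?M A B C (F B g', F A f') (F B g'', F A f'') (T B \<beta>', T A \<alpha>')) (?M A B C (F B g, F A f) (F B g', F A f') (T B \<beta>, T A \<alpha>))"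
    using functor_cmp[OF LF, of "(T B \<beta>', T A \<alpha>')" "(F B g', F A f')" "(F B g'', F A f'')" "(T B \<beta>, T A \<alpha>)" "(F B g, F A f)"]
     T1[OF s(1,2) h(1)] T1[OF s(1,2) h(2)] T1[OF s(2,3) h(3)] T1[OF s(2,3) h(4)] LCs by simp
   then have "?m A B C (g, f) (g'', f'') (cmp (?H B C) g g' g'' \<beta>' \<beta>, cmp (?H A B) f f' f'' \<alpha>' \<alpha>) =
    cmp (?H A C) (?o A B C (g, f)) (?o A B C (g', f')) (?o A B C (g'', f'')) (?m A B C (g', f') (g'', f'') (\<beta>', \<alpha>')) (?m A B C (g, f) (g', f') (\<beta>, \<alpha>))"
    by (intro T2[OF s(1,3) m1[OF s a b] cat_cmp[OF cs(3) y x]])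
     (simp add: m2[OF s a b] M[OF s(1,3) x y] M[OF s(1,2) h(1,2)] M[OF s(2,3) h(3,4)] m2[OF s h(1,3)] m2[OF s h(2,4)] o2[OF s o(1) o(5)] o2[OF s o(2) o(6)] o2[OF s o(4) o(8)])
   then show ?case using h o by (simp add: cs)
  qed
  then show "is_functor (prod_cat (?H B C) (?H A B)) (?H A C) (tcmp K A B C)" by (simp only: H0[OF s])
 next
  fix A B f f' \<alpha> assume s: "A \<in> tobj K" "B \<in> tobj K" and f: "f \<in> obj (?H A B)" "f' \<in> obj (?H A B)" and a: "\<alpha> \<in> hom (?H A B) f f'"
  note nA = N[OF s(1)] and nB = N[OF s(2)]
  note iA = cat_id[OF cat[OF s(1,1)] nA[THEN conjunct1]] and iB = cat_id[OF cat[OF s(2,2)] nB[THEN conjunct1]]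
  note u = unit[OF s f(1)] unit[OF s f(2)]
  note l5 = L5[OF ob[OF s(1)] ob[OF s(2)] F1[OF s f(1)] F1[OF s f(2)] T1[OF s a]]
  show "?m A A B (f, tid K A) (f', tid K A) (\<alpha>, tid2 K A) = \<alpha>"
   by (rule T2[OF s _ a]) (use H2[OF s(1,1,2) iA a] u l5 nA I[OF s(1,1)] in auto)
  show "?m A B B (tid K B, f) (tid K B, f') (tid2 K B, \<alpha>) = \<alpha>"
   by (rule T2[OF s _ a]) (use H2[OF s(1,2,2) a iB] u l5 nB I[OF s(2,2)] in auto)
 next
  fix A B C D h h' \<gamma> g g' \<beta> f f' \<alpha> assume s: "A \<in> tobj K" "B \<in> tobj K" "C \<in> tobj K" "D \<in> tobj K"
   and h: "h \<in> obj (?H C D)" "h' \<in> obj (?H C D)" "g \<in> obj (?H B C)" "g' \<in> obj (?H B C)" "f \<in> obj (?H A B)" "f' \<in> obj (?H A B)"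
   and c: "\<gamma> \<in> hom (?H C D) h h'" and b: "\<beta> \<in> hom (?H B C) g g'" and a: "\<alpha> \<in> hom (?H A B) f f'"
  note x = m1[OF s(2,3,4) b c] and y = m1[OF s(1,2,3) a b]
  show "?m A B D (?o B C D (h, g), f) (?o B C D (h', g'), f') (?m B C D (h, g) (h', g') (\<gamma>, \<beta>), \<alpha>) =
   ?m A C D (h, ?o A B C (g, f)) (h', ?o A B C (g', f')) (\<gamma>, ?m A B C (g, f) (g', f') (\<beta>, \<alpha>))"
   by (rule T2[OF s(1,4) m1[OF s(1,2,4) a x, unfolded assoc[OF s h(1,3,5)] assoc[OF s h(2,4,6)]] m1[OF s(1,3,4) y c]])
    (simp add: m2[OF s(1,2,4) a x] m2[OF s(1,3,4) y c] m2[OF s(2,3,4) b c] m2[OF s(1,2,3) a b]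
     o2[OF s(2,3,4) h(3,1)] o2[OF s(2,3,4) h(4,2)] o2[OF s(1,2,3) h(5,3)] o2[OF s(1,2,3) h(6,4)]
     L7[OF ob[OF s(1)] ob[OF s(2)] ob[OF s(3)] ob[OF s(4)] F1[OF s(3,4) h(1)] F1[OF s(3,4) h(2)] T1[OF s(3,4) c]
      F1[OF s(2,3) h(3)] F1[OF s(2,3) h(4)] T1[OF s(2,3) b] F1[OF s(1,2) h(5)] F1[OF s(1,2) h(6)] T1[OF s(1,2) a]])
 qed (use cat N unit assoc in auto)
qed

section \<open>The 2-category of partially finitely complete categories\<close>

lemma parfl_simps [simp]:
 "obj (parfl_hom_cat C D) = {F. partially_lex_functor C D F}"
 "hom (parfl_hom_cat C D) F G = (if partially_lex_functor C D F & partially_lex_functor C D G then {\<alpha>. nat_trans (ucat C) (ucat D) F G \<alpha>} else {})"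
 "partially_lex_functor C D F ==> idm (parfl_hom_cat C D) F = id_trans (ucat C) (ucat D) F"
 "partially_lex_functor C D F ==> partially_lex_functor C D G ==> partially_lex_functor C D H ==>
  nat_trans (ucat C) (ucat D) F G \<alpha> ==> nat_trans (ucat C) (ucat D) G H \<beta> ==>
  cmp (parfl_hom_cat C D) F G H \<beta> \<alpha> = comp_trans (ucat C) (ucat D) F G H \<beta> \<alpha>"
 unfolding parfl_hom_cat_def by auto

lemma parfl_functor: "partially_lex_functor C D F ==> is_functor (ucat C) (ucat D) F"
 unfolding partially_lex_functor_def by blast

lemma parfl_comp:
 assumes F: "partially_lex_functor C D F" and G: "partially_lex_functor D E G" and C: "partially_lex_cat C"
 shows "partially_lex_functor C E (comp_func (ucat C) G F)"
 unfolding partially_lex_functor_def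
proof (intro conjI ballI, safe)
 note f = parfl_functor[OF F] parfl_functor[OF G]
 show "is_functor (ucat C) (ucat E) (comp_func (ucat C) G F)" by (rule comp_functor[OF f])
 fix A X assume s: "(A, X) \<in> sieve C"
 then have X: "is_functor A (ucat C) X"
  using C unfolding partially_lex_cat_def left_exact_sieve_def lex_functor_def by blast
 have "(A, comp_func A G (comp_func A F X)) \<in> sieve E" using F G s unfolding partially_lex_functor_def by blast
 then show "(A, comp_func A (comp_func (ucat C) G F) X) \<in> sieve E" by (simp add: comp_func_assoc[OF X f])
qed

lemma parfl_id:
 assumes C: "partially_lex_cat C" shows "partially_lex_functor C C (id_func (ucat C))"
 unfolding partially_lex_functor_def
proof (intro conjI ballI, safe)
 show "is_functor (ucat C) (ucat C) (id_func (ucat C))" using C unfolding partially_lex_cat_def by (simp add: id_functor)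
 fix A X assume s: "(A, X) \<in> sieve C"
 then have X: "is_functor A (ucat C) X"
  using C unfolding partially_lex_cat_def left_exact_sieve_def lex_functor_def by blast
 show "(A, comp_func A (id_func (ucat C)) X) \<in> sieve C" using s X by simp
qed

lemma PARFL_simps [simp]:
 "tobj PARFL = {C. partially_lex_cat C}" "thom PARFL = parfl_hom_cat" "tid PARFL C = id_func (ucat C)"
 by (simp_all add: PARFL_def)

lemma parfl_hom_category: "category (parfl_hom_cat C D)"
 unfolding parfl_hom_cat_def
proof (rule categoryI, goal_cases)
 case (3 F G \<alpha>)
 then show ?case using cat_id_right[OF fun_cat_category, of \<alpha> "ucat C" "ucat D" F G] by (simp add: parfl_functor id_nat)
next
 case (4 F G \<alpha>)
 then show ?case using cat_id_left[OF fun_cat_category, of \<alpha> "ucat C" "ucat D" F G] by (simp add: parfl_functor id_nat)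
next
 case (5 F G H K \<gamma> \<beta> \<alpha>)
 then show ?case using cat_assoc[OF fun_cat_category, of \<alpha> "ucat C" "ucat D" F G \<beta> H \<gamma> K] by (simp add: comp_nat)
qed (auto intro: id_nat comp_nat parfl_functor)

lemma PARFL_tcmp [simp]:
 "partially_lex_functor C D F ==> partially_lex_functor D E G ==> omap (tcmp PARFL C D E) (G, F) = comp_func (ucat C) G F"
 "partially_lex_functor C D F ==> partially_lex_functor D E G ==> partially_lex_functor C D F' ==> partially_lex_functor D E G' ==>
  nat_trans (ucat C) (ucat D) F F' \<alpha> ==> nat_trans (ucat D) (ucat E) G G' \<beta> ==>
  mmap (tcmp PARFL C D E) (G, F) (G', F') (\<beta>, \<alpha>) = hcomp_trans (ucat C) (ucat E) G G' F F' \<beta> \<alpha>"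
 by (simp_all add: PARFL_def parfl_hom_category hcomp_trans_def)

text \<open>Forgetting the sieve is the identity on 1-cells and on 2-cells, so the injectivity
  required of the embedding into CAT is immediate.\<close>

lemma two_category_PARFL: "two_category PARFL"
proof (rule two_category_embed[OF two_category_CAT, where P = ucat and F = "\<lambda>_ f. f" and T = "\<lambda>_ \<alpha>. \<alpha>"], goal_cases)
 case 2 show ?case unfolding PARFL_simps by (rule parfl_hom_category)
next
 case 10 then show ?case by (simp add: PARFL_def)
next
 case (11 A B C f g) then show ?case by (auto simp: parfl_comp CAT_simps(4)[OF parfl_functor parfl_functor])
next
 case (12 A B C f f' g g' \<alpha> \<beta>)
 then have a: "nat_trans (ucat A) (ucat B) f f' \<alpha>" and b: "nat_trans (ucat B) (ucat C) g g' \<beta>" by (simp_all split: if_splits)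
 show ?case using 12 hcomp_nat[OF a b] CAT_tcmp_simps[OF a b] by (simp add: parfl_comp split: if_splits)
qed (auto simp: partially_lex_cat_def parfl_functor id_nat comp_nat parfl_comp parfl_id split: if_splits)

section \<open>\<open>LexProf\<close>-functors and transformations on total categories\<close>

text \<open>The limit of the empty diagram, a terminal object. A LexProf-functor shows its value on
  X only through the pairs (X, i), so with an empty extent the passage to total categories could not
  be injective on 1-cells.\<close>

lemma lex_nonempty:
 assumes A: "small_lex_cat A" shows "obj A \<noteq> {}"
proof -
 let ?J = "mk_cat {} (\<lambda>_ _. {}) (\<lambda>_. 0) (\<lambda>_ _ _ _ _. 0) :: (nat, nat) cat"
 let ?D = "mk_func ?J (\<lambda>_. undefined) (\<lambda>_ _ _. undefined)"
 have J: "category ?J" by (rule categoryI) auto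
 have "finite_cat ?J" unfolding finite_cat_def using J by simp
 moreover have "is_functor ?J A ?D" by (rule functorI[OF J small_lex_catD(1)[OF A]]) auto
 ultimately have "\<exists>l p. is_limit ?J A ?D l p"
  by (rule small_lex_catD(4)[OF A, unfolded has_finite_limits_def, rule_format, OF conjI])
 then obtain l p where l: "is_limit ?J A ?D l p" by (elim exE)
 have "l \<in> obj A" by (rule cone_obj[OF limit_cone[OF l]])
 then show ?thesis by (metis empty_iff)
qed

definition totF :: "'v::universe lpcat => 'v lpfunc => 'v vfunc" where
 "totF C F = mk_func (tot C) (\<lambda>p. vpair (lpo F (vfst p)) (vsnd p)) (\<lambda>p q f. lpm F (vfst p) (vfst q) (vsnd p, vsnd q) f)"

definition totT :: "'v::universe lpcat => ('v => 'v cell) => 'v => 'v" where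
 "totT C \<theta> = restrict (\<lambda>p. \<theta> (vfst p) (vsnd p, vsnd p) (idm (ext C (vfst p)) (vsnd p))) (obj (tot C))"

lemma totT_app [simp]: "X \<in> lobj C ==> i \<in> obj (ext C X) ==> totT C \<theta> (vpair X i) = \<theta> X (i, i) (idm (ext C X) i)"
 by (simp add: totT_def)

definition mk_lpfunc :: "'v::universe lpcat => ('v => 'v) => ('v => 'v => 'v => 'v => 'v => 'v) => 'v lpfunc" where
 "mk_lpfunc C P m = \<lparr>lpo = restrict P (lobj C),
   lpm = (\<lambda>X Y. if X \<in> lobj C & Y \<in> lobj C then mk_cell (ext C X) (ext C Y) (lhom C X Y) (m X Y) else undefined)\<rparr>"

lemma mk_lpfunc_simps [simp]:
 "X \<in> lobj C ==> lpo (mk_lpfunc C P m) X = P X"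
 "X \<in> lobj C ==> Y \<in> lobj C ==> i \<in> obj (ext C X) ==> j \<in> obj (ext C Y) ==> f \<in> omap (lhom C X Y) (i, j) ==>
  lpm (mk_lpfunc C P m) X Y (i, j) f = m X Y i j f"
 by (simp_all add: mk_lpfunc_def)

lemma lpf_cats: "lp_functor C D F ==> lp_category C" "lp_functor C D F ==> lp_category D"
 unfolding lp_functor_def by blast+

lemma lpf_obj_ext:
 assumes F: "lp_functor C D F" shows "X \<in> lobj C ==> lpo F X \<in> lobj D & ext D (lpo F X) = ext C X"
 by (rule F[unfolded lp_functor_def, THEN conj4, THEN conjunct1, rule_format])

lemma lpf_obj: "lp_functor C D F ==> X \<in> lobj C ==> lpo F X \<in> lobj D"
 and lpf_ext: "lp_functor C D F ==> X \<in> lobj C ==> ext D (lpo F X) = ext C X"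
 using lpf_obj_ext by blast+

lemma lpf_cell:
 assumes F: "lp_functor C D F"
 shows "X \<in> lobj C ==> Y \<in> lobj C ==>
  two_cell (ext C X) (ext C Y) (lhom C X Y) (lhom D (lpo F X) (lpo F Y)) (lpm F X Y)"
 by (rule F[unfolded lp_functor_def, THEN conj4, THEN conjunct2, THEN conjunct1, rule_format])

lemma lpf_in: "lp_functor C D F ==> X \<in> lobj C ==> Y \<in> lobj C ==> i \<in> obj (ext C X) ==> j \<in> obj (ext C Y) ==>
  f \<in> omap (lhom C X Y) (i, j) ==> lpm F X Y (i, j) f \<in> omap (lhom D (lpo F X) (lpo F Y)) (i, j)"
 by (rule cell_in[OF lpf_cell])

lemma lpf_cmp:
 assumes F: "lp_functor C D F"
 shows "X \<in> lobj C ==> Y \<in> lobj C ==> Z \<in> lobj C ==> i \<in> obj (ext C X) ==> j \<in> obj (ext C Y) ==> k \<in> obj (ext C Z) ==>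
  g \<in> omap (lhom C Y Z) (j, k) ==> f \<in> omap (lhom C X Y) (i, j) ==>
  lpm F X Z (i, k) (lapp C X Y Z i j k g f) =
     lapp D (lpo F X) (lpo F Y) (lpo F Z) i j k (lpm F Y Z (j, k) g) (lpm F X Y (i, j) f)"
 by (rule F[unfolded lp_functor_def, THEN conj4, THEN conjunct2,
   THEN conjunct2, THEN conjunct1, rule_format])

lemma lpf_idm:
 assumes F: "lp_functor C D F"
 shows "X \<in> lobj C ==> p \<in> hom (ext C X) i j ==> lpm F X X (i, j) (lidm C X (i, j) p) = lidm D (lpo F X) (i, j) p"
 by (rule F[unfolded lp_functor_def, THEN conj4, THEN conjunct2,
   THEN conj2, rule_format])
  (auto dest: hom_obj[OF lpcategory.ext_cat, OF lpcategory.intro, OF lpf_cats(1)[OF F]])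

lemma lpf_mk:
 assumes F: "lp_functor C D F"
 shows "mk_lpfunc C (lpo F) (\<lambda>X Y i j. lpm F X Y (i, j)) = F"
proof -
 note n = F[unfolded lp_functor_def, THEN conj2]
 have "restrict (lpo F) (lobj C) = lpo F" by (rule extensional_restrict[OF n[THEN conjunct1]])
 moreover have "(if X \<in> lobj C & Y \<in> lobj C then mk_cell (ext C X) (ext C Y) (lhom C X Y) (\<lambda>i j. lpm F X Y (i, j)) else undefined) = lpm F X Y" for X Y
 proof (cases "X \<in> lobj C & Y \<in> lobj C")
  case True then show ?thesis using cell_mk[OF lpf_cell[OF F]] by simp
 next
  case False
  have "lpm F X Y = undefined" by (rule n[THEN conjunct2, THEN conjunct1, rule_format, OF False])
  then show ?thesis by (simp only: False if_False)
 qed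
 ultimately show ?thesis unfolding mk_lpfunc_def by simp
qed

lemma mk_lpfunc_cong:
 assumes "!!X. X \<in> lobj C ==> P X = P' X"
  and "!!X Y i j f. X \<in> lobj C ==> Y \<in> lobj C ==> i \<in> obj (ext C X) ==> j \<in> obj (ext C Y) ==> f \<in> omap (lhom C X Y) (i, j) ==>
   m X Y i j f = m' X Y i j f"
 shows "mk_lpfunc C P m = mk_lpfunc C P' m'"
proof -
 have "restrict P (lobj C) = restrict P' (lobj C)" by (rule restrict_ext) (rule assms(1))
 moreover have "(\<lambda>X Y. if X \<in> lobj C & Y \<in> lobj C then mk_cell (ext C X) (ext C Y) (lhom C X Y) (m X Y) else undefined) =
  (\<lambda>X Y. if X \<in> lobj C & Y \<in> lobj C then mk_cell (ext C X) (ext C Y) (lhom C X Y) (m' X Y) else undefined)"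
  by (rule ext, rule ext, rule if_cong[OF refl _ refl], rule mk_cell_cong) (simp add: assms(2))
 ultimately show ?thesis unfolding mk_lpfunc_def by simp
qed

lemma lpf_eqI:
 assumes "lp_functor C D F" "lp_functor C D' G" "!!X. X \<in> lobj C ==> lpo F X = lpo G X"
  and "!!X Y i j f. X \<in> lobj C ==> Y \<in> lobj C ==> i \<in> obj (ext C X) ==> j \<in> obj (ext C Y) ==> f \<in> omap (lhom C X Y) (i, j) ==>
   lpm F X Y (i, j) f = lpm G X Y (i, j) f"
 shows "F = G"
proof -
 have "mk_lpfunc C (lpo F) (\<lambda>X Y i j. lpm F X Y (i, j)) = mk_lpfunc C (lpo G) (\<lambda>X Y i j. lpm G X Y (i, j))"
  by (rule mk_lpfunc_cong) (rule assms(3,4); assumption)+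
 then show ?thesis unfolding lpf_mk[OF assms(1)] lpf_mk[OF assms(2)] .
qed

lemma totF_simps [simp]:
 "X \<in> lobj C ==> i \<in> obj (ext C X) ==> omap (totF C F) (vpair X i) = vpair (lpo F X) i"
 "X \<in> lobj C ==> i \<in> obj (ext C X) ==> Y \<in> lobj C ==> j \<in> obj (ext C Y) ==> f \<in> omap (lhom C X Y) (i, j) ==>
  mmap (totF C F) (vpair X i) (vpair Y j) f = lpm F X Y (i, j) f"
 by (simp_all add: totF_def)

lemma totF_functor:
 assumes F: "lp_functor C D F"
 shows "is_functor (tot C) (tot D) (totF C F)"
proof -
 interpret C: lpcategory C by unfold_locales (rule lpf_cats[OF F])
 interpret D: lpcategory D by unfold_locales (rule lpf_cats[OF F])
 note [simp] = lpf_obj[OF F] lpf_ext[OF F]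
 show ?thesis unfolding totF_def
 proof (rule functorI[OF C.tot_category D.tot_category], goal_cases)
  case (2 a b f) then show ?case by (auto elim!: tot_objE intro: lpf_in[OF F])
 next
  case (3 a) then show ?case by (auto elim!: tot_objE simp: lpf_idm[OF F] cat_id C.ext_cat)
 next
  case (4 a b c g f) then show ?case by (auto elim!: tot_objE simp: tot_cmp lpf_cmp[OF F] lpf_in[OF F])
 qed (auto elim!: tot_objE)
qed

lemma totF_inj:
 assumes F: "lp_functor C D F" and G: "lp_functor C D G" and e: "totF C F = totF C G"
 shows "F = G"
proof (rule lpf_eqI[OF F G])
 interpret C: lpcategory C by unfold_locales (rule lpf_cats[OF F])
 fix X assume X: "X \<in> lobj C"
 then obtain i where i: "i \<in> obj (ext C X)" using lex_nonempty[OF C.ext_lex] by blast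
 show "lpo F X = lpo G X" using e X i totF_simps(1)[of X C i F] totF_simps(1)[of X C i G] by simp
next
 fix X Y i j f assume h: "X \<in> lobj C" "Y \<in> lobj C" "i \<in> obj (ext C X)" "j \<in> obj (ext C Y)" "f \<in> omap (lhom C X Y) (i, j)"
 show "lpm F X Y (i, j) f = lpm G X Y (i, j) f"
  using e totF_simps(2)[OF h(1,3,2,4,5), of F] totF_simps(2)[OF h(1,3,2,4,5), of G] by simp
qed

text \<open>Naturality of the 2-cells is derived: by \<open>act_eq\<close> both actions are
  composites with identity 2-cells, so it follows from preservation of composites and of identity
  2-cells.\<close>

lemma mk_lpfunc_functor:
 assumes C: "lp_category C" and D: "lp_category D"
  and o: "!!X. X \<in> lobj C ==> P X \<in> lobj D" and e: "!!X. X \<in> lobj C ==> ext D (P X) = ext C X"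
  and i: "!!X Y i j f. X \<in> lobj C ==> Y \<in> lobj C ==> i \<in> obj (ext C X) ==> j \<in> obj (ext C Y) ==> f \<in> omap (lhom C X Y) (i, j) ==>
   m X Y i j f \<in> omap (lhom D (P X) (P Y)) (i, j)"
  and c: "!!X Y Z i j k g f. X \<in> lobj C ==> Y \<in> lobj C ==> Z \<in> lobj C ==> i \<in> obj (ext C X) ==> j \<in> obj (ext C Y) ==>
   k \<in> obj (ext C Z) ==> g \<in> omap (lhom C Y Z) (j, k) ==> f \<in> omap (lhom C X Y) (i, j) ==>
   m X Z i k (cmpv (tot C) X i Y j Z k g f) =
   cmpv (tot D) (P X) i (P Y) j (P Z) k (m Y Z j k g) (m X Y i j f)"
  and d: "!!X i j p. X \<in> lobj C ==> p \<in> hom (ext C X) i j ==> m X X i j (lidm C X (i, j) p) = lidm D (P X) (i, j) p"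
 shows "lp_functor C D (mk_lpfunc C P m)"
proof -
 interpret C: lpcategory C by unfold_locales (rule C)
 interpret D: lpcategory D by unfold_locales (rule D)
 have cell: "two_cell (ext C X) (ext C Y) (lhom C X Y) (lhom D (P X) (P Y)) (mk_cell (ext C X) (ext C Y) (lhom C X Y) (m X Y))"
  if XY: "X \<in> lobj C" "Y \<in> lobj C" for X Y
 proof (rule cellI[OF C.hom_is_prof[OF XY]])
  show "is_prof (ext C X) (ext C Y) (lhom D (P X) (P Y))" using D.hom_is_prof[OF o[OF XY(1)] o[OF XY(2)]] e XY by simp
  fix a b a' b' f g x assume f: "f \<in> hom (ext C X) a' a" and g: "g \<in> hom (ext C Y) b b'" and x: "x \<in> omap (lhom C X Y) (a, b)"
  have obs: "a \<in> obj (ext C X)" "a' \<in> obj (ext C X)" "b \<in> obj (ext C Y)" "b' \<in> obj (ext C Y)"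
   using f g hom_obj C.ext_cat XY by metis+
  note fi = C.idm_in[OF XY(1) f] and gi = C.idm_in[OF XY(2) g]
  have xf: "cmpv (tot C) X a' X a Y b x (lidm C X (a', a) f) \<in> omap (lhom C X Y) (a', b)"
   using cat_cmp[OF C.tot_category, of x "vpair X a" "vpair Y b" "lidm C X (a', a) f" "vpair X a'"] x fi XY obs by simp
  show "m X Y a' b' (mmap (lhom C X Y) (a, b) (a', b') (f, g) x) = mmap (lhom D (P X) (P Y)) (a, b) (a', b') (f, g) (m X Y a b x)"
   using C.act_eq[OF XY f g x] D.act_eq[OF o[OF XY(1)] o[OF XY(2)], of f a' a g b b' "m X Y a b x"] f g x XY obs fi gi xf
   by (simp add: e c i d)
 qed (rule i[OF XY])
 show ?thesis unfolding lp_functor_def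
 proof (intro conjI ballI allI impI C D, goal_cases)
  case 1 then show ?case by (simp add: mk_lpfunc_def)
 next
  case 2 then show ?case by (auto simp: mk_lpfunc_def)
 next
  case 5 then show ?case using cell by (simp add: mk_lpfunc_def)
 next
  case (6 X Y Z i j k g f)
  then show ?case using c[of X Y Z i j k g f] by (simp add: tot_cmp C.lapp_in o e i)
 next
  case (7 X i j p) then show ?case by (simp add: C.idm_in d)
 qed (use o e in auto)
qed

lemma lp_id_functor_mk: "lp_id_functor C = mk_lpfunc C (\<lambda>X. X) (\<lambda>X Y i j f. f)"
 by (simp add: lp_id_functor_def mk_lpfunc_def)

lemma lp_comp_functor_mk: "lp_comp_functor C G F = mk_lpfunc C (\<lambda>X. lpo G (lpo F X))
  (\<lambda>X Y i j f. lpm G (lpo F X) (lpo F Y) (i, j) (lpm F X Y (i, j) f))"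
 by (simp add: lp_comp_functor_def mk_lpfunc_def)

lemma lp_id: "lp_category C ==> lp_functor C C (lp_id_functor C)"
 unfolding lp_id_functor_mk by (rule mk_lpfunc_functor) auto

lemma lp_comp:
 assumes F: "lp_functor C D F" and G: "lp_functor D E G"
 shows "lp_functor C E (lp_comp_functor C G F)"
 unfolding lp_comp_functor_mk
proof (rule mk_lpfunc_functor[OF lpf_cats(1)[OF F] lpf_cats(2)[OF G]], goal_cases)
 case (4 X Y Z i j k g f)
 then show ?case
  by (simp add: tot_cmp lpf_cmp[OF F] lpf_cmp[OF G] lpf_in[OF F] lpf_in[OF G] lpf_obj[OF F] lpf_obj[OF G] lpf_ext[OF F] lpf_ext[OF G])
next
 case (5 X i j p)
 then show ?case by (simp add: lpf_idm[OF F] lpf_idm[OF G] lpf_obj[OF F] lpf_ext[OF F])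
qed (auto simp: lpf_obj[OF F] lpf_obj[OF G] lpf_ext[OF F] lpf_ext[OF G] intro!: lpf_in[OF G] lpf_in[OF F])

lemma lp_comp_simps [simp]:
 fixes C :: "'v::universe lpcat"
 shows
 "X \<in> lobj C ==> lpo (lp_comp_functor C G F) X = lpo G (lpo F X)"
 "X \<in> lobj C ==> Y \<in> lobj C ==> i \<in> obj (ext C X) ==> j \<in> obj (ext C Y) ==> f \<in> omap (lhom C X Y) (i, j) ==>
  lpm (lp_comp_functor C G F) X Y (i, j) f = lpm G (lpo F X) (lpo F Y) (i, j) (lpm F X Y (i, j) f)"
 unfolding lp_comp_functor_mk by simp_all

lemma lp_id_simps [simp]:
 fixes C :: "'v::universe lpcat"
 shows
 "X \<in> lobj C ==> lpo (lp_id_functor C) X = X"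
 "X \<in> lobj C ==> Y \<in> lobj C ==> i \<in> obj (ext C X) ==> j \<in> obj (ext C Y) ==> f \<in> omap (lhom C X Y) (i, j) ==>
  lpm (lp_id_functor C) X Y (i, j) f = f"
 unfolding lp_id_functor_mk by simp_all

lemma totF_id: "lp_category C ==> totF C (lp_id_functor C) = id_func (tot C)"
 using lpcategory.tot_category[OF lpcategory.intro]
 by (intro functor_eqI[OF totF_functor[OF lp_id] id_functor]) (auto elim!: tot_objE)

lemma totF_comp:
 assumes F: "lp_functor C D F" and G: "lp_functor D E G"
 shows "totF C (lp_comp_functor C G F) = comp_func (tot C) (totF D G) (totF C F)"
 by (rule functor_eqI[OF totF_functor[OF lp_comp[OF F G]] comp_functor[OF totF_functor[OF F] totF_functor[OF G]]])
  (auto elim!: tot_objE simp: lpf_obj[OF F] lpf_ext[OF F] lpf_in[OF F])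

text \<open>A transformation is recovered from its components at identities: its value at \<open>p : i \<rightarrow> j\<close> is that component
 followed by the image of \<open>p\<close>.\<close>

definition mkT :: "'v::universe lpcat => 'v lpcat => 'v lpfunc => 'v lpfunc => ('v => 'v) => 'v => 'v cell" where
 "mkT C D F G \<alpha> = restrict (\<lambda>X. mk_cell (ext C X) (ext C X) (id_prof (ext C X))
   (\<lambda>i j p. cmpv (tot D) (lpo F X) i (lpo G X) i (lpo G X) j
    (lidm D (lpo G X) (i, j) p) (\<alpha> (vpair X i)))) (lobj C)"

lemma lpt_funcs: "lp_trans C D F G \<theta> ==> lp_functor C D F" "lp_trans C D F G \<theta> ==> lp_functor C D G"
 unfolding lp_trans_def by blast+

lemma lpt_cell:
 assumes t: "lp_trans C D F G \<theta>"
 shows "X \<in> lobj C ==> two_cell (ext C X) (ext C X) (id_prof (ext C X)) (lhom D (lpo F X) (lpo G X)) (\<theta> X)"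
 by (rule t[unfolded lp_trans_def, THEN conj2, THEN conjunct2, THEN conjunct1, rule_format])

lemma lpt_in:
 assumes t: "lp_trans C D F G \<theta>" and X: "X \<in> lobj C" and p: "p \<in> hom (ext C X) i j"
 shows "\<theta> X (i, j) p \<in> omap (lhom D (lpo F X) (lpo G X)) (i, j)"
proof -
 interpret C: lpcategory C by unfold_locales (rule lpf_cats[OF lpt_funcs(1)[OF t]])
 have "i \<in> obj (ext C X)" "j \<in> obj (ext C X)" using hom_obj[OF C.ext_cat[OF X] p] by auto
 then show ?thesis using p by (intro cell_in[OF lpt_cell[OF t X]]) auto
qed

lemma lpt_nat:
 assumes t: "lp_trans C D F G \<theta>" and h: "X \<in> lobj C" "Y \<in> lobj C" "i \<in> obj (ext C X)" "j \<in> obj (ext C Y)" "f \<in> omap (lhom C X Y) (i, j)"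
 shows "cmpv (tot D) (lpo F X) i (lpo F Y) j (lpo G Y) j (\<theta> Y (j, j) (idm (ext C Y) j)) (lpm F X Y (i, j) f) =
  cmpv (tot D) (lpo F X) i (lpo G X) i (lpo G Y) j (lpm G X Y (i, j) f) (\<theta> X (i, i) (idm (ext C X) i))"
proof -
 note F = lpt_funcs(1)[OF t] and G = lpt_funcs(2)[OF t]
 interpret C: lpcategory C by unfold_locales (rule lpf_cats[OF F])
 have "lapp D (lpo F X) (lpo F Y) (lpo G Y) i j j (\<theta> Y (j, j) (idm (ext C Y) j)) (lpm F X Y (i, j) f) =
    lapp D (lpo F X) (lpo G X) (lpo G Y) i i j (lpm G X Y (i, j) f) (\<theta> X (i, i) (idm (ext C X) i))"
  by (rule t[unfolded lp_trans_def, THEN conj4, rule_format]) (use h in auto)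
 then show ?thesis using h
  by (simp add: tot_cmp lpf_obj[OF F] lpf_ext[OF F] lpf_obj[OF G] lpf_ext[OF G] lpf_in[OF F] lpf_in[OF G] lpt_in[OF t] cat_id C.ext_cat)
qed

lemma totT_nat:
 assumes t: "lp_trans C D F G \<theta>"
 shows "nat_trans (tot C) (tot D) (totF C F) (totF C G) (totT C \<theta>)"
 unfolding totT_def
proof (rule natI)
 note F = lpt_funcs(1)[OF t] and G = lpt_funcs(2)[OF t]
 interpret C: lpcategory C by unfold_locales (rule lpf_cats[OF F])
 note [simp] = lpf_obj[OF F] lpf_ext[OF F] lpf_obj[OF G] lpf_ext[OF G]
 show "is_functor (tot C) (tot D) (totF C F)" "is_functor (tot C) (tot D) (totF C G)"
  by (rule totF_functor[OF F] totF_functor[OF G])+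
 fix a assume "a \<in> obj (tot C)"
 then show "\<theta> (vfst a) (vsnd a, vsnd a) (idm (ext C (vfst a)) (vsnd a)) \<in> hom (tot D) (omap (totF C F) a) (omap (totF C G) a)"
  by (auto elim!: tot_objE intro!: lpt_in[OF t] cat_id C.ext_cat)
next
 fix a b f assume "a \<in> obj (tot C)" "b \<in> obj (tot C)" "f \<in> hom (tot C) a b"
 then show "cmp (tot D) (omap (totF C F) a) (omap (totF C F) b) (omap (totF C G) b)
   (\<theta> (vfst b) (vsnd b, vsnd b) (idm (ext C (vfst b)) (vsnd b))) (mmap (totF C F) a b f) =
  cmp (tot D) (omap (totF C F) a) (omap (totF C G) a) (omap (totF C G) b) (mmap (totF C G) a b f)
   (\<theta> (vfst a) (vsnd a, vsnd a) (idm (ext C (vfst a)) (vsnd a)))"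
  by (auto elim!: tot_objE simp: lpt_nat[OF t])
qed

text \<open>A morphism p is the identity of i acted on by p, and on D(FX,GX) this action is
  composition with the image of p; so the components at identities determine the
  transformation.\<close>

lemma lpt_expand:
 assumes t: "lp_trans C D F G \<theta>" and X: "X \<in> lobj C" and p: "p \<in> hom (ext C X) i j"
 shows "\<theta> X (i, j) p = cmpv (tot D) (lpo F X) i (lpo G X) i (lpo G X) j
    (lidm D (lpo G X) (i, j) p) (\<theta> X (i, i) (idm (ext C X) i))"
proof -
 note F = lpt_funcs(1)[OF t] and G = lpt_funcs(2)[OF t]
 interpret C: lpcategory C by unfold_locales (rule lpf_cats[OF F])
 interpret D: lpcategory D by unfold_locales (rule lpf_cats[OF F])
 note [simp] = lpf_obj[OF F] lpf_ext[OF F] lpf_obj[OF G] lpf_ext[OF G]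
 note E = C.ext_cat[OF X]
 have o: "i \<in> obj (ext C X)" "j \<in> obj (ext C X)" using hom_obj[OF E p] by auto
 note ii = cat_id[OF E o(1)]
 have "\<theta> X (i, j) (ract (ext C X) (id_prof (ext C X)) i i j p (idm (ext C X) i)) =
  ract (ext C X) (lhom D (lpo F X) (lpo G X)) i i j p (\<theta> X (i, i) (idm (ext C X) i))"
  using o ii p by (intro cell_nat[OF lpt_cell[OF t X] E E]) auto
 then have "\<theta> X (i, j) p = ract (ext C X) (lhom D (lpo F X) (lpo G X)) i i j p (\<theta> X (i, i) (idm (ext C X) i))"
  using ii p E by (simp add: cat_id_right)
 also have "\<dots> = lapp D (lpo F X) (lpo G X) (lpo G X) i i j (lidm D (lpo G X) (i, j) p) (\<theta> X (i, i) (idm (ext C X) i))"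
  using D.lp_unit_left[of "lpo F X" "lpo G X" i p i j "\<theta> X (i, i) (idm (ext C X) i)"] X o p lpt_in[OF t X ii] by simp
 finally show ?thesis using X o p lpt_in[OF t X ii] D.idm_in[of "lpo G X" p i j] by (simp add: tot_cmp)
qed

lemma mkT_app:
 assumes F: "lp_functor C D F" and G: "lp_functor C D G" and X: "X \<in> lobj C" and p: "p \<in> hom (ext C X) i j"
 shows "mkT C D F G \<alpha> X (i, j) p = cmpv (tot D) (lpo F X) i (lpo G X) i (lpo G X) j
    (lidm D (lpo G X) (i, j) p) (\<alpha> (vpair X i))"
proof -
 interpret C: lpcategory C by unfold_locales (rule lpf_cats[OF F])
 show ?thesis using X p hom_obj[OF C.ext_cat[OF X] p] by (simp add: mkT_def)
qed

lemma mkT_totT: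
 assumes t: "lp_trans C D F G \<theta>" shows "mkT C D F G (totT C \<theta>) = \<theta>"
proof -
 note F = lpt_funcs(1)[OF t] and G = lpt_funcs(2)[OF t]
 interpret C: lpcategory C by unfold_locales (rule lpf_cats[OF F])
 have "mk_cell (ext C X) (ext C X) (id_prof (ext C X))
   (\<lambda>i j p. cmpv (tot D) (lpo F X) i (lpo G X) i (lpo G X) j
    (lidm D (lpo G X) (i, j) p) (totT C \<theta> (vpair X i))) = \<theta> X" if X: "X \<in> lobj C" for X
 proof -
  have "mk_cell (ext C X) (ext C X) (id_prof (ext C X))
   (\<lambda>i j p. cmpv (tot D) (lpo F X) i (lpo G X) i (lpo G X) j
    (lidm D (lpo G X) (i, j) p) (totT C \<theta> (vpair X i))) = mk_cell (ext C X) (ext C X) (id_prof (ext C X)) (\<lambda>i j. \<theta> X (i, j))"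
   by (rule mk_cell_cong) (use X lpt_expand[OF t X] in simp)
  then show ?thesis using cell_mk[OF lpt_cell[OF t X]] by simp
 qed
 moreover have "\<theta> \<in> extensional (lobj C)" using t unfolding lp_trans_def by blast
 ultimately show ?thesis unfolding mkT_def by (intro extensionalityI[of _ "lobj C"]) auto
qed

lemma totT_inj: "lp_trans C D F G \<theta> ==> lp_trans C D F G \<phi> ==> totT C \<theta> = totT C \<phi> ==> \<theta> = \<phi>"
 by (metis mkT_totT)

text \<open>With \<open>mkT_totT\<close>, LexProf-transformations correspond bijectively to natural
  transformations between the functors on total categories.\<close>

lemma mkT_trans:
 assumes F: "lp_functor C D F" and G: "lp_functor C D G" and a: "nat_trans (tot C) (tot D) (totF C F) (totF C G) \<alpha>"
 shows "lp_trans C D F G (mkT C D F G \<alpha>)" "totT C (mkT C D F G \<alpha>) = \<alpha>"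
proof -
 interpret C: lpcategory C by unfold_locales (rule lpf_cats[OF F])
 interpret D: lpcategory D by unfold_locales (rule lpf_cats[OF F])
 note [simp] = lpf_obj[OF F] lpf_ext[OF F] lpf_obj[OF G] lpf_ext[OF G]
 let ?c = "\<lambda>X i j p. cmpv (tot D) (lpo F X) i (lpo G X) i (lpo G X) j (lidm D (lpo G X) (i, j) p) (\<alpha> (vpair X i))"
 have ai: "\<alpha> (vpair X i) \<in> omap (lhom D (lpo F X) (lpo G X)) (i, i)" if "X \<in> lobj C" "i \<in> obj (ext C X)" for X i
  using nat_hom[OF a, of "vpair X i"] that by simp
 have di: "lidm D (lpo G X) (i, j) p \<in> omap (lhom D (lpo G X) (lpo G X)) (i, j)"
  "lidm D (lpo F X) (i, j) p \<in> omap (lhom D (lpo F X) (lpo F X)) (i, j)" if "X \<in> lobj C" "p \<in> hom (ext C X) i j" for X i j p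
  using that by (auto intro!: D.idm_in)
 have one: "mkT C D F G \<alpha> X (i, i) (idm (ext C X) i) = \<alpha> (vpair X i)" if X: "X \<in> lobj C" and i: "i \<in> obj (ext C X)" for X i
  using cat_id_left[OF D.tot_category, of "\<alpha> (vpair X i)" "vpair (lpo F X) i" "vpair (lpo G X) i"] ai[OF X i] X i
  by (simp add: mkT_app[OF F G X cat_id[OF C.ext_cat[OF X] i]])
 \<comment> \<open>Naturality of \<alpha> on morphisms coming from the extent; it moves the left
   action past \<alpha>.\<close>
 have inc_nat: "cmpv (tot D) (lpo F X) i (lpo F X) j (lpo G X) j (\<alpha> (vpair X j)) (lidm D (lpo F X) (i, j) p) =
  ?c X i j p"
  if X: "X \<in> lobj C" and p: "p \<in> hom (ext C X) i j" for X i j p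
  using nat_nat[OF a, of "lidm C X (i, j) p" "vpair X i" "vpair X j"] X p hom_obj[OF C.ext_cat[OF X] p]
  by (simp add: C.idm_in lpf_idm[OF F] lpf_idm[OF G])
 show "lp_trans C D F G (mkT C D F G \<alpha>)" unfolding lp_trans_def
 proof (intro conjI ballI F G)
  show "mkT C D F G \<alpha> \<in> extensional (lobj C)" by (simp add: mkT_def)
  fix X assume X: "X \<in> lobj C"
  let ?E = "ext C X" and ?f = "lpo F X" and ?g = "lpo G X"
  note E = C.ext_cat[OF X]
  have FX: "lpo F X \<in> lobj D" "lpo G X \<in> lobj D" using X by simp_all
  have "two_cell ?E ?E (id_prof ?E) (lhom D ?f ?g) (mk_cell ?E ?E (id_prof ?E)
   (\<lambda>i j p. ?c X i j p))"
  proof (rule cellI[OF id_prof_prof[OF C.ext_lex[OF X]]])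
   show "is_prof ?E ?E (lhom D ?f ?g)" using D.hom_is_prof[OF FX] X by simp
   fix i j p assume o: "i \<in> obj ?E" "j \<in> obj ?E" and p: "p \<in> omap (id_prof ?E) (i, j)"
   show "?c X i j p
    \<in> omap (lhom D ?f ?g) (i, j)"
    using cat_cmp[OF D.tot_category, of "lidm D ?g (i, j) p" "vpair ?g i" "vpair ?g j" "\<alpha> (vpair X i)" "vpair ?f i"]
     ai[OF X o(1)] di[OF X] o p X by simp
  next
   fix i j i' j' r q p assume r: "r \<in> hom ?E i' i" and q: "q \<in> hom ?E j j'" and p: "p \<in> omap (id_prof ?E) (i, j)"
   have o: "i \<in> obj ?E" "i' \<in> obj ?E" "j \<in> obj ?E" "j' \<in> obj ?E" using r q hom_obj E by metis+
   have p': "p \<in> hom ?E i j" using p o by simp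
   have co: "lidm D ?g (i', j') (cmp ?E i' j j' q (cmp ?E i' i j p r)) =
    cmpv (tot D) ?g i' ?g j ?g j' (lidm D ?g (j, j') q)
     (cmpv (tot D) ?g i' ?g i ?g j (lidm D ?g (i, j) p) (lidm D ?g (i', i) r))"
    using functor_cmp[OF D.inc_functor[OF FX(2)], of p i j r i'] functor_cmp[OF D.inc_functor[OF FX(2)], of q j j' "cmp ?E i' i j p r" i']
     X o q p' r by (simp add: cat_cmp[OF E])
   have h: "\<alpha> (vpair X i) \<in> homv (tot D) ?f i ?g i" "\<alpha> (vpair X i') \<in> homv (tot D) ?f i' ?g i'"
    "lidm D ?g (j, j') q \<in> homv (tot D) ?g j ?g j'"
    "lidm D ?g (i, j) p \<in> homv (tot D) ?g i ?g j"
    "lidm D ?g (i', i) r \<in> homv (tot D) ?g i' ?g i"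
    "lidm D ?f (i', i) r \<in> homv (tot D) ?f i' ?f i"
    using ai di X o q p' r by simp_all
   note T = D.tot_category
   have m: "?c X i j p \<in>
     omap (lhom D ?f ?g) (i, j)" using cat_cmp[OF T h(4,1)] X o by simp
   show "cmpv (tot D) ?f i' ?g i' ?g j'
     (lidm D ?g (i', j') (mmap (id_prof ?E) (i, j) (i', j') (r, q) p)) (\<alpha> (vpair X i')) =
    mmap (lhom D ?f ?g) (i, j) (i', j') (r, q)
     (?c X i j p)"
   proof -
    have r': "r \<in> hom (ext D ?f) i' i" and q': "q \<in> hom (ext D ?g) j j'" using r q X by simp_all
    have e: "mmap (id_prof ?E) (i, j) (i', j') (r, q) p = cmp ?E i' j j' q (cmp ?E i' i j p r)"
     using r q p' E by simp
    note pr = cat_cmp[OF T h(4,5)]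
    show ?thesis
     unfolding e co cat_assoc[OF T h(2) pr h(3)] cat_assoc[OF T h(2,5,4)] D.act_eq[OF FX r' q' m]
      cat_assoc[OF T h(6,1,4)] inc_nat[OF X r] ..
   qed
  qed
  then show "two_cell ?E ?E (id_prof ?E) (lhom D ?f ?g) (mkT C D F G \<alpha> X)"
   using X by (simp add: mkT_def)
 next
  fix X Y i j f assume h: "X \<in> lobj C" "Y \<in> lobj C" "i \<in> obj (ext C X)" "j \<in> obj (ext C Y)" "f \<in> omap (lhom C X Y) (i, j)"
  show "lapp D (lpo F X) (lpo F Y) (lpo G Y) i j j (mkT C D F G \<alpha> Y (j, j) (idm (ext C Y) j)) (lpm F X Y (i, j) f) =
    lapp D (lpo F X) (lpo G X) (lpo G Y) i i j (lpm G X Y (i, j) f) (mkT C D F G \<alpha> X (i, i) (idm (ext C X) i))"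
   using nat_nat[OF a, of f "vpair X i" "vpair Y j"] h by (simp add: one tot_cmp ai lpf_in[OF F] lpf_in[OF G])
 qed
 show "totT C (mkT C D F G \<alpha>) = \<alpha>"
  by (rule extensionalityI[OF _ nat_ext[OF a]]) (auto simp: totT_def one elim!: tot_objE)
qed

section \<open>The 2-category \<open>LexProf-CAT\<close>\<close>

lemma lp_hom_simps [simp]:
 "obj (lp_hom_cat C D) = {F. lp_functor C D F}"
 "hom (lp_hom_cat C D) F G = {\<theta>. lp_trans C D F G \<theta>}"
 "lp_functor C D F ==> idm (lp_hom_cat C D) F = restrict (\<lambda>X. lidm D (lpo F X)) (lobj C)"
 "lp_trans C D F G \<theta> ==> lp_trans C D G H \<phi> ==> cmp (lp_hom_cat C D) F G H \<phi> \<theta> =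
   restrict (\<lambda>X. lp_paste D (lpo F X) (lpo G X) (lpo H X) (\<phi> X) (\<theta> X)) (lobj C)"
 unfolding lp_hom_cat_def by (simp_all, auto dest: lpt_funcs, subst mk_cat_simps, auto dest: lpt_funcs)

text \<open>Together with \<open>lp_pasteT\<close> and \<open>lp_hcompT\<close>: identities,
  vertical and horizontal composites of LexProf-transformations are \<open>mkT\<close> of the
  ordinary ones. Well-typedness and all equations then come from CAT through
  \<open>totT\<close>.\<close>

lemma lp_idT:
 assumes F: "lp_functor C D F"
 shows "restrict (\<lambda>X. lidm D (lpo F X)) (lobj C) = mkT C D F F (id_trans (tot C) (tot D) (totF C F))"
proof (rule extensionalityI)
 interpret D: lpcategory D by unfold_locales (rule lpf_cats[OF F])
 interpret C: lpcategory C by unfold_locales (rule lpf_cats[OF F])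
 note t = mkT_trans(1)[OF F F id_nat[OF totF_functor[OF F]]]
 fix X assume X: "X \<in> lobj C"
 note o = lpf_obj[OF F X] lpf_ext[OF F X]
 have "lidm D (lpo F X) = mkT C D F F (id_trans (tot C) (tot D) (totF C F)) X"
 proof (rule cell_eqI)
  show "two_cell (ext C X) (ext C X) (id_prof (ext C X)) (lhom D (lpo F X) (lpo F X)) (lidm D (lpo F X))"
   using D.idm_cell[OF o(1)] o(2) by simp
  show "two_cell (ext C X) (ext C X) (id_prof (ext C X)) (lhom D (lpo F X) (lpo F X)) (mkT C D F F (id_trans (tot C) (tot D) (totF C F)) X)"
   by (rule lpt_cell[OF t X])
  fix i j p assume h: "i \<in> obj (ext C X)" "j \<in> obj (ext C X)" "p \<in> omap (id_prof (ext C X)) (i, j)"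
  show "lidm D (lpo F X) (i, j) p = mkT C D F F (id_trans (tot C) (tot D) (totF C F)) X (i, j) p"
   using cat_id_right[OF D.tot_category, of "lidm D (lpo F X) (i, j) p" "vpair (lpo F X) i" "vpair (lpo F X) j"]
    h X o D.idm_in[OF o(1), of p i j] by (simp add: mkT_app[OF F F X])
 qed
 then show "restrict (\<lambda>X. lidm D (lpo F X)) (lobj C) X = mkT C D F F (id_trans (tot C) (tot D) (totF C F)) X"
  using X by simp
qed (auto simp: mkT_def)

lemma lp_pasteT:
 assumes t: "lp_trans C D F G \<theta>" and u: "lp_trans C D G H \<phi>"
 shows "restrict (\<lambda>X. lp_paste D (lpo F X) (lpo G X) (lpo H X) (\<phi> X) (\<theta> X)) (lobj C) =
  mkT C D F H (comp_trans (tot C) (tot D) (totF C F) (totF C G) (totF C H) (totT C \<phi>) (totT C \<theta>))"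
 unfolding mkT_def
proof (rule restrict_ext)
 note F = lpt_funcs(1)[OF t] and G = lpt_funcs(2)[OF t] and H = lpt_funcs(2)[OF u]
 interpret D: lpcategory D by unfold_locales (rule lpf_cats[OF F])
 interpret C: lpcategory C by unfold_locales (rule lpf_cats[OF F])
 fix X assume X: "X \<in> lobj C"
 note o = lpf_obj[OF F X] lpf_ext[OF F X] lpf_obj[OF G X] lpf_ext[OF G X] lpf_obj[OF H X] lpf_ext[OF H X]
 show "lp_paste D (lpo F X) (lpo G X) (lpo H X) (\<phi> X) (\<theta> X) =
     mk_cell (ext C X) (ext C X) (id_prof (ext C X)) (\<lambda>i j p. cmpv (tot D) (lpo F X) i (lpo H X) i (lpo H X) j
      (lidm D (lpo H X) (i, j) p) (comp_trans (tot C) (tot D) (totF C F) (totF C G) (totF C H) (totT C \<phi>) (totT C \<theta>) (vpair X i)))"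
  unfolding lp_paste_def o(2)
 proof (rule mk_cell_cong)
  fix i j p assume i: "i \<in> obj (ext C X)" and j: "j \<in> obj (ext C X)" and "p \<in> omap (id_prof (ext C X)) (i, j)"
  then have p: "p \<in> hom (ext C X) i j" by simp
  note ii = cat_id[OF C.ext_cat[OF X] i]
  have h: "\<theta> X (i, i) (idm (ext C X) i) \<in> homv (tot D) (lpo F X) i (lpo G X) i"
   "\<phi> X (i, i) (idm (ext C X) i) \<in> homv (tot D) (lpo G X) i (lpo H X) i"
   "lidm D (lpo H X) (i, j) p \<in> homv (tot D) (lpo H X) i (lpo H X) j"
   using X i j o lpt_in[OF t X ii] lpt_in[OF u X ii] D.idm_in[OF o(5), of p i j] p by simp_all
  have "lapp D (lpo F X) (lpo G X) (lpo H X) i i j (\<phi> X (i, j) p) (\<theta> X (i, i) (idm (ext C X) i)) =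
   cmpv (tot D) (lpo F X) i (lpo G X) i (lpo H X) j (\<phi> X (i, j) p) (\<theta> X (i, i) (idm (ext C X) i))"
   using X i j o lpt_in[OF t X ii] lpt_in[OF u X p] by (simp add: tot_cmp)
  then show "lapp D (lpo F X) (lpo G X) (lpo H X) i i j (\<phi> X (i, j) p) (\<theta> X (i, i) (idm (ext C X) i)) =
    cmpv (tot D) (lpo F X) i (lpo H X) i (lpo H X) j
      (lidm D (lpo H X) (i, j) p) (comp_trans (tot C) (tot D) (totF C F) (totF C G) (totF C H) (totT C \<phi>) (totT C \<theta>) (vpair X i))"
   \<comment> \<open>Pulling the image of p out of \<phi> leaves the vertical composite at the
     identity of i.\<close>
   unfolding lpt_expand[OF u X p] cat_assoc[OF D.tot_category h] using X i by simp
 qed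
qed

lemma lp_hcompT:
 assumes t: "lp_trans C D F F' \<theta>" and u: "lp_trans D E G G' \<phi>"
 shows "restrict (\<lambda>X. lp_paste E (lpo G (lpo F X)) (lpo G (lpo F' X)) (lpo G' (lpo F' X)) (\<phi> (lpo F' X))
       (vcomp (ext C X) (ext C X) (id_prof (ext C X)) (lhom D (lpo F X) (lpo F' X)) (lhom E (lpo G (lpo F X)) (lpo G (lpo F' X)))
        (lpm G (lpo F X) (lpo F' X)) (\<theta> X))) (lobj C) =
  mkT C E (lp_comp_functor C G F) (lp_comp_functor C G' F')
   (hcomp_trans (tot C) (tot E) (totF D G) (totF D G') (totF C F) (totF C F') (totT D \<phi>) (totT C \<theta>))"
 unfolding mkT_def
proof (rule restrict_ext)
 note F = lpt_funcs(1)[OF t] and F' = lpt_funcs(2)[OF t] and G = lpt_funcs(1)[OF u] and G' = lpt_funcs(2)[OF u]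
 interpret E: lpcategory E by unfold_locales (rule lpf_cats[OF G])
 interpret D: lpcategory D by unfold_locales (rule lpf_cats[OF F])
 interpret C: lpcategory C by unfold_locales (rule lpf_cats[OF F])
 fix X assume X: "X \<in> lobj C"
 let ?E = "ext C X" and ?f = "lpo F X" and ?f' = "lpo F' X" and ?g = "lpo G (lpo F X)" and ?g' = "lpo G (lpo F' X)" and ?h' = "lpo G' (lpo F' X)"
 note [simp] = lpf_obj[OF F] lpf_ext[OF F] lpf_obj[OF F'] lpf_ext[OF F'] lpf_obj[OF G] lpf_ext[OF G] lpf_obj[OF G'] lpf_ext[OF G']
 have oX: "lpo F X \<in> lobj D" "lpo F' X \<in> lobj D" "lpo G' ?f' \<in> lobj E" "ext E (lpo G ?f) = ?E" using X by simp_all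
 let ?v = "vcomp ?E ?E (id_prof ?E) (lhom D ?f ?f') (lhom E (lpo G ?f) (lpo G ?f'))
        (lpm G ?f ?f') (\<theta> X)"
 show "lp_paste E (lpo G ?f) (lpo G ?f') (lpo G' ?f') (\<phi> ?f') ?v =
     mk_cell ?E ?E (id_prof ?E) (\<lambda>i j p. cmp (tot E) (vpair (lpo (lp_comp_functor C G F) X) i)
      (vpair (lpo (lp_comp_functor C G' F') X) i) (vpair (lpo (lp_comp_functor C G' F') X) j)
      (lidm E (lpo (lp_comp_functor C G' F') X) (i, j) p)
      (hcomp_trans (tot C) (tot E) (totF D G) (totF D G') (totF C F) (totF C F') (totT D \<phi>) (totT C \<theta>) (vpair X i)))"
  unfolding lp_paste_def oX(4)
 proof (rule mk_cell_cong)
  fix i j p assume i: "i \<in> obj ?E" and j: "j \<in> obj ?E" and "p \<in> omap (id_prof ?E) (i, j)"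
  then have p: "p \<in> hom ?E i j" by simp
  note ii = cat_id[OF C.ext_cat[OF X] i]
  have p': "p \<in> hom (ext D ?f') i j" and ii': "idm ?E i \<in> hom (ext D ?f') i i" using p X ii by simp_all
  have th: "\<theta> X (i, i) (idm ?E i) \<in> omap (lhom D ?f ?f') (i, i)" by (rule lpt_in[OF t X ii])
  have Gcell: "two_cell ?E ?E (lhom D ?f ?f') (lhom E (lpo G ?f) (lpo G ?f')) (lpm G ?f ?f')"
   using lpf_cell[OF G oX(1,2)] X by simp
  have v: "?v (i, i) (idm ?E i) = lpm G ?f ?f' (i, i) (\<theta> X (i, i) (idm ?E i))"
   using i ii by (simp add: vcomp_simp[OF lpt_cell[OF t X] Gcell])
  have h: "lpm G ?f ?f' (i, i) (\<theta> X (i, i) (idm ?E i)) \<in> homv (tot E) (lpo G ?f) i (lpo G ?f') i"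
   "\<phi> ?f' (i, i) (idm ?E i) \<in> homv (tot E) (lpo G ?f') i (lpo G' ?f') i"
   "lidm E (lpo G' ?f') (i, j) p \<in> homv (tot E) (lpo G' ?f') i (lpo G' ?f') j"
   using X i j lpf_in[OF G oX(1,2) _ _ th] lpt_in[OF u oX(2) ii'] E.idm_in[OF oX(3), of p i j] p by simp_all
  have "lapp E (lpo G ?f) (lpo G ?f') (lpo G' ?f') i i j (\<phi> ?f' (i, j) p) (?v (i, i) (idm ?E i)) =
   cmpv (tot E) (lpo G ?f) i (lpo G ?f') i (lpo G' ?f') j
    (\<phi> ?f' (i, j) p) (lpm G ?f ?f' (i, i) (\<theta> X (i, i) (idm ?E i)))"
   unfolding v using X i j h lpt_in[OF u oX(2) p'] by (simp add: tot_cmp)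
  moreover have "\<phi> ?f' (i, j) p = cmpv (tot E) (lpo G ?f') i (lpo G' ?f') i (lpo G' ?f') j
    (lidm E (lpo G' ?f') (i, j) p) (\<phi> ?f' (i, i) (idm ?E i))"
   using lpt_expand[OF u oX(2) p'] X by simp
  ultimately show "lapp E (lpo G ?f) (lpo G ?f') (lpo G' ?f') i i j (\<phi> ?f' (i, j) p) (?v (i, i) (idm ?E i)) =
    cmp (tot E) (vpair (lpo (lp_comp_functor C G F) X) i)
      (vpair (lpo (lp_comp_functor C G' F') X) i) (vpair (lpo (lp_comp_functor C G' F') X) j)
      (lidm E (lpo (lp_comp_functor C G' F') X) (i, j) p)
      (hcomp_trans (tot C) (tot E) (totF D G) (totF D G') (totF C F) (totF C F') (totT D \<phi>) (totT C \<theta>) (vpair X i))"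
   using X i th by (simp add: cat_assoc[OF E.tot_category h])
 qed
qed

lemma lp_id_trans:
 assumes F: "lp_functor C D F"
 shows "lp_trans C D F F (idm (lp_hom_cat C D) F)"
  and "totT C (idm (lp_hom_cat C D) F) = id_trans (tot C) (tot D) (totF C F)"
 using mkT_trans[OF F F id_nat[OF totF_functor[OF F]]] F by (simp_all add: lp_idT[OF F])

lemma lp_cmp_trans:
 assumes t: "lp_trans C D F G \<theta>" and u: "lp_trans C D G H \<phi>"
 shows "lp_trans C D F H (cmp (lp_hom_cat C D) F G H \<phi> \<theta>)"
  and "totT C (cmp (lp_hom_cat C D) F G H \<phi> \<theta>) = comp_trans (tot C) (tot D) (totF C F) (totF C G) (totF C H) (totT C \<phi>) (totT C \<theta>)"
 using mkT_trans[OF lpt_funcs(1)[OF t] lpt_funcs(2)[OF u] comp_nat[OF totT_nat[OF t] totT_nat[OF u]]] t u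
 by (simp_all add: lp_pasteT[OF t u])

text \<open>Each axiom is reflected from the functor category, since \<open>totT\<close> is
  injective and respects identities and composites.\<close>

lemma lp_hom_category: "category (lp_hom_cat C D)"
proof -
 have "category (mk_cat {F. lp_functor C D F} (\<lambda>F G. {\<theta>. lp_trans C D F G \<theta>}) (idm (lp_hom_cat C D)) (cmp (lp_hom_cat C D)))"
 proof (rule categoryI, goal_cases)
  case (3 F G \<alpha>)
  then have F: "lp_functor C D F" and t: "lp_trans C D F G \<alpha>" by simp_all
  show ?case by (rule totT_inj[OF lp_cmp_trans(1)[OF lp_id_trans(1)[OF F] t] t])
   (use cat_id_right[OF fun_cat_category, of "totT C \<alpha>" "tot C" "tot D" "totF C F" "totF C G"] totT_nat[OF t] in
    \<open>simp add: lp_cmp_trans(2)[OF lp_id_trans(1)[OF F] t] lp_id_trans(2)[OF F] totF_functor[OF F] id_nat del: lp_hom_simps\<close>)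
 next
  case (4 F G \<alpha>)
  then have G: "lp_functor C D G" and t: "lp_trans C D F G \<alpha>" by simp_all
  show ?case by (rule totT_inj[OF lp_cmp_trans(1)[OF t lp_id_trans(1)[OF G]] t])
   (use cat_id_left[OF fun_cat_category, of "totT C \<alpha>" "tot C" "tot D" "totF C F" "totF C G"] totT_nat[OF t] in
    \<open>simp add: lp_cmp_trans(2)[OF t lp_id_trans(1)[OF G]] lp_id_trans(2)[OF G] totF_functor[OF G] id_nat del: lp_hom_simps\<close>)
 next
  case (5 F G H K \<gamma> \<beta> \<alpha>)
  then have a: "lp_trans C D F G \<alpha>" and b: "lp_trans C D G H \<beta>" and c: "lp_trans C D H K \<gamma>" by simp_all
  note ab = lp_cmp_trans[OF a b] and bc = lp_cmp_trans[OF b c]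
  show ?case by (rule totT_inj[OF lp_cmp_trans(1)[OF a bc(1)] lp_cmp_trans(1)[OF ab(1) c]])
   (use cat_assoc[OF fun_cat_category, of "totT C \<alpha>" "tot C" "tot D" "totF C F" "totF C G" "totT C \<beta>" "totF C H" "totT C \<gamma>" "totF C K"]
    totT_nat[OF a] totT_nat[OF b] totT_nat[OF c] in
    \<open>simp add: lp_cmp_trans(2)[OF a bc(1)] lp_cmp_trans(2)[OF ab(1) c] ab(2) bc(2) comp_nat del: lp_hom_simps\<close>)
 qed (simp_all only: mem_Collect_eq lp_id_trans(1) lp_cmp_trans(1))
 moreover have "mk_cat {F. lp_functor C D F} (\<lambda>F G. {\<theta>. lp_trans C D F G \<theta>}) (idm (lp_hom_cat C D)) (cmp (lp_hom_cat C D)) = lp_hom_cat C D"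
  unfolding lp_hom_cat_def mk_cat_def by (auto simp: restrict_def fun_eq_iff)
 ultimately show ?thesis by simp
qed

lemma LexProf_simps [simp]:
 "tobj LexProf_CAT = {C. lp_category C}" "thom LexProf_CAT = lp_hom_cat" "tid LexProf_CAT = lp_id_functor"
 "lp_functor C D F ==> lp_functor D E G ==> omap (tcmp LexProf_CAT C D E) (G, F) = lp_comp_functor C G F"
 by (simp_all add: LexProf_CAT_def)

lemma LexProf_tcmp:
 assumes t: "lp_trans C D F F' \<theta>" and u: "lp_trans D E G G' \<phi>"
 shows "lp_trans C E (lp_comp_functor C G F) (lp_comp_functor C G' F') (mmap (tcmp LexProf_CAT C D E) (G, F) (G', F') (\<phi>, \<theta>))"
  "totT C (mmap (tcmp LexProf_CAT C D E) (G, F) (G', F') (\<phi>, \<theta>)) =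
   hcomp_trans (tot C) (tot E) (totF D G) (totF D G') (totF C F) (totF C F') (totT D \<phi>) (totT C \<theta>)"
proof -
 note f = lpt_funcs[OF t] lpt_funcs[OF u]
 have e: "mmap (tcmp LexProf_CAT C D E) (G, F) (G', F') (\<phi>, \<theta>) = mkT C E (lp_comp_functor C G F) (lp_comp_functor C G' F')
   (hcomp_trans (tot C) (tot E) (totF D G) (totF D G') (totF C F) (totF C F') (totT D \<phi>) (totT C \<theta>))"
  using t u f by (simp add: LexProf_CAT_def lp_hom_category lp_hcompT[OF t u])
 have n: "nat_trans (tot C) (tot E) (totF C (lp_comp_functor C G F)) (totF C (lp_comp_functor C G' F'))
   (hcomp_trans (tot C) (tot E) (totF D G) (totF D G') (totF C F) (totF C F') (totT D \<phi>) (totT C \<theta>))"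
  using hcomp_nat[OF totT_nat[OF t] totT_nat[OF u]] by (simp add: totF_comp[OF f(1,3)] totF_comp[OF f(2,4)])
 note m = mkT_trans[OF lp_comp[OF f(1,3)] lp_comp[OF f(2,4)] n]
 show "lp_trans C E (lp_comp_functor C G F) (lp_comp_functor C G' F') (mmap (tcmp LexProf_CAT C D E) (G, F) (G', F') (\<phi>, \<theta>))"
  "totT C (mmap (tcmp LexProf_CAT C D E) (G, F) (G', F') (\<phi>, \<theta>)) =
   hcomp_trans (tot C) (tot E) (totF D G) (totF D G') (totF C F) (totF C F') (totT D \<phi>) (totT C \<theta>)"
  unfolding e by (rule m)+
qed

lemma two_category_LexProf: "two_category LexProf_CAT"
proof (rule two_category_embed[OF two_category_CAT, where P = tot and F = totF and T = totT], goal_cases)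
 case (1 A) then show ?case by (simp add: lpcategory.tot_category lpcategory.intro)
next
 case 2 show ?case unfolding LexProf_simps by (rule lp_hom_category)
next
 case 4 then show ?case by (auto intro: totF_inj)
next
 case 6 then show ?case by (auto intro: totT_inj)
next
 case (7 A B f) then show ?case using lp_id_trans[of A B f] by (simp add: totF_functor)
next
 case (8 A B f g h \<beta> \<alpha>)
 then show ?case using lp_cmp_trans[of A B f g \<alpha> h \<beta>] totT_nat[of A B f g \<alpha>] totT_nat[of A B g h \<beta>] by simp
next
 case (9 A) then show ?case by (simp add: lp_id totF_id)
next
 case 10 then show ?case by (simp add: LexProf_CAT_def)
next
 case (11 A B C f g)
 then show ?case by (simp add: lp_comp totF_comp totF_functor CAT_simps(4)[OF totF_functor totF_functor])
next
 case (12 A B C f f' g g' \<alpha> \<beta>)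
 then have a: "lp_trans A B f f' \<alpha>" and b: "lp_trans B C g g' \<beta>" by simp_all
 show ?case using LexProf_tcmp[OF a b] CAT_tcmp_simps[OF totT_nat[OF a] totT_nat[OF b]] lpt_funcs[OF a] lpt_funcs[OF b] by simp
qed (auto intro: totF_functor totT_nat)

section \<open>Natural isomorphisms and their lifts to LexProf-transformations\<close>

lemma nat_iso_inverse:
 assumes "naturally_isomorphic A B F G"
 shows "\<exists>\<alpha> \<beta>. nat_trans A B F G \<alpha> & nat_trans A B G F \<beta> &
  (\<forall>a\<in>obj A. cmp B (omap F a) (omap G a) (omap F a) (\<beta> a) (\<alpha> a) = idm B (omap F a) &
   cmp B (omap G a) (omap F a) (omap G a) (\<alpha> a) (\<beta> a) = idm B (omap G a))"
proof -
 obtain \<alpha> where n: "nat_trans A B F G \<alpha>" and i: "!!a. a \<in> obj A ==> is_iso B (omap F a) (omap G a) (\<alpha> a)"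
  using assms unfolding naturally_isomorphic_def by blast
 note F = nat_functors(1)[OF n] and G = nat_functors(2)[OF n]
 note B = functor_cats(2)[OF F]
 have "\<exists>\<beta>. a \<in> obj A \<longrightarrow> \<beta> \<in> hom B (omap G a) (omap F a) & cmp B (omap F a) (omap G a) (omap F a) \<beta> (\<alpha> a) = idm B (omap F a) &
   cmp B (omap G a) (omap F a) (omap G a) (\<alpha> a) \<beta> = idm B (omap G a)" for a
  using i[of a] unfolding is_iso_def by blast
 then obtain \<beta> where b: "!!a. a \<in> obj A ==> \<beta> a \<in> hom B (omap G a) (omap F a)"
  "!!a. a \<in> obj A ==> cmp B (omap F a) (omap G a) (omap F a) (\<beta> a) (\<alpha> a) = idm B (omap F a)"
  "!!a. a \<in> obj A ==> cmp B (omap G a) (omap F a) (omap G a) (\<alpha> a) (\<beta> a) = idm B (omap G a)" by metis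
 have "nat_trans A B G F (restrict \<beta> (obj A))"
 proof (rule natI[OF G F b(1)])
  fix a a' f assume a: "a \<in> obj A" "a' \<in> obj A" and f: "f \<in> hom A a a'"
  note Ff = functor_hom[OF F f] and Gf = functor_hom[OF G f] and h = nat_hom[OF n a(1)] nat_hom[OF n a(2)]
  note Fb = cat_cmp[OF B Ff b(1)[OF a(1)]]
  have "cmp B (omap G a) (omap G a') (omap F a') (\<beta> a') (mmap G a a' f) =
   cmp B (omap G a) (omap G a') (omap F a') (\<beta> a') (cmp B (omap G a) (omap G a) (omap G a') (mmap G a a' f) (cmp B (omap G a) (omap F a) (omap G a) (\<alpha> a) (\<beta> a)))"
   using b(3)[OF a(1)] cat_id_right[OF B Gf] by simp
  also have "\<dots> = cmp B (omap G a) (omap G a') (omap F a') (\<beta> a') (cmp B (omap G a) (omap F a') (omap G a') (\<alpha> a') (cmp B (omap G a) (omap F a) (omap F a') (mmap F a a' f) (\<beta> a)))"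
   unfolding cat_assoc[OF B b(1)[OF a(1)] h(1) Gf, symmetric] nat_nat[OF n f, symmetric] cat_assoc[OF B b(1)[OF a(1)] Ff h(2)] ..
  also have "\<dots> = cmp B (omap G a) (omap F a) (omap F a') (mmap F a a' f) (\<beta> a)"
   unfolding cat_assoc[OF B Fb h(2) b(1)[OF a(2)], symmetric] b(2)[OF a(2)] by (rule cat_id_left[OF B Fb])
  finally show "cmp B (omap G a) (omap G a') (omap F a') (\<beta> a') (mmap G a a' f) = cmp B (omap G a) (omap F a) (omap F a') (mmap F a a' f) (\<beta> a)" .
 qed
 then show ?thesis using n b by (intro exI[of _ \<alpha>] exI[of _ "restrict \<beta> (obj A)"]) simp
qed

lemma nat_isoI:
 assumes "nat_trans A B F G \<alpha>" "nat_trans A B G F \<beta>"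
  and "!!a. a \<in> obj A ==> cmp B (omap F a) (omap G a) (omap F a) (\<beta> a) (\<alpha> a) = idm B (omap F a)"
  and "!!a. a \<in> obj A ==> cmp B (omap G a) (omap F a) (omap G a) (\<alpha> a) (\<beta> a) = idm B (omap G a)"
 shows "naturally_isomorphic A B F G"
 unfolding naturally_isomorphic_def is_iso_def
 using assms nat_hom[OF assms(1)] nat_hom[OF assms(2)] functor_obj[OF nat_functors(1)[OF assms(1)]] functor_obj[OF nat_functors(2)[OF assms(1)]]
 by blast

lemma nat_iso_sym: "naturally_isomorphic A B F G ==> naturally_isomorphic A B G F"
 by (drule nat_iso_inverse) (auto intro: nat_isoI)

text \<open>An inverse pair on total categories lifts by \<open>mkT\<close>; the inverse laws are
  checked after the injective \<open>totT\<close>.\<close>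

lemma lp_iso:
 assumes F: "lp_functor C D F" and G: "lp_functor C D G" and n: "naturally_isomorphic (tot C) (tot D) (totF C F) (totF C G)"
 shows "\<exists>\<theta>. is_iso (lp_hom_cat C D) F G \<theta>"
proof -
 obtain \<alpha> \<beta> where a: "nat_trans (tot C) (tot D) (totF C F) (totF C G) \<alpha>" and b: "nat_trans (tot C) (tot D) (totF C G) (totF C F) \<beta>"
  and inv: "\<forall>p\<in>obj (tot C). cmp (tot D) (omap (totF C F) p) (omap (totF C G) p) (omap (totF C F) p) (\<beta> p) (\<alpha> p) = idm (tot D) (omap (totF C F) p) &
   cmp (tot D) (omap (totF C G) p) (omap (totF C F) p) (omap (totF C G) p) (\<alpha> p) (\<beta> p) = idm (tot D) (omap (totF C G) p)"
  using nat_iso_inverse[OF n] by blast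
 note ma = mkT_trans[OF F G a] and mb = mkT_trans[OF G F b]
 have "cmp (lp_hom_cat C D) F G F (mkT C D G F \<beta>) (mkT C D F G \<alpha>) = idm (lp_hom_cat C D) F"
  by (rule totT_inj[OF lp_cmp_trans(1)[OF ma(1) mb(1)] lp_id_trans(1)[OF F]])
   (simp only: lp_cmp_trans(2)[OF ma(1) mb(1)] lp_id_trans(2)[OF F] ma(2) mb(2),
    rule nat_eqI[OF comp_nat[OF a b] id_nat[OF totF_functor[OF F]]], simp_all add: inv)
 moreover have "cmp (lp_hom_cat C D) G F G (mkT C D F G \<alpha>) (mkT C D G F \<beta>) = idm (lp_hom_cat C D) G"
  by (rule totT_inj[OF lp_cmp_trans(1)[OF mb(1) ma(1)] lp_id_trans(1)[OF G]])
   (simp only: lp_cmp_trans(2)[OF mb(1) ma(1)] lp_id_trans(2)[OF G] ma(2) mb(2),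
    rule nat_eqI[OF comp_nat[OF b a] id_nat[OF totF_functor[OF G]]], simp_all add: inv)
 ultimately show ?thesis unfolding is_iso_def using F G ma mb by (intro exI[of _ "mkT C D F G \<alpha>"]) (auto simp del: lp_hom_simps(3,4))
qed

section \<open>Equivalences of categories\<close>

lemma iso_reflect:
 assumes F: "is_functor A B F"
  and full: "!!a b h. a \<in> obj A ==> b \<in> obj A ==> h \<in> hom B (omap F a) (omap F b) ==> \<exists>f\<in>hom A a b. mmap F a b f = h"
  and faithful: "!!a b f g. f \<in> hom A a b ==> g \<in> hom A a b ==> mmap F a b f = mmap F a b g ==> f = g"
  and ab: "a \<in> obj A" "b \<in> obj A" and f: "f \<in> hom A a b" and i: "is_iso B (omap F a) (omap F b) (mmap F a b f)"
 shows "is_iso A a b f"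
proof -
 note A = functor_cats(1)[OF F]
 obtain h where h: "h \<in> hom B (omap F b) (omap F a)" "cmp B (omap F a) (omap F b) (omap F a) h (mmap F a b f) = idm B (omap F a)"
  "cmp B (omap F b) (omap F a) (omap F b) (mmap F a b f) h = idm B (omap F b)" using i by (rule is_isoD)
 obtain g where g: "g \<in> hom A b a" "mmap F b a g = h" using full[OF ab(2,1) h(1)] by blast
 have "cmp A a b a g f = idm A a"
  by (rule faithful[OF cat_cmp[OF A g(1) f] cat_id[OF A ab(1)]]) (simp add: functor_cmp[OF F g(1) f] g h functor_id[OF F ab(1)])
 moreover have "cmp A b a b f g = idm A b"
  by (rule faithful[OF cat_cmp[OF A f g(1)] cat_id[OF A ab(2)]]) (simp add: functor_cmp[OF F f g(1)] g h functor_id[OF F ab(2)])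
 ultimately show ?thesis unfolding is_iso_def using ab f g by blast
qed

text \<open>Objects and isomorphisms over b are chosen, and morphisms are chosen as preimages of
  conjugates; faithfulness makes the chosen preimages functorial.\<close>

lemma equivalenceI:
 assumes F: "is_functor A B F"
  and full: "!!a b h. a \<in> obj A ==> b \<in> obj A ==> h \<in> hom B (omap F a) (omap F b) ==> \<exists>f\<in>hom A a b. mmap F a b f = h"
  and faithful: "!!a b f g. f \<in> hom A a b ==> g \<in> hom A a b ==> mmap F a b f = mmap F a b g ==> f = g"
  and surj: "!!b. b \<in> obj B ==> \<exists>a\<in>obj A. \<exists>e. is_iso B (omap F a) b e"
 shows "is_equivalence A B F"
proof -
 note A = functor_cats(1)[OF F] and B = functor_cats(2)[OF F]
 have "\<exists>a e e'. a \<in> obj A & e \<in> hom B (omap F a) b & e' \<in> hom B b (omap F a) &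
  cmp B (omap F a) b (omap F a) e' e = idm B (omap F a) & cmp B b (omap F a) b e e' = idm B b" if "b \<in> obj B" for b
  using surj[OF that] unfolding is_iso_def by blast
 then obtain P e e' where P: "!!b. b \<in> obj B ==> P b \<in> obj A" and e: "!!b. b \<in> obj B ==> e b \<in> hom B (omap F (P b)) b"
  and e': "!!b. b \<in> obj B ==> e' b \<in> hom B b (omap F (P b))"
  and ee: "!!b. b \<in> obj B ==> cmp B (omap F (P b)) b (omap F (P b)) (e' b) (e b) = idm B (omap F (P b))"
   "!!b. b \<in> obj B ==> cmp B b (omap F (P b)) b (e b) (e' b) = idm B b"
  by metis
 \<comment> \<open>Conjugation of h by the chosen isomorphisms \<open>e\<close>; \<open>Q\<close> is
   a preimage of it under F.\<close>
 define T where "T b c h = cmp B (omap F (P b)) c (omap F (P c)) (e' c) (cmp B (omap F (P b)) b c h (e b))" for b c h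
 define Q where "Q b c h = (SOME f. f \<in> hom A (P b) (P c) & mmap F (P b) (P c) f = T b c h)" for b c h
 have T: "T b c h \<in> hom B (omap F (P b)) (omap F (P c))" if "h \<in> hom B b c" for b c h
  unfolding T_def using that hom_obj[OF B that] by (auto intro!: cat_cmp[OF B] e e')
 have Q: "Q b c h \<in> hom A (P b) (P c)" "mmap F (P b) (P c) (Q b c h) = T b c h" if h: "h \<in> hom B b c" for b c h
 proof -
  have "\<exists>f. f \<in> hom A (P b) (P c) & mmap F (P b) (P c) f = T b c h"
   using full[OF P P T[OF h]] hom_obj[OF B h] by blast
  from someI_ex[OF this] show "Q b c h \<in> hom A (P b) (P c)" "mmap F (P b) (P c) (Q b c h) = T b c h"
   unfolding Q_def by blast+
 qed
 define G where "G = mk_func B P Q"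
 have G: "is_functor B A G" unfolding G_def
 proof (rule functorI[OF B A P])
  fix b assume b: "b \<in> obj B"
  note i = cat_id[OF B b]
  show "Q b b (idm B b) = idm A (P b)"
   by (rule faithful[OF Q(1)[OF i] cat_id[OF A P[OF b]]])
    (simp add: Q(2)[OF i] functor_id[OF F P[OF b]] T_def cat_id_left[OF B e[OF b]] ee[OF b])
 next
  fix b c d k h assume o: "b \<in> obj B" "c \<in> obj B" "d \<in> obj B" and k: "k \<in> hom B c d" and h: "h \<in> hom B b c"
  note kh = cat_cmp[OF B k h]
  note x = cat_cmp[OF B h e[OF o(1)]] and y = cat_cmp[OF B k e[OF o(2)]]
  have "cmp B c (omap F (P c)) d (cmp B (omap F (P c)) c d k (e c)) (e' c) = k"
   by (simp add: cat_assoc[OF B e'[OF o(2)] e[OF o(2)] k] ee[OF o(2)] cat_id_right[OF B k])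
  then have "T b d (cmp B b c d k h) = cmp B (omap F (P b)) (omap F (P c)) (omap F (P d)) (T c d k) (T b c h)"
   unfolding T_def cat_assoc[OF B cat_cmp[OF B e'[OF o(2)] x] y e'[OF o(3)]] cat_assoc[OF B x e'[OF o(2)] y, symmetric]
   by (simp add: cat_assoc[OF B e[OF o(1)] h k])
  then show "Q b d (cmp B b c d k h) = cmp A (P b) (P c) (P d) (Q c d k) (Q b c h)"
   by (intro faithful[OF Q(1)[OF kh] cat_cmp[OF A Q(1)[OF k] Q(1)[OF h]]])
    (simp add: Q(2)[OF kh] functor_cmp[OF F Q(1)[OF k] Q(1)[OF h]] Q(2)[OF k] Q(2)[OF h])
 qed (auto intro: Q(1))
 have Gs: "!!b. b \<in> obj B ==> omap G b = P b" "!!b c h. h \<in> hom B b c ==> mmap G b c h = Q b c h"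
  using hom_obj[OF B] unfolding G_def by auto
 have nat: "cmp B (omap F (P b)) (omap F (P c)) c (e c) (T b c h) = cmp B (omap F (P b)) b c h (e b)" if h: "h \<in> hom B b c" for b c h
 proof -
  have o: "b \<in> obj B" "c \<in> obj B" using hom_obj[OF B h] by auto
  note he = cat_cmp[OF B h e[OF o(1)]]
  show ?thesis unfolding T_def by (simp add: cat_assoc[OF B he e'[OF o(2)] e[OF o(2)], symmetric] ee[OF o(2)] cat_id_left[OF B he])
 qed
 have iso_e: "is_iso B (omap F (P b)) b (e b)" if "b \<in> obj B" for b
  unfolding is_iso_def using that e e' ee functor_obj[OF F P] by blast
 have "nat_trans B B (comp_func B F G) (id_func B) (restrict e (obj B))"
  by (rule natI[OF comp_functor[OF G F] id_functor[OF B]]) (simp_all add: Gs e Q(2) nat)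
 then have 1: "naturally_isomorphic B B (comp_func B F G) (id_func B)"
  unfolding naturally_isomorphic_def using iso_e Gs by (intro exI[of _ "restrict e (obj B)"]) auto
 \<comment> \<open>The comparison from the inverse applied to F a back to a: a preimage of
   \<open>e (omap F a)\<close>, invertible because a fully faithful functor reflects
   isomorphisms.\<close>
 define u where "u a = (SOME f. f \<in> hom A (P (omap F a)) a & mmap F (P (omap F a)) a f = e (omap F a))" for a
 have u: "u a \<in> hom A (P (omap F a)) a" "mmap F (P (omap F a)) a (u a) = e (omap F a)" if a: "a \<in> obj A" for a
 proof -
  note Fa = functor_obj[OF F a]
  have "\<exists>f. f \<in> hom A (P (omap F a)) a & mmap F (P (omap F a)) a f = e (omap F a)"
   using full[OF P[OF Fa] a e[OF Fa]] by blast
  from someI_ex[OF this] show "u a \<in> hom A (P (omap F a)) a" "mmap F (P (omap F a)) a (u a) = e (omap F a)" unfolding u_def by blast+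
 qed
 have "nat_trans A A (comp_func A G F) (id_func A) (restrict u (obj A))"
 proof (rule natI[OF comp_functor[OF F G] id_functor[OF A]])
  fix a b f assume o: "a \<in> obj A" "b \<in> obj A" and f: "f \<in> hom A a b"
  note Ff = functor_hom[OF F f]
  have "cmp A (P (omap F a)) (P (omap F b)) b (u b) (Q (omap F a) (omap F b) (mmap F a b f)) = cmp A (P (omap F a)) a b f (u a)"
   by (rule faithful[OF cat_cmp[OF A u(1)[OF o(2)] Q(1)[OF Ff]] cat_cmp[OF A f u(1)[OF o(1)]]])
    (simp add: functor_cmp[OF F u(1)[OF o(2)] Q(1)[OF Ff]] functor_cmp[OF F f u(1)[OF o(1)]] u o Q(2)[OF Ff] nat[OF Ff])
  then show "cmp A (omap (comp_func A G F) a) (omap (comp_func A G F) b) (omap (id_func A) b) (u b) (mmap (comp_func A G F) a b f) =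
     cmp A (omap (comp_func A G F) a) (omap (id_func A) a) (omap (id_func A) b) (mmap (id_func A) a b f) (u a)"
   using o f Ff by (simp add: Gs functor_obj[OF F])
 qed (simp add: Gs functor_obj[OF F] u)
 moreover have "is_iso A (P (omap F a)) a (u a)" if a: "a \<in> obj A" for a
  by (rule iso_reflect[OF F full faithful]) (use a u[OF a] iso_e functor_obj[OF F a] P in auto)
 ultimately have "naturally_isomorphic A A (comp_func A G F) (id_func A)"
  unfolding naturally_isomorphic_def using Gs functor_obj[OF F] by (intro exI[of _ "restrict u (obj A)"]) auto
 then show ?thesis unfolding is_equivalence_def using F G 1 by blast
qed

section \<open>The 2-functor \<open>\<Gamma>\<close>\<close>

lemma hom_prof_act_left:
 assumes X: "is_functor A K X" and Y: "is_functor B K Y"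
  and f: "f \<in> hom A a' a" and b: "b \<in> obj B" and h: "h \<in> hom K (omap X a) (omap Y b)"
 shows "lact B (hom_prof A B K X Y) b a a' f h = cmp K (omap X a') (omap X a) (omap Y b) h (mmap X a' a f)"
 using f b h functor_cats[OF X] functor_cats[OF Y] cat_cmp[of K h "omap X a" "omap Y b" "mmap X a' a f" "omap X a'"] functor_hom[OF X f]
 by (simp add: cat_id functor_id[OF Y] cat_id_left)

lemma hom_prof_act_right:
 assumes X: "is_functor A K X" and Y: "is_functor B K Y"
  and a: "a \<in> obj A" and g: "g \<in> hom B b b'" and h: "h \<in> hom K (omap X a) (omap Y b)"
 shows "ract A (hom_prof A B K X Y) a b b' g h = cmp K (omap X a) (omap Y b) (omap Y b') (mmap Y b b' g) h"
 using a g h functor_cats[OF X] functor_cats[OF Y] by (simp add: cat_id functor_id[OF X] cat_id_right)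

locale parflcat =
 fixes C :: "'v::universe parfl"
 assumes pl: "partially_lex_cat C"
begin

abbreviation "K \<equiv> ucat C"
abbreviation "S \<equiv> code ` sieve C"
abbreviation "dm \<equiv> gdom C"
abbreviation "fn \<equiv> gfun C"
abbreviation "HP x y \<equiv> hom_prof (dm x) (dm y) K (fn x) (fn y)"

lemma cat_K: "category K" and small_K: "locally_small K" and sieve_K: "left_exact_sieve K (sieve C)"
 using pl unfolding partially_lex_cat_def by blast+

lemma sieve_lex: "(A, X) \<in> sieve C ==> small_lex_cat A" "(A, X) \<in> sieve C ==> lex_functor A K X"
 using sieve_K unfolding left_exact_sieve_def by blast+

lemma sieve_comp: "(B, X) \<in> sieve C ==> small_lex_cat A ==> lex_functor A B G ==> (A, comp_func A X G) \<in> sieve C"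
 using sieve_K unfolding left_exact_sieve_def by blast

lemma sieve_iso: "(A, X) \<in> sieve C ==> naturally_isomorphic A K X Y ==> (A, Y) \<in> sieve C"
 using sieve_K unfolding left_exact_sieve_def by blast

lemma sieve_cover: "c \<in> obj K ==> \<exists>A X a. (A, X) \<in> sieve C & a \<in> obj A & omap X a = c"
 using sieve_K unfolding left_exact_sieve_def by blast

lemma decode_code: "s \<in> sieve C ==> decode C (code s) = s"
 unfolding decode_def by (rule inv_into_f_f[OF code_inj_on_sieve[OF pl]])

lemma code_simps [simp]: "(A, X) \<in> sieve C ==> gdom C (code (A, X)) = A" "(A, X) \<in> sieve C ==> gfun C (code (A, X)) = X"
 by (simp_all add: decode_code)

lemma dom_fn: "x \<in> S ==> (dm x, fn x) \<in> sieve C"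
 by (auto simp: decode_code)

lemma dom_lex: "x \<in> S ==> small_lex_cat (dm x)"
 and fn_lex: "x \<in> S ==> lex_functor (dm x) K (fn x)"
 and fn_functor: "x \<in> S ==> is_functor (dm x) K (fn x)"
 using sieve_lex[OF dom_fn] lex_functorD by blast+

lemma dom_cat: "x \<in> S ==> category (dm x)"
 by (rule small_lex_catD(1)[OF dom_lex])

lemma code_dom_fn: "x \<in> S ==> code (dm x, fn x) = x"
 by (auto simp: decode_code)

lemma Gamma_hom_eq: "Gamma_hom C x y = HP x y"
 by (simp add: Gamma_hom_def hom_prof_def mk_prof_def Let_def)

lemma Gamma_obj_simps [simp]:
 "lobj (Gamma_obj C) = S"
 "x \<in> S ==> ext (Gamma_obj C) x = dm x"
 "x \<in> S ==> y \<in> S ==> lhom (Gamma_obj C) x y = HP x y"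
 "x \<in> S ==> y \<in> S ==> z \<in> S ==> lcmp (Gamma_obj C) x y z = Gamma_cmp C x y z"
 unfolding Gamma_obj_def Let_def by (simp_all add: Gamma_hom_eq)

lemma Gamma_lex: "x \<in> S ==> y \<in> S ==> lex_prof (dm x) (dm y) (HP x y)"
 by (intro hom_prof_lex fn_functor fn_lex small_K dom_lex)

text \<open>Composition in the underlying category is dinatural in the middle variable by
  associativity, so it descends to the coend.\<close>

lemma Gamma_cmp_cell:
 assumes x: "x \<in> S" and y: "y \<in> S" and z: "z \<in> S"
 shows "two_cell (dm x) (dm z) (tensor (dm x) (dm y) (dm z) (HP y z) (HP x y))
   (HP x z) (Gamma_cmp C x y z)"
  and "!!i j k g f. i \<in> obj (dm x) ==> j \<in> obj (dm y) ==> k \<in> obj (dm z) ==> g \<in> hom K (omap (fn y) j) (omap (fn z) k) ==>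
   f \<in> hom K (omap (fn x) i) (omap (fn y) j) ==>
   Gamma_cmp C x y z (i, k) (coend_class (dm x) (dm y) (dm z) (HP y z) (HP x y) i k (j, g, f))
    = cmp K (omap (fn x) i) (omap (fn y) j) (omap (fn z) k) g f"
proof -
 interpret composable "dm x" "dm y" "dm z" "HP y z" "HP x y"
  by (intro composable_lex Gamma_lex x y z)
 note fx = fn_functor[OF x] and fy = fn_functor[OF y] and fz = fn_functor[OF z]
 note * = tensor_cellI[of "HP x z" "\<lambda>i j k. cmp K (omap (fn x) i) (omap (fn y) j) (omap (fn z) k)"]
 have 1: "is_prof (dm x) (dm z) (HP x z)" by (rule lex_profD(3)[OF Gamma_lex[OF x z]])
 have 2: "cmp K (omap (fn x) a) (omap (fn y) b) (omap (fn z) c) n m \<in> omap (HP x z) (a, c)"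
  if "a \<in> obj (dm x)" "b \<in> obj (dm y)" "c \<in> obj (dm z)" "n \<in> omap (HP y z) (b, c)"
   "m \<in> omap (HP x y) (a, b)" for a b c n m
  using that by (auto intro: cat_cmp[OF cat_K])
 have 3: "cmp K (omap (fn x) a) (omap (fn y) b) (omap (fn z) c) (lact (dm z) (HP y z) c b' b g n) m =
   cmp K (omap (fn x) a) (omap (fn y) b') (omap (fn z) c) n (ract (dm x) (HP x y) a b b' g m)"
  if h: "a \<in> obj (dm x)" "c \<in> obj (dm z)" "g \<in> hom (dm y) b b'" "n \<in> omap (HP y z) (b', c)"
   "m \<in> omap (HP x y) (a, b)" for a b b' c g n m
 proof -
  have o: "b \<in> obj (dm y)" "b' \<in> obj (dm y)" using hom_obj[OF dom_cat[OF y] h(3)] by auto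
  have nm: "n \<in> hom K (omap (fn y) b') (omap (fn z) c)" "m \<in> hom K (omap (fn x) a) (omap (fn y) b)" using h o by simp_all
  show ?thesis
   by (simp add: hom_prof_act_left[OF fy fz h(3,2) nm(1)] hom_prof_act_right[OF fx fy h(1,3) nm(2)] cat_assoc[OF cat_K nm(2) functor_hom[OF fy h(3)] nm(1)])
 qed
 have 4: "cmp K (omap (fn x) a') (omap (fn y) b) (omap (fn z) c') (ract (dm y) (HP y z) b c c' g n)
   (lact (dm y) (HP x y) b a a' f m) =
   mmap (HP x z) (a, c) (a', c') (f, g) (cmp K (omap (fn x) a) (omap (fn y) b) (omap (fn z) c) n m)"
  if h: "f \<in> hom (dm x) a' a" "g \<in> hom (dm z) c c'" "b \<in> obj (dm y)" "n \<in> omap (HP y z) (b, c)"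
   "m \<in> omap (HP x y) (a, b)" for a a' b c c' f g n m
 proof -
  have o: "a \<in> obj (dm x)" "a' \<in> obj (dm x)" "c \<in> obj (dm z)" "c' \<in> obj (dm z)" using hom_obj[OF dom_cat[OF x] h(1)] hom_obj[OF dom_cat[OF z] h(2)] by auto
  have nm: "n \<in> hom K (omap (fn y) b) (omap (fn z) c)" "m \<in> hom K (omap (fn x) a) (omap (fn y) b)" using h o by simp_all
  note F = functor_hom[OF fx h(1)] and G = functor_hom[OF fz h(2)]
  note mF = cat_cmp[OF cat_K nm(2) F]
  show ?thesis
   using hom_prof_simps(2)[OF dom_cat[OF x] dom_cat[OF z] h(1,2) cat_cmp[OF cat_K nm]]
   by (simp add: hom_prof_act_left[OF fx fy h(1,3) nm(2)] hom_prof_act_right[OF fy fz h(3,2) nm(1)] cat_assoc[OF cat_K mF nm(1) G] cat_assoc[OF cat_K F nm(2,1)])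
 qed
 note r = *[OF 1 2 3 4]
 show "two_cell (dm x) (dm z) NM (HP x z) (Gamma_cmp C x y z)"
  unfolding Gamma_cmp_def Gamma_hom_eq by (rule r(1))
 show "Gamma_cmp C x y z (i, k) (cls i k (j, g, f)) = cmp K (omap (fn x) i) (omap (fn y) j) (omap (fn z) k) g f"
  if "i \<in> obj (dm x)" "j \<in> obj (dm y)" "k \<in> obj (dm z)" "g \<in> hom K (omap (fn y) j) (omap (fn z) k)"
   "f \<in> hom K (omap (fn x) i) (omap (fn y) j)" for i j k g f
  unfolding Gamma_cmp_def Gamma_hom_eq by (rule r(2)) (use that in auto)
qed

lemma Gamma_lapp [simp]:
 "x \<in> S ==> y \<in> S ==> z \<in> S ==> i \<in> obj (dm x) ==> j \<in> obj (dm y) ==> k \<in> obj (dm z) ==>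
  g \<in> hom K (omap (fn y) j) (omap (fn z) k) ==> f \<in> hom K (omap (fn x) i) (omap (fn y) j) ==>
  lapp (Gamma_obj C) x y z i j k g f = cmp K (omap (fn x) i) (omap (fn y) j) (omap (fn z) k) g f"
 by (simp add: lapp_def Gamma_cmp_cell(2))

lemma Gamma_lidm [simp]: "x \<in> S ==> p \<in> hom (dm x) i j ==> lidm (Gamma_obj C) x (i, j) p = mmap (fn x) i j p"
 using hom_obj[OF dom_cat[of x]] by (simp add: Gamma_obj_def Let_def)

lemma Gamma_lp: "lp_category (Gamma_obj C)"
 unfolding lp_category_def
proof (intro conjI ballI allI impI, goal_cases)
 case (1 x) then show ?case by (simp add: dom_lex)
next
 case (2 x y) then show ?case by (simp add: Gamma_lex)
next
 case (3 x y z) then show ?case by (simp add: Gamma_cmp_cell(1))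
next
 case (4 x)
 then have x: "x \<in> S" by simp
 note f = fn_functor[OF x]
 have "two_cell (dm x) (dm x) (id_prof (dm x)) (HP x x) (mk_cell (dm x) (dm x) (id_prof (dm x)) (mmap (fn x)))"
 proof (rule cellI[OF id_prof_prof[OF dom_lex[OF x]] lex_profD(3)[OF Gamma_lex[OF x x]]])
  fix a b a' b' r q p assume h: "r \<in> hom (dm x) a' a" "q \<in> hom (dm x) b b'" and "p \<in> omap (id_prof (dm x)) (a, b)"
  then have p: "p \<in> hom (dm x) a b" using hom_obj[OF dom_cat[OF x]] h by auto
  note pr = cat_cmp[OF dom_cat[OF x] p h(1)]
  show "mmap (fn x) a' b' (mmap (id_prof (dm x)) (a, b) (a', b') (r, q) p) = mmap (HP x x) (a, b) (a', b') (r, q) (mmap (fn x) a b p)"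
   using h p functor_hom[OF f p] dom_cat[OF x] by (simp add: functor_cmp[OF f h(2) pr] functor_cmp[OF f p h(1)])
 qed (auto intro: functor_hom[OF f])
 then show ?case using x by (simp add: Gamma_obj_def Let_def Gamma_hom_eq)
next
 case (5 X Y Z W i j k l h g f)
 then show ?case by (simp add: cat_cmp[OF cat_K] cat_assoc[OF cat_K])
next
 case (6 x y i' i j p f)
 then have x: "x \<in> S" and y: "y \<in> S" by simp_all
 show ?case using 6 hom_prof_act_left[OF fn_functor[OF x] fn_functor[OF y], of p i' i j f] functor_hom[OF fn_functor[OF x], of p i' i] x y
  by simp
next
 case (7 x y i j j' q f)
 then have x: "x \<in> S" and y: "y \<in> S" by simp_all
 show ?case using 7 hom_prof_act_right[OF fn_functor[OF x] fn_functor[OF y], of i q j j' f] functor_hom[OF fn_functor[OF y], of q j j'] x y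
  by simp
next
 case 8 show ?case by (simp add: Gamma_obj_def Let_def)
next
 case 9 show ?case by (simp add: Gamma_obj_def Let_def)
next
 case (10 X Y) then show ?case by (auto simp: Gamma_obj_def Let_def)
next
 case (11 X Y Z) then show ?case by (auto simp: Gamma_obj_def Let_def)
qed

sublocale G: lpcategory "Gamma_obj C"
 by unfold_locales (rule Gamma_lp)

text \<open>Evaluation identifies the total category of \<open>\<Gamma>(C)\<close> with \<open>C\<close> up to repetition of objects.\<close>

definition ev :: "'v => 'v" where "ev p = omap (fn (vfst p)) (vsnd p)"

lemma ev_vpair [simp]: "ev (vpair x i) = omap (fn x) i"
 by (simp add: ev_def)

lemma ev_obj: "p \<in> obj (tot (Gamma_obj C)) ==> ev p \<in> obj K"
 by (erule tot_objE) (auto intro!: functor_obj[OF fn_functor])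

lemma G_hom: "p \<in> obj (tot (Gamma_obj C)) ==> q \<in> obj (tot (Gamma_obj C)) ==> hom (tot (Gamma_obj C)) p q = hom K (ev p) (ev q)"
 by (erule tot_objE, erule tot_objE) simp

lemma G_cmp: "p \<in> obj (tot (Gamma_obj C)) ==> q \<in> obj (tot (Gamma_obj C)) ==> r \<in> obj (tot (Gamma_obj C)) ==>
  g \<in> hom K (ev q) (ev r) ==> f \<in> hom K (ev p) (ev q) ==> cmp (tot (Gamma_obj C)) p q r g f = cmp K (ev p) (ev q) (ev r) g f"
 by (erule tot_objE, erule tot_objE, erule tot_objE) (simp add: tot_cmp)

lemma G_idm: "p \<in> obj (tot (Gamma_obj C)) ==> idm (tot (Gamma_obj C)) p = idm K (ev p)"
 by (erule tot_objE) (simp add: cat_id dom_cat functor_id[OF fn_functor])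

text \<open>Condition (iii) on sieves; this is why fullness, faithfulness and essential surjectivity
  on hom-categories can be settled on pairs.\<close>

lemma ev_surj: "c \<in> obj K ==> \<exists>p\<in>obj (tot (Gamma_obj C)). ev p = c"
proof -
 assume "c \<in> obj K"
 then obtain A X a where s: "(A, X) \<in> sieve C" "a \<in> obj A" "omap X a = c" using sieve_cover by blast
 then show ?thesis by (intro bexI[of _ "vpair (code (A, X)) a"]) auto
qed

end

section \<open>Gamma on 1-cells\<close>

lemma Gamma_fun_mk:
 assumes C: "partially_lex_cat C"
 shows "Gamma_fun C F = mk_lpfunc (Gamma_obj C) (\<lambda>x. code (gdom C x, comp_func (gdom C x) F (gfun C x)))
   (\<lambda>x y i j. mmap F (omap (gfun C x) i) (omap (gfun C y) j))"
proof -
 interpret parflcat C by unfold_locales (rule C)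
 show ?thesis unfolding Gamma_fun_def mk_lpfunc_def Let_def by (auto simp: Gamma_hom_eq fun_eq_iff)
qed

locale parflfun = C: parflcat C + D: parflcat D for C D :: "'v::universe parfl" +
 fixes F assumes F: "partially_lex_functor C D F"
begin

lemma F_functor: "is_functor (ucat C) (ucat D) F" by (rule parfl_functor[OF F])

lemma F_sieve: "(A, X) \<in> sieve C ==> (A, comp_func A F X) \<in> sieve D"
 using F unfolding partially_lex_functor_def by blast

lemma GF_simps [simp]:
 "x \<in> C.S ==> lpo (Gamma_fun C F) x = code (gdom C x, comp_func (gdom C x) F (gfun C x))"
 "x \<in> C.S ==> y \<in> C.S ==> i \<in> obj (gdom C x) ==> j \<in> obj (gdom C y) ==> f \<in> hom (ucat C) (omap (gfun C x) i) (omap (gfun C y) j) ==>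
  lpm (Gamma_fun C F) x y (i, j) f = mmap F (omap (gfun C x) i) (omap (gfun C y) j) f"
 unfolding Gamma_fun_mk[OF C.pl] by simp_all

lemma GF_in: "x \<in> C.S ==> (gdom C x, comp_func (gdom C x) F (gfun C x)) \<in> sieve D"
 by (rule F_sieve[OF C.dom_fn])

lemma GF_functor: "lp_functor (Gamma_obj C) (Gamma_obj D) (Gamma_fun C F)"
 unfolding Gamma_fun_mk[OF C.pl]
proof (rule mk_lpfunc_functor[OF C.Gamma_lp D.Gamma_lp], goal_cases)
 case (1 X) then show ?case by (auto intro: GF_in)
next
 case (2 X) then show ?case using GF_in[of X] by auto
next
 case (3 X Y i j f) then show ?case using GF_in[of X] GF_in[of Y] by (auto intro: functor_hom[OF F_functor])
next
 case (4 X Y Z i j k g f)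
 then have o: "X \<in> C.S" "Y \<in> C.S" "Z \<in> C.S" and ijk: "i \<in> obj (gdom C X)" "j \<in> obj (gdom C Y)" "k \<in> obj (gdom C Z)"
  and gf: "g \<in> hom (ucat C) (omap (gfun C Y) j) (omap (gfun C Z) k)" "f \<in> hom (ucat C) (omap (gfun C X) i) (omap (gfun C Y) j)" by simp_all
 note s = GF_in[OF o(1)] GF_in[OF o(2)] GF_in[OF o(3)]
 have so: "code (gdom C x, comp_func (gdom C x) F (gfun C x)) \<in> D.S" if "x \<in> C.S" for x using GF_in[OF that] by blast
 show ?case using o ijk gf s so[OF o(1)] so[OF o(2)] so[OF o(3)] functor_hom[OF F_functor gf(1)] functor_hom[OF F_functor gf(2)]
  by (simp add: tot_cmp functor_cmp[OF F_functor gf])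
next
 case (5 X i j p)
 then have o: "X \<in> C.S" and p: "p \<in> hom (gdom C X) i j" by simp_all
 have so: "code (gdom C X, comp_func (gdom C X) F (gfun C X)) \<in> D.S" using GF_in[OF o] by blast
 show ?case using o p so GF_in[OF o] hom_obj[OF C.dom_cat[OF o] p] by simp
qed

text \<open>Seen through evaluation, \<open>totF\<close> of Gamma(F) is F; equations about Gamma
  thereby become equations in the underlying categories.\<close>

lemma GF_ev: "p \<in> obj (tot (Gamma_obj C)) ==> D.ev (omap (totF (Gamma_obj C) (Gamma_fun C F)) p) = omap F (C.ev p)"
 by (erule tot_objE) (simp add: GF_in)

lemma GF_mmap: "p \<in> obj (tot (Gamma_obj C)) ==> q \<in> obj (tot (Gamma_obj C)) ==> f \<in> hom (ucat C) (C.ev p) (C.ev q) ==>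
  mmap (totF (Gamma_obj C) (Gamma_fun C F)) p q f = mmap F (C.ev p) (C.ev q) f"
 by (erule tot_objE, erule tot_objE) simp

lemma GF_obj: "p \<in> obj (tot (Gamma_obj C)) ==> omap (totF (Gamma_obj C) (Gamma_fun C F)) p \<in> obj (tot (Gamma_obj D))"
 by (rule functor_obj[OF totF_functor[OF GF_functor]])

end

section \<open>Gamma on 2-cells\<close>

context
 fixes C D :: "'v::universe parfl" and F G \<alpha>
 assumes C: "partially_lex_cat C" and D: "partially_lex_cat D" and F: "partially_lex_functor C D F" and G: "partially_lex_functor C D G"
  and a: "nat_trans (ucat C) (ucat D) F G \<alpha>"
begin

interpretation FF: parflfun C D F by unfold_locales (rule C D F)+
interpretation GG: parflfun C D G by unfold_locales (rule G)

text \<open>The whiskering of \<alpha> with evaluation; \<open>Gamma_trans\<close> is its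
  transcription by \<open>mkT\<close>.\<close>

lemma Gamma_trans_nat:
 "nat_trans (tot (Gamma_obj C)) (tot (Gamma_obj D)) (totF (Gamma_obj C) (Gamma_fun C F)) (totF (Gamma_obj C) (Gamma_fun C G))
  (restrict (\<lambda>p. \<alpha> (FF.C.ev p)) (obj (tot (Gamma_obj C))))"
proof (rule natI[OF totF_functor[OF FF.GF_functor] totF_functor[OF GG.GF_functor]])
 fix p assume p: "p \<in> obj (tot (Gamma_obj C))"
 show "\<alpha> (FF.C.ev p) \<in> hom (tot (Gamma_obj D)) (omap (totF (Gamma_obj C) (Gamma_fun C F)) p) (omap (totF (Gamma_obj C) (Gamma_fun C G)) p)"
  using nat_hom[OF a FF.C.ev_obj[OF p]] p by (simp add: FF.D.G_hom FF.GF_obj GG.GF_obj FF.GF_ev GG.GF_ev)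
next
 fix p q f assume p: "p \<in> obj (tot (Gamma_obj C))" and q: "q \<in> obj (tot (Gamma_obj C))" and "f \<in> hom (tot (Gamma_obj C)) p q"
 then have f: "f \<in> hom (ucat C) (FF.C.ev p) (FF.C.ev q)" by (simp add: FF.C.G_hom)
 show "cmp (tot (Gamma_obj D)) (omap (totF (Gamma_obj C) (Gamma_fun C F)) p) (omap (totF (Gamma_obj C) (Gamma_fun C F)) q)
   (omap (totF (Gamma_obj C) (Gamma_fun C G)) q) (\<alpha> (FF.C.ev q)) (mmap (totF (Gamma_obj C) (Gamma_fun C F)) p q f) =
  cmp (tot (Gamma_obj D)) (omap (totF (Gamma_obj C) (Gamma_fun C F)) p) (omap (totF (Gamma_obj C) (Gamma_fun C G)) p)
   (omap (totF (Gamma_obj C) (Gamma_fun C G)) q) (mmap (totF (Gamma_obj C) (Gamma_fun C G)) p q f) (\<alpha> (FF.C.ev p))"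
  using p q f nat_nat[OF a f] nat_hom[OF a FF.C.ev_obj[OF p]] nat_hom[OF a FF.C.ev_obj[OF q]] functor_hom[OF FF.F_functor f] functor_hom[OF GG.F_functor f]
  by (simp add: FF.GF_mmap GG.GF_mmap FF.D.G_cmp FF.GF_obj GG.GF_obj FF.GF_ev GG.GF_ev)
qed

lemma Gamma_trans_mkT: "Gamma_trans C D F G \<alpha> = mkT (Gamma_obj C) (Gamma_obj D) (Gamma_fun C F) (Gamma_fun C G)
  (restrict (\<lambda>p. \<alpha> (FF.C.ev p)) (obj (tot (Gamma_obj C))))"
 unfolding Gamma_trans_def mkT_def Let_def FF.C.Gamma_obj_simps(1)
proof (rule restrict_ext)
 fix x assume x: "x \<in> FF.C.S"
 have e: "ext (Gamma_obj C) x = gdom C x" using x by simp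
 show "mk_cell (gdom C x) (gdom C x) (id_prof (gdom C x)) (\<lambda>i j p. cmp (ucat D) (omap F (omap (gfun C x) i)) (omap G (omap (gfun C x) i)) (omap G (omap (gfun C x) j))
       (mmap G (omap (gfun C x) i) (omap (gfun C x) j) (mmap (gfun C x) i j p)) (\<alpha> (omap (gfun C x) i))) =
  mk_cell (ext (Gamma_obj C) x) (ext (Gamma_obj C) x) (id_prof (ext (Gamma_obj C) x)) (\<lambda>i j p. cmp (tot (Gamma_obj D)) (vpair (lpo (Gamma_fun C F) x) i)
   (vpair (lpo (Gamma_fun C G) x) i) (vpair (lpo (Gamma_fun C G) x) j) (lidm (Gamma_obj D) (lpo (Gamma_fun C G) x) (i, j) p)
   (restrict (\<lambda>p. \<alpha> (FF.C.ev p)) (obj (tot (Gamma_obj C))) (vpair x i)))"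
  unfolding e
 proof (rule mk_cell_cong)
  fix i j p assume i: "i \<in> obj (gdom C x)" and j: "j \<in> obj (gdom C x)" and "p \<in> omap (id_prof (gdom C x)) (i, j)"
  then have p: "p \<in> hom (gdom C x) i j" by simp
  have so: "code (gdom C x, comp_func (gdom C x) H (gfun C x)) \<in> FF.D.S" if "(gdom C x, comp_func (gdom C x) H (gfun C x)) \<in> sieve D" for H
   using that by blast
  note s = FF.GF_in[OF x] GG.GF_in[OF x]
  note Xp = functor_hom[OF FF.C.fn_functor[OF x] p]
  show "cmp (ucat D) (omap F (omap (gfun C x) i)) (omap G (omap (gfun C x) i)) (omap G (omap (gfun C x) j))
       (mmap G (omap (gfun C x) i) (omap (gfun C x) j) (mmap (gfun C x) i j p)) (\<alpha> (omap (gfun C x) i)) =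
   cmp (tot (Gamma_obj D)) (vpair (lpo (Gamma_fun C F) x) i)
   (vpair (lpo (Gamma_fun C G) x) i) (vpair (lpo (Gamma_fun C G) x) j) (lidm (Gamma_obj D) (lpo (Gamma_fun C G) x) (i, j) p)
   (restrict (\<lambda>p. \<alpha> (FF.C.ev p)) (obj (tot (Gamma_obj C))) (vpair x i))"
   using x i j p s so[OF s(1)] so[OF s(2)] functor_hom[OF GG.F_functor Xp] nat_hom[OF a functor_obj[OF FF.C.fn_functor[OF x] i]]
   by (simp add: FF.D.G_cmp)
 qed
qed

lemma Gamma_trans_trans:
 "lp_trans (Gamma_obj C) (Gamma_obj D) (Gamma_fun C F) (Gamma_fun C G) (Gamma_trans C D F G \<alpha>)"
 "totT (Gamma_obj C) (Gamma_trans C D F G \<alpha>) = restrict (\<lambda>p. \<alpha> (FF.C.ev p)) (obj (tot (Gamma_obj C)))"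
 unfolding Gamma_trans_mkT using mkT_trans[OF FF.GF_functor GG.GF_functor Gamma_trans_nat] by auto

end

section \<open>Gamma as a 2-functor\<close>

lemma Gamma_simps [simp]:
 "tfo Gamma = Gamma_obj"
 "partially_lex_functor C D F ==> omap (tfm Gamma C D) F = Gamma_fun C F"
 "partially_lex_functor C D F ==> partially_lex_functor C D G ==> nat_trans (ucat C) (ucat D) F G \<alpha> ==>
  mmap (tfm Gamma C D) F G \<alpha> = Gamma_trans C D F G \<alpha>"
 by (simp_all add: Gamma_def)

lemma Gamma_local_functor:
 assumes C: "partially_lex_cat C" and D: "partially_lex_cat D"
 shows "is_functor (parfl_hom_cat C D) (lp_hom_cat (Gamma_obj C) (Gamma_obj D)) (tfm Gamma C D)"
proof -
 interpret C: parflcat C by unfold_locales (rule C)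
 interpret D: parflcat D by unfold_locales (rule D)
 have GF: "lp_functor (Gamma_obj C) (Gamma_obj D) (Gamma_fun C F)" if "partially_lex_functor C D F" for F
 proof -
  interpret parflfun C D F by unfold_locales (rule that)
  show ?thesis by (rule GF_functor)
 qed
 have ev: "D.ev (omap (totF (Gamma_obj C) (Gamma_fun C F)) p) = omap F (C.ev p)"
   "omap (totF (Gamma_obj C) (Gamma_fun C F)) p \<in> obj (tot (Gamma_obj D))"
  if "partially_lex_functor C D F" "p \<in> obj (tot (Gamma_obj C))" for F p
 proof -
  interpret parflfun C D F by unfold_locales (rule that)
  show "D.ev (omap (totF (Gamma_obj C) (Gamma_fun C F)) p) = omap F (C.ev p)"
   "omap (totF (Gamma_obj C) (Gamma_fun C F)) p \<in> obj (tot (Gamma_obj D))" using GF_ev GF_obj that by auto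
 qed
 have "is_functor (parfl_hom_cat C D) (lp_hom_cat (Gamma_obj C) (Gamma_obj D)) (mk_func (parfl_hom_cat C D) (Gamma_fun C) (Gamma_trans C D))"
 proof (rule functorI[OF parfl_hom_category lp_hom_category], goal_cases)
  case (1 F) then show ?case by (simp add: GF)
 next
  case (2 F G \<alpha>) then show ?case using Gamma_trans_trans(1)[OF C D] by simp
 next
  case (3 F)
  then have F: "partially_lex_functor C D F" by simp
  note i = id_nat[OF parfl_functor[OF F]]
  have "Gamma_trans C D F F (id_trans (ucat C) (ucat D) F) = idm (lp_hom_cat (Gamma_obj C) (Gamma_obj D)) (Gamma_fun C F)"
   by (rule totT_inj[OF Gamma_trans_trans(1)[OF C D F F i] lp_id_trans(1)[OF GF[OF F]]],
    simp only: Gamma_trans_trans(2)[OF C D F F i] lp_id_trans(2)[OF GF[OF F]],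
    rule extensionalityI[of _ "obj (tot (Gamma_obj C))"])
    (auto simp: id_trans_def C.ev_obj D.G_idm ev[OF F])
  then show ?case using F by simp
 next
  case (4 F G H \<beta> \<alpha>)
  then have F: "partially_lex_functor C D F" and G: "partially_lex_functor C D G" and H: "partially_lex_functor C D H"
   and a: "nat_trans (ucat C) (ucat D) F G \<alpha>" and b: "nat_trans (ucat C) (ucat D) G H \<beta>" by simp_all
  note ab = comp_nat[OF a b]
  note ta = Gamma_trans_trans[OF C D F G a] and tb = Gamma_trans_trans[OF C D G H b] and tab = Gamma_trans_trans[OF C D F H ab]
  have "Gamma_trans C D F H (comp_trans (ucat C) (ucat D) F G H \<beta> \<alpha>) =
   cmp (lp_hom_cat (Gamma_obj C) (Gamma_obj D)) (Gamma_fun C F) (Gamma_fun C G) (Gamma_fun C H) (Gamma_trans C D G H \<beta>) (Gamma_trans C D F G \<alpha>)"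
   by (rule totT_inj[OF tab(1) lp_cmp_trans(1)[OF ta(1) tb(1)]],
    simp only: tab(2) lp_cmp_trans(2)[OF ta(1) tb(1)] ta(2) tb(2), rule extensionalityI[of _ "obj (tot (Gamma_obj C))"])
    (auto simp: comp_trans_def C.ev_obj D.G_cmp ev[OF F] ev[OF G] ev[OF H] nat_hom[OF a] nat_hom[OF b])
  then show ?case using F G H a b by simp
 qed
 then show ?thesis by (simp add: Gamma_def)
qed

lemma Gamma_fun_comp:
 assumes A: "partially_lex_cat A" and B: "partially_lex_cat B" and C: "partially_lex_cat C"
  and f: "partially_lex_functor A B f" and g: "partially_lex_functor B C g"
 shows "Gamma_fun A (comp_func (ucat A) g f) = lp_comp_functor (Gamma_obj A) (Gamma_fun B g) (Gamma_fun A f)"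
proof -
 interpret f: parflfun A B f by unfold_locales (rule A B f)+
 interpret g: parflfun B C g by unfold_locales (rule B C g)+
 show ?thesis
  unfolding Gamma_fun_mk[OF A, of "comp_func (ucat A) g f"] lp_comp_functor_mk
 proof (rule mk_lpfunc_cong, goal_cases)
  case (1 x)
  then have x: "x \<in> f.C.S" by simp
  then have fx: "code (gdom A x, comp_func (gdom A x) f (gfun A x)) \<in> f.D.S" using f.GF_in by blast
  show ?case using x fx by (simp add: f.GF_in comp_func_assoc[OF f.C.fn_functor f.F_functor g.F_functor])
 next
  case (2 x y i j h)
  then have x: "x \<in> f.C.S" and y: "y \<in> f.C.S" and h: "h \<in> hom (ucat A) (omap (gfun A x) i) (omap (gfun A y) j)" by simp_all
  have fx: "code (gdom A z, comp_func (gdom A z) f (gfun A z)) \<in> f.D.S" if "z \<in> f.C.S" for z using f.GF_in that by blast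
  show ?case using 2 x y h fx[OF x] fx[OF y] functor_hom[OF f.F_functor h] functor_obj[OF f.C.fn_functor[OF x]] functor_obj[OF f.C.fn_functor[OF y]]
   by (simp add: f.GF_in)
 qed
qed

theorem Gamma_two_functor: "two_functor PARFL LexProf_CAT Gamma"
 unfolding two_functor_def
proof (intro conjI ballI two_category_PARFL two_category_LexProf, goal_cases)
 case (1 A) then show ?case by (simp add: parflcat.Gamma_lp parflcat.intro)
next
 case (2 A B) then show ?case by (simp add: Gamma_local_functor)
next
 case (3 A)
 then interpret A: parflcat A by unfold_locales simp
 have "Gamma_fun A (id_func (ucat A)) = lp_id_functor (Gamma_obj A)"
  unfolding Gamma_fun_mk[OF A.pl] lp_id_functor_mk
  by (rule mk_lpfunc_cong)
   (auto simp: comp_func_id(2)[OF A.fn_functor] A.decode_code A.code_dom_fn functor_obj[OF A.fn_functor] simp del: comp_func_id)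
 then show ?case using 3 by (simp add: parfl_id)
next
 case (4 A B C g f)
 then have A: "partially_lex_cat A" and B: "partially_lex_cat B" and C: "partially_lex_cat C"
  and f: "partially_lex_functor A B f" and g: "partially_lex_functor B C g" by simp_all
 interpret f: parflfun A B f by unfold_locales (rule A B f)+
 interpret g: parflfun B C g by unfold_locales (rule B C g)+
 show ?case using Gamma_fun_comp[OF A B C f g] A B C f g f.GF_functor g.GF_functor by (simp add: parfl_comp[OF f g A])
next
 case (5 A B C g g' \<beta> f f' \<alpha>)
 then have A: "partially_lex_cat A" and B: "partially_lex_cat B" and C: "partially_lex_cat C"
  and f: "partially_lex_functor A B f" "partially_lex_functor A B f'" and g: "partially_lex_functor B C g" "partially_lex_functor B C g'"
  and a: "nat_trans (ucat A) (ucat B) f f' \<alpha>" and b: "nat_trans (ucat B) (ucat C) g g' \<beta>" by (simp_all split: if_splits)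
 interpret f: parflfun A B f by unfold_locales (rule A B f)+
 interpret f': parflfun A B f' by unfold_locales (rule f)
 interpret g: parflfun B C g by unfold_locales (rule B C g)+
 interpret g': parflfun B C g' by unfold_locales (rule g)
 note gf = parfl_comp[OF f(1) g(1) A] and gf' = parfl_comp[OF f(2) g(2) A]
 note h = hcomp_nat[OF a b]
 note ta = Gamma_trans_trans[OF A B f a] and tb = Gamma_trans_trans[OF B C g b] and th = Gamma_trans_trans[OF A C gf gf' h]
 note tc = LexProf_tcmp[OF ta(1) tb(1)]
 note e = Gamma_fun_comp[OF A B C]
 have "Gamma_trans A C (comp_func (ucat A) g f) (comp_func (ucat A) g' f') (hcomp_trans (ucat A) (ucat C) g g' f f' \<beta> \<alpha>) =
  mmap (tcmp LexProf_CAT (Gamma_obj A) (Gamma_obj B) (Gamma_obj C)) (Gamma_fun B g, Gamma_fun A f) (Gamma_fun B g', Gamma_fun A f')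
   (Gamma_trans B C g g' \<beta>, Gamma_trans A B f f' \<alpha>)"
 proof (rule totT_inj[OF th(1) tc(1)[folded e[OF f(1) g(1)] e[OF f(2) g(2)]]], unfold th(2) tc(2) ta(2) tb(2), rule extensionalityI[of _ "obj (tot (Gamma_obj A))"])
  fix p assume p: "p \<in> obj (tot (Gamma_obj A))"
  note m = nat_hom[OF a f.C.ev_obj[OF p]]
  note n = functor_hom[OF g.F_functor m] nat_hom[OF b functor_obj[OF f'.F_functor f.C.ev_obj[OF p]]]
  note o = functor_obj[OF totF_functor[OF g.GF_functor] f.GF_obj[OF p]] functor_obj[OF totF_functor[OF g.GF_functor] f'.GF_obj[OF p]]
   functor_obj[OF totF_functor[OF g'.GF_functor] f'.GF_obj[OF p]]
  show "restrict (\<lambda>p. hcomp_trans (ucat A) (ucat C) g g' f f' \<beta> \<alpha> (f.C.ev p)) (obj (tot (Gamma_obj A))) p =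
   hcomp_trans (tot (Gamma_obj A)) (tot (Gamma_obj C)) (totF (Gamma_obj B) (Gamma_fun B g)) (totF (Gamma_obj B) (Gamma_fun B g'))
    (totF (Gamma_obj A) (Gamma_fun A f)) (totF (Gamma_obj A) (Gamma_fun A f')) (restrict (\<lambda>p. \<beta> (f.D.ev p)) (obj (tot (Gamma_obj B))))
    (restrict (\<lambda>p. \<alpha> (f.C.ev p)) (obj (tot (Gamma_obj A)))) p"
   using p m n o f.C.ev_obj[OF p] f.GF_obj[OF p] f'.GF_obj[OF p]
   by (simp add: f'.GF_ev f.GF_ev g.GF_ev g'.GF_ev g.GF_mmap g.D.G_cmp)
 qed (auto simp: hcomp_trans_def)
 then show ?case using f g a b f.GF_functor g.GF_functor gf gf' h by simp
qed

section \<open>\<open>\<Gamma>\<close> is locally an equivalence\<close>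

text \<open>A transformation on total categories descends along evaluation as soon as its components
  depend only on the evaluated object.\<close>

lemma Gamma_full:
 assumes C: "partially_lex_cat C" and D: "partially_lex_cat D" and F: "partially_lex_functor C D F" and G: "partially_lex_functor C D G"
  and t: "lp_trans (Gamma_obj C) (Gamma_obj D) (Gamma_fun C F) (Gamma_fun C G) \<theta>"
 shows "\<exists>\<alpha>. nat_trans (ucat C) (ucat D) F G \<alpha> & Gamma_trans C D F G \<alpha> = \<theta>"
proof -
 interpret F: parflfun C D F by unfold_locales (rule C D F)+
 interpret G: parflfun C D G by unfold_locales (rule G)
 let ?T = "tot (Gamma_obj C)"
 define s where "s = totT (Gamma_obj C) \<theta>"
 have n: "nat_trans ?T (tot (Gamma_obj D)) (totF (Gamma_obj C) (Gamma_fun C F)) (totF (Gamma_obj C) (Gamma_fun C G)) s"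
  unfolding s_def by (rule totT_nat[OF t])
 have s: "s p \<in> hom (ucat D) (omap F (F.C.ev p)) (omap G (F.C.ev p))" if p: "p \<in> obj ?T" for p
  using nat_hom[OF n p] p by (simp add: F.D.G_hom F.GF_obj G.GF_obj F.GF_ev G.GF_ev)
 have nat: "cmp (ucat D) (omap F (F.C.ev p)) (omap F (F.C.ev q)) (omap G (F.C.ev q)) (s q) (mmap F (F.C.ev p) (F.C.ev q) h) =
  cmp (ucat D) (omap F (F.C.ev p)) (omap G (F.C.ev p)) (omap G (F.C.ev q)) (mmap G (F.C.ev p) (F.C.ev q) h) (s p)"
  if p: "p \<in> obj ?T" and q: "q \<in> obj ?T" and h: "h \<in> hom (ucat C) (F.C.ev p) (F.C.ev q)" for p q h
 proof -
  have "h \<in> hom ?T p q" using h p q by (simp add: F.C.G_hom)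
  from nat_nat[OF n this] show ?thesis
   using p q h s[OF p] s[OF q] functor_hom[OF F.F_functor h] functor_hom[OF G.F_functor h]
   by (simp add: F.GF_mmap G.GF_mmap F.D.G_cmp F.GF_obj G.GF_obj F.GF_ev G.GF_ev)
 qed
 \<comment> \<open>Two pairs with the same value are joined by an identity of the underlying
   category, and naturality along it equates the components.\<close>
 have indep: "s p = s q" if p: "p \<in> obj ?T" and q: "q \<in> obj ?T" and e: "F.C.ev p = F.C.ev q" for p q
 proof -
  note o = F.C.ev_obj[OF q]
  have i: "idm (ucat C) (F.C.ev q) \<in> hom (ucat C) (F.C.ev p) (F.C.ev q)" using cat_id[OF F.C.cat_K o] e by simp
  show ?thesis using nat[OF p q i] s[OF p] s[OF q] e
   by (simp add: functor_id[OF F.F_functor o] functor_id[OF G.F_functor o] cat_id_left[OF F.D.cat_K] cat_id_right[OF F.D.cat_K])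
 qed
 obtain r where r: "!!c. c \<in> obj (ucat C) ==> r c \<in> obj ?T" "!!c. c \<in> obj (ucat C) ==> F.C.ev (r c) = c"
  using F.C.ev_surj by metis
 have a: "nat_trans (ucat C) (ucat D) F G (restrict (\<lambda>c. s (r c)) (obj (ucat C)))"
 proof (rule natI[OF F.F_functor G.F_functor])
  fix c assume c: "c \<in> obj (ucat C)"
  show "s (r c) \<in> hom (ucat D) (omap F c) (omap G c)" using s[OF r(1)[OF c]] r(2)[OF c] by simp
 next
  fix c d h assume c: "c \<in> obj (ucat C)" and d: "d \<in> obj (ucat C)" and h: "h \<in> hom (ucat C) c d"
  show "cmp (ucat D) (omap F c) (omap F d) (omap G d) (s (r d)) (mmap F c d h) = cmp (ucat D) (omap F c) (omap G c) (omap G d) (mmap G c d h) (s (r c))"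
   using nat[OF r(1)[OF c] r(1)[OF d], of h] r(2)[OF c] r(2)[OF d] h by simp
 qed
 note ta = Gamma_trans_trans[OF C D F G a]
 have "Gamma_trans C D F G (restrict (\<lambda>c. s (r c)) (obj (ucat C))) = \<theta>"
 proof (rule totT_inj[OF ta(1) t], unfold ta(2) s_def[symmetric], rule extensionalityI[OF _ nat_ext[OF n]])
  fix p assume p: "p \<in> obj ?T"
  show "restrict (\<lambda>p. restrict (\<lambda>c. s (r c)) (obj (ucat C)) (F.C.ev p)) (obj ?T) p = s p"
   using p F.C.ev_obj[OF p] indep[OF r(1) p r(2)] by simp
 qed simp
 then show ?thesis using a by blast
qed

lemma Gamma_faithful:
 assumes C: "partially_lex_cat C" and D: "partially_lex_cat D" and F: "partially_lex_functor C D F" and G: "partially_lex_functor C D G"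
  and a: "nat_trans (ucat C) (ucat D) F G \<alpha>" and b: "nat_trans (ucat C) (ucat D) F G \<beta>"
  and e: "Gamma_trans C D F G \<alpha> = Gamma_trans C D F G \<beta>"
 shows "\<alpha> = \<beta>"
proof (rule nat_eqI[OF a b refl])
 interpret C: parflcat C by unfold_locales (rule C)
 fix c assume "c \<in> obj (ucat C)"
 then obtain p where p: "p \<in> obj (tot (Gamma_obj C))" "C.ev p = c" using C.ev_surj by blast
 have "restrict (\<lambda>p. \<alpha> (C.ev p)) (obj (tot (Gamma_obj C))) = restrict (\<lambda>p. \<beta> (C.ev p)) (obj (tot (Gamma_obj C)))"
  using Gamma_trans_trans(2)[OF C D F G a] Gamma_trans_trans(2)[OF C D F G b] e by simp
 from fun_cong[OF this, of p] show "\<alpha> c = \<beta> c" using p by simp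
qed

text \<open>A functor on total categories is brought down to the underlying category by choosing a
  pair over each object. Another pair over the same object differs by an identity morphism, which H
  sends to an isomorphism, not in general to an identity; so H is reached only up to
  isomorphism.\<close>

lemma Gamma_ess_surj:
 assumes C: "partially_lex_cat C" and D: "partially_lex_cat D" and H: "lp_functor (Gamma_obj C) (Gamma_obj D) H"
 shows "\<exists>F. partially_lex_functor C D F & (\<exists>\<theta>. is_iso (lp_hom_cat (Gamma_obj C) (Gamma_obj D)) (Gamma_fun C F) H \<theta>)"
proof -
 interpret C: parflcat C by unfold_locales (rule C)
 interpret D: parflcat D by unfold_locales (rule D)
 let ?T = "tot (Gamma_obj C)"
 define M where "M = totF (Gamma_obj C) H"
 have M: "is_functor ?T (tot (Gamma_obj D)) M" unfolding M_def by (rule totF_functor[OF H])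
 note Mo = functor_obj[OF M]
 have Mh: "mmap M p q f \<in> hom (ucat D) (D.ev (omap M p)) (D.ev (omap M q))"
  if "p \<in> obj ?T" "q \<in> obj ?T" "f \<in> hom (ucat C) (C.ev p) (C.ev q)" for p q f
  using functor_hom[OF M, of f p q] that Mo by (simp add: C.G_hom D.G_hom)
 have Mc: "mmap M p r (cmp (ucat C) (C.ev p) (C.ev q) (C.ev r) g f) =
   cmp (ucat D) (D.ev (omap M p)) (D.ev (omap M q)) (D.ev (omap M r)) (mmap M q r g) (mmap M p q f)"
  if "p \<in> obj ?T" "q \<in> obj ?T" "r \<in> obj ?T" "g \<in> hom (ucat C) (C.ev q) (C.ev r)" "f \<in> hom (ucat C) (C.ev p) (C.ev q)" for p q r g f
  using functor_cmp[OF M, of g q r f p] that Mo Mh by (simp add: C.G_hom C.G_cmp D.G_cmp)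
 have Mi: "mmap M p p (idm (ucat C) (C.ev p)) = idm (ucat D) (D.ev (omap M p))" if "p \<in> obj ?T" for p
  using functor_id[OF M that] that Mo by (simp add: C.G_idm D.G_idm)
 let ?K = "ucat C" and ?L = "ucat D" and ?m = "\<lambda>p. D.ev (omap M p)"
 obtain r where r: "!!c. c \<in> obj (ucat C) ==> r c \<in> obj ?T" "!!c. c \<in> obj (ucat C) ==> C.ev (r c) = c"
  using C.ev_surj by metis
 define F where "F = mk_func ?K (\<lambda>c. ?m (r c)) (\<lambda>c d. mmap M (r c) (r d))"
 have F: "is_functor ?K ?L F" unfolding F_def
 proof (rule functorI[OF C.cat_K D.cat_K], goal_cases)
  case (1 c) then show ?case by (intro D.ev_obj Mo r)
 next
  case (2 c d f) then show ?case using Mh[OF r(1) r(1), of c d f] r(2) by simp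
 next
  case (3 c) then show ?case using Mi[OF r(1), of c] r(2) by simp
 next
  case (4 c d e g f) then show ?case using Mc[OF r(1) r(1) r(1), of c d e g f] r(2) by simp
 qed
 let ?f = "\<lambda>p. omap F (C.ev p)"
 have Fs: "!!c. c \<in> obj ?K ==> omap F c = ?m (r c)"
  "!!c d f. f \<in> hom ?K c d ==> mmap F c d f = mmap M (r c) (r d) f"
  unfolding F_def using hom_obj[OF C.cat_K] by auto
 \<comment> \<open>The image under H of the identity of \<open>C.ev p\<close>, read as a morphism
   from p to the chosen pair over the same object; \<psi> is the same identity read
   backwards.\<close>
 define \<phi> where "\<phi> p = mmap M p (r (C.ev p)) (idm ?K (C.ev p))" for p
 define \<psi> where "\<psi> p = mmap M (r (C.ev p)) p (idm ?K (C.ev p))" for p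
 have idp: "idm ?K (C.ev p) \<in> hom ?K (C.ev p) (C.ev p)" if "p \<in> obj ?T" for p
  by (rule cat_id[OF C.cat_K C.ev_obj[OF that]])
 have rp: "r (C.ev p) \<in> obj ?T" "C.ev (r (C.ev p)) = C.ev p" if "p \<in> obj ?T" for p
  using r C.ev_obj[OF that] by auto
 have \<phi>: "\<phi> p \<in> hom ?L (?m p) (?f p)" and \<psi>: "\<psi> p \<in> hom ?L (?f p) (?m p)"
  if p: "p \<in> obj ?T" for p
  using Mh[OF p rp(1)[OF p]] Mh[OF rp(1)[OF p] p] idp[OF p] rp[OF p] unfolding \<phi>_def \<psi>_def by (simp_all add: Fs C.ev_obj[OF p])
 have inv: "cmp ?L (?f p) (?m p) (?f p) (\<phi> p) (\<psi> p) = idm ?L (?f p)"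
  "cmp ?L (?m p) (?f p) (?m p) (\<psi> p) (\<phi> p) = idm ?L (?m p)"
  if p: "p \<in> obj ?T" for p
  using Mc[OF rp(1)[OF p] p rp(1)[OF p], of "idm ?K (C.ev p)" "idm ?K (C.ev p)"]
   Mc[OF p rp(1)[OF p] p, of "idm ?K (C.ev p)" "idm ?K (C.ev p)"] idp[OF p] rp[OF p] Mi[OF p] Mi[OF rp(1)[OF p]]
  unfolding \<phi>_def \<psi>_def by (simp_all add: Fs C.ev_obj[OF p] cat_id_left[OF C.cat_K])
 have n\<phi>: "cmp ?L (?m p) (?m q) (?f q) (\<phi> q) (mmap M p q f) =
   cmp ?L (?m p) (?f p) (?f q) (mmap F (C.ev p) (C.ev q) f) (\<phi> p)"
  if p: "p \<in> obj ?T" and q: "q \<in> obj ?T" and f: "f \<in> hom ?K (C.ev p) (C.ev q)" for p q f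
  using Mc[OF p q rp(1)[OF q], of "idm ?K (C.ev q)" f] Mc[OF p rp(1)[OF p] rp(1)[OF q], of f "idm ?K (C.ev p)"]
   idp[OF p] idp[OF q] rp[OF p] rp[OF q] f
  unfolding \<phi>_def \<psi>_def by (simp_all add: Fs(2)[OF f] Fs(1)[OF C.ev_obj[OF p]] Fs(1)[OF C.ev_obj[OF q]] cat_id_left[OF C.cat_K f] cat_id_right[OF C.cat_K f])
 have "(A, comp_func A F X) \<in> sieve D" if s: "(A, X) \<in> sieve C" for A X
 \<comment> \<open>F after X is isomorphic, by \<phi>, to the functor coded by the value of H at x;
   sieves are closed under isomorphism.\<close>
 proof (rule D.sieve_iso)
  define x where "x = code (A, X)"
  have x: "x \<in> C.S" and xs: "gdom C x = A" "gfun C x = X" using s unfolding x_def by auto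
  define y where "y = lpo H x"
  have y: "y \<in> D.S" using lpf_obj[OF H, of x] x unfolding y_def by simp
  have dy: "gdom D y = A" using lpf_ext[OF H, of x] x y xs unfolding y_def by simp
  show "(A, gfun D y) \<in> sieve D" using D.dom_fn[OF y] dy by simp
  have X: "is_functor A ?K X" by (rule lex_functorD[OF C.sieve_lex(2)[OF s]])
  have Y: "is_functor A ?L (gfun D y)" using D.fn_functor[OF y] dy by simp
  have pi: "vpair x i \<in> obj ?T" "C.ev (vpair x i) = omap X i" "omap M (vpair x i) = vpair y i" if "i \<in> obj A" for i
   using that x xs unfolding M_def y_def by simp_all
  note A = small_lex_catD(1)[OF C.sieve_lex(1)[OF s]]
  have "nat_trans A ?L (gfun D y) (comp_func A F X) (restrict (\<lambda>i. \<phi> (vpair x i)) (obj A))"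
  proof (rule natI[OF Y comp_functor[OF X F]])
   fix i assume i: "i \<in> obj A"
   show "\<phi> (vpair x i) \<in> hom ?L (omap (gfun D y) i) (omap (comp_func A F X) i)"
    using \<phi>[OF pi(1)[OF i]] i pi[OF i] by simp
  next
   fix i j p assume i: "i \<in> obj A" and j: "j \<in> obj A" and p: "p \<in> hom A i j"
   note Xp = functor_hom[OF X p]
   have Xpt: "mmap X i j p \<in> omap (lhom (Gamma_obj C) x x) (i, j)" using Xp x xs i j by simp
   \<comment> \<open>On morphisms coming from the extent H is forced: it preserves identity 2-cells,
     and those of Gamma are the actions of the coded functors on morphisms.\<close>
   have "mmap M (vpair x i) (vpair x j) (mmap X i j p) = lpm H x x (i, j) (mmap X i j p)"
    unfolding M_def by (rule totF_simps(2)) (use x xs i j Xpt in auto)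
   also have "\<dots> = lpm H x x (i, j) (lidm (Gamma_obj C) x (i, j) p)" using x xs p by simp
   also have "\<dots> = lidm (Gamma_obj D) y (i, j) p" unfolding y_def by (rule lpf_idm[OF H]) (use x xs p in auto)
   also have "\<dots> = mmap (gfun D y) i j p" using y dy p by simp
   finally show "cmp ?L (omap (gfun D y) i) (omap (gfun D y) j) (omap (comp_func A F X) j) (\<phi> (vpair x j)) (mmap (gfun D y) i j p) =
    cmp ?L (omap (gfun D y) i) (omap (comp_func A F X) i) (omap (comp_func A F X) j) (mmap (comp_func A F X) i j p) (\<phi> (vpair x i))"
    using n\<phi>[OF pi(1)[OF i] pi(1)[OF j], of "mmap X i j p"] Xp i j p pi[OF i] pi[OF j] by simp
  qed
  moreover have "is_iso ?L (omap (gfun D y) i) (omap (comp_func A F X) i) (restrict (\<lambda>i. \<phi> (vpair x i)) (obj A) i)" if i: "i \<in> obj A" for i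
   using \<phi>[OF pi(1)[OF i]] \<psi>[OF pi(1)[OF i]] inv[OF pi(1)[OF i]] i pi[OF i] hom_obj[OF D.cat_K \<phi>[OF pi(1)[OF i]]]
   unfolding is_iso_def by auto
  ultimately show "naturally_isomorphic A ?L (gfun D y) (comp_func A F X)" unfolding naturally_isomorphic_def by blast
 qed
 then have pF: "partially_lex_functor C D F" unfolding partially_lex_functor_def using F by blast
 interpret F: parflfun C D F by unfold_locales (rule pF)
 let ?F = "totF (Gamma_obj C) (Gamma_fun C F)" and ?D = "tot (Gamma_obj D)"
 have FM: "is_functor ?T ?D ?F" by (rule totF_functor[OF F.GF_functor])
 have "nat_trans ?T ?D M ?F (restrict \<phi> (obj ?T))"
 proof (rule natI[OF M FM])
  fix p assume p: "p \<in> obj ?T"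
  show "\<phi> p \<in> hom ?D (omap M p) (omap ?F p)" using \<phi>[OF p] p Mo by (simp add: D.G_hom F.GF_obj F.GF_ev)
 next
  fix p q f assume p: "p \<in> obj ?T" and q: "q \<in> obj ?T" and "f \<in> hom ?T p q"
  then have f: "f \<in> hom ?K (C.ev p) (C.ev q)" by (simp add: C.G_hom)
  show "cmp ?D (omap M p) (omap M q) (omap ?F q) (\<phi> q) (mmap M p q f) = cmp ?D (omap M p) (omap ?F p) (omap ?F q) (mmap ?F p q f) (\<phi> p)"
   using p q f n\<phi>[OF p q f] \<phi>[OF p] \<phi>[OF q] Mh[OF p q f] functor_hom[OF F f] Mo
   by (simp add: D.G_cmp F.GF_obj F.GF_ev F.GF_mmap)
 qed
 moreover have "is_iso ?D (omap M p) (omap ?F p) (restrict \<phi> (obj ?T) p)" if p: "p \<in> obj ?T" for p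
  unfolding is_iso_def using p inv[OF p] \<phi>[OF p] \<psi>[OF p] Mo by (auto simp: D.G_cmp D.G_hom D.G_idm F.GF_obj F.GF_ev)
 ultimately have "naturally_isomorphic ?T ?D M ?F" unfolding naturally_isomorphic_def by blast
 from lp_iso[OF F.GF_functor H nat_iso_sym[OF this[unfolded M_def]]] show ?thesis using pF by blast
qed

theorem Gamma_local_equivalence: "local_equivalence PARFL LexProf_CAT Gamma"
 unfolding local_equivalence_def
proof (intro ballI)
 fix C D :: "'a parfl" assume "C \<in> tobj PARFL" "D \<in> tobj PARFL"
 then have C: "partially_lex_cat C" and D: "partially_lex_cat D" by simp_all
 have "is_equivalence (parfl_hom_cat C D) (lp_hom_cat (Gamma_obj C) (Gamma_obj D)) (tfm Gamma C D)"
 proof (rule equivalenceI[OF Gamma_local_functor[OF C D]], goal_cases)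
  case (1 F G \<theta>)
  then have F: "partially_lex_functor C D F" and G: "partially_lex_functor C D G" by simp_all
  then have "lp_trans (Gamma_obj C) (Gamma_obj D) (Gamma_fun C F) (Gamma_fun C G) \<theta>" using 1 by simp
  from Gamma_full[OF C D F G this] show ?case using F G by auto
 next
  case (2 F G \<alpha> \<beta>)
  then have F: "partially_lex_functor C D F" and G: "partially_lex_functor C D G"
   and a: "nat_trans (ucat C) (ucat D) F G \<alpha>" and b: "nat_trans (ucat C) (ucat D) F G \<beta>" by (simp_all split: if_splits)
  show ?case by (rule Gamma_faithful[OF C D F G a b]) (use 2 F G a b in simp)
 next
  case (3 H)
  then have "lp_functor (Gamma_obj C) (Gamma_obj D) H" by simp
  from Gamma_ess_surj[OF C D this] show ?case by auto
 qed
 then show "is_equivalence (thom PARFL C D) (thom LexProf_CAT (tfo Gamma C) (tfo Gamma D)) (tfm Gamma C D)" by simp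
qed

section \<open>Tensors on elements\<close>

context lpcategory begin

lemma act_left:
 assumes XY: "X \<in> lobj C" "Y \<in> lobj C" and p: "p \<in> hom (ext C X) i' i" and j: "j \<in> obj (ext C Y)" and f: "f \<in> omap (lhom C X Y) (i, j)"
 shows "lact (ext C Y) (lhom C X Y) j i i' p f = cmpv (tot C) X i' X i Y j f (lidm C X (i', i) p)"
 using lp_unit_right[OF XY j p f] XY j f p hom_obj[OF ext_cat[OF XY(1)] p] by (simp add: tot_cmp idm_in)

lemma act_right:
 assumes XY: "X \<in> lobj C" "Y \<in> lobj C" and i: "i \<in> obj (ext C X)" and q: "q \<in> hom (ext C Y) j j'" and f: "f \<in> omap (lhom C X Y) (i, j)"
 shows "ract (ext C X) (lhom C X Y) i j j' q f = cmpv (tot C) X i Y j Y j' (lidm C Y (j, j') q) f"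
 using lp_unit_left[OF XY i q f] XY i f q hom_obj[OF ext_cat[OF XY(2)] q] by (simp add: tot_cmp idm_in)

end

text \<open>A candidate tensor, before any universal property; it serves both for proving that
  something is a tensor and for unpacking one.\<close>

locale weighted = lpcategory C for C +
 fixes A B :: "'v::universe vcat" and W :: "'v prof" and X T :: 'v and u :: "'v cell"
 assumes W: "lex_prof A B W" and X: "X \<in> lobj C" and eX: "ext C X = A" and T: "T \<in> lobj C" and eT: "ext C T = B"
  and u: "two_cell A B W (lhom C X T) u"
begin

lemma catA: "category A" and catB: "category B" and pW: "is_prof A B W"
 using lex_profD[OF W] small_lex_catD by blast+

abbreviation "K \<equiv> tot C"

lemma u_in: "a \<in> obj A ==> b \<in> obj B ==> m \<in> omap W (a, b) ==> u (a, b) m \<in> omap (lhom C X T) (a, b)"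
 by (rule cell_in[OF u])

lemma u_left: "m \<in> omap W (a, b) ==> p \<in> hom A a' a ==> b \<in> obj B ==>
  u (a', b) (lact B W b a a' p m) = cmpv K X a' X a T b (u (a, b) m) (lidm C X (a', a) p)"
 using cell_nat[OF u catA catB, of m a b p a' "idm B b" b] cat_id[OF catB] hom_obj[OF catA, of p a' a]
  act_left[OF X T, of p a' a b "u (a, b) m"] u_in by (simp add: eX eT)

lemma u_right: "m \<in> omap W (a, b) ==> r \<in> hom B b b' ==> a \<in> obj A ==>
  u (a, b') (ract A W a b b' r m) = cmpv K X a T b T b' (lidm C T (b, b') r) (u (a, b) m)"
 using cell_nat[OF u catA catB, of m a b "idm A a" a r b'] cat_id[OF catA] hom_obj[OF catB, of r b b']
  act_right[OF X T, of a r b b' "u (a, b) m"] u_in by (simp add: eX eT)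

definition trans :: "'v vcat => 'v prof => 'v => 'v cell => 'v cell" where
 "trans D U Z f = vcomp A D (tensor A B D U W) (tensor A B D (lhom C T Z) (lhom C X T)) (lhom C X Z)
         (lcmp C X T Z) (hcomp A B D U W (lhom C T Z) (lhom C X T) f u)"

lemma trans_cell:
 assumes U: "lex_prof B D U" and Z: "Z \<in> lobj C" and eZ: "ext C Z = D" and f: "two_cell B D U (lhom C T Z) f"
 shows "two_cell A D (tensor A B D U W) (lhom C X Z) (trans D U Z f)"
  and "!!a b d n m. a \<in> obj A ==> b \<in> obj B ==> d \<in> obj D ==> n \<in> omap U (b, d) ==> m \<in> omap W (a, b) ==>
   trans D U Z f (a, d) (coend_class A B D U W a d (b, n, m)) = cmpv K X a T b Z d (f (b, d) n) (u (a, b) m)"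
proof -
 interpret UW: composable A B D U W by (rule composable_lex[OF W U])
 have c: "composable A B D (lhom C T Z) (lhom C X T)" using hom_composable[OF X T Z] eX eT eZ by simp
 note h = UW.hcomp_cell[OF c f u]
 have l: "two_cell A D (tensor A B D (lhom C T Z) (lhom C X T)) (lhom C X Z) (lcmp C X T Z)"
  using cmp_cell[OF X T Z] eX eT eZ by simp
 show "two_cell A D (tensor A B D U W) (lhom C X Z) (trans D U Z f)" unfolding trans_def by (rule vcomp_cell[OF h(1) l])
 show "trans D U Z f (a, d) (coend_class A B D U W a d (b, n, m)) = cmpv K X a T b Z d (f (b, d) n) (u (a, b) m)"
  if i: "a \<in> obj A" "b \<in> obj B" "d \<in> obj D" "n \<in> omap U (b, d)" "m \<in> omap W (a, b)" for a b d n m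
  unfolding trans_def vcomp_simp[OF h(1) l i(1,3) UW.tensor_in[OF i(1,3,2,4,5)]] h(2)[OF i]
  using i cell_in[OF f i(2,3,4)] u_in[OF i(1,2,5)] X T Z by (simp add: tot_cmp eX eT eZ lapp_def)
qed

lemma is_tensor_iff: "is_tensor C A B W X T u \<longleftrightarrow> (\<forall>D U Z. lex_prof B D U & Z \<in> lobj C & ext C Z = D \<longrightarrow>
  bij_betw (trans D U Z) {f. two_cell B D U (lhom C T Z) f} {h. two_cell A D (tensor A B D U W) (lhom C X Z) h})"
 unfolding is_tensor_def trans_def using W X eX T eT u by simp

text \<open>Equality of 2-cells out of the coend is tested on classes, which turns the bijection in
  \<open>is_tensor\<close> into existence and uniqueness statements about elements.\<close>

lemma is_tensorI:
 assumes e: "!!D U Z h. lex_prof B D U ==> Z \<in> lobj C ==> ext C Z = D ==> two_cell A D (tensor A B D U W) (lhom C X Z) h ==>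
   \<exists>f. two_cell B D U (lhom C T Z) f & (\<forall>a\<in>obj A. \<forall>b\<in>obj B. \<forall>d\<in>obj D. \<forall>n\<in>omap U (b, d). \<forall>m\<in>omap W (a, b).
    cmpv K X a T b Z d (f (b, d) n) (u (a, b) m) = h (a, d) (coend_class A B D U W a d (b, n, m)))"
  and q: "!!D U Z f f' b d n. lex_prof B D U ==> Z \<in> lobj C ==> ext C Z = D ==> two_cell B D U (lhom C T Z) f ==> two_cell B D U (lhom C T Z) f' ==>
   (!!a b d n m. a \<in> obj A ==> b \<in> obj B ==> d \<in> obj D ==> n \<in> omap U (b, d) ==> m \<in> omap W (a, b) ==>
    cmpv K X a T b Z d (f (b, d) n) (u (a, b) m) = cmpv K X a T b Z d (f' (b, d) n) (u (a, b) m))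
   ==> b \<in> obj B ==> d \<in> obj D ==> n \<in> omap U (b, d) ==> f (b, d) n = f' (b, d) n"
 shows "is_tensor C A B W X T u"
 unfolding is_tensor_iff
proof (intro allI impI, elim conjE)
 fix D U Z assume U: "lex_prof B D U" and Z: "Z \<in> lobj C" and eZ: "ext C Z = D"
 interpret UW: composable A B D U W by (rule composable_lex[OF W U])
 note tc = trans_cell[OF U Z eZ]
 show "bij_betw (trans D U Z) {f. two_cell B D U (lhom C T Z) f} {h. two_cell A D (tensor A B D U W) (lhom C X Z) h}"
  unfolding bij_betw_def
 proof (intro conjI inj_onI equalityI subsetI)
  fix f f' assume "f \<in> {f. two_cell B D U (lhom C T Z) f}" "f' \<in> {f. two_cell B D U (lhom C T Z) f}" and e: "trans D U Z f = trans D U Z f'"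
  then have f: "two_cell B D U (lhom C T Z) f" and f': "two_cell B D U (lhom C T Z) f'" by simp_all
  show "f = f'"
  proof (rule cell_eqI[OF f f'])
   fix b d n assume i: "b \<in> obj B" "d \<in> obj D" "n \<in> omap U (b, d)"
   show "f (b, d) n = f' (b, d) n"
    by (rule q[OF U Z eZ f f' _ i]) (use tc(2)[OF f] tc(2)[OF f'] e in metis)
  qed
 next
  fix h assume "h \<in> trans D U Z ` {f. two_cell B D U (lhom C T Z) f}"
  then show "h \<in> {h. two_cell A D (tensor A B D U W) (lhom C X Z) h}" using tc(1) by blast
 next
  fix h assume "h \<in> {h. two_cell A D (tensor A B D U W) (lhom C X Z) h}"
  then have h: "two_cell A D (tensor A B D U W) (lhom C X Z) h" by simp
  from e[OF U Z eZ h] obtain f where f: "two_cell B D U (lhom C T Z) f" "!!a b d n m. a \<in> obj A ==> b \<in> obj B ==> d \<in> obj D ==> n \<in> omap U (b, d) ==> m \<in> omap W (a, b) ==>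
    cmpv K X a T b Z d (f (b, d) n) (u (a, b) m) = h (a, d) (coend_class A B D U W a d (b, n, m))" by metis
  have "trans D U Z f = h"
   by (rule UW.tensor_cell_eqI[OF tc(1)[OF f(1)] h]) (simp add: tc(2)[OF f(1)] f(2))
  then show "h \<in> trans D U Z ` {f. two_cell B D U (lhom C T Z) f}" using f(1) by blast
 qed
qed

lemma tensorD:
 assumes t: "is_tensor C A B W X T u" and U: "lex_prof B D U" and Z: "Z \<in> lobj C" and eZ: "ext C Z = D"
 shows "two_cell A D (tensor A B D U W) (lhom C X Z) h ==>
   \<exists>f. two_cell B D U (lhom C T Z) f & (\<forall>a\<in>obj A. \<forall>b\<in>obj B. \<forall>d\<in>obj D. \<forall>n\<in>omap U (b, d). \<forall>m\<in>omap W (a, b).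
    cmpv K X a T b Z d (f (b, d) n) (u (a, b) m) = h (a, d) (coend_class A B D U W a d (b, n, m)))"
  and "two_cell B D U (lhom C T Z) f ==> two_cell B D U (lhom C T Z) f' ==>
   (!!a b d n m. a \<in> obj A ==> b \<in> obj B ==> d \<in> obj D ==> n \<in> omap U (b, d) ==> m \<in> omap W (a, b) ==>
    cmpv K X a T b Z d (f (b, d) n) (u (a, b) m) = cmpv K X a T b Z d (f' (b, d) n) (u (a, b) m))
   ==> f = f'"
proof -
 interpret UW: composable A B D U W by (rule composable_lex[OF W U])
 note tc = trans_cell[OF U Z eZ]
 have b: "bij_betw (trans D U Z) {f. two_cell B D U (lhom C T Z) f} {h. two_cell A D (tensor A B D U W) (lhom C X Z) h}"
  using t U Z eZ unfolding is_tensor_iff by blast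
 show "\<exists>f. two_cell B D U (lhom C T Z) f & (\<forall>a\<in>obj A. \<forall>b\<in>obj B. \<forall>d\<in>obj D. \<forall>n\<in>omap U (b, d). \<forall>m\<in>omap W (a, b).
    cmpv K X a T b Z d (f (b, d) n) (u (a, b) m) = h (a, d) (coend_class A B D U W a d (b, n, m)))"
  if h: "two_cell A D (tensor A B D U W) (lhom C X Z) h"
 proof -
  have "h \<in> trans D U Z ` {f. two_cell B D U (lhom C T Z) f}" using b h unfolding bij_betw_def by simp
  then obtain f where f: "two_cell B D U (lhom C T Z) f" "trans D U Z f = h" by blast
  then show ?thesis using tc(2)[OF f(1)] by (intro exI[of _ f]) auto
 qed
 show "f = f'" if f: "two_cell B D U (lhom C T Z) f" and f': "two_cell B D U (lhom C T Z) f'" and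
   e: "!!a b d n m. a \<in> obj A ==> b \<in> obj B ==> d \<in> obj D ==> n \<in> omap U (b, d) ==> m \<in> omap W (a, b) ==>
    cmpv K X a T b Z d (f (b, d) n) (u (a, b) m) = cmpv K X a T b Z d (f' (b, d) n) (u (a, b) m)"
 proof -
  have "trans D U Z f = trans D U Z f'"
   by (rule UW.tensor_cell_eqI[OF tc(1)[OF f] tc(1)[OF f']]) (simp add: tc(2)[OF f] tc(2)[OF f'] e)
  then show ?thesis using b f f' unfolding bij_betw_def inj_on_def by blast
 qed
qed

text \<open>It suffices to verify the universal property one object at a time.\<close>

lemma pointwise_tensor:
 assumes ex: "!!Z b d \<phi>. Z \<in> lobj C ==> b \<in> obj B ==> d \<in> obj (ext C Z) ==>
   (!!a m. a \<in> obj A ==> m \<in> omap W (a, b) ==> \<phi> a m \<in> omap (lhom C X Z) (a, d)) ==>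
   (!!a a' p m. p \<in> hom A a' a ==> m \<in> omap W (a, b) ==>
    \<phi> a' (lact B W b a a' p m) = cmpv K X a' X a Z d (\<phi> a m) (lidm C X (a', a) p)) ==>
   \<exists>t\<in>omap (lhom C T Z) (b, d). \<forall>a\<in>obj A. \<forall>m\<in>omap W (a, b). cmpv K X a T b Z d t (u (a, b) m) = \<phi> a m"
  and uniq: "!!Z b d t t'. Z \<in> lobj C ==> b \<in> obj B ==> d \<in> obj (ext C Z) ==> t \<in> omap (lhom C T Z) (b, d) ==> t' \<in> omap (lhom C T Z) (b, d) ==>
   (!!a m. a \<in> obj A ==> m \<in> omap W (a, b) ==> cmpv K X a T b Z d t (u (a, b) m) =
     cmpv K X a T b Z d t' (u (a, b) m)) ==> t = t'"
 shows "is_tensor C A B W X T u"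
proof (rule is_tensorI)
 fix D U Z h assume U: "lex_prof B D U" and Z: "Z \<in> lobj C" and eZ: "ext C Z = D" and h: "two_cell A D (tensor A B D U W) (lhom C X Z) h"
 interpret UW: composable A B D U W by (rule composable_lex[OF W U])
 note pU = lex_profD(3)[OF U]
 note catD = prof_cats(2)[OF pU]
 let ?h = "\<lambda>a b d n m. h (a, d) (UW.cls a d (b, n, m))" and ?c = "\<lambda>a b d. cmpv K X a T b Z d" and ?H = "lhom C T Z"
 have hin: "?h a b d n m \<in> omap (lhom C X Z) (a, d)"
  if "a \<in> obj A" "b \<in> obj B" "d \<in> obj D" "n \<in> omap U (b, d)" "m \<in> omap W (a, b)" for a b d n m
  using that by (intro cell_in[OF h] UW.tensor_in)
 have hn: "h (a', d) (UW.cls a' d (b, n, lact B W b a a' p m)) =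
   cmpv K X a' X a Z d (?h a b d n m) (lidm C X (a', a) p)"
  if i: "b \<in> obj B" "d \<in> obj D" "n \<in> omap U (b, d)" "p \<in> hom A a' a" "m \<in> omap W (a, b)" for a a' b d n m p
  using UW.tensor_cell_nat[OF h i(4) cat_id[OF catD i(2)] i(1,3,5)] act_left[OF X Z, of p a' a d "?h a b d n m"]
   hin[OF _ i(1,2,3,5)] hom_obj[OF catA i(4)] i by (simp add: prof_id[OF pU i(1,2,3)] eX eZ)
 \<comment> \<open>With n frozen, h becomes a single cocone on W(-,b); the values chosen for the
   various n remain to be shown natural.\<close>
 have "\<exists>t. b \<in> obj B \<longrightarrow> d \<in> obj D \<longrightarrow> n \<in> omap U (b, d) \<longrightarrow> t \<in> omap ?H (b, d) &
   (\<forall>a\<in>obj A. \<forall>m\<in>omap W (a, b). ?c a b d t (u (a, b) m) = ?h a b d n m)" for b d n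
  using ex[OF Z, of b d "\<lambda>a m. ?h a b d n m"] hin hn eZ by blast
 then obtain s where s: "!!b d n. b \<in> obj B ==> d \<in> obj D ==> n \<in> omap U (b, d) ==> s b d n \<in> omap ?H (b, d)"
  "!!a b d n m. b \<in> obj B ==> d \<in> obj D ==> n \<in> omap U (b, d) ==> a \<in> obj A ==> m \<in> omap W (a, b) ==>
   ?c a b d (s b d n) (u (a, b) m) = ?h a b d n m" by metis
 have pTZ: "is_prof B D ?H" using hom_is_prof[OF T Z] eT eZ by simp
 have "two_cell B D U ?H (mk_cell B D U s)"
 proof (rule cellI[OF pU pTZ s(1)])
  fix b d b' d' r q n assume r: "r \<in> hom B b' b" and q: "q \<in> hom D d d'" and n: "n \<in> omap U (b, d)"
  have o: "b \<in> obj B" "b' \<in> obj B" "d \<in> obj D" "d' \<in> obj D" using hom_obj[OF catB r] hom_obj[OF catD q] by auto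
  note n' = prof_act[OF pU n r q] and sn = s(1)[OF o(1,3) n]
  have act: "mmap ?H (b, d) (b', d') (r, q) (s b d n) = cmpv K T b' Z d Z d' (lidm C Z (d, d') q)
    (cmpv K T b' T b Z d (s b d n) (lidm C T (b', b) r))"
   using act_eq[OF T Z, of r b' b q d d' "s b d n"] r q sn by (simp add: eT eZ)
  have R: "lidm C T (b', b) r \<in> homv K T b' T b" and Q: "lidm C Z (d, d') q \<in> homv K Z d Z d'"
   and S: "s b d n \<in> homv K T b Z d"
   using T Z o sn idm_in[OF T, of r b' b] idm_in[OF Z, of q d d'] r q by (simp_all add: eT eZ)
  show "s b' d' (mmap U (b, d) (b', d') (r, q) n) = mmap ?H (b, d) (b', d') (r, q) (s b d n)"
  \<comment> \<open>Naturality of s is decided after composing with u, where uniqueness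
    applies.\<close>
  proof (rule uniq[OF Z o(2) _ s(1)[OF o(2,4) n'] prof_act[OF pTZ sn r q]])
   show "d' \<in> obj (ext C Z)" using o eZ by simp
   fix a m assume a: "a \<in> obj A" and m: "m \<in> omap W (a, b')"
   have um: "u (a, b') m \<in> homv K X a T b'" using u_in[OF a o(2) m] X T a o eX eT by simp
   note ia = cat_id[OF catA a]
   note m' = prof_act[OF pW m ia r]
   have "?c a b' d' (mmap ?H (b, d) (b', d') (r, q) (s b d n)) (u (a, b') m) =
    cmpv K X a Z d Z d' (lidm C Z (d, d') q)
     (?c a b d (s b d n) (cmpv K X a T b' T b (lidm C T (b', b) r) (u (a, b') m)))"
    unfolding act cat_assoc[OF tot_category um cat_cmp[OF tot_category S R] Q] cat_assoc[OF tot_category um R S] ..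
   also have "cmpv K X a T b' T b (lidm C T (b', b) r) (u (a, b') m) = u (a, b) (ract A W a b' b r m)"
    by (rule u_right[OF m r a, symmetric])
   also have "?c a b d (s b d n) (u (a, b) (ract A W a b' b r m)) =
     h (a, d) (UW.cls a d (b, n, ract A W a b' b r m))"
    by (rule s(2)[OF o(1,3) n a m'])
   also have "cmpv K X a Z d Z d' (lidm C Z (d, d') q) (h (a, d) (UW.cls a d (b, n, ract A W a b' b r m))) =
     ract A (lhom C X Z) a d d' q (h (a, d) (UW.cls a d (b, n, ract A W a b' b r m)))"
    using act_right[OF X Z, of a q d d'] hin[OF a o(1,3) n m'] a q by (simp add: eX eZ)
   also have "\<dots> = h (a, d') (UW.cls a d' (b, ract B U b d d' q n, ract A W a b' b r m))"
    using UW.tensor_cell_nat[OF h ia q o(1) n m'] by (simp add: prof_id[OF pW a o(1) m'])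
   \<comment> \<open>The coend relation moves the action of r from W over to U.\<close>
   also have "UW.cls a d' (b, ract B U b d d' q n, ract A W a b' b r m) =
     UW.cls a d' (b', lact D U d' b b' r (ract B U b d d' q n), m)"
    by (rule UW.cls_step[OF a o(4) r prof_act[OF pU n cat_id[OF catB o(1)] q] m, symmetric])
   also have "lact D U d' b b' r (ract B U b d d' q n) = mmap U (b, d) (b', d') (r, q) n"
    by (rule prof_split(2)[OF pU n r q, symmetric])
   finally show "?c a b' d' (s b' d' (mmap U (b, d) (b', d') (r, q) n)) (u (a, b') m) =
    ?c a b' d' (mmap ?H (b, d) (b', d') (r, q) (s b d n)) (u (a, b') m)"
    by (simp add: s(2)[OF o(2,4) n' a m])
  qed
 qed
 then show "\<exists>f. two_cell B D U ?H f & (\<forall>a\<in>obj A. \<forall>b\<in>obj B. \<forall>d\<in>obj D. \<forall>n\<in>omap U (b, d). \<forall>m\<in>omap W (a, b).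
    ?c a b d (f (b, d) n) (u (a, b) m) = ?h a b d n m)"
  by (intro exI[of _ "mk_cell B D U s"]) (simp add: s)
next
 fix D U Z f f' b d n assume U: "lex_prof B D U" and Z: "Z \<in> lobj C" and eZ: "ext C Z = D"
  and f: "two_cell B D U (lhom C T Z) f" and f': "two_cell B D U (lhom C T Z) f'"
  and e: "!!a b d n m. a \<in> obj A ==> b \<in> obj B ==> d \<in> obj D ==> n \<in> omap U (b, d) ==> m \<in> omap W (a, b) ==>
    cmpv K X a T b Z d (f (b, d) n) (u (a, b) m) = cmpv K X a T b Z d (f' (b, d) n) (u (a, b) m)"
  and i: "b \<in> obj B" "d \<in> obj D" "n \<in> omap U (b, d)"
 show "f (b, d) n = f' (b, d) n"
  by (rule uniq[OF Z i(1) _ cell_in[OF f i] cell_in[OF f' i]]) (use e i eZ in auto)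
qed

end

lemma tensor_weighted: "lp_category C ==> is_tensor C A B W X T u ==> weighted C A B W X T u"
 unfolding is_tensor_def by unfold_locales auto

section \<open>Represented weights\<close>

text \<open>A weight \<open>W \<cong> A(-, G-)\<close>, presented by universal elements \<open>w b\<close> of \<open>W(G b, b)\<close>.\<close>

locale rep_weight =
 fixes A B :: "'v::universe vcat" and W :: "'v prof" and G w :: "'v => 'v"
 assumes W: "lex_prof A B W"
  and G: "b \<in> obj B ==> G b \<in> obj A"
  and w: "b \<in> obj B ==> w b \<in> omap W (G b, b)"
  and rep: "b \<in> obj B ==> a \<in> obj A ==> m \<in> omap W (a, b) ==>
   \<exists>!p. p \<in> hom A a (G b) & lact B W b (G b) a p (w b) = m"
begin

lemma lexA: "small_lex_cat A" and lexB: "small_lex_cat B" and pW: "is_prof A B W"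
 using lex_profD[OF W] by auto

lemma catA: "category A" and catB: "category B"
 using lexA lexB by (auto dest: small_lex_catD)

text \<open>The morphism a -> G b classifying an element m of W(a,b); inverse to acting on the
  universal element \<open>w b\<close>.\<close>

definition cl :: "'v => 'v => 'v => 'v" where
 "cl a b m = (THE p. p \<in> hom A a (G b) & lact B W b (G b) a p (w b) = m)"

lemma cl: "b \<in> obj B ==> a \<in> obj A ==> m \<in> omap W (a, b) ==> cl a b m \<in> hom A a (G b)"
 and cl_eq: "b \<in> obj B ==> a \<in> obj A ==> m \<in> omap W (a, b) ==> lact B W b (G b) a (cl a b m) (w b) = m"
 using theI'[OF rep] unfolding cl_def by blast+

lemma cl_act: "b \<in> obj B ==> p \<in> hom A a (G b) ==> cl a b (lact B W b (G b) a p (w b)) = p"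
 unfolding cl_def
 by (rule the1_equality[OF rep]) (auto dest: hom_dom[OF catA] intro: prof_act[OF pW w] cat_id[OF catB])

lemma w_act: "b \<in> obj B ==> p \<in> hom A a (G b) ==> lact B W b (G b) a p (w b) \<in> omap W (a, b)"
 by (intro prof_act[OF pW w] cat_id[OF catB])

lemma w_cmp: "b \<in> obj B ==> p \<in> hom A a (G b) ==> q \<in> hom A a' a ==>
  lact B W b a a' q (lact B W b (G b) a p (w b)) =
  lact B W b (G b) a' (cmp A a' a (G b) p q) (w b)"
 using prof_cmp[OF pW w, of b p a q a' "idm B b" b "idm B b" b] cat_id[OF catB, of b] cat_id_left[OF catB, of "idm B b" b b] by simp

lemma cl_cmp: "b \<in> obj B ==> m \<in> omap W (a, b) ==> q \<in> hom A a' a ==>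
  cl a' b (lact B W b a a' q m) = cmp A a' a (G b) (cl a b m) q"
proof -
 assume b: "b \<in> obj B" and m: "m \<in> omap W (a, b)" and q: "q \<in> hom A a' a"
 note a = hom_cod[OF catA q]
 note p = cl[OF b a m]
 show ?thesis
  using cl_act[OF b cat_cmp[OF catA p q]] w_cmp[OF b p q] cl_eq[OF b a m] by simp
qed

text \<open>The action on morphisms is the one that makes the bijections between W(a,b) and A(a, G
  b) natural in b.\<close>

definition GF :: "'v vfunc" where
 "GF = mk_func B G (\<lambda>b b' r. cl (G b) b' (ract A W (G b) b b' r (w b)))"

lemma wr_in: "r \<in> hom B b b' ==> ract A W (G b) b b' r (w b) \<in> omap W (G b, b')"
 using hom_obj[OF catB, of r b b'] by (intro prof_act[OF pW w] cat_id[OF catA G]) auto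

lemma GF_simps [simp]: "b \<in> obj B ==> omap GF b = G b"
 "r \<in> hom B b b' ==> mmap GF b b' r = cl (G b) b' (ract A W (G b) b b' r (w b))"
 using hom_obj[OF catB, of r b b'] by (simp_all add: GF_def)

lemma GF_w: "r \<in> hom B b b' ==>
  lact B W b' (G b') (G b) (mmap GF b b' r) (w b') = ract A W (G b) b b' r (w b)"
 using hom_obj[OF catB, of r b b'] by (simp add: cl_eq G wr_in)

lemma GF_hom: "r \<in> hom B b b' ==> mmap GF b b' r \<in> hom A (G b) (G b')"
 using hom_obj[OF catB, of r b b'] by (simp add: cl G wr_in)

lemma cl_right: "r \<in> hom B b b' ==> a \<in> obj A ==> m \<in> omap W (a, b) ==>
  cl a b' (ract A W a b b' r m) = cmp A a (G b) (G b') (mmap GF b b' r) (cl a b m)"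
proof -
 assume r: "r \<in> hom B b b'" and a: "a \<in> obj A" and m: "m \<in> omap W (a, b)"
 have o: "b \<in> obj B" "b' \<in> obj B" using hom_obj[OF catB r] by auto
 note p = cl[OF o(1) a m]
 have "ract A W a b b' r m = ract A W a b b' r (lact B W b (G b) a (cl a b m) (w b))"
  by (simp add: cl_eq[OF o(1) a m])
 also have "\<dots> = lact B W b' (G b) a (cl a b m) (ract A W (G b) b b' r (w b))"
  using prof_split[OF pW w[OF o(1)] p r] by simp
 also have "\<dots> = lact B W b' (G b') a (cmp A a (G b) (G b') (mmap GF b b' r) (cl a b m)) (w b')"
  unfolding GF_w[OF r, symmetric] by (rule w_cmp[OF o(2) GF_hom[OF r] p])
 finally show ?thesis using cl_act[OF o(2) cat_cmp[OF catA GF_hom[OF r] p]] by simp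
qed

lemma GF_functor: "is_functor B A GF"
 unfolding GF_def
proof (rule functorI[OF catB catA G], goal_cases)
 case (2 b b' r) then show ?case by (intro cl wr_in G)
next
 case (3 b)
 then show ?case using cl_act[OF 3 cat_id[OF catA G[OF 3]]] by simp
next
 case (4 b c d k h)
 note ig = cat_id[OF catA G[OF 4(1)]]
 have e: "ract A W (G b) b d (cmp B b c d k h) (w b) =
   ract A W (G b) c d k (ract A W (G b) b c h (w b))"
  using prof_cmp[OF pW w[OF 4(1)] ig ig 4(5,4)] by (simp add: cat_id_left[OF catA ig])
 show ?case unfolding e using cl_right[OF 4(4) G[OF 4(1)] wr_in[OF 4(5)]] 4 by simp
qed

text \<open>The classifying bijections carry exactness of W(a,-) over to A(a, G-).\<close>

lemma GF_lex: "lex_functor B A GF"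
 unfolding lex_functor_iff_hom[OF GF_functor]
proof
 fix a assume a: "a \<in> obj A"
 show "lex_action B (\<lambda>b. hom A a (omap GF b)) (\<lambda>b b' g h. cmp A a (omap GF b) (omap GF b') (mmap GF b b' g) h)"
 proof (rule lex_action_iso[OF lex_prof_action[OF W a], where \<phi> = "\<lambda>b. cl a b"], goal_cases)
  case (1 b)
  show ?case
   by (rule bij_betw_byWitness[where f' = "\<lambda>p. lact B W b (G b) a p (w b)"])
    (auto simp: 1 a cl_eq cl_act intro: cl w_act)
 next
  case (2 b b' g x) then show ?case using cl_right[OF 2(3) a 2(4)] by simp
 next
  case (3 b b' g x) then show ?case by (intro prof_act[OF pW] cat_id[OF catA a])
 qed
qed

end

text \<open>Cells out of \<open>D(H-, -) \<otimes> W\<close> are, by the Yoneda lemma, families natural over \<open>A\<close> and \<open>B\<close>.\<close>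

context weighted begin

context
 fixes D H Z
 assumes t: "is_tensor C A B W X T u" and H: "is_functor B D H" and Z: "Z \<in> lobj C" and eZ: "ext C Z = D"
begin

abbreviation "L d d' n \<equiv> lidm C Z (d, d') n"
abbreviation "U \<equiv> hom_prof B D D H (id_func D)"

lemma catD: "category D" and lexD: "small_lex_cat D"
 using ext_cat[OF Z] ext_lex[OF Z] eZ by auto

lemma L: "n \<in> hom D d d' ==> L d d' n \<in> homv K Z d Z d'"
 using functor_hom[OF inc_functor[OF Z], of n d d'] hom_obj[OF catD, of n d d'] Z by (simp add: eZ)

lemma L_id: "d \<in> obj D ==> L d d (idm D d) = idm K (vpair Z d)"
 using functor_id[OF inc_functor[OF Z], of d] cat_id[OF catD, of d] Z by (simp add: eZ)

lemma L_cmp: "n \<in> hom D d d' ==> q \<in> hom D d' d'' ==>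
  L d d'' (cmp D d d' d'' q n) = cmpv K Z d Z d' Z d'' (L d' d'' q) (L d d' n)"
 using functor_cmp[OF inc_functor[OF Z], of q d' d'' n d] hom_obj[OF catD] cat_cmp[OF catD] Z by (simp add: eZ)

lemma U_lex: "lex_prof B D U"
 by (rule hom_prof_lex[OF H id_lex[OF catD] _ lex_profD(2)[OF W] lexD]) (use lexD in \<open>simp add: small_lex_cat_def\<close>)

lemma U_simps: "b \<in> obj B ==> d \<in> obj D ==> omap U (b, d) = hom D (omap H b) d"
 "p \<in> hom B b' b ==> q \<in> hom D d d' ==> n \<in> hom D (omap H b) d ==>
  mmap U (b, d) (b', d') (p, q) n = cmp D (omap H b') d d' q (cmp D (omap H b') (omap H b) d n (mmap H b' b p))"
 using catB catD hom_obj[OF catD, of q d d'] by simp_all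

lemma family_nat:
 assumes "!!b. b \<in> obj B ==> f b \<in> homv K T b Z (omap H b)"
  and "!!b b' r. r \<in> hom B b b' ==> cmpv K T b T b' Z (omap H b') (f b') (lidm C T (b, b') r) =
   cmpv K T b Z (omap H b) Z (omap H b') (L (omap H b) (omap H b') (mmap H b b' r)) (f b)"
 shows "nat_trans B K (inc C T) (comp_func B (inc C Z) H) (restrict f (obj B))"
 by (rule natI[OF inc_functor[OF T, unfolded eT] comp_functor[OF H inc_functor[OF Z, unfolded eZ]]])
  (use assms functor_obj[OF H] functor_hom[OF H] T Z in \<open>simp_all add: eT eZ del: tot_hom\<close>)

lemma tensor_family:
 assumes \<phi>: "!!a b m. a \<in> obj A ==> b \<in> obj B ==> m \<in> omap W (a, b) ==> \<phi> a b m \<in> homv K X a Z (omap H b)"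
  and l: "!!a a' b p m. p \<in> hom A a' a ==> b \<in> obj B ==> m \<in> omap W (a, b) ==>
   \<phi> a' b (lact B W b a a' p m) = cmpv K X a' X a Z (omap H b) (\<phi> a b m) (lidm C X (a', a) p)"
  and r: "!!a b b' r m. a \<in> obj A ==> r \<in> hom B b b' ==> m \<in> omap W (a, b) ==>
   \<phi> a b' (ract A W a b b' r m) =
   cmpv K X a Z (omap H b) Z (omap H b') (L (omap H b) (omap H b') (mmap H b b' r)) (\<phi> a b m)"
 shows "\<exists>f. nat_trans B K (inc C T) (comp_func B (inc C Z) H) f &
  (\<forall>a\<in>obj A. \<forall>b\<in>obj B. \<forall>m\<in>omap W (a, b). cmpv K X a T b Z (omap H b) (f b) (u (a, b) m) = \<phi> a b m)"
proof -
 let ?h = "omap H" and ?x = "vpair X" and ?t = "vpair T" and ?z = "vpair Z"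
 note Ho = functor_obj[OF H] and Hh = functor_hom[OF H] and cK = tot_category
 interpret UW: composable A B D U W by (rule composable_lex[OF W U_lex])
 \<comment> \<open>The Yoneda extension of \<phi>: an element n of D(H b, d) acts on the component
   at H b.\<close>
 define s where "s a b d n m = cmp K (?x a) (?z (?h b)) (?z d) (L (?h b) d n) (\<phi> a b m)" for a b d n m
 have P: "is_prof A D (lhom C X Z)" "is_prof B D (lhom C T Z)" using hom_is_prof[OF X Z] hom_is_prof[OF T Z] by (simp_all add: eX eT eZ)
 have sh: "s a b d n m \<in> hom K (?x a) (?z d)" if "a \<in> obj A" "b \<in> obj B" "n \<in> hom D (?h b) d" "m \<in> omap W (a, b)" for a b d n m
  unfolding s_def by (rule cat_cmp[OF cK L[OF that(3)] \<phi>[OF that(1,2,4)]])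
 have 1: "s a b d n m \<in> omap (lhom C X Z) (a, d)"
  if "a \<in> obj A" "b \<in> obj B" "d \<in> obj D" "n \<in> omap U (b, d)" "m \<in> omap W (a, b)" for a b d n m
  using sh[OF that(1,2) _ that(5), of n d] that X Z by (simp add: U_simps eX eZ)
 have 2: "s a b d (lact D U d b' b g n) m = s a b' d n (ract A W a b b' g m)"
  if h: "a \<in> obj A" "d \<in> obj D" "g \<in> hom B b b'" "n \<in> omap U (b', d)" "m \<in> omap W (a, b)" for a b b' d g n m
 proof -
  have o: "b \<in> obj B" "b' \<in> obj B" using hom_obj[OF catB h(3)] by auto
  have n: "n \<in> hom D (?h b') d" using h o by (simp add: U_simps)
  show ?thesis unfolding s_def U_simps(2)[OF h(3) cat_id[OF catD h(2)] n] cat_id_left[OF catD cat_cmp[OF catD n Hh[OF h(3)]]]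
   L_cmp[OF Hh[OF h(3)] n] r[OF h(1,3,5)] by (rule cat_assoc[OF cK \<phi>[OF h(1) o(1) h(5)] L[OF Hh[OF h(3)]] L[OF n]])
 qed
 have 3: "s a' b d' (ract B U b d d' g n) (lact B W b a a' f m) = mmap (lhom C X Z) (a, d) (a', d') (f, g) (s a b d n m)"
  if h: "f \<in> hom A a' a" "g \<in> hom D d d'" "b \<in> obj B" "n \<in> omap U (b, d)" "m \<in> omap W (a, b)" for a a' b d d' f g n m
 proof -
  have o: "a \<in> obj A" "a' \<in> obj A" "d \<in> obj D" "d' \<in> obj D" using hom_obj[OF catA h(1)] hom_obj[OF catD h(2)] by auto
  have n: "n \<in> hom D (?h b) d" using h o by (simp add: U_simps)
  have Xf: "lidm C X (a', a) f \<in> hom K (?x a') (?x a)" using idm_in[OF X] h(1) o X by (simp add: eX)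
  note p = \<phi>[OF o(1) h(3,5)]
  show ?thesis
   using act_eq[OF X Z, of f a' a g d d' "s a b d n m"] 1[OF o(1) h(3) o(3) h(4,5)] h(1,2)
   unfolding s_def U_simps(2)[OF cat_id[OF catB h(3)] h(2) n] functor_id[OF H h(3)] cat_id_right[OF catD n] L_cmp[OF n h(2)] l[OF h(1,3,5)]
    cat_assoc[OF cK cat_cmp[OF cK p Xf] L[OF n] L[OF h(2)]] by (simp add: eX eZ cat_assoc[OF cK Xf p L[OF n]])
 qed
 let ?g = "mk_cell A D UW.NM (\<lambda>a c z. case UW.rep a c z of (b, n, m) => s a b c n m)"
 have "two_cell A D UW.NM (lhom C X Z) ?g" by (rule UW.tensor_cellI(1)[OF P(1)]) (fact 1 2 3)+
 then obtain f where f: "two_cell B D U (lhom C T Z) f" and fc: "\<forall>a\<in>obj A. \<forall>b\<in>obj B. \<forall>d\<in>obj D. \<forall>n\<in>omap U (b, d). \<forall>m\<in>omap W (a, b).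
   cmp K (?x a) (?t b) (?z d) (f (b, d) n) (u (a, b) m) = ?g (a, d) (UW.cls a d (b, n, m))"
  using tensorD(1)[OF t U_lex Z eZ] by blast
 have fu: "cmp K (?x a) (?t b) (?z d) (f (b, d) n) (u (a, b) m) = s a b d n m"
  if h: "a \<in> obj A" "b \<in> obj B" "d \<in> obj D" "n \<in> omap U (b, d)" "m \<in> omap W (a, b)" for a b d n m
  unfolding fc[rule_format, OF h] by (rule UW.tensor_cellI(2)[OF P(1)]) (fact 1 2 3 h)+
 \<comment> \<open>A 2-cell out of D(H-,-) is recovered from its values at identities.\<close>
 define v where "v b = f (b, ?h b) (idm D (?h b))" for b
 have iU: "idm D (?h b) \<in> omap U (b, ?h b)" if "b \<in> obj B" for b using that Ho[OF that] cat_id[OF catD Ho[OF that]] by (simp add: U_simps)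
 have vl: "v b \<in> omap (lhom C T Z) (b, ?h b)" if "b \<in> obj B" for b unfolding v_def by (rule cell_in[OF f that Ho[OF that] iU[OF that]])
 have "nat_trans B K (inc C T) (comp_func B (inc C Z) H) (restrict v (obj B))"
 proof (rule family_nat)
  show "v b \<in> hom K (?t b) (?z (?h b))" if "b \<in> obj B" for b using vl[OF that] that Ho[OF that] T Z by (simp add: eT eZ)
 next
  fix b b' r assume r: "r \<in> hom B b b'"
  have o: "b \<in> obj B" "b' \<in> obj B" using hom_obj[OF catB r] by auto
  note Hr = Hh[OF r] and i = cat_id[OF catD Ho[OF o(1)]] cat_id[OF catD Ho[OF o(2)]]
  have "cmp K (?t b) (?t b') (?z (?h b')) (v b') (lidm C T (b, b') r) = lact D (lhom C T Z) (?h b') b' b r (v b')"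
   using act_left[OF T Z, of r b b' "?h b'" "v b'"] vl[OF o(2)] r Ho[OF o(2)] by (simp add: eT eZ)
  also have "\<dots> = f (b, ?h b') (lact D U (?h b') b' b r (idm D (?h b')))"
   unfolding v_def by (rule cell_nat[OF f catB catD iU[OF o(2)] r i(2), symmetric])
  also have "lact D U (?h b') b' b r (idm D (?h b')) = ract B U b (?h b) (?h b') (mmap H b b' r) (idm D (?h b))"
   unfolding U_simps(2)[OF r i(2) i(2)] U_simps(2)[OF cat_id[OF catB o(1)] Hr i(1)] functor_id[OF H o(1)]
   by (simp add: cat_id_left[OF catD Hr] cat_id_right[OF catD Hr] cat_id_right[OF catD i(1)])
  also have "f (b, ?h b') \<dots> = ract B (lhom C T Z) b (?h b) (?h b') (mmap H b b' r) (v b)"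
   unfolding v_def by (rule cell_nat[OF f catB catD iU[OF o(1)] cat_id[OF catB o(1)] Hr])
  also have "\<dots> = cmp K (?t b) (?z (?h b)) (?z (?h b')) (L (?h b) (?h b') (mmap H b b' r)) (v b)"
   using act_right[OF T Z, of b "mmap H b b' r" "?h b" "?h b'" "v b"] vl[OF o(1)] Hr o(1) by (simp add: eT eZ)
  finally show "cmp K (?t b) (?t b') (?z (?h b')) (v b') (lidm C T (b, b') r) = \<dots>" .
 qed
 moreover have "cmp K (?x a) (?t b) (?z (?h b)) (v b) (u (a, b) m) = \<phi> a b m" if "a \<in> obj A" "b \<in> obj B" "m \<in> omap W (a, b)" for a b m
  unfolding v_def fu[OF that(1,2) Ho[OF that(2)] iU[OF that(2)] that(3)] s_def L_id[OF Ho[OF that(2)]] by (rule cat_id_left[OF cK \<phi>[OF that]])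
 ultimately show ?thesis by (intro exI[of _ "restrict v (obj B)"]) simp
qed

lemma tensor_family_eq:
 assumes f: "nat_trans B K (inc C T) (comp_func B (inc C Z) H) f" and f': "nat_trans B K (inc C T) (comp_func B (inc C Z) H) f'"
  and e: "!!a b m. a \<in> obj A ==> b \<in> obj B ==> m \<in> omap W (a, b) ==>
   cmpv K X a T b Z (omap H b) (f b) (u (a, b) m) = cmpv K X a T b Z (omap H b) (f' b) (u (a, b) m)"
 shows "f = f'"
proof -
 let ?h = "omap H" and ?x = "vpair X" and ?t = "vpair T" and ?z = "vpair Z"
 note Ho = functor_obj[OF H] and Hh = functor_hom[OF H] and cK = tot_category
 \<comment> \<open>The 2-cell out of D(H-,-) generated by the family f; uniqueness for families is
   the uniqueness of \<open>tensorD\<close> for these 2-cells.\<close>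
 define c where "c f = mk_cell B D U (\<lambda>b d n. cmp K (?t b) (?z (?h b)) (?z d) (L (?h b) d n) (f b))" for f :: "'v => 'v"
 have fh: "f b \<in> hom K (?t b) (?z (?h b))" if "nat_trans B K (inc C T) (comp_func B (inc C Z) H) f" "b \<in> obj B" for f b
  using nat_hom[OF that] that(2) Ho[OF that(2)] by (simp add: eT eZ del: tot_hom)
 have fn: "cmp K (?t b) (?t b') (?z (?h b')) (f b') (lidm C T (b, b') r) = cmp K (?t b) (?z (?h b)) (?z (?h b')) (L (?h b) (?h b') (mmap H b b' r)) (f b)"
  if "nat_trans B K (inc C T) (comp_func B (inc C Z) H) f" "r \<in> hom B b b'" for f b b' r
  using nat_nat[OF that] that(2) hom_obj[OF catB that(2)] Ho Hh[OF that(2)] T Z by (simp add: eT eZ)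
 have P: "is_prof B D (lhom C T Z)" using hom_is_prof[OF T Z] by (simp add: eT eZ)
 have cc: "two_cell B D U (lhom C T Z) (c f)" if f: "nat_trans B K (inc C T) (comp_func B (inc C Z) H) f" for f
  unfolding c_def
 proof (rule cellI[OF lex_profD(3)[OF U_lex] P])
  fix b d n assume h: "b \<in> obj B" "d \<in> obj D" "n \<in> omap U (b, d)"
  then show "cmp K (?t b) (?z (?h b)) (?z d) (L (?h b) d n) (f b) \<in> omap (lhom C T Z) (b, d)"
   using cat_cmp[OF cK L fh[OF f h(1)], of n d] T Z by (simp add: U_simps eT eZ)
 next
  fix b d b' d' p q n assume p: "p \<in> hom B b' b" and q: "q \<in> hom D d d'" and "n \<in> omap U (b, d)"
  have o: "b \<in> obj B" "b' \<in> obj B" "d \<in> obj D" "d' \<in> obj D" using hom_obj[OF catB p] hom_obj[OF catD q] by auto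
  have n: "n \<in> hom D (?h b) d" using \<open>n \<in> omap U (b, d)\<close> o by (simp add: U_simps)
  have Tp: "lidm C T (b', b) p \<in> hom K (?t b') (?t b)" using idm_in[OF T] p o T by (simp add: eT)
  note i = fh[OF f o(1)] fh[OF f o(2)] L[OF n] L[OF q] L[OF Hh[OF p]]
  have "cmp K (?t b') (?z (?h b')) (?z d') (L (?h b') d' (mmap U (b, d) (b', d') (p, q) n)) (f b') =
   cmp K (?t b') (?z d) (?z d') (L d d' q) (cmp K (?t b') (?t b) (?z d) (cmp K (?t b) (?z (?h b)) (?z d) (L (?h b) d n) (f b)) (lidm C T (b', b) p))"
   unfolding U_simps(2)[OF p q n] L_cmp[OF cat_cmp[OF catD n Hh[OF p]] q] L_cmp[OF Hh[OF p] n]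
    cat_assoc[OF cK i(2) cat_cmp[OF cK i(3,5)] i(4)] cat_assoc[OF cK i(2,5,3)] cat_assoc[OF cK Tp i(1,3)] fn[OF f p] ..
  also have "\<dots> = mmap (lhom C T Z) (b, d) (b', d') (p, q) (cmp K (?t b) (?z (?h b)) (?z d) (L (?h b) d n) (f b))"
   using act_eq[OF T Z, of p b' b q d d'] p q cat_cmp[OF cK i(3,1)] T Z o by (simp add: eT eZ)
  finally show "cmp K (?t b') (?z (?h b')) (?z d') (L (?h b') d' (mmap U (b, d) (b', d') (p, q) n)) (f b') = \<dots>" .
 qed
 have "c f = c f'"
 proof (rule tensorD(2)[OF t U_lex Z eZ cc[OF f] cc[OF f']])
  fix a b d n m assume h: "a \<in> obj A" "b \<in> obj B" "d \<in> obj D" "n \<in> omap U (b, d)" "m \<in> omap W (a, b)"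
  then have n: "n \<in> hom D (?h b) d" by (simp add: U_simps)
  have um: "u (a, b) m \<in> hom K (?x a) (?t b)" using u_in[OF h(1,2,5)] X T h by (simp add: eX eT)
  show "cmp K (?x a) (?t b) (?z d) (c f (b, d) n) (u (a, b) m) = cmp K (?x a) (?t b) (?z d) (c f' (b, d) n) (u (a, b) m)"
   unfolding c_def using h e[OF h(1,2,5)] by (simp add: cat_assoc[OF cK um fh[OF f h(2)] L[OF n]] cat_assoc[OF cK um fh[OF f' h(2)] L[OF n]])
 qed
 have cf: "c f (b, ?h b) (idm D (?h b)) = f b" if "b \<in> obj B" "nat_trans B K (inc C T) (comp_func B (inc C Z) H) f" for b f
  unfolding c_def using that cat_id[OF catD Ho[OF that(1)]] Ho[OF that(1)] cat_id_left[OF cK fh[OF that(2,1)]] by (simp add: U_simps L_id)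
 show ?thesis
  by (rule nat_eqI[OF f f' refl]) (use cf[OF _ f] cf[OF _ f'] \<open>c f = c f'\<close> in metis)
qed

end

end

section \<open>Tensors by represented weights\<close>

locale rep_weighted = weighted C A B W X T u + R: rep_weight A B W G w
 for C :: "'v::universe lpcat" and A B W X T u G w
begin

abbreviation "e b \<equiv> u (G b, b) (w b)"

lemma e_in: "b \<in> obj B ==> e b \<in> homv K X (G b) T b"
 using u_in[OF R.G _ R.w, of b] R.G[of b] X T by (simp add: eX eT)

lemma u_e: "b \<in> obj B ==> a \<in> obj A ==> m \<in> omap W (a, b) ==>
  u (a, b) m = cmpv K X a X (G b) T b (e b) (lidm C X (a, G b) (R.cl a b m))"
 using u_left[of "w b" "G b" b "R.cl a b m" a] R.w[of b] R.cl[of b a m] R.cl_eq[of b a m] by simp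

lemma e_nat: "r \<in> hom B b b' ==> cmpv K X (G b) T b T b' (lidm C T (b, b') r) (e b) =
  cmpv K X (G b) X (G b') T b' (e b') (lidm C X (G b, G b') (mmap R.GF b b' r))"
 using u_right[of "w b" "G b" b r b'] R.w[of b] u_e[of b' "G b" "ract A W (G b) b b' r (w b)"] R.wr_in[of r b b'] R.G[of b] hom_obj[OF catB, of r b b'] by simp

text \<open>Cocones on W(-,b) are determined by their value on \<open>w b\<close>, by Yoneda. Once
  the image \<open>e b\<close> of the universal element is invertible, the factorisation of \<phi>
  can only be \<phi>(w b) composed with the inverse of \<open>e b\<close>.\<close>

lemma inv_tensor:
 assumes i: "!!b. b \<in> obj B ==> is_iso K (vpair X (G b)) (vpair T b) (e b)"
 shows "is_tensor C A B W X T u"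
proof (rule pointwise_tensor)
 fix Z b d \<phi> assume Z: "Z \<in> lobj C" and b: "b \<in> obj B" and d: "d \<in> obj (ext C Z)"
  and \<phi>: "!!a m. a \<in> obj A ==> m \<in> omap W (a, b) ==> \<phi> a m \<in> omap (lhom C X Z) (a, d)"
  and nat: "!!a a' p m. p \<in> hom A a' a ==> m \<in> omap W (a, b) ==>
    \<phi> a' (lact B W b a a' p m) = cmpv K X a' X a Z d (\<phi> a m) (lidm C X (a', a) p)"
 obtain v where v: "v \<in> homv K T b X (G b)" "cmpv K X (G b) T b X (G b) v (e b) = idm K (vpair X (G b))"
  using i[OF b] by (rule is_isoD)
 have pw: "\<phi> (G b) (w b) \<in> homv K X (G b) Z d" using \<phi>[OF R.G[OF b] R.w[OF b]] X Z d R.G[OF b] by (simp add: eX)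
 note t = cat_cmp[OF tot_category pw v(1)]
 show "\<exists>t\<in>omap (lhom C T Z) (b, d). \<forall>a\<in>obj A. \<forall>m\<in>omap W (a, b). cmpv K X a T b Z d t (u (a, b) m) = \<phi> a m"
 proof (intro bexI[of _ "cmpv K T b X (G b) Z d (\<phi> (G b) (w b)) v"] ballI)
  show "cmpv K T b X (G b) Z d (\<phi> (G b) (w b)) v \<in> omap (lhom C T Z) (b, d)"
   using t T Z b d by (simp add: eT)
  fix a m assume a: "a \<in> obj A" and m: "m \<in> omap W (a, b)"
  note c = R.cl[OF b a m]
  have ic: "lidm C X (a, G b) (R.cl a b m) \<in> homv K X a X (G b)" using idm_in[OF X, of "R.cl a b m"] c X a R.G[OF b] by (simp add: eX)
  have xG: "vpair X (G b) \<in> obj K" using X R.G[OF b] by (simp add: eX)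
  have "cmpv K X a T b Z d (cmpv K T b X (G b) Z d (\<phi> (G b) (w b)) v) (u (a, b) m) =
   cmpv K X a X (G b) Z d (\<phi> (G b) (w b)) (lidm C X (a, G b) (R.cl a b m))"
   unfolding u_e[OF b a m] cat_assoc[OF tot_category ic e_in[OF b] t, symmetric] cat_assoc[OF tot_category e_in[OF b] v(1) pw] v(2)
    cat_id_right[OF tot_category pw] ..
  also have "\<dots> = \<phi> a m" using nat[OF c R.w[OF b]] R.cl_eq[OF b a m] by simp
  finally show "cmpv K X a T b Z d (cmpv K T b X (G b) Z d (\<phi> (G b) (w b)) v) (u (a, b) m) = \<phi> a m" .
 qed
next
 fix Z b d t t' assume Z: "Z \<in> lobj C" and b: "b \<in> obj B" and d: "d \<in> obj (ext C Z)" and t: "t \<in> omap (lhom C T Z) (b, d)" "t' \<in> omap (lhom C T Z) (b, d)"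
  and eq: "!!a m. a \<in> obj A ==> m \<in> omap W (a, b) ==> cmpv K X a T b Z d t (u (a, b) m) =
     cmpv K X a T b Z d t' (u (a, b) m)"
 obtain v where v: "v \<in> homv K T b X (G b)" "cmpv K T b X (G b) T b (e b) v = idm K (vpair T b)"
  using i[OF b] by (rule is_isoD)
 have t': "t \<in> homv K T b Z d" "t' \<in> homv K T b Z d" using t T Z b d by (simp_all add: eT)
 have "cmpv K T b X (G b) Z d (cmpv K X (G b) T b Z d t (e b)) v =
  cmpv K T b X (G b) Z d (cmpv K X (G b) T b Z d t' (e b)) v"
  using eq[OF R.G[OF b] R.w[OF b]] by simp
 then show "t = t'"
  using t' by (simp add: cat_assoc[OF tot_category v(1) e_in[OF b]] v(2) cat_id_right[OF tot_category])
qed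

lemma e_trans: "nat_trans B K (comp_func B (inc C X) R.GF) (inc C T) (restrict (\<lambda>b. e b) (obj B))"
proof (rule natI[OF comp_functor[OF R.GF_functor inc_functor[OF X, unfolded eX]] inc_functor[OF T, unfolded eT]])
 show "e b \<in> hom K (omap (comp_func B (inc C X) R.GF) b) (omap (inc C T) b)" if "b \<in> obj B" for b
  using e_in[OF that] that R.G[OF that] by (simp add: eX eT del: tot_hom)
qed (use e_nat R.G R.GF_hom X T in \<open>simp_all add: eX eT del: R.GF_simps(2)\<close>)

text \<open>The classifying morphisms form a cocone from X to its restriction along
  \<open>GF\<close>, and the map v out of T that it induces is inverse to \<open>e\<close>.\<close>

lemma tensor_inv:
 assumes t: "is_tensor C A B W X T u" and b: "b \<in> obj B"
 shows "is_iso K (vpair X (G b)) (vpair T b) (e b)"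
proof -
 note cK = tot_category and If = inc_functor[OF X, unfolded eX]
 have I: "lidm C X (a, a') p \<in> homv K X a X a'" if "p \<in> hom A a a'" for a a' p
  using functor_hom[OF If that] that hom_obj[OF catA that] X by (simp add: eX)
 have Ic: "lidm C X (a, c) (cmp A a a' c q p) = cmpv K X a X a' X c (lidm C X (a', c) q) (lidm C X (a, a') p)"
  if "q \<in> hom A a' c" "p \<in> hom A a a'" for a a' c p q
  using functor_cmp[OF If that] that hom_obj[OF catA that(1)] hom_obj[OF catA that(2)] X cat_cmp[OF catA that] by (simp add: eX)
 have "\<exists>f. nat_trans B K (inc C T) (comp_func B (inc C X) R.GF) f & (\<forall>a\<in>obj A. \<forall>b\<in>obj B. \<forall>m\<in>omap W (a, b).
   cmpv K X a T b X (omap R.GF b) (f b) (u (a, b) m) = lidm C X (a, G b) (R.cl a b m))"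
 proof (rule tensor_family[OF t R.GF_functor X eX], goal_cases)
  case (1 a b m) then show ?case using I[OF R.cl[OF 1(2,1,3)]] by simp
 next
  case (2 a a' b p m) then show ?case using Ic[OF R.cl[OF 2(2) hom_cod[OF catA 2(1)] 2(3)] 2(1)] R.cl_cmp[OF 2(2,3,1)] by simp
 next
  case (3 a b b' r m)
  then show ?case using Ic[OF R.GF_hom[OF 3(2)] R.cl[OF hom_dom[OF catB 3(2)] 3(1,3)]] R.cl_right[OF 3(2,1,3)] hom_obj[OF catB 3(2)]
   by (simp del: R.GF_simps(2))
 qed
 then obtain v where v: "nat_trans B K (inc C T) (comp_func B (inc C X) R.GF) v" and
  vu: "!!a b m. a \<in> obj A ==> b \<in> obj B ==> m \<in> omap W (a, b) ==> cmpv K X a T b X (G b) (v b) (u (a, b) m) = lidm C X (a, G b) (R.cl a b m)"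
  by auto
 have vh: "v b \<in> homv K T b X (G b)" if "b \<in> obj B" for b
  using nat_hom[OF v that] that R.G[OF that] by (simp add: eX eT del: tot_hom)
 have clw: "R.cl (G b) b (w b) = idm A (G b)" using R.cl_act[OF b cat_id[OF catA R.G[OF b]]] by (simp add: prof_id[OF R.pW R.G[OF b] b R.w[OF b]])
 have ve: "cmpv K X (G b) T b X (G b) (v b) (e b) = idm K (vpair X (G b))"
  using vu[OF R.G[OF b] b R.w[OF b]] clw X R.G[OF b] by (simp add: eX)
 have Ti: "comp_func B (inc C T) (id_func B) = inc C T" using inc_functor[OF T] eT by simp
 \<comment> \<open>One composite was the identity by evaluation at \<open>w b\<close>; for this one,
   both sides agree on the cocone u, so uniqueness applies.\<close>
 have "comp_trans B K (inc C T) (comp_func B (inc C X) R.GF) (inc C T) (restrict (\<lambda>b. e b) (obj B)) v = id_trans B K (inc C T)"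
 proof (rule tensor_family_eq[OF t id_functor[OF catB] T eT, unfolded Ti, OF comp_nat[OF v e_trans] id_nat[OF inc_functor[OF T, unfolded eT]]])
  fix a b m assume h: "a \<in> obj A" "b \<in> obj B" "m \<in> omap W (a, b)"
  have um: "u (a, b) m \<in> homv K X a T b" using u_in[OF h] X T h by (simp add: eX eT)
  have "cmpv K X a T b T b (cmpv K T b X (G b) T b (e b) (v b)) (u (a, b) m) = u (a, b) m"
   unfolding cat_assoc[OF cK um vh[OF h(2)] e_in[OF h(2)]] vu[OF h] using u_e[OF h(2,1,3)] by simp
  then show "cmpv K X a T b T (omap (id_func B) b) (comp_trans B K (inc C T) (comp_func B (inc C X) R.GF) (inc C T) (restrict (\<lambda>b. e b) (obj B)) v b) (u (a, b) m) =
   cmpv K X a T b T (omap (id_func B) b) (id_trans B K (inc C T) b) (u (a, b) m)"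
   using h R.G[OF h(2)] cat_id_left[OF cK um] by (simp add: eX eT del: tot_idm)
 qed
 from fun_cong[OF this, of b] have "cmpv K T b X (G b) T b (e b) (v b) = idm K (vpair T b)"
  using b R.G[OF b] by (simp add: eX eT del: tot_idm)
 then show ?thesis unfolding is_iso_def using ve vh[OF b] e_in[OF b] X T b R.G[OF b] by (auto simp: eX eT simp del: tot_hom tot_idm)
qed

end

lemma functor_iso:
 assumes F: "is_functor A B F" and i: "is_iso A a b f"
 shows "is_iso B (omap F a) (omap F b) (mmap F a b f)"
proof -
 obtain g where g: "g \<in> hom A b a" "cmp A a b a g f = idm A a" "cmp A b a b f g = idm A b" using i by (rule is_isoD)
 have f: "f \<in> hom A a b" "a \<in> obj A" "b \<in> obj A" using i unfolding is_iso_def by auto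
 show ?thesis unfolding is_iso_def
  using functor_obj[OF F] functor_hom[OF F] f g functor_cmp[OF F f(1) g(1)] functor_cmp[OF F g(1) f(1)] functor_id[OF F]
  by (metis (no_types, lifting))
qed

text \<open>By \<open>inv_tensor\<close> and \<open>tensor_inv\<close>, being a tensor by a
  represented weight means that certain morphisms are invertible, which every functor
  preserves.\<close>

lemma rep_absolute:
 assumes R: "rep_weight A B W G w" shows "absolute_weight A B W"
 unfolding absolute_weight_def
proof (intro conjI allI impI)
 interpret R: rep_weight A B W G w by (rule R)
 show "lex_prof A B W" by (rule R.W)
 fix C D F X T u assume "lp_functor C D F & is_tensor C A B W X T u"
 then have F: "lp_functor C D F" and t: "is_tensor C A B W X T u" by blast+
 interpret wc: weighted C A B W X T u by (rule tensor_weighted[OF lpf_cats(1)[OF F] t])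
 interpret rc: rep_weighted C A B W X T u G w ..
 interpret D: lpcategory D by unfold_locales (rule lpf_cats[OF F])
 let ?u = "vcomp A B W (lhom C X T) (lhom D (lpo F X) (lpo F T)) (lpm F X T) u"
 note o = lpf_obj[OF F wc.X] lpf_obj[OF F wc.T] and e = lpf_ext[OF F wc.X] lpf_ext[OF F wc.T]
 have c: "two_cell A B (lhom C X T) (lhom D (lpo F X) (lpo F T)) (lpm F X T)"
  using lpf_cell[OF F wc.X wc.T] by (simp add: wc.eX wc.eT)
 interpret wd: weighted D A B W "lpo F X" "lpo F T" ?u
  by unfold_locales (use o e wc.W vcomp_cell[OF wc.u c] in \<open>auto simp: wc.eX wc.eT\<close>)
 interpret rd: rep_weighted D A B W "lpo F X" "lpo F T" ?u G w ..
 show "is_tensor D A B W (lpo F X) (lpo F T) ?u"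
 proof (rule rd.inv_tensor)
  fix b assume b: "b \<in> obj B"
  have "is_iso (tot D) (omap (totF C F) (vpair X (G b))) (omap (totF C F) (vpair T b)) (mmap (totF C F) (vpair X (G b)) (vpair T b) (rc.e b))"
   by (rule functor_iso[OF totF_functor[OF F] rc.tensor_inv[OF t b]])
  moreover have "?u (G b, b) (w b) = lpm F X T (G b, b) (rc.e b)"
   by (rule vcomp_simp[OF wc.u c R.G[OF b] b R.w[OF b]])
  ultimately show "is_iso (tot D) (vpair (lpo F X) (G b)) (vpair (lpo F T) b) (?u (G b, b) (w b))"
   using b R.G[OF b] R.w[OF b] wc.X wc.T wc.u_in[OF R.G[OF b] b R.w[OF b]] by (simp add: wc.eX wc.eT)
 qed
qed

lemma hom_rep_weight:
 assumes A: "small_lex_cat A" and B: "small_lex_cat B" and G: "lex_functor B A G"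
 shows "rep_weight A B (hom_prof A B A (id_func A) G) (omap G) (\<lambda>b. idm A (omap G b))"
proof
 note cA = small_lex_catD(1)[OF A] and Gf = lex_functorD[OF G]
 show "lex_prof A B (hom_prof A B A (id_func A) G)"
  by (rule hom_prof_lex[OF id_functor[OF cA] G _ A B]) (use A in \<open>simp add: small_lex_cat_def\<close>)
 fix b assume b: "b \<in> obj B"
 note Gb = functor_obj[OF Gf b]
 show "omap G b \<in> obj A" by (rule Gb)
 show "idm A (omap G b) \<in> omap (hom_prof A B A (id_func A) G) (omap G b, b)" using b Gb cat_id[OF cA Gb] by simp
 fix a m assume a: "a \<in> obj A" and m: "m \<in> omap (hom_prof A B A (id_func A) G) (a, b)"
 have e: "lact B (hom_prof A B A (id_func A) G) b (omap G b) a p (idm A (omap G b)) = p" if p: "p \<in> hom A a (omap G b)" for p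
  using hom_prof_act_left[OF id_functor[OF cA] Gf p b] cat_id[OF cA Gb] Gb a p by (simp add: cat_id_left[OF cA p])
 show "\<exists>!p. p \<in> hom A a (omap G b) & lact B (hom_prof A B A (id_func A) G) b (omap G b) a p (idm A (omap G b)) = m"
  using m a b e by auto
qed

section \<open>Composition of finite-limit-preserving profunctors\<close>

definition disc_pair :: "(nat, nat) cat" where
 "disc_pair = mk_cat {0, 1} (\<lambda>i j. if i = j then {0} else {}) (\<lambda>_. 0) (\<lambda>_ _ _ g f. g + f)"

text \<open>Identities are coded by 0, and of two composable arrows at least one is an identity, so
  addition is composition.\<close>

definition par_pair :: "(nat, nat) cat" where
 "par_pair = mk_cat {0, 1} (\<lambda>i j. if i = j then {0} else if i = 0 then {0, 1} else {}) (\<lambda>_. 0) (\<lambda>_ _ _ g f. g + f)"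

lemma disc_pair_simps [simp]:
 "obj disc_pair = {0, 1}" "hom disc_pair i j = (if i \<in> {0, 1} & i = j then {0} else {})"
 "i \<in> {0, 1} ==> idm disc_pair i = 0"
 "i \<in> {0, 1} ==> cmp disc_pair i i i 0 0 = 0"
 unfolding disc_pair_def by auto

lemma par_pair_simps [simp]:
 "obj par_pair = {0, 1}"
 "hom par_pair i j = (if i \<in> {0, 1} & i = j then {0} else if i = 0 & j = 1 then {0, 1} else {})"
 "i \<in> {0, 1} ==> idm par_pair i = 0"
 "i \<in> {0, 1} ==> j \<in> {0, 1} ==> k \<in> {0, 1} ==> g \<in> hom par_pair j k ==> f \<in> hom par_pair i j ==> cmp par_pair i j k g f = g + f"
 unfolding par_pair_def by auto

lemma finite_disc_pair: "finite_cat disc_pair"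
proof -
 have "category disc_pair" unfolding disc_pair_def by (rule categoryI) (auto split: if_splits)
 then show ?thesis unfolding finite_cat_def by auto
qed

lemma finite_par_pair: "finite_cat par_pair"
proof -
 have "category par_pair" unfolding par_pair_def by (rule categoryI) (auto split: if_splits)
 then show ?thesis unfolding finite_cat_def by auto
qed

definition disc_diag :: "('o, 'm) cat => 'o => 'o => (nat, nat, 'o, 'm) func" where
 "disc_diag A a b = mk_func disc_pair (\<lambda>i. if i = 0 then a else b) (\<lambda>i _ _. idm A (if i = 0 then a else b))"

definition par_diag :: "('o, 'm) cat => 'o => 'o => 'm => 'm => (nat, nat, 'o, 'm) func" where
 "par_diag A a b u v = mk_func par_pair (\<lambda>i. if i = 0 then a else b)
   (\<lambda>i j f. if i = j then idm A (if i = 0 then a else b) else if f = 0 then u else v)"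

lemma disc_diag_functor: "category A ==> a \<in> obj A ==> b \<in> obj A ==> is_functor disc_pair A (disc_diag A a b)"
 unfolding disc_diag_def
 by (rule functorI) (use finite_disc_pair in \<open>auto simp: finite_cat_def cat_id cat_id_left split: if_splits\<close>)

lemma par_diag_functor:
 assumes A: "category A" and uv: "u \<in> hom A a b" "v \<in> hom A a b"
 shows "is_functor par_pair A (par_diag A a b u v)"
 unfolding par_diag_def
proof (rule functorI)
 note o = hom_obj[OF A uv(1)]
 show "category par_pair" "category A" using finite_par_pair A unfolding finite_cat_def by auto
qed (use hom_obj[OF A uv(1)] A uv in \<open>auto simp: cat_id cat_id_left cat_id_right split: if_splits\<close>)

lemma diag_simps [simp]:
 "omap (disc_diag A a b) 0 = a" "omap (disc_diag A a b) (Suc 0) = b"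
 "omap (par_diag A a b u v) 0 = a" "omap (par_diag A a b u v) (Suc 0) = b"
 "mmap (disc_diag A a b) 0 0 0 = idm A a" "mmap (disc_diag A a b) (Suc 0) (Suc 0) 0 = idm A b"
 "mmap (par_diag A a b u v) 0 0 0 = idm A a" "mmap (par_diag A a b u v) (Suc 0) (Suc 0) 0 = idm A b"
 "mmap (par_diag A a b u v) 0 (Suc 0) 0 = u" "mmap (par_diag A a b u v) 0 (Suc 0) (Suc 0) = v"
 unfolding disc_diag_def par_diag_def by simp_all

lemma lim_exists:
 assumes "small_lex_cat A" "finite_cat (J :: (nat, nat) cat)" "is_functor J A D"
 obtains l p where "is_limit J A D l p"
proof -
 have "\<exists>l p. is_limit J A D l p"
  by (rule small_lex_catD(4)[OF assms(1), unfolded has_finite_limits_def, rule_format, OF conjI[OF assms(2,3)]])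
 then show thesis using that by (elim exE)
qed

lemma prof_right_cmp:
 assumes M: "is_prof A B M" and a: "a \<in> obj A" and x: "x \<in> omap M (a, b)" and g: "g \<in> hom B b b'" "g' \<in> hom B b' b''"
 shows "ract A M a b' b'' g' (ract A M a b b' g x) = ract A M a b b'' (cmp B b b' b'' g' g) x"
proof -
 note ia = cat_id[OF prof_cats(1)[OF M] a]
 show ?thesis unfolding prof_cmp[OF M x ia ia g] cat_id_left[OF prof_cats(1)[OF M] ia] ..
qed

lemma prof_left_cmp:
 assumes M: "is_prof A B M" and b: "b \<in> obj B" and x: "x \<in> omap M (a, b)" and f: "f \<in> hom A a' a" "f' \<in> hom A a'' a'"
 shows "lact B M b a' a'' f' (lact B M b a a' f x) = lact B M b a a'' (cmp A a'' a' a f f') x"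
proof -
 note ib = cat_id[OF prof_cats(2)[OF M] b]
 show ?thesis unfolding prof_cmp[OF M x f ib ib] cat_id_left[OF prof_cats(2)[OF M] ib] ..
qed

text \<open>The category of elements of a finite-limit-preserving functor is cofiltered.\<close>

context
 fixes A B :: "'v::universe vcat" and M a
 assumes lex: "lex_prof A B M" and a: "a \<in> obj A"
begin

private lemma pM: "is_prof A B M"
 by (rule lex_profD(3)[OF lex])

private lemma lexB: "small_lex_cat B"
 by (rule lex_profD(2)[OF lex])

private lemma B: "category B"
 by (rule small_lex_catD(1)[OF lexB])

private lemma ia: "idm A a \<in> hom A a a"
 by (rule cat_id[OF prof_cats(1)[OF pM] a])

lemma elements_nonempty: "\<exists>b m. b \<in> obj B & m \<in> omap M (a, b)"
proof -
 let ?J = "mk_cat {} (\<lambda>_ _. {}) (\<lambda>_. 0) (\<lambda>_ _ _ _ _. 0) :: (nat, nat) cat"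
 let ?D = "mk_func ?J (\<lambda>_. undefined) (\<lambda>_ _ _. undefined)"
 have J: "category ?J" by (rule categoryI) auto
 have fJ: "finite_cat ?J" unfolding finite_cat_def using J by simp
 have D: "is_functor ?J B ?D" by (rule functorI[OF J B]) auto
 obtain l p where l: "is_limit ?J B ?D l p" by (rule lim_exists[OF lexB fJ D])
 have "matching ?J ?D (\<lambda>b. omap M (a, b)) (ract A M a) (\<lambda>_. undefined)"
  unfolding matching_def by simp
 from lex_actionD[OF lex_prof_action[OF lex a] fJ D l this] obtain x where "x \<in> omap M (a, l)" by (elim ex1E conjE)
 then show ?thesis using cone_obj[OF limit_cone[OF l]] by (intro exI conjI)
qed

text \<open>By exactness of M(a,-), an element over a binary product is a pair of elements over the
  factors.\<close>

lemma elements_pair: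
 assumes b: "b \<in> obj B" "b' \<in> obj B" and m: "m \<in> omap M (a, b)" "m' \<in> omap M (a, b')"
 shows "\<exists>c m0 p q. m0 \<in> omap M (a, c) & p \<in> hom B c b & q \<in> hom B c b' &
  ract A M a c b p m0 = m & ract A M a c b' q m0 = m'"
proof -
 note D = disc_diag_functor[OF B b]
 obtain l p where l: "is_limit disc_pair B (disc_diag B b b') l p" by (rule lim_exists[OF lexB finite_disc_pair D])
 note cn = limit_cone[OF l]
 have "matching disc_pair (disc_diag B b b') (\<lambda>b. omap M (a, b)) (ract A M a) (\<lambda>i. if i = 0 then m else m')"
  unfolding matching_def using m b a by (auto simp: prof_id[OF pM] split: if_splits)
 from lex_actionD[OF lex_prof_action[OF lex a] finite_disc_pair D l this] obtain x where
  "x \<in> omap M (a, l)" "ract A M a l b (p 0) x = m" "ract A M a l b' (p (Suc 0)) x = m'"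
  by auto
 then show ?thesis using cone_hom[OF cn, of 0] cone_hom[OF cn, of "Suc 0"] by auto
qed

text \<open>Exactness at an equaliser: an element on which the two actions agree lifts to the
  equaliser.\<close>

lemma elements_parallel:
 assumes uv: "u \<in> hom B b b'" "v \<in> hom B b b'" and m: "m \<in> omap M (a, b)"
  and e: "ract A M a b b' u m = ract A M a b b' v m"
 shows "\<exists>c e m0. e \<in> hom B c b & m0 \<in> omap M (a, c) & ract A M a c b e m0 = m & cmp B c b b' u e = cmp B c b b' v e"
proof -
 note o = hom_obj[OF B uv(1)]
 note D = par_diag_functor[OF B uv]
 obtain l p where l: "is_limit par_pair B (par_diag B b b' u v) l p" by (rule lim_exists[OF lexB finite_par_pair D])
 note cn = limit_cone[OF l]
 have "matching par_pair (par_diag B b b' u v) (\<lambda>b. omap M (a, b)) (ract A M a)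
   (\<lambda>i. if i = 0 then m else ract A M a b b' u m)"
  unfolding matching_def using m a o uv e prof_act[OF pM m ia uv(1)] by (auto simp: prof_id[OF pM] split: if_splits)
 from lex_actionD[OF lex_prof_action[OF lex a] finite_par_pair D l this] obtain x where
  "x \<in> omap M (a, l)" "ract A M a l b (p 0) x = m" by auto
 moreover have "cmp B l b b' u (p 0) = p (Suc 0)" "cmp B l b b' v (p 0) = p (Suc 0)"
  using cone_cmp[OF cn, of 0 "Suc 0" 0] cone_cmp[OF cn, of 0 "Suc 0" "Suc 0"] by auto
 ultimately show ?thesis using cone_hom[OF cn, of 0]
  by - (rule exI[of _ l], rule exI[of _ "p 0"], rule exI[of _ x], simp)
qed

lemma elements_finite:
 assumes "finite I" "!!i. i \<in> I ==> b i \<in> obj B" "!!i. i \<in> I ==> m i \<in> omap M (a, b i)"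
 shows "\<exists>c m0 p. c \<in> obj B & m0 \<in> omap M (a, c) & (\<forall>i\<in>I. p i \<in> hom B c (b i) & ract A M a c (b i) (p i) m0 = m i)"
 using assms
proof (induction I)
 case empty then show ?case using elements_nonempty by auto
next
 case (insert k I)
 have "\<exists>c m0 p. c \<in> obj B & m0 \<in> omap M (a, c) & (\<forall>i\<in>I. p i \<in> hom B c (b i) & ract A M a c (b i) (p i) m0 = m i)"
  by (rule insert.IH) (use insert.prems in auto)
 then obtain c m0 p where c12: "c \<in> obj B" "m0 \<in> omap M (a, c)"
  and cp: "\<forall>i\<in>I. p i \<in> hom B c (b i) & ract A M a c (b i) (p i) m0 = m i" by (elim exE conjE)
 have c34: "!!i. i \<in> I ==> p i \<in> hom B c (b i)" "!!i. i \<in> I ==> ract A M a c (b i) (p i) m0 = m i"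
  using cp by auto
 note c = c12 c34
 have k: "b k \<in> obj B" "m k \<in> omap M (a, b k)" using insert.prems by auto
 from elements_pair[OF c(1) k(1) c(2) k(2)] obtain d m1 q r where d: "m1 \<in> omap M (a, d)" "q \<in> hom B d c" "r \<in> hom B d (b k)"
  "ract A M a d c q m1 = m0" "ract A M a d (b k) r m1 = m k" by blast
 show ?case
 proof (rule exI[of _ d], rule exI[of _ m1], rule exI[of _ "\<lambda>i. if i = k then r else cmp B d c (b i) (p i) q"], intro conjI ballI)
  show "d \<in> obj B" using hom_obj[OF B d(2)] by simp
  show "m1 \<in> omap M (a, d)" by (rule d)
  fix i assume i: "i \<in> insert k I"
  show "(if i = k then r else cmp B d c (b i) (p i) q) \<in> hom B d (b i)"
   using i d c cat_cmp[OF B c(3) d(2)] by auto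
  show "ract A M a d (b i) (if i = k then r else cmp B d c (b i) (p i) q) m1 = m i"
   using i d c(3,4) prof_right_cmp[OF pM a d(1,2) c(3), of i] by auto
 qed
qed

end

section \<open>Coends over cofiltered categories of elements\<close>

locale lex_composable =
 fixes A B C :: "'v::universe vcat" and N M :: "'v prof"
 assumes lM: "lex_prof A B M" and lN: "lex_prof B C N"

sublocale lex_composable \<subseteq> composable A B C N M
 by (rule composable_lex[OF lM lN])

context lex_composable begin

text \<open>A single span between two triples. As the elements of M(a,-) are cofiltered, spans
  already exhaust the equivalence relation generated by the coend, as in the usual description of
  filtered colimits.\<close>

definition zz :: "'v => 'v => 'v => 'v => 'v => 'v => 'v => 'v => bool" where
 "zz a c b n m b' n' m' \<longleftrightarrow> (\<exists>d g g' m0. g \<in> hom B d b & g' \<in> hom B d b' & m0 \<in> omap M (a, d) &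
   ract A M a d b g m0 = m & ract A M a d b' g' m0 = m' &
   lact C N c b d g n = lact C N c b' d g' n')"

lemma zz_trans:
 assumes a: "a \<in> obj A" and c: "c \<in> obj C"
  and n: "n1 \<in> omap N (b1, c)" "n2 \<in> omap N (b2, c)" "n3 \<in> omap N (b3, c)"
  and 1: "zz a c b1 n1 m1 b2 n2 m2" and 2: "zz a c b2 n2 m2 b3 n3 m3"
 shows "zz a c b1 n1 m1 b3 n3 m3"
proof -
 obtain d g g' x where d: "g \<in> hom B d b1" "g' \<in> hom B d b2" "x \<in> omap M (a, d)"
   "ract A M a d b1 g x = m1" "ract A M a d b2 g' x = m2"
   "lact C N c b1 d g n1 = lact C N c b2 d g' n2"
  using 1 unfolding zz_def by blast
 obtain e k k' y where e: "k \<in> hom B e b2" "k' \<in> hom B e b3" "y \<in> omap M (a, e)"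
   "ract A M a e b2 k y = m2" "ract A M a e b3 k' y = m3"
   "lact C N c b2 e k n2 = lact C N c b3 e k' n3"
  using 2 unfolding zz_def by blast
 have o: "d \<in> obj B" "e \<in> obj B" using hom_obj[OF cats(2) d(1)] hom_obj[OF cats(2) e(1)] by auto
 \<comment> \<open>The two spans meet over \<open>m2\<close>: a common refinement of their apexes is
   found, and then an equaliser makes the two legs into \<open>b2\<close> agree.\<close>
 from elements_pair[OF lM a o d(3) e(3)] obtain h z p q where h: "z \<in> omap M (a, h)" "p \<in> hom B h d" "q \<in> hom B h e"
  "ract A M a h d p z = x" "ract A M a h e q z = y" by blast
 note gp = cat_cmp[OF cats(2) d(2) h(2)] and kq = cat_cmp[OF cats(2) e(1) h(3)]
 have "ract A M a h b2 (cmp B h d b2 g' p) z = ract A M a h b2 (cmp B h e b2 k q) z"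
  using prof_right_cmp[OF M a h(1,2) d(2)] prof_right_cmp[OF M a h(1,3) e(1)] h d e by simp
 from elements_parallel[OF lM a gp kq h(1) this] obtain j r w where j: "r \<in> hom B j h" "w \<in> omap M (a, j)" "ract A M a j h r w = z"
  "cmp B j h b2 (cmp B h d b2 g' p) r = cmp B j h b2 (cmp B h e b2 k q) r" by blast
 note pr = cat_cmp[OF cats(2) h(2) j(1)] and qr = cat_cmp[OF cats(2) h(3) j(1)]
 note G = cat_cmp[OF cats(2) d(1) pr] and K = cat_cmp[OF cats(2) e(2) qr]
 have w1: "ract A M a j d (cmp B j h d p r) w = x" "ract A M a j e (cmp B j h e q r) w = y"
  using prof_right_cmp[OF M a j(2,1) h(2)] prof_right_cmp[OF M a j(2,1) h(3)] j h by simp_all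
 have "ract A M a j b1 (cmp B j d b1 g (cmp B j h d p r)) w = m1"
  "ract A M a j b3 (cmp B j e b3 k' (cmp B j h e q r)) w = m3"
  using prof_right_cmp[OF M a j(2) pr d(1)] prof_right_cmp[OF M a j(2) qr e(2)] w1 d e by simp_all
 moreover have "lact C N c b1 j (cmp B j d b1 g (cmp B j h d p r)) n1 = lact C N c b3 j (cmp B j e b3 k' (cmp B j h e q r)) n3"
  using prof_left_cmp[OF N c n(1) d(1) pr] prof_left_cmp[OF N c n(2) d(2) pr] prof_left_cmp[OF N c n(2) e(1) qr] prof_left_cmp[OF N c n(3) e(2) qr]
   d(6) e(6) j(4) cat_assoc[OF cats(2) j(1) h(2) d(2)] cat_assoc[OF cats(2) j(1) h(3) e(1)] by metis
 ultimately show ?thesis unfolding zz_def using G K j(2) by blast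
qed

lemma zz_sym: "zz a c b n m b' n' m' ==> zz a c b' n' m' b n m"
 unfolding zz_def by metis

lemma zz_refl: "a \<in> obj A ==> b \<in> obj B ==> m \<in> omap M (a, b) ==> zz a c b n m b n m"
 unfolding zz_def using cat_id[OF cats(2)] prof_id[OF M] by blast

lemma zz_step:
 assumes a: "a \<in> obj A" and c: "c \<in> obj C" and g: "g \<in> hom B b b'" and n: "n \<in> omap N (b', c)" and m: "m \<in> omap M (a, b)"
 shows "zz a c b (lact C N c b' b g n) m b' n (ract A M a b b' g m)"
 unfolding zz_def
proof (intro exI conjI)
 have b: "b \<in> obj B" using hom_obj[OF cats(2) g] by simp
 show "idm B b \<in> hom B b b" by (rule cat_id[OF cats(2) b])
 show "g \<in> hom B b b'" "m \<in> omap M (a, b)" by (fact g m)+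
 show "mmap M (a, b) (a, b) (idm A a, idm B b) m = m" by (rule prof_id[OF M a b m])
 show "ract A M a b b' g m = ract A M a b b' g m" ..
 show "mmap N (b, c) (b, c) (idm B b, idm C c) (lact C N c b' b g n) = lact C N c b' b g n"
  by (rule prof_id[OF N b c prof_act[OF N n g cat_id[OF cats(3) c]]])
qed

text \<open>Induction along the zigzag: each step is a span, and spans compose by
  \<open>zz_trans\<close>.\<close>

lemma cls_zz:
 assumes a: "a \<in> obj A" and c: "c \<in> obj C" and t: "b \<in> obj B" "n \<in> omap N (b, c)" "m \<in> omap M (a, b)"
  and t': "b' \<in> obj B" "n' \<in> omap N (b', c)" "m' \<in> omap M (a, b')"
  and e: "cls a c (b, n, m) = cls a c (b', n', m')"
 shows "zz a c b n m b' n' m'"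
proof -
 have tr: "(b, n, m) \<in> triples a c" using t by (simp add: triples_iff)
 have "((b, n, m), (b', n', m')) \<in> conv a c" using e cls_eq[OF a c] t t' by (simp add: triples_iff)
 then have "(case (b', n', m') of (b', n', m') => (b', n', m') \<in> triples a c & zz a c b n m b' n' m')"
 proof (induction rule: rtrancl_induct)
  case base then show ?case using tr zz_refl[OF a t(1) t(3)] by simp
 next
  case (step y z)
  obtain b1 n1 m1 b2 n2 m2 where [simp]: "y = (b1, n1, m1)" "z = (b2, n2, m2)" by (metis surj_pair)
  have y: "(b1, n1, m1) \<in> triples a c" "zz a c b n m b1 n1 m1" using step.IH by auto
  have z: "(b2, n2, m2) \<in> triples a c" using step.hyps(2) step_triples[OF _ a c] by auto
  have "zz a c b1 n1 m1 b2 n2 m2"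
   using step.hyps(2)
  proof
   assume "(y, z) \<in> coend_step A B C N M a c" then show ?thesis by (rule stepE) (use zz_step[OF a c] in auto)
  next
   assume "(y, z) \<in> (coend_step A B C N M a c)\<inverse>"
   then have "(z, y) \<in> coend_step A B C N M a c" by simp
   then show ?thesis by (rule stepE) (use zz_sym[OF zz_step[OF a c]] in auto)
  qed
  from zz_trans[OF a c t(2) _ _ y(2) this] y(1) z show ?case by (simp add: triples_iff)
 qed
 then show ?thesis by simp
qed

lemma cls_pull:
 "a \<in> obj A ==> c \<in> obj C ==> g \<in> hom B b b' ==> n \<in> omap N (b', c) ==> m \<in> omap M (a, b) ==> ract A M a b b' g m = m' ==>
  cls a c (b', n, m') = cls a c (b, lact C N c b' b g n, m)"
 using cls_step by metis

text \<open>Both legs of the span send the same element to m, so they become equal on a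
  refinement.\<close>

lemma cls_same:
 assumes a: "a \<in> obj A" and c: "c \<in> obj C" and b: "b \<in> obj B" and n: "n \<in> omap N (b, c)" "n' \<in> omap N (b, c)" and m: "m \<in> omap M (a, b)"
  and e: "cls a c (b, n, m) = cls a c (b, n', m)"
 shows "\<exists>d g m0. g \<in> hom B d b & m0 \<in> omap M (a, d) & ract A M a d b g m0 = m &
  lact C N c b d g n = lact C N c b d g n'"
proof -
 obtain d g g' x where d: "g \<in> hom B d b" "g' \<in> hom B d b" "x \<in> omap M (a, d)"
   "ract A M a d b g x = m" "ract A M a d b g' x = m"
   "lact C N c b d g n = lact C N c b d g' n'"
  using cls_zz[OF a c b n(1) m b n(2) m e] unfolding zz_def by blast
 from elements_parallel[OF lM a d(1,2,3)] d(4,5) obtain h r y where h: "r \<in> hom B h d" "y \<in> omap M (a, h)" "ract A M a h d r y = x"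
  "cmp B h d b g r = cmp B h d b g' r" by metis
 show ?thesis
  using cat_cmp[OF cats(2) d(1) h(1)] h prof_right_cmp[OF M a h(2,1) d(1)] d(4,6)
   prof_left_cmp[OF N c n(1) d(1) h(1)] prof_left_cmp[OF N c n(2) d(2) h(1)] by metis
qed

text \<open>Finitely many identifications are realised at once by composing refinements, one for
  each.\<close>

lemma cls_same_finite:
 assumes "finite I" and a: "a \<in> obj A" and b: "b \<in> obj B" and m: "m \<in> omap M (a, b)"
  and "!!i. i \<in> I ==> c i \<in> obj C" "!!i. i \<in> I ==> n i \<in> omap N (b, c i)" "!!i. i \<in> I ==> n' i \<in> omap N (b, c i)"
  "!!i. i \<in> I ==> cls a (c i) (b, n i, m) = cls a (c i) (b, n' i, m)"
 shows "\<exists>d g m0. g \<in> hom B d b & m0 \<in> omap M (a, d) & ract A M a d b g m0 = m &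
  (\<forall>i\<in>I. lact C N (c i) b d g (n i) = lact C N (c i) b d g (n' i))"
 using assms(1,5-)
proof (induction I)
 case empty
 show ?case using cat_id[OF cats(2) b] m prof_id[OF M a b m] by auto
next
 case (insert k I)
 then obtain d g m0 where d: "g \<in> hom B d b" "m0 \<in> omap M (a, d)" "ract A M a d b g m0 = m"
  "!!i. i \<in> I ==> lact C N (c i) b d g (n i) = lact C N (c i) b d g (n' i)" by auto
 have k: "c k \<in> obj C" "n k \<in> omap N (b, c k)" "n' k \<in> omap N (b, c k)" "cls a (c k) (b, n k, m) = cls a (c k) (b, n' k, m)"
  using insert.prems by auto
 note ic = cat_id[OF cats(3) k(1)]
 have d0: "d \<in> obj B" using hom_obj[OF cats(2) d(1)] by simp
 have "cls a (c k) (d, lact C N (c k) b d g (n k), m0) = cls a (c k) (d, lact C N (c k) b d g (n' k), m0)"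
  using cls_pull[OF a k(1) d(1) k(2) d(2,3)] cls_pull[OF a k(1) d(1) k(3) d(2,3)] k(4) by simp
 from cls_same[OF a k(1) d0 prof_act[OF N k(2) d(1) ic] prof_act[OF N k(3) d(1) ic] d(2) this]
 obtain e h m1 where e: "h \<in> hom B e d" "m1 \<in> omap M (a, e)" "ract A M a e d h m1 = m0"
  "lact C N (c k) d e h (lact C N (c k) b d g (n k)) =
   lact C N (c k) d e h (lact C N (c k) b d g (n' k))" by blast
 show ?case
 proof (rule exI[of _ e], rule exI[of _ "cmp B e d b g h"], rule exI[of _ m1], intro conjI ballI)
  show "cmp B e d b g h \<in> hom B e b" by (rule cat_cmp[OF cats(2) d(1) e(1)])
  show "m1 \<in> omap M (a, e)" by (rule e)
  show "ract A M a e b (cmp B e d b g h) m1 = m" using prof_right_cmp[OF M a e(2,1) d(1)] e d by simp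
  fix i assume i: "i \<in> insert k I"
  have ii: "c i \<in> obj C" "n i \<in> omap N (b, c i)" "n' i \<in> omap N (b, c i)" using insert.prems i by auto
  show "lact C N (c i) b e (cmp B e d b g h) (n i) = lact C N (c i) b e (cmp B e d b g h) (n' i)"
   using i e(4) d(4) prof_left_cmp[OF N ii(1,2) d(1) e(1)] prof_left_cmp[OF N ii(1,3) d(1) e(1)] by auto
 qed
qed

lemma tensor_right: "a \<in> obj A ==> q \<in> hom C c c' ==> b \<in> obj B ==> n \<in> omap N (b, c) ==> m \<in> omap M (a, b) ==>
  ract A NM a c c' q (cls a c (b, n, m)) = cls a c' (b, ract B N b c c' q n, m)"
 using tensor_act[OF cat_id[OF cats(1)], of a q c c' b n m] prof_id[OF M, of a b m] by simp

text \<open>Finite limits commute with filtered colimits, carried out on representatives: the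
  members of a matching family are put over one element of M(a,-), a refinement turns the finitely
  many matching conditions into equations in N(d,-), and exactness of N(d,-) solves these.\<close>

theorem lex_prof_tensor: "lex_prof A C NM"
proof (rule lex_profI[OF lex_profD(1)[OF lM] lex_profD(2)[OF lN] tensor_prof])
 fix a assume a: "a \<in> obj A"
 show "lex_action C (\<lambda>c. omap NM (a, c)) (ract A NM a)"
  unfolding lex_action_def
 proof (intro allI impI, elim conjE)
  fix J :: "(nat, nat) cat" and D l p z
  assume J: "finite_cat J" and D: "is_functor J C D" and l: "is_limit J C D l p"
   and z: "matching J D (\<lambda>c. omap NM (a, c)) (ract A NM a) z"
  note cn = limit_cone[OF l]
  let ?E = "\<lambda>x. x \<in> omap NM (a, l) & (\<forall>j\<in>obj J. ract A NM a l (omap D j) (p j) x = z j)"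
  note lo = cone_obj[OF cn]
  have fJ: "finite (obj J)" "!!i j. i \<in> obj J ==> j \<in> obj J ==> finite (hom J i j)" "category J" using J unfolding finite_cat_def by auto
  have Do: "omap D j \<in> obj C" if "j \<in> obj J" for j by (rule functor_obj[OF D that])
  have zj: "z j \<in> omap NM (a, omap D j)" if "j \<in> obj J" for j using z that unfolding matching_def by blast
  have zf: "ract A NM a (omap D i) (omap D j) (mmap D i j f) (z i) = z j" if "i \<in> obj J" "j \<in> obj J" "f \<in> hom J i j" for i j f
   using z that unfolding matching_def by blast
  have "\<exists>b n m. j \<in> obj J \<longrightarrow> b \<in> obj B & n \<in> omap N (b, omap D j) & m \<in> omap M (a, b) & z j = cls a (omap D j) (b, n, m)" for j
   using tensor_cases[OF zj a Do] by metis
  then obtain \<beta> \<nu> \<mu> where t: "!!j. j \<in> obj J ==> \<beta> j \<in> obj B" "!!j. j \<in> obj J ==> \<nu> j \<in> omap N (\<beta> j, omap D j)"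
   "!!j. j \<in> obj J ==> \<mu> j \<in> omap M (a, \<beta> j)" "!!j. j \<in> obj J ==> z j = cls a (omap D j) (\<beta> j, \<nu> j, \<mu> j)" by metis
  have "\<exists>c m0 p. c \<in> obj B & m0 \<in> omap M (a, c) & (\<forall>i\<in>obj J. p i \<in> hom B c (\<beta> i) & ract A M a c (\<beta> i) (p i) m0 = \<mu> i)"
   by (rule elements_finite[OF lM a fJ(1)]) (auto intro: t)
  then obtain b m g where b12: "b \<in> obj B" "m \<in> omap M (a, b)"
   and bg: "\<forall>j\<in>obj J. g j \<in> hom B b (\<beta> j) & ract A M a b (\<beta> j) (g j) m = \<mu> j" by (elim exE conjE)
  have b34: "!!j. j \<in> obj J ==> g j \<in> hom B b (\<beta> j)" "!!j. j \<in> obj J ==> ract A M a b (\<beta> j) (g j) m = \<mu> j"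
   using bg by auto
  note b = b12 b34
  define n where "n j = lact C N (omap D j) (\<beta> j) b (g j) (\<nu> j)" for j
  have n: "n j \<in> omap N (b, omap D j)" "z j = cls a (omap D j) (b, n j, m)" if j: "j \<in> obj J" for j
   unfolding n_def t(4)[OF j] using prof_act[OF N t(2)[OF j] b(3)[OF j] cat_id[OF cats(3) Do[OF j]]]
    cls_pull[OF a Do[OF j] b(3)[OF j] t(2)[OF j] b(2) b(4)[OF j]] by auto
  \<comment> \<open>All arrows of the shape, a finite set: one matching condition for each.\<close>
  let ?I = "SIGMA i:obj J. SIGMA j:obj J. hom J i j"
  have "\<exists>d h m0. h \<in> hom B d b & m0 \<in> omap M (a, d) & ract A M a d b h m0 = m &
   (\<forall>(i, j, f)\<in>?I. lact C N (omap D j) b d h (ract B N b (omap D i) (omap D j) (mmap D i j f) (n i)) =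
    lact C N (omap D j) b d h (n j))"
  proof -
   have "\<exists>d h m0. h \<in> hom B d b & m0 \<in> omap M (a, d) & ract A M a d b h m0 = m &
   (\<forall>x\<in>?I. lact C N (omap D (fst (snd x))) b d h
      (ract B N b (omap D (fst x)) (omap D (fst (snd x))) (mmap D (fst x) (fst (snd x)) (snd (snd x))) (n (fst x))) =
    lact C N (omap D (fst (snd x))) b d h (n (fst (snd x))))"
   proof (rule cls_same_finite[OF _ a b(1,2)])
    show "finite ?I" using fJ by (intro finite_SigmaI) auto
    fix x assume "x \<in> ?I"
    then obtain i j f where [simp]: "x = (i, j, f)" and i: "i \<in> obj J" and j: "j \<in> obj J" and f: "f \<in> hom J i j" by auto
    note Df = functor_hom[OF D f]
    show "omap D (fst (snd x)) \<in> obj C" "n (fst (snd x)) \<in> omap N (b, omap D (fst (snd x)))" using Do[OF j] n(1)[OF j] by simp_all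
    show "ract B N b (omap D (fst x)) (omap D (fst (snd x))) (mmap D (fst x) (fst (snd x)) (snd (snd x))) (n (fst x)) \<in> omap N (b, omap D (fst (snd x)))"
     using prof_act[OF N n(1)[OF i] cat_id[OF cats(2) b(1)] Df] by simp
    show "cls a (omap D (fst (snd x))) (b, ract B N b (omap D (fst x)) (omap D (fst (snd x))) (mmap D (fst x) (fst (snd x)) (snd (snd x))) (n (fst x)), m) =
     cls a (omap D (fst (snd x))) (b, n (fst (snd x)), m)"
     using zf[OF i j f] tensor_right[OF a Df b(1) n(1)[OF i] b(2)] n(2)[OF i] n(2)[OF j] by simp
   qed
   then show ?thesis by (simp add: split_def)
  qed
  then obtain d h m0 where d: "h \<in> hom B d b" "m0 \<in> omap M (a, d)" "ract A M a d b h m0 = m"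
   and dh: "!!i j f. i \<in> obj J ==> j \<in> obj J ==> f \<in> hom J i j ==>
    lact C N (omap D j) b d h (ract B N b (omap D i) (omap D j) (mmap D i j f) (n i)) =
    lact C N (omap D j) b d h (n j)" by (auto simp: split_def)
  have do: "d \<in> obj B" using hom_obj[OF cats(2) d(1)] by simp
  define n0 where "n0 j = lact C N (omap D j) b d h (n j)" for j
  have "matching J D (\<lambda>c. omap N (d, c)) (ract B N d) n0"
   unfolding matching_def
  proof (intro conjI ballI)
   fix j assume j: "j \<in> obj J"
   show "n0 j \<in> omap N (d, omap D j)" unfolding n0_def by (rule prof_act[OF N n(1)[OF j] d(1) cat_id[OF cats(3) Do[OF j]]])
  next
   fix i j f assume i: "i \<in> obj J" and j: "j \<in> obj J" and f: "f \<in> hom J i j"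
   show "ract B N d (omap D i) (omap D j) (mmap D i j f) (n0 i) = n0 j"
    unfolding n0_def acts_commute[OF n(1)[OF i] d(1) functor_hom[OF D f]] by (rule dh[OF i j f])
  qed
  from lex_actionD[OF lex_prof_action[OF lN do] J D l this] obtain x where
   x: "x \<in> omap N (d, l)" "!!j. j \<in> obj J ==> ract B N d l (omap D j) (p j) x = n0 j" by auto
  show "\<exists>!x. ?E x"
  proof (rule ex_ex1I)
   show "\<exists>x. ?E x"
   proof (intro exI[of _ "cls a l (d, x, m0)"] conjI ballI)
    show "cls a l (d, x, m0) \<in> omap NM (a, l)" by (rule tensor_in[OF a lo do x(1) d(2)])
    fix j assume j: "j \<in> obj J"
    show "ract A NM a l (omap D j) (p j) (cls a l (d, x, m0)) = z j"
     unfolding tensor_right[OF a cone_hom[OF cn j] do x(1) d(2)] x(2)[OF j] n0_def n(2)[OF j]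
     by (rule cls_pull[OF a Do[OF j] d(1) n(1)[OF j] d(2,3), symmetric])
   qed
  next
   fix x y
   assume "?E x"
    "?E y"
   then have x: "x \<in> omap NM (a, l)" and y: "y \<in> omap NM (a, l)"
    and xy: "!!j. j \<in> obj J ==> ract A NM a l (omap D j) (p j) x = ract A NM a l (omap D j) (p j) y" by auto
   obtain b1 n1 m1 where 1: "b1 \<in> obj B" "n1 \<in> omap N (b1, l)" "m1 \<in> omap M (a, b1)" "x = cls a l (b1, n1, m1)" by (rule tensor_cases[OF x a lo])
   obtain b2 n2 m2 where 2: "b2 \<in> obj B" "n2 \<in> omap N (b2, l)" "m2 \<in> omap M (a, b2)" "y = cls a l (b2, n2, m2)" by (rule tensor_cases[OF y a lo])
   \<comment> \<open>Uniqueness by the same method: both solutions are moved over one element and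
     refined until their projections agree, where exactness of N(d,-) decides.\<close>
   from elements_pair[OF lM a 1(1) 2(1) 1(3) 2(3)] obtain b m g h where b: "m \<in> omap M (a, b)" "g \<in> hom B b b1" "h \<in> hom B b b2"
    "ract A M a b b1 g m = m1" "ract A M a b b2 h m = m2" by blast
   have bo: "b \<in> obj B" using hom_obj[OF cats(2) b(2)] by simp
   note il = cat_id[OF cats(3) lo]
   define n where "n = lact C N l b1 b g n1"
   define n' where "n' = lact C N l b2 b h n2"
   have n: "n \<in> omap N (b, l)" "x = cls a l (b, n, m)" and n': "n' \<in> omap N (b, l)" "y = cls a l (b, n', m)"
    unfolding n_def n'_def 1(4) 2(4) using prof_act[OF N 1(2) b(2) il] prof_act[OF N 2(2) b(3) il]
     cls_pull[OF a lo b(2) 1(2) b(1,4)] cls_pull[OF a lo b(3) 2(2) b(1,5)] by auto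
   have "\<exists>d h m0. h \<in> hom B d b & m0 \<in> omap M (a, d) & ract A M a d b h m0 = m &
    (\<forall>j\<in>obj J. lact C N (omap D j) b d h (ract B N b l (omap D j) (p j) n) =
     lact C N (omap D j) b d h (ract B N b l (omap D j) (p j) n'))"
   proof (rule cls_same_finite[OF fJ(1) a bo b(1) Do])
    fix j assume j: "j \<in> obj J"
    note pj = cone_hom[OF cn j] and ib = cat_id[OF cats(2) bo]
    show "ract B N b l (omap D j) (p j) n \<in> omap N (b, omap D j)" "ract B N b l (omap D j) (p j) n' \<in> omap N (b, omap D j)"
     by (rule prof_act[OF N n(1) ib pj] prof_act[OF N n'(1) ib pj])+
    show "cls a (omap D j) (b, ract B N b l (omap D j) (p j) n, m) = cls a (omap D j) (b, ract B N b l (omap D j) (p j) n', m)"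
     using xy[OF j] unfolding n(2) n'(2) tensor_right[OF a pj bo n(1) b(1)] tensor_right[OF a pj bo n'(1) b(1)] .
   qed
   then obtain d h m0 where d: "h \<in> hom B d b" "m0 \<in> omap M (a, d)" "ract A M a d b h m0 = m"
    and eq: "!!j. j \<in> obj J ==> lact C N (omap D j) b d h (ract B N b l (omap D j) (p j) n) =
     lact C N (omap D j) b d h (ract B N b l (omap D j) (p j) n')" by auto
   have do: "d \<in> obj B" using hom_obj[OF cats(2) d(1)] by simp
   define k where "k = lact C N l b d h n"
   define k' where "k' = lact C N l b d h n'"
   have k: "k \<in> omap N (d, l)" "k' \<in> omap N (d, l)" unfolding k_def k'_def by (rule prof_act[OF N n(1) d(1) il] prof_act[OF N n'(1) d(1) il])+
   have kk: "ract B N d l (omap D j) (p j) k = ract B N d l (omap D j) (p j) k'" if j: "j \<in> obj J" for j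
    unfolding k_def k'_def acts_commute[OF n(1) d(1) cone_hom[OF cn j]] acts_commute[OF n'(1) d(1) cone_hom[OF cn j]] by (rule eq[OF j])
   have "matching J D (\<lambda>c. omap N (d, c)) (ract B N d) (\<lambda>j. ract B N d l (omap D j) (p j) k)"
    unfolding matching_def
   proof (intro conjI ballI)
    fix j assume j: "j \<in> obj J"
    show "ract B N d l (omap D j) (p j) k \<in> omap N (d, omap D j)"
     by (rule prof_act[OF N k(1) cat_id[OF cats(2) do] cone_hom[OF cn j]])
   next
    fix i j f assume i: "i \<in> obj J" and j: "j \<in> obj J" and f: "f \<in> hom J i j"
    show "ract B N d (omap D i) (omap D j) (mmap D i j f) (ract B N d l (omap D i) (p i) k) = ract B N d l (omap D j) (p j) k"
     using prof_right_cmp[OF N do k(1) cone_hom[OF cn i] functor_hom[OF D f]] cone_cmp[OF cn i j f] by simp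
   qed
   from lex_actionD[OF lex_prof_action[OF lN do] J D l this] have "k = k'" using k kk by metis
   then show "x = y" unfolding n(2) n'(2) cls_pull[OF a lo d(1) n(1) d(2,3)] cls_pull[OF a lo d(1) n'(1) d(2,3)] k_def k'_def by simp
  qed
 qed
qed

end

section \<open>Coding categories in the universe\<close>

text \<open>Brings a category of arbitrary type into the universe: elements of S name objects
  through P, and \<open>em\<close> codes morphisms, injectively on each hom-set. Used for sets and
  for presheaves.\<close>

locale recoding =
 fixes Q :: "('o, 'm) cat" and S :: "'v::universe set" and P :: "'v => 'o" and em :: "'v => 'v => 'm => 'v"
 assumes Q: "category Q" and P: "s \<in> S ==> P s \<in> obj Q"
  and inj: "s \<in> S ==> t \<in> S ==> inj_on (em s t) (hom Q (P s) (P t))"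
begin

definition dec :: "'v => 'v => 'v => 'm" where
 "dec s t = inv_into (hom Q (P s) (P t)) (em s t)"

definition RC :: "'v vcat" where
 "RC = mk_cat S (\<lambda>s t. em s t ` hom Q (P s) (P t)) (\<lambda>s. em s s (idm Q (P s)))
   (\<lambda>a b c g f. em a c (cmp Q (P a) (P b) (P c) (dec b c g) (dec a b f)))"

lemma dec_em [simp]: "s \<in> S ==> t \<in> S ==> f \<in> hom Q (P s) (P t) ==> dec s t (em s t f) = f"
 unfolding dec_def by (rule inv_into_f_f[OF inj])

lemma RC_obj [simp]: "obj RC = S" by (simp add: RC_def)

lemma RC_hom: "s \<in> S ==> t \<in> S ==> hom RC s t = em s t ` hom Q (P s) (P t)" by (simp add: RC_def)

lemma em_in: "s \<in> S ==> t \<in> S ==> f \<in> hom Q (P s) (P t) ==> em s t f \<in> hom RC s t"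
 by (simp add: RC_hom)

lemma dec_in: "s \<in> S ==> t \<in> S ==> f \<in> hom RC s t ==> dec s t f \<in> hom Q (P s) (P t)"
 by (auto simp: RC_hom)

lemma em_dec: "s \<in> S ==> t \<in> S ==> f \<in> hom RC s t ==> em s t (dec s t f) = f"
 by (auto simp: RC_hom)

lemma RC_idm: "s \<in> S ==> idm RC s = em s s (idm Q (P s))" by (simp add: RC_def)

lemma RC_cmp: "a \<in> S ==> b \<in> S ==> c \<in> S ==> g \<in> hom RC b c ==> f \<in> hom RC a b ==>
  cmp RC a b c g f = em a c (cmp Q (P a) (P b) (P c) (dec b c g) (dec a b f))"
 unfolding RC_def by simp

lemma RC_cmp_em: "a \<in> S ==> b \<in> S ==> c \<in> S ==> g \<in> hom Q (P b) (P c) ==> f \<in> hom Q (P a) (P b) ==>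
  cmp RC a b c (em b c g) (em a b f) = em a c (cmp Q (P a) (P b) (P c) g f)"
 by (simp add: RC_cmp em_in)

lemma dec_cmp: "a \<in> S ==> b \<in> S ==> c \<in> S ==> g \<in> hom RC b c ==> f \<in> hom RC a b ==>
  dec a c (cmp RC a b c g f) = cmp Q (P a) (P b) (P c) (dec b c g) (dec a b f)"
 by (simp add: RC_cmp dec_in cat_cmp[OF Q])

lemma RC_category: "category RC"
 unfolding RC_def
proof (rule categoryI, goal_cases)
 case (1 a) then show ?case by (simp add: cat_id[OF Q P])
next
 case (2 a b c g f) then show ?case by (auto intro: cat_cmp[OF Q])
next
 case (3 a b f) then show ?case by (auto simp: cat_id[OF Q P] cat_id_right[OF Q])
next
 case (4 a b f) then show ?case by (auto simp: cat_id[OF Q P] cat_id_left[OF Q])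
next
 case (5 a b c d h g f) then show ?case by (auto simp: cat_cmp[OF Q] cat_assoc[OF Q])
qed

definition lift :: "('x, 'y) cat => ('x => 'v) => ('x, 'y, 'o, 'm) func => ('x, 'y, 'v, 'v) func" where
 "lift A y Y = mk_func A y (\<lambda>a b f. em (y a) (y b) (mmap Y a b f))"

lemma lift_simps [simp]: "a \<in> obj A ==> omap (lift A y Y) a = y a"
 "a \<in> obj A ==> b \<in> obj A ==> f \<in> hom A a b ==> mmap (lift A y Y) a b f = em (y a) (y b) (mmap Y a b f)"
 by (simp_all add: lift_def)

lemma lift_functor:
 assumes Y: "is_functor A Q Y" and y: "!!a. a \<in> obj A ==> y a \<in> S" "!!a. a \<in> obj A ==> P (y a) = omap Y a"
 shows "is_functor A RC (lift A y Y)"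
 unfolding lift_def
proof (rule functorI[OF functor_cats(1)[OF Y] RC_category], goal_cases)
 case (1 a) then show ?case by (simp add: y)
next
 case (2 a b f) then show ?case using functor_hom[OF Y 2(3)] by (intro em_in) (auto simp: y)
next
 case (3 a) then show ?case by (simp add: RC_idm y functor_id[OF Y])
next
 case (4 a b c g f) then show ?case using functor_hom[OF Y 4(4)] functor_hom[OF Y 4(5)]
  by (simp add: RC_cmp_em y functor_cmp[OF Y 4(4,5)])
qed

text \<open>Coding is full on the named objects, so the hom-actions of the coded functor are in
  bijection with those of Y.\<close>

lemma lift_lex:
 assumes Y: "lex_functor A Q Y" and y: "!!a. a \<in> obj A ==> y a \<in> S" "!!a. a \<in> obj A ==> P (y a) = omap Y a"
 shows "lex_functor A RC (lift A y Y)"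
proof -
 note Yf = lex_functorD[OF Y]
 have lf: "is_functor A RC (lift A y Y)" by (rule lift_functor[OF Yf]) (rule y, assumption)+
 show ?thesis unfolding lex_functor_iff_hom[OF lf]
 proof
  fix c assume "c \<in> obj RC"
  then have c: "c \<in> S" by simp
  show "lex_action A (\<lambda>b. hom RC c (omap (lift A y Y) b)) (\<lambda>b b' g h. cmp RC c (omap (lift A y Y) b) (omap (lift A y Y) b') (mmap (lift A y Y) b b' g) h)"
  proof (rule lex_action_iso[OF lex_functor_hom[OF Y P[OF c]], where \<phi> = "\<lambda>b. em c (y b)"], goal_cases)
   case (1 b) then show ?case using inj[OF c y(1)[OF 1]] by (simp add: bij_betw_def RC_hom c y)
  next
   case (2 b b' g x) then show ?case using functor_hom[OF Yf 2(3)] by (simp add: RC_cmp_em c y)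
  next
   case (3 b b' g x) then show ?case by (intro cat_cmp[OF Q functor_hom[OF Yf]])
  qed
 qed
qed

end

text \<open>The largest candidate sieve, so that among the conditions on sieves only (iii)
  constrains K.\<close>

definition full_parfl :: "'v::universe vcat => 'v parfl" where
 "full_parfl K = \<lparr>ucat = K, sieve = {(A, X). small_lex_cat A & lex_functor A K X}\<rparr>"

lemma full_parfl_simps [simp]: "ucat (full_parfl K) = K"
 "(A, X) \<in> sieve (full_parfl K) \<longleftrightarrow> small_lex_cat A & lex_functor A K X"
 by (simp_all add: full_parfl_def)

lemma full_parfl:
 fixes K :: "'v::universe vcat"
 assumes "category K" "locally_small K"
  and c: "!!c. c \<in> obj K ==> \<exists>(A :: 'v vcat) X a. small_lex_cat A & lex_functor A K X & a \<in> obj A & omap X a = c"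
 shows "partially_lex_cat (full_parfl K)"
 unfolding partially_lex_cat_def left_exact_sieve_def full_parfl_simps
proof (intro conjI allI impI ballI assms(1,2), goal_cases)
 case (1 s) then show ?case by (auto simp: full_parfl_def)
next
 case (2 A B X G) then show ?case by (auto intro: lex_comp)
next
 case (3 A B X G) then show ?case by (auto intro: lex_comp)
next
 case (4 A X Y) then show ?case by auto
next
 case (5 A X Y) then show ?case by (auto intro: lex_iso)
next
 case (6 k)
 from c[OF 6] obtain A :: "'v vcat" and X a where "small_lex_cat A" "lex_functor A K X" "a \<in> obj A" "omap X a = k" by blast
 then show ?case by (intro bexI[of _ "(A, X)"]) auto
qed

section \<open>Absolute weights are represented\<close>

text \<open>Not every small set is a value of a finite-limit-preserving functor on a small category (without infinity,
 only subsingletons are), and condition (iii) on sieves forces us to restrict to those that are.\<close>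

definition lex_sets :: "'v::universe set" where
 "lex_sets = {s. \<exists>(A :: 'v vcat) X a. small_lex_cat A & lex_functor A set_cat X & a \<in> obj A & omap X a = elts s}"

section \<open>The coded category of sets\<close>

lemma small_elts: "small (elts x)"
 unfolding small_def by blast

lemma vset_elts: "vset (elts x) = x"
 by (rule elts_inject) (rule elts_vset[OF small_elts])

text \<open>A function is coded by its graph, which determines it on the given domain; the codomain
  is supplied by the hom-set.\<close>

interpretation VS: recoding set_cat lex_sets elts "\<lambda>s t. vgraph (elts s)"
proof
 show "category set_cat" by (rule set_category)
 show "elts s \<in> obj set_cat" for s :: 'a by (simp add: small_elts)
 show "inj_on (vgraph (elts s)) (hom set_cat (elts s) (elts t))" for s t :: 'a
 proof (rule inj_onI)
  fix f g assume f: "f \<in> hom set_cat (elts s) (elts t)" and g: "g \<in> hom set_cat (elts s) (elts t)" and e: "vgraph (elts s) f = vgraph (elts s) g"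
  show "f = g" by (rule set_hom_eqI[OF f g]) (use vgraph_inject[OF small_elts small_elts e] in blast)
 qed
qed

abbreviation VSet :: "'v::universe vcat" where "VSet \<equiv> VS.RC"

definition ap :: "'v::universe => 'v => 'v => 'v => 'v" where "ap = VS.dec"

lemma ap_in: "s \<in> lex_sets ==> t \<in> lex_sets ==> h \<in> hom VSet s t ==> x \<in> elts s ==> ap s t h x \<in> elts t"
 unfolding ap_def by (rule set_hom_in[OF VS.dec_in])

lemma ap_cmp: "a \<in> lex_sets ==> b \<in> lex_sets ==> c \<in> lex_sets ==> g \<in> hom VSet b c ==> f \<in> hom VSet a b ==> x \<in> elts a ==>
  ap a c (cmp VSet a b c g f) x = ap b c g (ap a b f x)"
 unfolding ap_def by (simp add: VS.dec_cmp set_cmp[OF VS.dec_in VS.dec_in])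

lemma ap_id: "s \<in> lex_sets ==> x \<in> elts s ==> ap s s (idm VSet s) x = x"
 unfolding ap_def using VS.dec_em[of s s "idm set_cat (elts s)"] cat_id[OF set_category, of "elts s"]
 by (simp add: VS.RC_idm small_elts)

lemma ap_eqI:
 assumes st: "s \<in> lex_sets" "t \<in> lex_sets" and h: "h \<in> hom VSet s t" "h' \<in> hom VSet s t"
  and e: "!!x. x \<in> elts s ==> ap s t h x = ap s t h' x"
 shows "h = h'"
proof -
 have "ap s t h = ap s t h'"
  by (rule set_hom_eqI[OF VS.dec_in[OF st h(1), folded ap_def] VS.dec_in[OF st h(2), folded ap_def] e])
 then show ?thesis using VS.em_dec[OF st h(1)] VS.em_dec[OF st h(2)] unfolding ap_def by metis
qed

lemma vgraph_hom:
 assumes st: "s \<in> lex_sets" "t \<in> lex_sets" and S: "elts s = S" and f: "!!x. x \<in> S ==> f x \<in> elts t"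
 shows "vgraph S f \<in> hom VSet s t" "x \<in> S ==> ap s t (vgraph S f) x = f x"
proof -
 have h: "restrict f (elts s) \<in> hom set_cat (elts s) (elts t)" by (rule set_homI[OF small_elts small_elts]) (rule f, simp add: S)
 have "vgraph (elts s) (restrict f (elts s)) = vgraph S f"
  unfolding vgraph_def S by (rule arg_cong[OF image_cong[OF refl]]) simp
 then show "vgraph S f \<in> hom VSet s t" "x \<in> S ==> ap s t (vgraph S f) x = f x"
  using VS.em_in[OF st h] VS.dec_em[OF st h] S unfolding ap_def by auto
qed

definition VL :: "'v::universe vcat => ('v, 'v, 'v set, 'v => 'v) func => 'v vfunc" where
 "VL A Y = VS.lift A (\<lambda>a. vset (omap Y a)) Y"

lemma VSet_locally_small: "locally_small VSet"
 unfolding locally_small_def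
proof (intro ballI)
 fix s t :: 'a assume "s \<in> obj VSet" "t \<in> obj VSet"
 then have "hom VSet s t = vgraph (elts s) ` hom set_cat (elts s) (elts t)" by (simp add: VS.RC_hom)
 moreover have "small (vgraph (elts s) ` hom set_cat (elts s) (elts t))"
  by (rule small_subset[OF small_graphs[OF small_elts[of s] small_elts[of t]]]) (auto simp: set_hom PiE_iff intro!: imageI)
 ultimately show "small (hom VSet s t)" by simp
qed

lemma lex_sets_vset:
 fixes A :: "'v::universe vcat" and Y :: "('v, 'v, 'v set, 'v => 'v) func"
 assumes A: "small_lex_cat A" and Y: "lex_functor A set_cat Y" and a: "a \<in> obj A"
 shows "vset (omap Y a) \<in> lex_sets" "elts (vset (omap Y a)) = omap Y a"
proof -
 have "small (omap Y a)" using functor_obj[OF lex_functorD[OF Y] a] by simp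
 then show e: "elts (vset (omap Y a)) = omap Y a" by (rule elts_vset)
 show "vset (omap Y a) \<in> lex_sets" unfolding lex_sets_def mem_Collect_eq e using A Y a by blast
qed

lemma VL_lex: "small_lex_cat A ==> lex_functor A set_cat Y ==> lex_functor A VSet (VL A Y)"
 unfolding VL_def by (rule VS.lift_lex) (simp_all add: lex_sets_vset)

text \<open>Condition (iii) holds because \<open>lex_sets\<close> consists of values of
  finite-limit-preserving functors, and these functors lift to \<open>VSet\<close>.\<close>

lemma VSet_parfl: "partially_lex_cat (full_parfl VSet)"
proof (rule full_parfl[OF VS.RC_category VSet_locally_small])
 fix s :: 'a assume "s \<in> obj VSet"
 then have "s \<in> lex_sets" by simp
 then obtain A :: "'a vcat" and X a where "small_lex_cat A" "lex_functor A set_cat X" "a \<in> obj A" "omap X a = elts s"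
  unfolding lex_sets_def by blast
 then show "\<exists>(A :: 'a vcat) X a. small_lex_cat A & lex_functor A VSet X & a \<in> obj A & omap X a = s"
  by (intro exI[of _ A] exI[of _ "VL A X"] exI[of _ a]) (auto simp: VL_lex, simp add: VL_def vset_elts)
qed

section \<open>Covariant hom-functors into sets\<close>

definition hom_func :: "'v::universe vcat => 'v => ('v, 'v, 'v set, 'v => 'v) func" where
 "hom_func K c = mk_func K (\<lambda>k. hom K c k) (\<lambda>k k' f. restrict (\<lambda>h. cmp K c k k' f h) (hom K c k))"

lemma hom_func_functor:
 assumes K: "category K" "locally_small K" and c: "c \<in> obj K"
 shows "is_functor K set_cat (hom_func K c)"
 unfolding hom_func_def
proof (rule functorI[OF K(1) set_category])
 have sm: "small (hom K c k)" if "k \<in> obj K" for k using K(2) c that unfolding locally_small_def by blast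
 have h: "restrict (\<lambda>h. cmp K c k k' f h) (hom K c k) \<in> hom set_cat (hom K c k) (hom K c k')" if "f \<in> hom K k k'" for k k' f
  using hom_obj[OF K(1) that] by (intro set_homI sm cat_cmp[OF K(1) that]) auto
 show "hom K c k \<in> obj set_cat" if "k \<in> obj K" for k using sm[OF that] by simp
 show "restrict (\<lambda>h. cmp K c k k' f h) (hom K c k) \<in> hom set_cat (hom K c k) (hom K c k')" if "f \<in> hom K k k'" for k k' f
  by (rule h[OF that])
 show "restrict (\<lambda>h. cmp K c k k (idm K k) h) (hom K c k) = idm set_cat (hom K c k)" if "k \<in> obj K" for k
  using sm[OF that] by (auto simp: cat_id_left[OF K(1)] intro!: restrict_ext)
 show "restrict (\<lambda>h. cmp K c k k'' (cmp K k k' k'' g f) h) (hom K c k) =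
   cmp set_cat (hom K c k) (hom K c k') (hom K c k'') (restrict (\<lambda>h. cmp K c k' k'' g h) (hom K c k')) (restrict (\<lambda>h. cmp K c k k' f h) (hom K c k))"
  if g: "g \<in> hom K k' k''" and f: "f \<in> hom K k k'" for k k' k'' g f
  unfolding set_cmp_eq[OF h[OF f] h[OF g]] by (rule restrict_ext) (simp add: cat_assoc[OF K(1) _ f g] cat_cmp[OF K(1) f])
qed

lemma hom_func_simps [simp]:
 "k \<in> obj K ==> omap (hom_func K c) k = hom K c k"
 "k \<in> obj K ==> k' \<in> obj K ==> f \<in> hom K k k' ==> mmap (hom_func K c) k k' f = restrict (\<lambda>h. cmp K c k k' f h) (hom K c k)"
 by (simp_all add: hom_func_def)

lemma hom_func_lex:
 assumes K: "category K" "locally_small K" and c: "c \<in> obj K" and Y: "lex_functor A K Y"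
 shows "lex_functor A set_cat (comp_func A (hom_func K c) Y)"
proof -
 note Yf = lex_functorD[OF Y]
 show ?thesis unfolding lex_set_iff[OF comp_functor[OF Yf hom_func_functor[OF K c]]]
  by (rule lex_action_cong[OF lex_functor_hom[OF Y c]])
   (auto simp: functor_obj[OF Yf] functor_hom[OF Yf] intro!: cat_cmp[OF K(1)])
qed

text \<open>A fully faithful \<open>X\<close> and a \<open>T\<close> whose values are the \<open>W\<close>-weighted colimits of \<open>X\<close> in the conical sense:
 in \<open>\<Gamma>(K)\<close>, \<open>T\<close> is the tensor of \<open>X\<close> by \<open>W\<close>.\<close>

locale dense_weight =
 fixes A B :: "'v::universe vcat" and W :: "'v prof" and K :: "'v vcat" and X T :: "'v vfunc" and u :: "'v => 'v => 'v => 'v"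
 assumes lW: "lex_prof A B W" and cK: "category K" and sK: "locally_small K"
  and X: "lex_functor A K X" and T: "lex_functor B K T"
  and X_full: "a \<in> obj A ==> a' \<in> obj A ==> h \<in> hom K (omap X a) (omap X a') ==> \<exists>p\<in>hom A a a'. mmap X a a' p = h"
  and X_faithful: "p \<in> hom A a a' ==> p' \<in> hom A a a' ==> mmap X a a' p = mmap X a a' p' ==> p = p'"
  and u_in: "a \<in> obj A ==> b \<in> obj B ==> m \<in> omap W (a, b) ==> u a b m \<in> hom K (omap X a) (omap T b)"
  and u_left: "p \<in> hom A a' a ==> b \<in> obj B ==> m \<in> omap W (a, b) ==>
   u a' b (lact B W b a a' p m) = cmp K (omap X a') (omap X a) (omap T b) (u a b m) (mmap X a' a p)"
  and u_right: "a \<in> obj A ==> r \<in> hom B b b' ==> m \<in> omap W (a, b) ==>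
   u a b' (ract A W a b b' r m) = cmp K (omap X a) (omap T b) (omap T b') (mmap T b b' r) (u a b m)"
  and u_inj: "a \<in> obj A ==> b \<in> obj B ==> m \<in> omap W (a, b) ==> m' \<in> omap W (a, b) ==> u a b m = u a b m' ==> m = m'"
  and dense_ex: "k \<in> obj K ==> b \<in> obj B ==> (!!a m. a \<in> obj A ==> m \<in> omap W (a, b) ==> \<phi> a m \<in> hom K (omap X a) k) ==>
   (!!a a' p m. p \<in> hom A a' a ==> m \<in> omap W (a, b) ==>
    \<phi> a' (lact B W b a a' p m) = cmp K (omap X a') (omap X a) k (\<phi> a m) (mmap X a' a p)) ==>
   \<exists>t\<in>hom K (omap T b) k. \<forall>a\<in>obj A. \<forall>m\<in>omap W (a, b). cmp K (omap X a) (omap T b) k t (u a b m) = \<phi> a m"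
  and dense_uniq: "k \<in> obj K ==> b \<in> obj B ==> t \<in> hom K (omap T b) k ==> t' \<in> hom K (omap T b) k ==>
   (!!a m. a \<in> obj A ==> m \<in> omap W (a, b) ==> cmp K (omap X a) (omap T b) k t (u a b m) = cmp K (omap X a) (omap T b) k t' (u a b m)) ==> t = t'"
  and cover: "k \<in> obj K ==> (\<exists>a\<in>obj A. omap X a = k) \<or> (\<exists>b\<in>obj B. omap T b = k)"
begin

lemma lexA: "small_lex_cat A" and lexB: "small_lex_cat B" and pW: "is_prof A B W"
 using lex_profD[OF lW] by auto

lemma catA: "category A" and catB: "category B"
 using small_lex_catD(1)[OF lexA] small_lex_catD(1)[OF lexB] by auto

lemma Xf: "is_functor A K X" and Tf: "is_functor B K T"
 using lex_functorD[OF X] lex_functorD[OF T] by auto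

lemma K_parfl: "partially_lex_cat (full_parfl K)"
proof (rule full_parfl[OF cK sK])
 fix k assume "k \<in> obj K"
 from cover[OF this] show "\<exists>(A :: 'v vcat) X a. small_lex_cat A & lex_functor A K X & a \<in> obj A & omap X a = k"
  using lexA lexB X T by blast
qed

sublocale KK: parflcat "full_parfl K" by unfold_locales (rule K_parfl)
sublocale VV: parflcat "full_parfl (VSet :: 'v vcat)" by unfold_locales (rule VSet_parfl)

abbreviation "x \<equiv> code (A, X)"
abbreviation "t \<equiv> code (B, T)"
abbreviation "GK \<equiv> Gamma_obj (full_parfl K)"
abbreviation "GV \<equiv> Gamma_obj (full_parfl (VSet :: 'v vcat))"

lemma sxt: "(A, X) \<in> sieve (full_parfl K)" "(B, T) \<in> sieve (full_parfl K)"
 using lexA lexB X T by simp_all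

lemma xt [simp]: "x \<in> KK.S" "t \<in> KK.S" "gdom (full_parfl K) x = A" "gfun (full_parfl K) x = X"
 "gdom (full_parfl K) t = B" "gfun (full_parfl K) t = T"
 using sxt KK.code_simps[OF sxt(1)] KK.code_simps[OF sxt(2)] by blast+

definition "uc = mk_cell A B W u"

lemma uc_cell: "two_cell A B W (lhom GK x t) uc"
proof -
 have "two_cell A B W (hom_prof A B K X T) uc" unfolding uc_def
 proof (rule cellI[OF pW hom_prof_is_prof[OF Xf Tf sK]])
  fix a b a' b' f g m assume f: "f \<in> hom A a' a" and g: "g \<in> hom B b b'" and m: "m \<in> omap W (a, b)"
  have o: "a \<in> obj A" "a' \<in> obj A" "b \<in> obj B" "b' \<in> obj B" using hom_obj[OF catA f] hom_obj[OF catB g] by auto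
  have m': "lact B W b a a' f m \<in> omap W (a', b)" by (rule prof_act[OF pW m f cat_id[OF catB o(3)]])
  show "u a' b' (mmap W (a, b) (a', b') (f, g) m) = mmap (hom_prof A B K X T) (a, b) (a', b') (f, g) (u a b m)"
   unfolding prof_split(1)[OF pW m f g] u_right[OF o(2) g m'] u_left[OF f o(3) m]
   using u_in[OF o(1,3) m] catA catB f g by simp
 qed (simp add: u_in)
 then show ?thesis by simp
qed

sublocale wk: weighted GK A B W x t uc
 by unfold_locales (use lW uc_cell KK.Gamma_lp in simp_all)

text \<open>The hypotheses \<open>dense_ex\<close> and \<open>dense_uniq\<close> are the pointwise
  universal property, transported to \<open>tot GK\<close> by evaluation.\<close>

lemma T_tensor: "is_tensor GK A B W x t uc"
proof (rule wk.pointwise_tensor)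
 fix z b d \<phi> assume z: "z \<in> lobj GK" and b: "b \<in> obj B" and d: "d \<in> obj (ext GK z)"
  and \<phi>: "!!a m. a \<in> obj A ==> m \<in> omap W (a, b) ==> \<phi> a m \<in> omap (lhom GK x z) (a, d)"
  and nat: "!!a a' p m. p \<in> hom A a' a ==> m \<in> omap W (a, b) ==>
    \<phi> a' (lact B W b a a' p m) = cmpv (tot GK) x a' x a z d (\<phi> a m) (lidm GK x (a', a) p)"
 have z': "z \<in> KK.S" and d': "d \<in> obj (gdom (full_parfl K) z)" using z d by simp_all
 let ?k = "omap (gfun (full_parfl K) z) d"
 have k: "?k \<in> obj K" using functor_obj[OF KK.fn_functor[OF z'] d'] by simp
 have \<phi>': "\<phi> a m \<in> hom K (omap X a) ?k" if "a \<in> obj A" "m \<in> omap W (a, b)" for a m using \<phi>[OF that] z' d' that by simp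
 have nat': "\<phi> a' (lact B W b a a' p m) = cmp K (omap X a') (omap X a) ?k (\<phi> a m) (mmap X a' a p)"
  if p: "p \<in> hom A a' a" and m: "m \<in> omap W (a, b)" for a a' p m
  using nat[OF p m] \<phi>'[OF _ m] hom_obj[OF catA p] p functor_hom[OF Xf p] z' d' by (simp add: KK.G_cmp)
 from dense_ex[OF k b \<phi>' nat'] obtain s where s: "s \<in> hom K (omap T b) ?k"
  "!!a m. a \<in> obj A ==> m \<in> omap W (a, b) ==> cmp K (omap X a) (omap T b) ?k s (u a b m) = \<phi> a m" by blast
 show "\<exists>s\<in>omap (lhom GK t z) (b, d). \<forall>a\<in>obj A. \<forall>m\<in>omap W (a, b). cmpv (tot GK) x a t b z d s (uc (a, b) m) = \<phi> a m"
  using s b z' d' u_in[OF _ b] by (intro bexI[of _ s]) (auto simp: uc_def KK.G_cmp)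
next
 fix z b d s s' assume z: "z \<in> lobj GK" and b: "b \<in> obj B" and d: "d \<in> obj (ext GK z)"
  and s: "s \<in> omap (lhom GK t z) (b, d)" "s' \<in> omap (lhom GK t z) (b, d)"
  and e: "!!a m. a \<in> obj A ==> m \<in> omap W (a, b) ==> cmpv (tot GK) x a t b z d s (uc (a, b) m) =
   cmpv (tot GK) x a t b z d s' (uc (a, b) m)"
 have z': "z \<in> KK.S" and d': "d \<in> obj (gdom (full_parfl K) z)" using z d by simp_all
 have s': "s \<in> hom K (omap T b) (omap (gfun (full_parfl K) z) d)" "s' \<in> hom K (omap T b) (omap (gfun (full_parfl K) z) d)" using s z' d' b by simp_all
 show "s = s'"
  by (rule dense_uniq[OF _ b s']) (use functor_obj[OF KK.fn_functor[OF z'] d'] e s' z' d' b u_in[OF _ b] in \<open>auto simp: uc_def KK.G_cmp\<close>)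
qed

section \<open>Testing an absolute tensor against a representable functor\<close>

context
 fixes b0 assumes b0: "b0 \<in> obj B" and abs: "absolute_weight A B W"
begin

abbreviation "k0 \<equiv> omap T b0"

lemma k0: "k0 \<in> obj K" by (rule functor_obj[OF Tf b0])

abbreviation "H \<equiv> hom_func K k0"

lemma H: "is_functor K set_cat H" by (rule hom_func_functor[OF cK sK k0])

definition "F = VS.lift K (\<lambda>k. vset (hom K k0 k)) H"

lemma hom_small: "k \<in> obj K ==> small (hom K k0 k)"
 using functor_obj[OF H, of k] by simp

text \<open>Every object of K is some X a or T b, and K(k0,-) after X or T preserves finite limits;
  so its values are admissible sets.\<close>

lemma vs: "k \<in> obj K ==> vset (hom K k0 k) \<in> lex_sets" "k \<in> obj K ==> elts (vset (hom K k0 k)) = hom K k0 k"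
proof -
 assume k: "k \<in> obj K"
 from cover[OF k] show "vset (hom K k0 k) \<in> lex_sets"
 proof
  assume "\<exists>a\<in>obj A. omap X a = k"
  then obtain a where a: "a \<in> obj A" "omap X a = k" by blast
  show ?thesis using lex_sets_vset(1)[OF lexA hom_func_lex[OF cK sK k0 X] a(1)] a functor_obj[OF Xf a(1)] by simp
 next
  assume "\<exists>b\<in>obj B. omap T b = k"
  then obtain b where b: "b \<in> obj B" "omap T b = k" by blast
  show ?thesis using lex_sets_vset(1)[OF lexB hom_func_lex[OF cK sK k0 T] b(1)] b functor_obj[OF Tf b(1)] by simp
 qed
 show "elts (vset (hom K k0 k)) = hom K k0 k" by (rule elts_vset[OF hom_small[OF k]])
qed

lemma F_obj: "k \<in> obj K ==> omap F k = vset (hom K k0 k)" "k \<in> obj K ==> omap F k \<in> lex_sets" "k \<in> obj K ==> elts (omap F k) = hom K k0 k"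
 using vs unfolding F_def by simp_all

lemma F_functor: "is_functor K VSet F"
 unfolding F_def by (rule VS.lift_functor[OF H]) (auto simp: vs)

lemma F_comp: "is_functor D K Y ==> comp_func D F Y = VL D (comp_func D H Y)"
 unfolding VL_def VS.lift_def comp_func_def[of D F]
 by (rule mk_func_cong) (auto simp: F_def functor_obj functor_hom dest: hom_obj[OF cK functor_hom])

text \<open>K(k0,-) after a finite-limit-preserving functor into K again preserves finite limits, so
  it maps the full sieve of K into that of \<open>VSet\<close>.\<close>

lemma F_parfl: "partially_lex_functor (full_parfl K) (full_parfl VSet) F"
 unfolding partially_lex_functor_def
proof (intro conjI ballI, safe)
 show "is_functor (ucat (full_parfl K)) (ucat (full_parfl VSet)) F" using F_functor by simp
 fix D Y assume "(D, Y) \<in> sieve (full_parfl K)"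
 then have D: "small_lex_cat D" and Y: "lex_functor D K Y" by simp_all
 show "(D, comp_func D F Y) \<in> sieve (full_parfl VSet)"
  using VL_lex[OF D hom_func_lex[OF cK sK k0 Y]] D by (simp add: F_comp[OF lex_functorD[OF Y]])
qed

interpretation FF: parflfun "full_parfl K" "full_parfl VSet" F
 by unfold_locales (rule F_parfl)

abbreviation "x' \<equiv> code (A, comp_func A F X)"
abbreviation "t' \<equiv> code (B, comp_func B F T)"

lemma x't' [simp]: "x' \<in> VV.S" "t' \<in> VV.S" "gdom (full_parfl VSet) x' = A" "gfun (full_parfl VSet) x' = comp_func A F X"
 "gdom (full_parfl VSet) t' = B" "gfun (full_parfl VSet) t' = comp_func B F T"
 using FF.F_sieve[OF sxt(1)] FF.F_sieve[OF sxt(2)] VV.code_simps by blast+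

lemma lpoF: "lpo (Gamma_fun (full_parfl K) F) x = x'" "lpo (Gamma_fun (full_parfl K) F) t = t'"
 by simp_all

definition "u' = vcomp A B W (lhom GK x t) (lhom GV x' t') (lpm (Gamma_fun (full_parfl K) F) x t) uc"

text \<open>Absoluteness is invoked for Gamma of K(k0,-), which therefore sends T to a tensor in
  Gamma of the category of sets.\<close>

lemma u'_tensor: "is_tensor GV A B W x' t' u'"
 using abs[unfolded absolute_weight_def, THEN conjunct2, rule_format, OF conjI[OF FF.GF_functor T_tensor]]
 unfolding u'_def lpoF .

lemma wv_weighted: "weighted GV A B W x' t' u'"
 by (rule tensor_weighted[OF VV.Gamma_lp u'_tensor])

interpretation wv: weighted GV A B W x' t' u' by (rule wv_weighted)

lemma u'_eq: "a \<in> obj A ==> b \<in> obj B ==> m \<in> omap W (a, b) ==> u' (a, b) m = mmap F (omap X a) (omap T b) (u a b m)"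
proof -
 assume h: "a \<in> obj A" "b \<in> obj B" "m \<in> omap W (a, b)"
 have c: "two_cell A B (lhom GK x t) (lhom GV x' t') (lpm (Gamma_fun (full_parfl K) F) x t)"
  using lpf_cell[OF FF.GF_functor, of x t] unfolding lpoF by simp
 show ?thesis unfolding u'_def vcomp_simp[OF uc_cell c h] using h u_in[OF h] by (simp add: uc_def)
qed

definition "N = hom_prof B A K T X"

lemma lN: "lex_prof B A N" unfolding N_def by (rule hom_prof_lex[OF Tf X sK lexB lexA])

lemma WN_lex: "lex_composable B A B W N" by unfold_locales (rule lN lW)+

interpretation WN: lex_composable B A B W N by (rule WN_lex)

lemma N_simps: "b \<in> obj B ==> a \<in> obj A ==> omap N (b, a) = hom K (omap T b) (omap X a)"
 "b \<in> obj B ==> p \<in> hom A a a' ==> y \<in> hom K (omap T b) (omap X a) ==>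
  ract B N b a a' p y = cmp K (omap T b) (omap X a) (omap X a') (mmap X a a' p) y"
 "a \<in> obj A ==> r \<in> hom B b' b ==> y \<in> hom K (omap T b) (omap X a) ==>
  lact A N a b b' r y = cmp K (omap T b') (omap T b) (omap X a) y (mmap T b' b r)"
 unfolding N_def using hom_prof_act_right[OF Tf Xf] hom_prof_act_left[OF Tf Xf] by simp_all

lemma F_ap:
 assumes f: "f \<in> hom K k k'" and h: "h \<in> hom K k0 k"
 shows "ap (omap F k) (omap F k') (mmap F k k' f) h = cmp K k0 k k' f h"
proof -
 note o = hom_obj[OF cK f]
 have "mmap F k k' f = vgraph (hom K k0 k) (restrict (cmp K k0 k k' f) (hom K k0 k))" using f o by (simp add: F_def vs)
 then show ?thesis using vgraph_hom(2)[OF F_obj(2) F_obj(2) F_obj(3), of k k' "restrict (cmp K k0 k k' f) (hom K k0 k)" h]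
  o h cat_cmp[OF cK f] F_obj(3)[of k'] by simp
qed

text \<open>The colimit \<open>\<integral>\<^sup>a W(a,-) \<times> K(k0, X a)\<close>, against which the preserved tensor is tested.\<close>

definition "Z0 = fix_first B B WN.NM b0"

lemma Z0_lex: "lex_functor B set_cat Z0"
 unfolding Z0_def using WN.lex_prof_tensor b0 unfolding lex_prof_def by blast

abbreviation "Z \<equiv> VL B Z0"
abbreviation "z \<equiv> code (B, Z)"

lemma Z: "lex_functor B VSet Z" by (rule VL_lex[OF lexB Z0_lex])

lemma z [simp]: "z \<in> VV.S" "gdom (full_parfl VSet) z = B" "gfun (full_parfl VSet) z = Z"
proof -
 have s: "(B, Z) \<in> sieve (full_parfl VSet)" using lexB Z by simp
 show "z \<in> VV.S" "gdom (full_parfl VSet) z = B" "gfun (full_parfl VSet) z = Z" using s VV.code_simps[OF s] by blast+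
qed

lemma Z_obj: "d \<in> obj B ==> omap Z d \<in> lex_sets" "d \<in> obj B ==> elts (omap Z d) = omap WN.NM (b0, d)"
 using lex_sets_vset[OF lexB Z0_lex, of d] by (simp_all add: Z0_def fix_first_def VL_def)

lemma Z_ap:
 assumes q: "q \<in> hom B d d'" and \<zeta>: "\<zeta> \<in> omap WN.NM (b0, d)"
 shows "ap (omap Z d) (omap Z d') (mmap Z d d' q) \<zeta> = ract B WN.NM b0 d d' q \<zeta>"
proof -
 note o = hom_obj[OF catB q]
 have "mmap Z d d' q = vgraph (omap WN.NM (b0, d)) (ract B WN.NM b0 d d' q)"
  using q o Z_obj(2)[of d] by (simp add: VL_def) (simp add: Z0_def fix_first_def)
 then show ?thesis using vgraph_hom(2)[OF Z_obj(1) Z_obj(1) Z_obj(2), of d d' "ract B WN.NM b0 d d' q" \<zeta>]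
  o \<zeta> prof_act[OF WN.tensor_prof _ cat_id[OF catB b0] q] Z_obj(2)[of d'] by simp
qed

text \<open>Composition through X a, as a map from the coend to K(T b, T d); the aim is to show that
  it hits the identity of k0.\<close>

lemma kappa:
 obtains \<kappa> where "two_cell B B WN.NM (hom_prof B B K T T) \<kappa>"
  "!!b a d w y. b \<in> obj B ==> a \<in> obj A ==> d \<in> obj B ==> w \<in> omap W (a, d) ==> y \<in> hom K (omap T b) (omap X a) ==>
   \<kappa> (b, d) (WN.cls b d (a, w, y)) = cmp K (omap T b) (omap X a) (omap T d) (u a d w) y"
proof -
 let ?P = "hom_prof B B K T T"
 have P: "is_prof B B ?P" by (rule hom_prof_is_prof[OF Tf Tf sK])
 have 1: "cmp K (omap T b) (omap X a) (omap T d) (u a d w) y \<in> omap ?P (b, d)"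
  if "b \<in> obj B" "a \<in> obj A" "d \<in> obj B" "w \<in> omap W (a, d)" "y \<in> omap N (b, a)" for b a d w y
  using that cat_cmp[OF cK u_in[OF that(2,3,4)]] by (simp add: N_simps)
 have 2: "cmp K (omap T b) (omap X a) (omap T d) (u a d (lact B W d a' a p w)) y =
   cmp K (omap T b) (omap X a') (omap T d) (u a' d w) (ract B N b a a' p y)"
  if h: "b \<in> obj B" "d \<in> obj B" "p \<in> hom A a a'" "w \<in> omap W (a', d)" "y \<in> omap N (b, a)" for b a a' d p w y
 proof -
  have o: "a \<in> obj A" "a' \<in> obj A" using hom_obj[OF catA h(3)] by auto
  have y: "y \<in> hom K (omap T b) (omap X a)" using h o by (simp add: N_simps)
  show ?thesis unfolding u_left[OF h(3,2,4)] N_simps(2)[OF h(1,3) y]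
   by (rule cat_assoc[OF cK y functor_hom[OF Xf h(3)] u_in[OF o(2) h(2,4)]])
 qed
 have 3: "cmp K (omap T b') (omap X a) (omap T d') (u a d' (ract A W a d d' q w)) (lact A N a b b' r y) =
   mmap ?P (b, d) (b', d') (r, q) (cmp K (omap T b) (omap X a) (omap T d) (u a d w) y)"
  if h: "r \<in> hom B b' b" "q \<in> hom B d d'" "a \<in> obj A" "w \<in> omap W (a, d)" "y \<in> omap N (b, a)" for b b' a d d' r q w y
 proof -
  have o: "b \<in> obj B" "b' \<in> obj B" "d \<in> obj B" "d' \<in> obj B" using hom_obj[OF catB h(1)] hom_obj[OF catB h(2)] by auto
  have y: "y \<in> hom K (omap T b) (omap X a)" using h o by (simp add: N_simps)
  note w = u_in[OF h(3) o(3) h(4)] and r = functor_hom[OF Tf h(1)] and q = functor_hom[OF Tf h(2)]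
  show ?thesis unfolding u_right[OF h(3,2,4)] N_simps(3)[OF h(3,1) y] hom_prof_simps(2)[OF catB catB h(1,2) cat_cmp[OF cK w y]]
   cat_assoc[OF cK r y w] cat_assoc[OF cK cat_cmp[OF cK y r] w q] ..
 qed
 note c = WN.tensor_cellI[OF P, of "\<lambda>b a d w y. cmp K (omap T b) (omap X a) (omap T d) (u a d w) y", OF 1 2 3]
 show thesis by (rule that, rule c(1), assumption+, rule c(2), assumption+, simp add: N_simps)
qed

text \<open>The coend preserves finite limits in its last variable and so is an admissible target
  for the tensor. The map f induced into it is a section of \<kappa>; applied to the identity of k0
  it yields a class (a, w, y) whose composite is that identity.\<close>

lemma retract:
 "\<exists>a w y. a \<in> obj A & w \<in> omap W (a, b0) & y \<in> hom K k0 (omap X a) & cmp K k0 (omap X a) k0 (u a b0 w) y = idm K k0"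
proof -
 obtain \<kappa> where \<kappa>: "two_cell B B WN.NM (hom_prof B B K T T) \<kappa>"
  and \<kappa>s: "!!b a d w y. b \<in> obj B ==> a \<in> obj A ==> d \<in> obj B ==> w \<in> omap W (a, d) ==> y \<in> hom K (omap T b) (omap X a) ==>
   \<kappa> (b, d) (WN.cls b d (a, w, y)) = cmp K (omap T b) (omap X a) (omap T d) (u a d w) y" by (rule kappa) blast
 note Xo = functor_obj[OF Xf] and To = functor_obj[OF Tf] and cV = VS.RC_category
 let ?FX = "\<lambda>a. omap F (omap X a)" and ?FT = "\<lambda>b. omap F (omap T b)" and ?Z = "omap Z"
 note oX = F_obj(2,3)[OF Xo] and oT = F_obj(2,3)[OF To]
 note FX = functor_hom[OF F_functor functor_hom[OF Xf]] and FT = functor_hom[OF F_functor functor_hom[OF Tf]] and ZZ = functor_hom[OF lex_functorD[OF Z]]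
 have um: "u' (a, b) m \<in> hom VSet (?FX a) (?FT b)" if "a \<in> obj A" "b \<in> obj B" "m \<in> omap W (a, b)" for a b m
  unfolding u'_eq[OF that] by (rule functor_hom[OF F_functor u_in[OF that]])
 \<comment> \<open>The coprojections into the coend, as coded functions.\<close>
 define \<phi> where "\<phi> a b m = vgraph (hom K k0 (omap X a)) (\<lambda>y. WN.cls b0 b (a, m, y))" for a b m
 have \<phi>: "\<phi> a b m \<in> hom VSet (?FX a) (?Z b)" "y \<in> hom K k0 (omap X a) ==> ap (?FX a) (?Z b) (\<phi> a b m) y = WN.cls b0 b (a, m, y)"
  if h: "a \<in> obj A" "b \<in> obj B" "m \<in> omap W (a, b)" for a b m y
  unfolding \<phi>_def using h b0 by (auto intro!: vgraph_hom oX Z_obj WN.tensor_in simp: N_simps Z_obj)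
 have "\<exists>f. nat_trans B (tot GV) (inc GV t') (comp_func B (inc GV z) (id_func B)) f & (\<forall>a\<in>obj A. \<forall>b\<in>obj B. \<forall>m\<in>omap W (a, b).
   cmpv (tot GV) x' a t' b z (omap (id_func B) b) (f b) (u' (a, b) m) = \<phi> a b m)"
 proof (rule wv.tensor_family[OF u'_tensor id_functor[OF catB]], goal_cases)
  case (3 a b m) then show ?case using \<phi> by simp
 next
  case (4 a a' b p m)
  note a = hom_obj[OF catA 4(1)] and m' = prof_act[OF pW 4(3,1) cat_id[OF catB 4(2)]]
  note i = \<phi>(1)[OF conjunct2[OF a] 4(2,3)] FX[OF 4(1)]
  have "\<phi> a' b (lact B W b a a' p m) = cmp VSet (?FX a') (?FX a) (?Z b) (\<phi> a b m) (mmap F (omap X a') (omap X a) (mmap X a' a p))"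
  proof (rule ap_eqI[OF oX(1) Z_obj(1) \<phi>(1) cat_cmp[OF cV i]])
   fix y assume "y \<in> elts (?FX a')"
   then have y: "y \<in> hom K k0 (omap X a')" using oX a by simp
   show "ap (?FX a') (?Z b) (\<phi> a' b (lact B W b a a' p m)) y =
    ap (?FX a') (?Z b) (cmp VSet (?FX a') (?FX a) (?Z b) (\<phi> a b m) (mmap F (omap X a') (omap X a) (mmap X a' a p))) y"
    using \<phi>(2)[OF _ 4(2) m' y] \<phi>(2)[OF _ 4(2,3) cat_cmp[OF cK functor_hom[OF Xf 4(1)] y]] WN.cls_step[OF b0 4(2,1,3), of y] y a b0 4(1,2) i
    by (simp add: ap_cmp oX Z_obj F_ap[OF functor_hom[OF Xf 4(1)]] N_simps)
  qed (use a 4 m' in simp_all)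
  then show ?case using a 4 i by (simp add: VV.G_cmp)
 next
  case (5 a b b' r m)
  note b = hom_obj[OF catB 5(2)] and m' = prof_act[OF pW 5(3) cat_id[OF catA 5(1)] 5(2)]
  note i = ZZ[OF 5(2)] \<phi>(1)[OF 5(1) conjunct1[OF b] 5(3)]
  have "\<phi> a b' (ract A W a b b' r m) = cmp VSet (?FX a) (?Z b) (?Z b') (mmap Z b b' r) (\<phi> a b m)"
  proof (rule ap_eqI[OF oX(1) Z_obj(1) \<phi>(1) cat_cmp[OF cV i]])
   fix y assume "y \<in> elts (?FX a)"
   then have y: "y \<in> hom K k0 (omap X a)" using oX 5 by simp
   have c: "WN.cls b0 b (a, m, y) \<in> omap WN.NM (b0, b)" by (rule WN.tensor_in) (use b0 b 5 y in \<open>simp_all add: N_simps\<close>)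
   show "ap (?FX a) (?Z b') (\<phi> a b' (ract A W a b b' r m)) y =
    ap (?FX a) (?Z b') (cmp VSet (?FX a) (?Z b) (?Z b') (mmap Z b b' r) (\<phi> a b m)) y"
    using \<phi>(2)[OF 5(1) _ m' y] \<phi>(2)[OF 5(1) _ 5(3) y] WN.tensor_right[OF b0 5(2,1,3), of y] y b b0 5(1) i c
    by (simp add: ap_cmp oX Z_obj Z_ap[OF 5(2)] N_simps)
  qed (use b 5 m' in simp_all)
  then show ?case using b 5 i by (simp add: VV.G_cmp)
 qed (simp_all)
 moreover have "comp_func B (inc GV z) (id_func B) = inc GV z" using VV.G.inc_functor[of z] by simp
 ultimately obtain f where fn: "nat_trans B (tot GV) (inc GV t') (inc GV z) f" and fa: "\<forall>a\<in>obj A. \<forall>b\<in>obj B. \<forall>m\<in>omap W (a, b).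
   cmpv (tot GV) x' a t' b z (omap (id_func B) b) (f b) (u' (a, b) m) = \<phi> a b m" by metis
 have f: "f b \<in> hom VSet (?FT b) (?Z b)" if "b \<in> obj B" for b using nat_hom[OF fn that] that by simp
 have fu': "cmp VSet (?FX a) (?FT b) (?Z b) (f b) (u' (a, b) m) = \<phi> a b m" if "a \<in> obj A" "b \<in> obj B" "m \<in> omap W (a, b)" for a b m
  using fa[rule_format, OF that] f[OF that(2)] um[OF that] that by (simp add: VV.G_cmp)
 \<comment> \<open>\<kappa> as a coded function, its first variable frozen at
   \<open>b0\<close>.\<close>
 define k where "k b = vgraph (omap WN.NM (b0, b)) (\<kappa> (b0, b))" for b
 have \<kappa>i: "\<kappa> (b0, b) \<zeta> \<in> hom K k0 (omap T b)" if "b \<in> obj B" "\<zeta> \<in> omap WN.NM (b0, b)" for b \<zeta>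
  using cell_in[OF \<kappa> b0 that] that b0 by simp
 have k: "k b \<in> hom VSet (?Z b) (?FT b)" "\<zeta> \<in> omap WN.NM (b0, b) ==> ap (?Z b) (?FT b) (k b) \<zeta> = \<kappa> (b0, b) \<zeta>" if "b \<in> obj B" for b \<zeta>
  unfolding k_def using \<kappa>i that by (auto intro!: vgraph_hom Z_obj oT simp: oT)
 have kn: "nat_trans B (tot GV) (inc GV z) (inc GV t') (restrict k (obj B))"
 proof (rule natI)
  show "is_functor B (tot GV) (inc GV z)" "is_functor B (tot GV) (inc GV t')" using VV.G.inc_functor[of z] VV.G.inc_functor[of t'] by simp_all
  show "k b \<in> hom (tot GV) (omap (inc GV z) b) (omap (inc GV t') b)" if "b \<in> obj B" for b using k that by simp
  fix b b' r assume b: "b \<in> obj B" "b' \<in> obj B" and r: "r \<in> hom B b b'"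
  note i = k(1)[OF b(1)] k(1)[OF b(2)] ZZ[OF r] FT[OF r]
  have "cmp VSet (?Z b) (?Z b') (?FT b') (k b') (mmap Z b b' r) = cmp VSet (?Z b) (?FT b) (?FT b') (mmap F (omap T b) (omap T b') (mmap T b b' r)) (k b)"
  proof (rule ap_eqI[OF Z_obj(1)[OF b(1)] oT(1)[OF b(2)] cat_cmp[OF cV i(2,3)] cat_cmp[OF cV i(4,1)]])
   fix \<zeta> assume "\<zeta> \<in> elts (?Z b)"
   then have \<zeta>: "\<zeta> \<in> omap WN.NM (b0, b)" using Z_obj b by simp
   show "ap (?Z b) (?FT b') (cmp VSet (?Z b) (?Z b') (?FT b') (k b') (mmap Z b b' r)) \<zeta> =
    ap (?Z b) (?FT b') (cmp VSet (?Z b) (?FT b) (?FT b') (mmap F (omap T b) (omap T b') (mmap T b b' r)) (k b)) \<zeta>"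
    using \<zeta> b i k(2)[OF b(1) \<zeta>] k(2)[OF b(2) prof_act[OF WN.tensor_prof \<zeta> cat_id[OF catB b0] r]] \<kappa>i[OF b(1) \<zeta>]
     cell_nat[OF \<kappa> catB catB \<zeta> cat_id[OF catB b0] r] hom_prof_act_right[OF Tf Tf b0 r \<kappa>i[OF b(1) \<zeta>]]
    by (simp add: ap_cmp oT Z_obj Z_ap[OF r] F_ap[OF functor_hom[OF Tf r]])
  qed
  then show "cmp (tot GV) (omap (inc GV z) b) (omap (inc GV z) b') (omap (inc GV t') b') (k b') (mmap (inc GV z) b b' r) =
   cmp (tot GV) (omap (inc GV z) b) (omap (inc GV t') b) (omap (inc GV t') b') (mmap (inc GV t') b b' r) (k b)"
   using b r i by (simp add: VV.G_cmp)
 qed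
 have tl: "t' \<in> lobj GV" "ext GV t' = B" and ti: "comp_func B (inc GV t') (id_func B) = inc GV t'" using VV.G.inc_functor[of t'] by simp_all
 \<comment> \<open>k after f agrees with the identity on the cocone \<open>u'\<close>, because
   \<kappa> of a class is a composite; uniqueness for the tensor concludes.\<close>
 have "comp_trans B (tot GV) (inc GV t') (inc GV z) (inc GV t') (restrict k (obj B)) f = id_trans B (tot GV) (inc GV t')"
 proof (rule wv.tensor_family_eq[OF u'_tensor id_functor[OF catB] tl, unfolded ti, OF comp_nat[OF fn kn] id_nat[OF nat_functors(2)[OF kn]]])
  fix a b m assume h: "a \<in> obj A" "b \<in> obj B" "m \<in> omap W (a, b)"
  note i = f[OF h(2)] um[OF h] \<phi>(1)[OF h] k(1)[OF h(2)]
  have "cmp VSet (?FX a) (?Z b) (?FT b) (k b) (\<phi> a b m) = u' (a, b) m"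
  proof (rule ap_eqI[OF oX(1)[OF h(1)] oT(1)[OF h(2)] cat_cmp[OF cV i(4,3)] i(2)])
   fix y assume "y \<in> elts (?FX a)"
   then have y: "y \<in> hom K k0 (omap X a)" using oX h by simp
   have c: "WN.cls b0 b (a, m, y) \<in> omap WN.NM (b0, b)" by (rule WN.tensor_in) (use b0 h y in \<open>simp_all add: N_simps\<close>)
   show "ap (?FX a) (?FT b) (cmp VSet (?FX a) (?Z b) (?FT b) (k b) (\<phi> a b m)) y = ap (?FX a) (?FT b) (u' (a, b) m) y"
    using \<phi>(2)[OF h y] k(2)[OF h(2) c] y h i \<kappa>s[OF b0 h(1,2,3) y] by (simp add: ap_cmp oX oT Z_obj u'_eq F_ap[OF u_in[OF h]])
  qed
  then have "cmp VSet (?FX a) (?FT b) (?FT b) (cmp VSet (?FT b) (?Z b) (?FT b) (k b) (f b)) (u' (a, b) m) = u' (a, b) m"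
   unfolding cat_assoc[OF cV i(2,1,4)] fu'[OF h] .
  then show "cmpv (tot GV) x' a t' b t' (omap (id_func B) b) (comp_trans B (tot GV) (inc GV t') (inc GV z) (inc GV t') (restrict k (obj B)) f b) (u' (a, b) m) =
   cmpv (tot GV) x' a t' b t' (omap (id_func B) b) (id_trans B (tot GV) (inc GV t') b) (u' (a, b) m)"
   using h i cat_cmp[OF cV i(4,1)] cat_id_left[OF cV i(2)] cat_id[OF cV, of "?FT b"] oT[OF h(2)] by (simp add: VV.G_cmp VV.G_idm del: tot_idm)
 qed
 \<comment> \<open>Evaluated at \<open>b0\<close> and then at the identity of k0, this makes the
   identity a value of \<kappa>.\<close>
 from fun_cong[OF this, of b0] have "cmp VSet (?FT b0) (?Z b0) (?FT b0) (k b0) (f b0) = idm VSet (?FT b0)"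
  using b0 f[OF b0] k(1)[OF b0] by (simp add: VV.G_cmp VV.G_idm del: tot_idm)
 then have "ap (?FT b0) (?FT b0) (cmp VSet (?FT b0) (?Z b0) (?FT b0) (k b0) (f b0)) (idm K k0) = idm K k0"
  using ap_id[OF oT(1)[OF b0], of "idm K k0"] oT(2)[OF b0] cat_id[OF cK k0] by simp
 moreover define \<zeta> where "\<zeta> = ap (?FT b0) (?Z b0) (f b0) (idm K k0)"
 have \<zeta>: "\<zeta> \<in> omap WN.NM (b0, b0)" unfolding \<zeta>_def
  using ap_in[OF oT(1)[OF b0] Z_obj(1)[OF b0] f[OF b0], of "idm K k0"] oT[OF b0] Z_obj[OF b0] cat_id[OF cK k0] by simp
 ultimately have k1: "\<kappa> (b0, b0) \<zeta> = idm K k0"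
  using k(1)[OF b0] k(2)[OF b0 \<zeta>] f[OF b0] cat_id[OF cK k0] ap_cmp[OF oT(1)[OF b0] Z_obj(1)[OF b0] oT(1)[OF b0], of "k b0" "f b0" "idm K k0"] oT(2)[OF b0]
  by (simp add: \<zeta>_def)
 obtain a w y where a: "a \<in> obj A" "w \<in> omap W (a, b0)" "y \<in> omap N (b0, a)" "\<zeta> = WN.cls b0 b0 (a, w, y)"
  by (rule WN.tensor_cases[OF \<zeta> b0 b0])
 have y: "y \<in> hom K k0 (omap X a)" using a b0 by (simp add: N_simps)
 show ?thesis using k1 \<kappa>s[OF b0 a(1) b0 a(2) y] a y by auto
qed

end

end

abbreviation "is_psh A \<equiv> is_functor (op_cat A) set_cat"
abbreviation "psh_trans A \<equiv> nat_trans (op_cat A) set_cat"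
abbreviation "psh_comp A \<equiv> comp_trans (op_cat A) set_cat"
abbreviation "psh_cat A \<equiv> fun_cat (op_cat A) set_cat"

section \<open>Representing objects from split idempotents\<close>

context dense_weight begin

text \<open>T b is a retract of X a. Composing \<open>u c b m\<close> with y and lifting along the
  fully faithful X gives a morphism c -> a classifying m up to the idempotent e; splitting e removes
  the ambiguity.\<close>

lemma absolute_universal:
 assumes b: "b \<in> obj B" and abs: "absolute_weight A B W"
 shows "\<exists>l v. l \<in> obj A & v \<in> omap W (l, b) &
  (\<forall>c\<in>obj A. \<forall>m\<in>omap W (c, b). \<exists>!p. p \<in> hom A c l & lact B W b l c p v = m)"
proof -
 obtain a w y where a: "a \<in> obj A" and w: "w \<in> omap W (a, b)" and y: "y \<in> hom K (omap T b) (omap X a)"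
  and wy: "cmp K (omap T b) (omap X a) (omap T b) (u a b w) y = idm K (omap T b)"
  using retract[OF b abs] by blast
 note uw = u_in[OF a b w]
 have yu: "cmp K (omap X c) (omap T b) (omap X a) y (u c b m) \<in> hom K (omap X c) (omap X a)" if "c \<in> obj A" "m \<in> omap W (c, b)" for c m
  by (rule cat_cmp[OF cK y u_in[OF that(1) b that(2)]])
 have wyu: "cmp K (omap X c) (omap X a) (omap T b) (u a b w) (cmp K (omap X c) (omap T b) (omap X a) y (u c b m)) = u c b m"
  if "c \<in> obj A" "m \<in> omap W (c, b)" for c m
  unfolding cat_assoc[OF cK u_in[OF that(1) b that(2)] y uw, symmetric] wy by (rule cat_id_left[OF cK u_in[OF that(1) b that(2)]])
 obtain e where e: "e \<in> hom A a a" and Xe: "mmap X a a e = cmp K (omap X a) (omap T b) (omap X a) y (u a b w)"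
  using X_full[OF a a yu[OF a w]] by blast
 \<comment> \<open>Morphisms lifted from composites of y with \<open>u c b m\<close> are fixed by e,
   since y followed by \<open>u a b w\<close> is the identity; for m = w this is
   idempotency.\<close>
 have abs_e: "cmp A c a a e q = q" if q: "q \<in> hom A c a" and m: "m \<in> omap W (c, b)" and Xq: "mmap X c a q = cmp K (omap X c) (omap T b) (omap X a) y (u c b m)" for c q m
 proof (rule X_faithful[OF cat_cmp[OF catA e q] q])
  have c: "c \<in> obj A" using hom_obj[OF catA q] by simp
  show "mmap X c a (cmp A c a a e q) = mmap X c a q"
   unfolding functor_cmp[OF Xf e q] Xe Xq cat_assoc[OF cK yu[OF c m] uw y] wyu[OF c m] ..
 qed
 have ee: "cmp A a a a e e = e" by (rule abs_e[OF e w Xe])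
 note ia = cat_id[OF catA a]
 \<comment> \<open>The idempotent is split by the equaliser of e and the identity.\<close>
 note D = par_diag_functor[OF catA e ia]
 obtain l p where l: "is_limit par_pair A (par_diag A a a e (idm A a)) l p" by (rule lim_exists[OF lexA finite_par_pair D])
 note cn = limit_cone[OF l]
 have uniq: "\<exists>!h. h \<in> hom A c l & (\<forall>j\<in>{0, 1}. cmp A c l a (p j) h = q j)"
  if q: "is_cone par_pair A (par_diag A a a e (idm A a)) c q" for c q
 proof -
  have "\<exists>!h. h \<in> hom A c l & (\<forall>j\<in>obj par_pair. cmp A c l (omap (par_diag A a a e (idm A a)) j) (p j) h = q j)"
   using l q unfolding is_limit_def by blast
  then show ?thesis by (simp)
 qed
 have r: "p 0 \<in> hom A l a" "p (Suc 0) \<in> hom A l a" using cone_hom[OF cn, of 0] cone_hom[OF cn, of "Suc 0"] by simp_all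
 have pp: "cmp A l a a e (p 0) = p (Suc 0)" "p (Suc 0) = p 0"
  using cone_cmp[OF cn, of 0 "Suc 0" 0] cone_cmp[OF cn, of 0 "Suc 0" "Suc 0"] cat_id_left[OF catA r(1)] by simp_all
 have lo: "l \<in> obj A" using hom_obj[OF catA r(1)] by simp
 have cone: "is_cone par_pair A (par_diag A a a e (idm A a)) c (\<lambda>_. q)" if q: "q \<in> hom A c a" "cmp A c a a e q = q" for c q
  unfolding is_cone_def using q hom_obj[OF catA q(1)] cat_id_left[OF catA q(1)] by (auto split: if_splits)
 obtain t where t: "t \<in> hom A a l" "cmp A a l a (p 0) t = e" using uniq[OF cone[OF e ee]] by auto
 have tr: "cmp A l a l t (p 0) = idm A l"
 proof -
  have c: "is_cone par_pair A (par_diag A a a e (idm A a)) l (\<lambda>_. p 0)" by (rule cone[OF r(1)]) (use pp in simp)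
  note tp = cat_cmp[OF catA t(1) r(1)]
  have "cmp A l l a (p 0) (cmp A l a l t (p 0)) = p 0"
   unfolding cat_assoc[OF catA r(1) t(1) r(1), symmetric] t(2) using pp by simp
  moreover have "cmp A l l a (p 0) (idm A l) = p 0" by (rule cat_id_right[OF catA r(1)])
  ultimately show ?thesis using uniq[OF c] tp cat_id[OF catA lo] pp(2) by auto
 qed
 \<comment> \<open>The universal element: w restricted along the inclusion of the split
   part.\<close>
 define v where "v = lact B W b a l (p 0) w"
 have v: "v \<in> omap W (l, b)" unfolding v_def by (rule prof_act[OF pW w r(1) cat_id[OF catB b]])
 have vq: "lact B W b l c q v = lact B W b a c (cmp A c l a (p 0) q) w" if "q \<in> hom A c l" for c q
  unfolding v_def by (rule prof_left_cmp[OF pW b w r(1) that])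
 have uni: "\<exists>!q. q \<in> hom A c l & lact B W b l c q v = m" if c: "c \<in> obj A" and m: "m \<in> omap W (c, b)" for c m
 proof -
  obtain q where q: "q \<in> hom A c a" and Xq: "mmap X c a q = cmp K (omap X c) (omap T b) (omap X a) y (u c b m)"
   using X_full[OF c a yu[OF c m]] by blast
  have wq: "lact B W b a c q w = m"
  proof (rule u_inj[OF c b prof_act[OF pW w q cat_id[OF catB b]] m])
   show "u c b (lact B W b a c q w) = u c b m" unfolding u_left[OF q b w] Xq by (rule wyu[OF c m])
  qed
  show ?thesis
  proof (intro ex1I[of _ "cmp A c a l t q"] conjI)
   show tq: "cmp A c a l t q \<in> hom A c l" by (rule cat_cmp[OF catA t(1) q])
   show "lact B W b l c (cmp A c a l t q) v = m"
    unfolding vq[OF tq] cat_assoc[OF catA q t(1) r(1), symmetric] t(2) abs_e[OF q m Xq] by (rule wq)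
   fix q' assume q': "q' \<in> hom A c l & lact B W b l c q' v = m"
   note rq = cat_cmp[OF catA r(1) q'[THEN conjunct1]]
   have "u c b m = cmp K (omap X c) (omap X a) (omap T b) (u a b w) (mmap X c a (cmp A c l a (p 0) q'))"
    using u_left[OF rq b w] vq[OF q'[THEN conjunct1]] q' by simp
   then have "mmap X c a q = mmap X c a (cmp A c a a e (cmp A c l a (p 0) q'))"
    unfolding Xq functor_cmp[OF Xf e rq] Xe by (simp add: cat_assoc[OF cK functor_hom[OF Xf rq] uw y])
   then have "q = cmp A c a a e (cmp A c l a (p 0) q')" by (rule X_faithful[OF q cat_cmp[OF catA e rq]])
   also have "\<dots> = cmp A c l a (p 0) q'"
    using cat_assoc[OF catA q'[THEN conjunct1] r(1) e] pp by simp
   finally have "cmp A c a l t q = cmp A c l l (cmp A l a l t (p 0)) q'" using cat_assoc[OF catA q'[THEN conjunct1] r(1) t(1)] by simp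
   then show "q' = cmp A c a l t q" using tr cat_id_left[OF catA q'[THEN conjunct1]] by simp
  qed
 qed
 show ?thesis using lo v uni by blast
qed

lemma absolute_rep:
 assumes abs: "absolute_weight A B W"
 shows "\<exists>G w. rep_weight A B W G w"
proof -
 have "\<exists>l v. b \<in> obj B \<longrightarrow> l \<in> obj A & v \<in> omap W (l, b) &
  (\<forall>c\<in>obj A. \<forall>m\<in>omap W (c, b). \<exists>!p. p \<in> hom A c l & lact B W b l c p v = m)" for b
  using absolute_universal[OF _ abs] by blast
 then obtain G w where G: "!!b. b \<in> obj B ==> G b \<in> obj A" "!!b. b \<in> obj B ==> w b \<in> omap W (G b, b)"
  "!!b c m. b \<in> obj B ==> c \<in> obj A ==> m \<in> omap W (c, b) ==> \<exists>!p. p \<in> hom A c (G b) & lact B W b (G b) c p (w b) = m"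
  by metis
 have "rep_weight A B W G w" by unfold_locales (rule lW G; assumption)+
 then show ?thesis by blast
qed

end

section \<open>Presheaves and the Yoneda lemma\<close>

context
 fixes A :: "'v::universe vcat"
 assumes A: "category A"
begin

lemma pre_hom: "is_psh A R ==> f \<in> hom A a' a ==> mmap R a a' f \<in> hom set_cat (omap R a) (omap R a')"
 using functor_hom[of "op_cat A" set_cat R f a a'] A by simp

lemma pre_act: "is_psh A R ==> f \<in> hom A a' a ==> r \<in> omap R a ==> mmap R a a' f r \<in> omap R a'"
 by (rule set_hom_in[OF pre_hom])

lemma pre_id: "is_psh A R ==> a \<in> obj A ==> r \<in> omap R a ==> mmap R a a (idm A a) r = r"
 using functor_id[of "op_cat A" set_cat R a] functor_obj[of "op_cat A" set_cat R a] by simp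

lemma pre_cmp: "is_psh A R ==> f \<in> hom A a' a ==> g \<in> hom A a'' a' ==> r \<in> omap R a ==>
  mmap R a a'' (cmp A a'' a' a f g) r = mmap R a' a'' g (mmap R a a' f r)"
 using functor_cmp[of "op_cat A" set_cat R g a' a'' f a] A set_cmp[OF pre_hom pre_hom, of R f a' a g a'' r] by simp

lemma pre_nat_hom: "psh_trans A R R' \<sigma> ==> a \<in> obj A ==> \<sigma> a \<in> hom set_cat (omap R a) (omap R' a)"
 using nat_hom[of "op_cat A" set_cat R R' \<sigma> a] by simp

lemma pre_nat_in: "psh_trans A R R' \<sigma> ==> a \<in> obj A ==> r \<in> omap R a ==> \<sigma> a r \<in> omap R' a"
 by (rule set_hom_in[OF pre_nat_hom])

lemma pre_nat:
 assumes n: "psh_trans A R R' \<sigma>" and f: "f \<in> hom A a' a" and r: "r \<in> omap R a"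
 shows "\<sigma> a' (mmap R a a' f r) = mmap R' a a' f (\<sigma> a r)"
proof -
 have o: "a \<in> obj A" "a' \<in> obj A" using hom_obj[OF A f] by auto
 note R = pre_hom[OF nat_functors(1)[OF n] f] and R' = pre_hom[OF nat_functors(2)[OF n] f]
 note s = pre_nat_hom[OF n o(1)] and s' = pre_nat_hom[OF n o(2)]
 have "f \<in> hom (op_cat A) a a'" using f A by simp
 from fun_cong[OF nat_nat[OF n this], of r] show ?thesis by (simp add: set_cmp[OF R s' r] set_cmp[OF s R' r])
qed

lemma pre_nat_eqI:
 assumes "psh_trans A R R' \<sigma>" "psh_trans A R R' \<tau>"
  and "!!a r. a \<in> obj A ==> r \<in> omap R a ==> \<sigma> a r = \<tau> a r"
 shows "\<sigma> = \<tau>"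
 by (rule nat_eqI[OF assms(1,2) refl]) (use assms(3) in \<open>auto intro!: set_hom_eqI[OF pre_nat_hom[OF assms(1)] pre_nat_hom[OF assms(2)]]\<close>)

lemma pre_comp: "psh_trans A R R' \<sigma> ==> psh_trans A R' R'' \<tau> ==> a \<in> obj A ==> r \<in> omap R a ==>
  psh_comp A R R' R'' \<tau> \<sigma> a r = \<tau> a (\<sigma> a r)"
 using set_cmp[OF pre_nat_hom pre_nat_hom] by simp

lemma pre_natI:
 assumes R: "is_psh A R" and R': "is_psh A R'"
  and h: "!!a. a \<in> obj A ==> s a \<in> hom set_cat (omap R a) (omap R' a)"
  and n: "!!a a' f r. f \<in> hom A a' a ==> r \<in> omap R a ==> s a' (mmap R a a' f r) = mmap R' a a' f (s a r)"
 shows "psh_trans A R R' (restrict s (obj A))"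
proof -
 have "psh_trans A R R' (restrict s (obj (op_cat A)))"
 proof (rule natI[OF R R'])
  fix a a' f assume "a \<in> obj (op_cat A)" "a' \<in> obj (op_cat A)" "f \<in> hom (op_cat A) a a'"
  then have a: "a \<in> obj A" "a' \<in> obj A" and f: "f \<in> hom A a' a" using A by simp_all
  note i = pre_hom[OF R f] pre_hom[OF R' f] h[OF a(1)] h[OF a(2)]
  show "cmp set_cat (omap R a) (omap R a') (omap R' a') (s a') (mmap R a a' f) = cmp set_cat (omap R a) (omap R' a) (omap R' a') (mmap R' a a' f) (s a)"
   by (rule set_hom_eqI[OF cat_cmp[OF set_category i(4,1)] cat_cmp[OF set_category i(2,3)]]) (simp add: set_cmp[OF i(1,4)] set_cmp[OF i(3,2)] n[OF f])
 qed (simp add: h)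
 then show ?thesis by simp
qed

end

text \<open>The dense situation is realised by presheaves: \<open>X\<close> is the Yoneda embedding and \<open>T b = W(-, b)\<close>.\<close>

definition psh :: "'v::universe vcat => 'v vcat => 'v prof => 'v => ('v, 'v, 'v set, 'v => 'v) func" where
 "psh A B M b = mk_func (op_cat A) (\<lambda>a. omap M (a, b)) (lact B M b)"

definition cur :: "'v::universe vcat => 'v vcat => 'v prof => ('v, 'v, ('v, 'v, 'v set, 'v => 'v) func, 'v => 'v => 'v) func" where
 "cur A B M = mk_func B (psh A B M) (\<lambda>b b' g. restrict (\<lambda>a. ract A M a b b' g) (obj A))"

lemma psh_simps [simp]:
 "a \<in> obj A ==> omap (psh A B M b) a = omap M (a, b)"
 "category A ==> f \<in> hom A a' a ==> mmap (psh A B M b) a a' f = lact B M b a a' f"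
 using hom_obj[of A f a' a] by (simp_all add: psh_def)

lemma psh_functor:
 assumes M: "is_prof A B M" and b: "b \<in> obj B"
 shows "is_psh A (psh A B M b)"
 unfolding psh_def
proof (rule functorI[OF op_category[OF prof_cats(1)[OF M]] set_category], goal_cases)
 note [simp] = prof_cats[OF M]
 note ib = cat_id[OF prof_cats(2)[OF M] b]
 { case (1 a) then show ?case using prof_small[OF M _ b] by simp }
 { case (2 a a' f) then show ?case using prof_hom[OF M _ ib] by simp }
 { case (3 a)
  then have a: "a \<in> obj A" by simp
  have "mmap M (a, b) (a, b) (idm A a, idm B b) = idm set_cat (omap M (a, b))"
   by (rule set_hom_eqI[OF prof_hom[OF M cat_id[OF _ a] ib] cat_id[OF set_category]])
    (use a b prof_small[OF M a b] prof_id[OF M a b] in auto)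
  then show ?case using a by simp }
 { case (4 a a' a'' g f)
  then have g: "g \<in> hom A a'' a'" and f: "f \<in> hom A a' a" by simp_all
  have "lact B M b a a'' (cmp A a'' a' a f g) = cmp set_cat (omap M (a, b)) (omap M (a', b)) (omap M (a'', b)) (lact B M b a' a'' g) (lact B M b a a' f)"
   by (rule set_hom_eqI[OF prof_hom[OF M cat_cmp[OF _ f g] ib] cat_cmp[OF set_category prof_hom[OF M g ib] prof_hom[OF M f ib]]])
    (simp_all add: set_cmp[OF prof_hom[OF M f ib] prof_hom[OF M g ib]] prof_left_cmp[OF M b _ f g])
  then show ?case using f g by simp }
qed

lemma cur_nat:
 assumes M: "is_prof A B M" and g: "g \<in> hom B b b'"
 shows "psh_trans A (psh A B M b) (psh A B M b') (restrict (\<lambda>a. ract A M a b b' g) (obj A))"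
proof -
 note c = prof_cats[OF M] and o = hom_obj[OF prof_cats(2)[OF M] g]
 show ?thesis
 proof (rule pre_natI[OF c(1) psh_functor[OF M conjunct1[OF o]] psh_functor[OF M conjunct2[OF o]]])
  show "ract A M a b b' g \<in> hom set_cat (omap (psh A B M b) a) (omap (psh A B M b') a)" if "a \<in> obj A" for a
   using prof_hom[OF M cat_id[OF c(1) that] g] that by simp
  show "ract A M a' b b' g (mmap (psh A B M b) a a' f r) = mmap (psh A B M b') a a' f (ract A M a b b' g r)"
   if "f \<in> hom A a' a" "r \<in> omap (psh A B M b) a" for a a' f r
   using that c hom_obj[OF c(1) that(1)] prof_split[OF M _ that(1) g, of r] by simp
 qed
qed

lemma cur_functor:
 assumes M: "is_prof A B M"
 shows "is_functor B (psh_cat A) (cur A B M)"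
 unfolding cur_def
proof (rule functorI[OF prof_cats(2)[OF M] fun_cat_category], goal_cases)
 note c = prof_cats[OF M]
 { case (1 b) then show ?case using psh_functor[OF M] by simp }
 { case (2 b b' g) then show ?case using cur_nat[OF M] by simp }
 { case (3 b)
  have "restrict (\<lambda>a. ract A M a b b (idm B b)) (obj A) = id_trans (op_cat A) set_cat (psh A B M b)"
   by (rule pre_nat_eqI[OF c(1) cur_nat[OF M cat_id[OF c(2) 3]] id_nat[OF psh_functor[OF M 3]]])
    (use 3 prof_small[OF M] prof_id[OF M] in simp)
  then show ?case using psh_functor[OF M 3] by simp }
 { case (4 b b' b'' k g)
  note n = cur_nat[OF M 4(5)] cur_nat[OF M 4(4)]
  have "restrict (\<lambda>a. ract A M a b b'' (cmp B b b' b'' k g)) (obj A) = psh_comp A (psh A B M b) (psh A B M b') (psh A B M b'')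
   (restrict (\<lambda>a. ract A M a b' b'' k) (obj A)) (restrict (\<lambda>a. ract A M a b b' g) (obj A))"
   by (rule pre_nat_eqI[OF c(1) cur_nat[OF M cat_cmp[OF c(2) 4(4,5)]] comp_nat[OF n]])
    (simp add: pre_comp[OF c(1) n] prof_right_cmp[OF M _ _ 4(5,4)] del: comp_trans_app)
  then show ?case using n by simp }
qed

lemma cur_simps [simp]:
 "b \<in> obj B ==> omap (cur A B M) b = psh A B M b"
 "category B ==> g \<in> hom B b b' ==> mmap (cur A B M) b b' g = restrict (\<lambda>a. ract A M a b b' g) (obj A)"
 using hom_obj[of B g b b'] by (simp_all add: cur_def)

text \<open>Limits of presheaves are pointwise: a matching family of transformations out of R is
  solved separately at each a and each element of R a, by exactness of M(a,-), and uniqueness makes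
  the solutions natural in a.\<close>

lemma cur_lex:
 fixes M :: "'v::universe prof"
 assumes lM: "lex_prof A B M"
 shows "lex_functor B (psh_cat A) (cur A B M)"
proof -
 note M = lex_profD(3)[OF lM]
 note c = prof_cats[OF M]
 let ?P = "psh_cat A" and ?m = "\<lambda>b. psh A B M b" and ?c = "cur A B M"
 show ?thesis unfolding lex_functor_iff_hom[OF cur_functor[OF M]]
 proof
  fix R :: "('v, 'v, 'v set, 'v => 'v) func" assume "R \<in> obj ?P"
  then have R: "is_psh A R" by simp
  show "lex_action B (\<lambda>b. hom ?P R (omap ?c b)) (\<lambda>b b' g h. cmp ?P R (omap ?c b) (omap ?c b') (mmap ?c b b' g) h)"
   unfolding lex_action_def
  proof (intro allI impI, elim conjE)
   fix J :: "(nat, nat) cat" and D l p z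
   assume J: "finite_cat J" and D: "is_functor J B D" and l: "is_limit J B D l p"
    and z: "matching J D (\<lambda>b. hom ?P R (omap ?c b)) (\<lambda>b b' g h. cmp ?P R (omap ?c b) (omap ?c b') (mmap ?c b b' g) h) z"
   note cn = limit_cone[OF l] and Do = functor_obj[OF D]
   note lo = cone_obj[OF cn] and ph = cone_hom[OF cn]
   have app: "psh_trans A R (?m b') (cmp ?P R (omap ?c b) (omap ?c b') (mmap ?c b b' g) \<sigma>)"
    "a \<in> obj A ==> r \<in> omap R a ==> cmp ?P R (omap ?c b) (omap ?c b') (mmap ?c b b' g) \<sigma> a r = ract A M a b b' g (\<sigma> a r)"
    if g: "g \<in> hom B b b'" and s: "psh_trans A R (?m b) \<sigma>" for b b' g \<sigma> a r
    using comp_nat[OF s cur_nat[OF M g]] pre_comp[OF c(1) s cur_nat[OF M g], of a r] hom_obj[OF c(2) g] g s cur_nat[OF M g] c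
    by (simp_all del: comp_trans_app)
   have zn: "psh_trans A R (?m (omap D j)) (z j)" if "j \<in> obj J" for j
   proof -
    have "z j \<in> hom ?P R (omap ?c (omap D j))" using z that unfolding matching_def by blast
    then show ?thesis using Do[OF that] by simp
   qed
   have ex: "\<exists>!x. x \<in> omap M (a, l) & (\<forall>j\<in>obj J. ract A M a l (omap D j) (p j) x = z j a r)" if a: "a \<in> obj A" and r: "r \<in> omap R a" for a r
   proof (rule lex_actionD[OF lex_prof_action[OF lM a] J D l])
    have "ract A M a (omap D i) (omap D j) (mmap D i j f) (z i a r) = z j a r" if h: "i \<in> obj J" "j \<in> obj J" "f \<in> hom J i j" for i j f
    proof -
     have "cmp ?P R (omap ?c (omap D i)) (omap ?c (omap D j)) (mmap ?c (omap D i) (omap D j) (mmap D i j f)) (z i) = z j"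
      using z h unfolding matching_def by blast
     then show ?thesis using app(2)[OF functor_hom[OF D h(3)] zn[OF h(1)] a r] by simp
    qed
    then show "matching J D (\<lambda>b. omap M (a, b)) (ract A M a) (\<lambda>j. z j a r)"
     unfolding matching_def using pre_nat_in[OF c(1) zn a r] a Do by simp
   qed
   then have "\<exists>x. a \<in> obj A \<longrightarrow> r \<in> omap R a \<longrightarrow> x \<in> omap M (a, l) & (\<forall>j\<in>obj J. ract A M a l (omap D j) (p j) x = z j a r)" for a r by blast
   then obtain \<sigma> where \<sigma>: "!!a r. a \<in> obj A ==> r \<in> omap R a ==> \<sigma> a r \<in> omap M (a, l)"
    "!!a r j. a \<in> obj A ==> r \<in> omap R a ==> j \<in> obj J ==> ract A M a l (omap D j) (p j) (\<sigma> a r) = z j a r" by metis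
   have uq: "x = \<sigma> a r" if "a \<in> obj A" "r \<in> omap R a" "x \<in> omap M (a, l)" "!!j. j \<in> obj J ==> ract A M a l (omap D j) (p j) x = z j a r" for a r x
    using ex[OF that(1,2)] \<sigma>[OF that(1,2)] that(3,4) by blast
   define \<tau> where "\<tau> = restrict (\<lambda>a. restrict (\<sigma> a) (omap R a)) (obj A)"
   have \<tau>: "psh_trans A R (?m l) \<tau>" unfolding \<tau>_def
   proof (rule pre_natI[OF c(1) R psh_functor[OF M lo]])
    show "restrict (\<sigma> a) (omap R a) \<in> hom set_cat (omap R a) (omap (?m l) a)" if "a \<in> obj A" for a
     using that functor_obj[OF R, of a] prof_small[OF M that lo] \<sigma>(1) by (intro set_homI) simp_all
    fix a a' f r assume f: "f \<in> hom A a' a" and r: "r \<in> omap R a"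
    note a = hom_obj[OF c(1) f] and r' = pre_act[OF c(1) R f r]
    have s: "\<sigma> a r \<in> omap M (a, l)" using \<sigma>(1) a r by blast
    have "lact B M l a a' f (\<sigma> a r) = \<sigma> a' (mmap R a a' f r)"
    \<comment> \<open>The restricted solution solves the problem posed by the restricted element,
      because the two actions of M commute.\<close>
    proof (rule uq[OF conjunct1[OF a] r' prof_act[OF M s f cat_id[OF c(2) lo]]])
     fix j assume j: "j \<in> obj J"
     have "ract A M a' l (omap D j) (p j) (lact B M l a a' f (\<sigma> a r)) = lact B M (omap D j) a a' f (ract A M a l (omap D j) (p j) (\<sigma> a r))"
      using prof_split[OF M s f ph[OF j]] by simp
     then show "ract A M a' l (omap D j) (p j) (lact B M l a a' f (\<sigma> a r)) = z j a' (mmap R a a' f r)"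
      using pre_nat[OF c(1) zn[OF j] f r] \<sigma>(2)[OF conjunct2[OF a] r j] f c by simp
    qed
    then show "restrict (\<sigma> a') (omap R a') (mmap R a a' f r) = mmap (?m l) a a' f (restrict (\<sigma> a) (omap R a) r)"
     using r r' f c by simp
   qed
   show "\<exists>!x. x \<in> hom ?P R (omap ?c l) & (\<forall>j\<in>obj J. cmp ?P R (omap ?c l) (omap ?c (omap D j)) (mmap ?c l (omap D j) (p j)) x = z j)"
   proof (intro ex1I[of _ \<tau>] conjI ballI)
    show "\<tau> \<in> hom ?P R (omap ?c l)" using \<tau> lo by simp
    fix j assume j: "j \<in> obj J"
    show "cmp ?P R (omap ?c l) (omap ?c (omap D j)) (mmap ?c l (omap D j) (p j)) \<tau> = z j"
     by (rule pre_nat_eqI[OF c(1) app(1)[OF ph[OF j] \<tau>] zn[OF j]]) (simp add: app(2)[OF ph[OF j] \<tau>] \<sigma>(2) j, simp add: \<tau>_def \<sigma>(2) j)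
   next
    fix h assume h: "h \<in> hom ?P R (omap ?c l) & (\<forall>j\<in>obj J. cmp ?P R (omap ?c l) (omap ?c (omap D j)) (mmap ?c l (omap D j) (p j)) h = z j)"
    then have hn: "psh_trans A R (?m l) h" using lo by simp
    show "h = \<tau>"
    proof (rule pre_nat_eqI[OF c(1) hn \<tau>])
     fix a r assume a: "a \<in> obj A" and r: "r \<in> omap R a"
     have "h a r = \<sigma> a r"
      by (rule uq[OF a r]) (use pre_nat_in[OF c(1) hn a r] a h app(2)[OF ph hn a r] in auto)
     then show "h a r = \<tau> a r" using a r by (simp add: \<tau>_def)
    qed
   qed
  qed
 qed
qed

context
 fixes A :: "'v::universe vcat"
 assumes A: "category A"
begin

text \<open>The transformation out of the representable at a that corresponds to the element \<rho>
  of R a under the Yoneda lemma.\<close>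

definition ynt :: "('v, 'v, 'v set, 'v => 'v) func => 'v => 'v => 'v => 'v => 'v" where
 "ynt R a \<rho> = restrict (\<lambda>a'. restrict (\<lambda>p. mmap R a a' p \<rho>) (hom A a' a)) (obj A)"

lemma ynt_app [simp]: "p \<in> hom A a' a ==> ynt R a \<rho> a' p = mmap R a a' p \<rho>"
 using hom_obj[OF A, of p a' a] by (simp add: ynt_def)

end

locale yoneda =
 fixes A :: "'v::universe vcat"
 assumes lA: "small_lex_cat A"
begin

lemma A: "category A" by (rule small_lex_catD(1)[OF lA])

abbreviation "ya a \<equiv> psh A A (id_prof A) a"

lemma ya_functor: "a \<in> obj A ==> is_psh A (ya a)"
 by (rule psh_functor[OF id_prof_prof[OF lA]])

lemma ya_simps: "a \<in> obj A ==> a' \<in> obj A ==> omap (ya a) a' = hom A a' a"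
 "p \<in> hom A a' a ==> f \<in> hom A a'' a' ==> mmap (ya a) a' a'' f p = cmp A a'' a' a p f"
 using A hom_obj[OF A, of p a' a] hom_obj[OF A, of f a'' a'] cat_id_left[OF A cat_cmp[OF A, of p a' a f a'']] cat_cmp[OF A, of p a' a f a'']
 by (simp_all add: cat_id)

lemma cur_ya: "f \<in> hom A a a' ==> p \<in> hom A c a ==> mmap (cur A A (id_prof A)) a a' f c p = cmp A c a a' f p"
 using A hom_obj[OF A, of p c a] cat_id_right[OF A, of p c a] by (simp add: cat_id)

lemma ynt_nat:
 assumes R: "is_psh A R" and a: "a \<in> obj A" and r: "r \<in> omap R a"
 shows "psh_trans A (ya a) R (ynt A R a r)"
proof -
 have "psh_trans A (ya a) R (restrict (\<lambda>c. restrict (\<lambda>p. mmap R a c p r) (omap (ya a) c)) (obj A))"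
  by (rule pre_natI[OF A ya_functor[OF a] R], rule set_homI)
   (use a r functor_obj[OF R] functor_obj[OF ya_functor[OF a]] hom_obj[OF A] pre_act[OF A ya_functor[OF a]] in
    \<open>auto simp: ya_simps pre_act[OF A R] pre_cmp[OF A R]\<close>)
 moreover have "restrict (\<lambda>c. restrict (\<lambda>p. mmap R a c p r) (omap (ya a) c)) (obj A) = ynt A R a r"
  unfolding ynt_def[OF A] using a by (auto simp: ya_simps intro!: restrict_ext)
 ultimately show ?thesis by simp
qed

text \<open>A morphism p is the identity restricted along p, so naturality determines \<sigma> by
  its value at the identity.\<close>

lemma ynt_eta:
 assumes \<sigma>: "psh_trans A (ya a) R \<sigma>" and a: "a \<in> obj A"
 shows "\<sigma> = ynt A R a (\<sigma> a (idm A a))" "\<sigma> a (idm A a) \<in> omap R a"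
proof -
 note ia = cat_id[OF A a]
 show r: "\<sigma> a (idm A a) \<in> omap R a" using pre_nat_in[OF A \<sigma> a] ia a by (simp add: ya_simps)
 show "\<sigma> = ynt A R a (\<sigma> a (idm A a))"
 proof (rule pre_nat_eqI[OF A \<sigma> ynt_nat[OF nat_functors(2)[OF \<sigma>] a r]])
  fix c p assume c: "c \<in> obj A" "p \<in> omap (ya a) c"
  then have p: "p \<in> hom A c a" using a by (simp add: ya_simps)
  show "\<sigma> c p = ynt A R a (\<sigma> a (idm A a)) c p"
   using pre_nat[OF A \<sigma> p, of "idm A a"] p ia a cat_id_left[OF A p] by (simp add: ya_simps ynt_app[OF A])
 qed
qed

lemma ynt_self: "is_psh A R ==> a \<in> obj A ==> r \<in> omap R a ==> ynt A R a r a (idm A a) = r"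
 using cat_id[OF A] by (simp add: ynt_app[OF A] pre_id[OF A])

text \<open>Naturality of the Yoneda bijection in the presheaf; \<open>ynt_pre\<close> is naturality
  in the object. Composites of coded morphisms are computed with these two.\<close>

lemma ynt_post:
 assumes \<tau>: "psh_trans A R R' \<tau>" and a: "a \<in> obj A" and r: "r \<in> omap R a"
 shows "psh_comp A (ya a) R R' \<tau> (ynt A R a r) = ynt A R' a (\<tau> a r)"
proof -
 note y = ynt_nat[OF nat_functors(1)[OF \<tau>] a r]
 show ?thesis
  by (rule pre_nat_eqI[OF A comp_nat[OF y \<tau>] ynt_nat[OF nat_functors(2)[OF \<tau>] a pre_nat_in[OF A \<tau> a r]]])
   (use a r in \<open>auto simp: pre_comp[OF A y \<tau>] ya_simps ynt_app[OF A] pre_nat[OF A \<tau>] simp del: comp_trans_app\<close>)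
qed

lemma ya_mor: "f \<in> hom A a a' ==> mmap (cur A A (id_prof A)) a a' f = ynt A (ya a') a f"
proof (rule pre_nat_eqI[OF A])
 assume f: "f \<in> hom A a a'"
 have o: "a \<in> obj A" "a' \<in> obj A" using hom_obj[OF A f] by auto
 show "psh_trans A (ya a) (ya a') (mmap (cur A A (id_prof A)) a a' f)"
  using cur_nat[OF id_prof_prof[OF lA] f] f A by simp
 show "psh_trans A (ya a) (ya a') (ynt A (ya a') a f)"
  by (rule ynt_nat[OF ya_functor[OF o(2)] o(1)]) (use f o in \<open>simp add: ya_simps\<close>)
 show "mmap (cur A A (id_prof A)) a a' f c p = ynt A (ya a') a f c p" if "c \<in> obj A" "p \<in> omap (ya a) c" for c p
  using that o f by (simp add: ya_simps cur_ya ynt_app[OF A])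
qed

lemma ynt_pre:
 assumes R: "is_psh A R" and f: "f \<in> hom A a' a" and r: "r \<in> omap R a"
 shows "psh_comp A (ya a') (ya a) R (ynt A R a r) (mmap (cur A A (id_prof A)) a' a f) = ynt A R a' (mmap R a a' f r)"
proof -
 have o: "a \<in> obj A" "a' \<in> obj A" using hom_obj[OF A f] by auto
 have f': "f \<in> omap (ya a) a'" using f o by (simp add: ya_simps)
 show ?thesis unfolding ya_mor[OF f] ynt_post[OF ynt_nat[OF R o(1) r] o(2) f'] using f by (simp add: ynt_app[OF A])
qed

end

text \<open>Provides the two tags that separate objects of A from objects of B.\<close>

lemma empty_neq_singleton: "vset {} \<noteq> vset {vset {}}"
 using vset_inject[OF small_empty small_doubleton[of "vset {}" "vset {}"]] by simp

section \<open>Realisation of the dense situation by presheaves\<close>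

locale presheaf_weight =
 fixes A B :: "'v::universe vcat" and W :: "'v prof"
 assumes lW: "lex_prof A B W"
begin

sublocale yoneda A by unfold_locales (rule lex_profD(1)[OF lW])

lemma lexB: "small_lex_cat B" and pW: "is_prof A B W" and catB: "category B"
 using lex_profD[OF lW] small_lex_catD(1) by auto

abbreviation "Wb b \<equiv> psh A B W b"

text \<open>A disjoint union, since A and B may share objects; presheaves are functions, so they are
  named by these elements of the universe.\<close>

definition tagged :: "'v set" where
 "tagged = vpair (vset {}) ` obj A \<union> vpair (vset {vset {}}) ` obj B"

definition pobj :: "'v => ('v, 'v, 'v set, 'v => 'v) func" where
 "pobj s = (if vfst s = vset {} then ya (vsnd s) else Wb (vsnd s))"

text \<open>A transformation is coded as a graph of graphs; recording the domains suffices for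
  injectivity on a fixed hom-set.\<close>

definition em :: "'v => ('v => 'v => 'v) => 'v" where
 "em s \<sigma> = vgraph (obj A) (\<lambda>a. vgraph (omap (pobj s) a) (\<sigma> a))"

abbreviation "ja \<equiv> vpair (vset {})"
abbreviation "jb \<equiv> vpair (vset {vset {}})"

lemma tagged_simps [simp]: "a \<in> obj A ==> ja a \<in> tagged" "b \<in> obj B ==> jb b \<in> tagged"
 "pobj (ja a) = ya a" "pobj (jb b) = Wb b"
 using empty_neq_singleton empty_neq_singleton[symmetric] by (auto simp: tagged_def pobj_def)

lemma pobj_functor: "s \<in> tagged ==> is_psh A (pobj s)"
 using ya_functor psh_functor[OF pW] unfolding tagged_def by auto

lemma pobj_small: "s \<in> tagged ==> a \<in> obj A ==> small (omap (pobj s) a)"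
 using functor_obj[OF pobj_functor, of s a] by simp

lemma small_objA: "small (obj A)"
 using lA unfolding small_lex_cat_def by blast

sublocale P: recoding "psh_cat A" tagged pobj "\<lambda>s t. em s"
proof
 show "category (psh_cat A)" by (rule fun_cat_category)
 show "pobj s \<in> obj (psh_cat A)" if "s \<in> tagged" for s using pobj_functor[OF that] by simp
 show "inj_on (em s) (hom (psh_cat A) (pobj s) (pobj t))" if s: "s \<in> tagged" for s t
 proof (rule inj_onI)
  fix \<sigma> \<tau> assume "\<sigma> \<in> hom (psh_cat A) (pobj s) (pobj t)" "\<tau> \<in> hom (psh_cat A) (pobj s) (pobj t)" and e: "em s \<sigma> = em s \<tau>"
  then have n: "psh_trans A (pobj s) (pobj t) \<sigma>" "psh_trans A (pobj s) (pobj t) \<tau>" by simp_all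
  show "\<sigma> = \<tau>"
  proof (rule pre_nat_eqI[OF A n])
   fix a r assume a: "a \<in> obj A" and r: "r \<in> omap (pobj s) a"
   have "vgraph (omap (pobj s) a) (\<sigma> a) = vgraph (omap (pobj s) a) (\<tau> a)"
    using vgraph_inject[OF small_objA small_objA e[unfolded em_def]] a by blast
   then show "\<sigma> a r = \<tau> a r" using vgraph_inject[OF pobj_small[OF s a] pobj_small[OF s a]] r by blast
  qed
 qed
qed

text \<open>Coded transformations are graphs on \<open>obj A\<close> with values in one small set,
  the union over a of the graphs between the values at a.\<close>

lemma RC_small: "locally_small P.RC"
 unfolding locally_small_def
proof (intro ballI)
 fix s t assume "s \<in> obj P.RC" "t \<in> obj P.RC"
 then have st: "s \<in> tagged" "t \<in> tagged" by simp_all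
 define V where "V = (\<Union>a\<in>obj A. vgraph (omap (pobj s) a) ` (omap (pobj s) a \<rightarrow> omap (pobj t) a))"
 have "small V" unfolding V_def by (intro small_Union small_objA small_graphs pobj_small st)
 moreover have "hom P.RC s t \<subseteq> vgraph (obj A) ` (obj A \<rightarrow> V)"
 proof
  fix h assume "h \<in> hom P.RC s t"
  then obtain \<sigma> where \<sigma>: "psh_trans A (pobj s) (pobj t) \<sigma>" and h: "h = em s \<sigma>" using P.RC_hom[OF st] by auto
  have "vgraph (omap (pobj s) a) (\<sigma> a) \<in> V" if "a \<in> obj A" for a
   unfolding V_def using pre_nat_in[OF A \<sigma> that] that by blast
  then show "h \<in> vgraph (obj A) ` (obj A \<rightarrow> V)" unfolding h em_def by blast
 qed
 ultimately show "small (hom P.RC s t)" by (rule small_subset[OF small_graphs[OF small_objA]])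
qed

definition "YX = P.lift A ja (cur A A (id_prof A))"
definition "YT = P.lift B jb (cur A B W)"
definition "yu a b m = em (ja a) (ynt A (Wb b) a m)"

lemma Y_simps [simp]: "a \<in> obj A ==> omap YX a = ja a" "f \<in> hom A a a' ==> mmap YX a a' f = em (ja a) (ynt A (ya a') a f)"
 "b \<in> obj B ==> omap YT b = jb b" "g \<in> hom B b b' ==> mmap YT b b' g = em (jb b) (mmap (cur A B W) b b' g)"
 using hom_obj[OF A, of f a a'] hom_obj[OF catB, of g b b'] by (simp_all add: YX_def YT_def ya_mor)

lemma YX_lex: "lex_functor A P.RC YX"
 unfolding YX_def by (rule P.lift_lex[OF cur_lex[OF id_prof_lex[OF lA]]]) simp_all

lemma YT_lex: "lex_functor B P.RC YT"
 unfolding YT_def by (rule P.lift_lex[OF cur_lex[OF lW]]) simp_all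

lemma ynt_W: "a \<in> obj A ==> b \<in> obj B ==> m \<in> omap W (a, b) ==> psh_trans A (ya a) (Wb b) (ynt A (Wb b) a m)"
 by (rule ynt_nat[OF psh_functor[OF pW]]) simp_all

lemma ynt_ya: "f \<in> hom A a a' ==> psh_trans A (ya a) (ya a') (ynt A (ya a') a f)"
 using hom_obj[OF A, of f a a'] by (intro ynt_nat[OF ya_functor]) (simp_all add: ya_simps)

lemma P_cmp: "s \<in> tagged ==> t \<in> tagged ==> r \<in> tagged ==> psh_trans A (pobj s) (pobj t) \<sigma> ==>
  psh_trans A (pobj t) (pobj r) \<tau> ==>
  cmp P.RC s t r (em t \<tau>) (em s \<sigma>) = em s (psh_comp A (pobj s) (pobj t) (pobj r) \<tau> \<sigma>)"
 using P.RC_cmp_em[of s t r \<tau> \<sigma>] by simp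

lemma em_eq: "s \<in> tagged ==> t \<in> tagged ==> psh_trans A (pobj s) (pobj t) \<sigma> ==>
  psh_trans A (pobj s) (pobj t) \<tau> ==> em s \<sigma> = em s \<tau> ==> \<sigma> = \<tau>"
 using P.inj[of s t] by (auto dest: inj_onD)

lemma em_hom: "s \<in> tagged ==> t \<in> tagged ==> psh_trans A (pobj s) (pobj t) \<sigma> ==> em s \<sigma> \<in> hom P.RC s t"
 using P.em_in[of s t \<sigma>] by simp

lemma hom_em: "s \<in> tagged ==> t \<in> tagged ==> h \<in> hom P.RC s t ==> \<exists>\<sigma>. psh_trans A (pobj s) (pobj t) \<sigma> & h = em s \<sigma>"
 using P.RC_hom[of s t] by auto

text \<open>By Yoneda, X is fully faithful and a morphism out of a representable is an element of
  its target. So a cocone on X indexed by the elements of W(-,b) is a transformation out of W(-,b):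
  representables are dense.\<close>

lemma dense: "dense_weight A B W P.RC YX YT yu"
proof
 show "lex_prof A B W" by (rule lW)
 show "category P.RC" by (rule P.RC_category)
 show "locally_small P.RC" by (rule RC_small)
 show "lex_functor A P.RC YX" by (rule YX_lex)
 show "lex_functor B P.RC YT" by (rule YT_lex)
next
 fix a a' h assume a: "a \<in> obj A" "a' \<in> obj A" and h: "h \<in> hom P.RC (omap YX a) (omap YX a')"
 obtain \<sigma> where \<sigma>: "psh_trans A (ya a) (ya a') \<sigma>" "h = em (ja a) \<sigma>"
  using hom_em[of "ja a" "ja a'" h] h a by auto
 note e = ynt_eta[OF \<sigma>(1) a(1)]
 show "\<exists>p\<in>hom A a a'. mmap YX a a' p = h"
  by (rule bexI[of _ "\<sigma> a (idm A a)"]) (use e a \<sigma> in \<open>simp_all add: ya_simps\<close>)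
next
 fix a a' p p' assume p: "p \<in> hom A a a'" "p' \<in> hom A a a'" and e: "mmap YX a a' p = mmap YX a a' p'"
 have a: "a \<in> obj A" "a' \<in> obj A" using hom_obj[OF A p(1)] by auto
 have "ynt A (ya a') a p = ynt A (ya a') a p'"
  by (rule em_eq[of "ja a" "ja a'"]) (use e p a ynt_ya in simp_all)
 then show "p = p'" using ynt_self[OF ya_functor[OF a(2)] a(1)] p a by (metis ya_simps(1))
next
 fix a b m assume a: "a \<in> obj A" and b: "b \<in> obj B" and m: "m \<in> omap W (a, b)"
 show "yu a b m \<in> hom P.RC (omap YX a) (omap YT b)"
  using em_hom[of "ja a" "jb b"] ynt_W[OF a b m] a b by (simp add: yu_def)
next
 fix a a' b p m assume p: "p \<in> hom A a' a" and b: "b \<in> obj B" and m: "m \<in> omap W (a, b)"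
 have a: "a \<in> obj A" "a' \<in> obj A" using hom_obj[OF A p] by auto
 have "cmp P.RC (ja a') (ja a) (jb b) (em (ja a) (ynt A (Wb b) a m)) (em (ja a') (ynt A (ya a) a' p)) =
  em (ja a') (ynt A (Wb b) a' (mmap (Wb b) a a' p m))"
  using P_cmp[of "ja a'" "ja a" "jb b"] ynt_W[OF a(1) b m] ynt_ya[OF p] a b ynt_pre[OF psh_functor[OF pW b] p, of m] m
  by (simp add: ya_mor[OF p])
 then show "yu a' b (lact B W b a a' p m) = cmp P.RC (omap YX a') (omap YX a) (omap YT b) (yu a b m) (mmap YX a' a p)"
  using a b p A by (simp add: yu_def)
next
 fix a b b' r m assume a: "a \<in> obj A" and r: "r \<in> hom B b b'" and m: "m \<in> omap W (a, b)"
 have b: "b \<in> obj B" "b' \<in> obj B" using hom_obj[OF catB r] by auto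
 have c: "psh_trans A (Wb b) (Wb b') (mmap (cur A B W) b b' r)" using cur_nat[OF pW r] r catB by simp
 have "psh_comp A (ya a) (Wb b) (Wb b') (mmap (cur A B W) b b' r) (ynt A (Wb b) a m) =
  ynt A (Wb b') a (mmap (cur A B W) b b' r a m)"
  by (rule ynt_post[OF c a]) (use m a in simp)
 then have "cmp P.RC (ja a) (jb b) (jb b') (em (jb b) (mmap (cur A B W) b b' r)) (em (ja a) (ynt A (Wb b) a m)) =
  em (ja a) (ynt A (Wb b') a (ract A W a b b' r m))"
  using P_cmp[of "ja a" "jb b" "jb b'"] ynt_W[OF a b(1) m] c a b r catB by simp
 then show "yu a b' (ract A W a b b' r m) = cmp P.RC (omap YX a) (omap YT b) (omap YT b') (mmap YT b b' r) (yu a b m)"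
  using a b r by (simp add: yu_def del: cur_simps)
next
 fix a b m m' assume a: "a \<in> obj A" and b: "b \<in> obj B" and m: "m \<in> omap W (a, b)" "m' \<in> omap W (a, b)" and e: "yu a b m = yu a b m'"
 have "ynt A (Wb b) a m = ynt A (Wb b) a m'"
  by (rule em_eq[of "ja a" "jb b"]) (use ynt_W[OF a b] e a b m in \<open>simp_all add: yu_def\<close>)
 then show "m = m'" using ynt_self[OF psh_functor[OF pW b] a] m a by (metis psh_simps(1))
next
 fix k b \<phi> assume k: "k \<in> obj P.RC" and b: "b \<in> obj B"
  and \<phi>: "!!a m. a \<in> obj A ==> m \<in> omap W (a, b) ==> \<phi> a m \<in> hom P.RC (omap YX a) k"
  and nat: "!!a a' p m. p \<in> hom A a' a ==> m \<in> omap W (a, b) ==>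
    \<phi> a' (lact B W b a a' p m) = cmp P.RC (omap YX a') (omap YX a) k (\<phi> a m) (mmap YX a' a p)"
 have k': "k \<in> tagged" using k by simp
 note R = pobj_functor[OF k']
 \<comment> \<open>Each leg of the cocone is, by Yoneda, an element of the presheaf
   \<open>pobj k\<close>; \<tau> collects these elements.\<close>
 have "\<exists>r. a \<in> obj A \<longrightarrow> m \<in> omap W (a, b) \<longrightarrow> r \<in> omap (pobj k) a & \<phi> a m = em (ja a) (ynt A (pobj k) a r)" for a m
 proof (cases "a \<in> obj A & m \<in> omap W (a, b)")
  case True
  then obtain \<sigma> where \<sigma>: "psh_trans A (ya a) (pobj k) \<sigma>" "\<phi> a m = em (ja a) \<sigma>"
   using hom_em[of "ja a" k "\<phi> a m"] \<phi>[of a m] k' by auto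
  then show ?thesis using ynt_eta[OF \<sigma>(1)] True by metis
 qed blast
 then obtain \<tau> where \<tau>: "!!a m. a \<in> obj A ==> m \<in> omap W (a, b) ==> \<tau> a m \<in> omap (pobj k) a"
  "!!a m. a \<in> obj A ==> m \<in> omap W (a, b) ==> \<phi> a m = em (ja a) (ynt A (pobj k) a (\<tau> a m))" by metis
 define t where "t = restrict (\<lambda>a. restrict (\<tau> a) (omap (Wb b) a)) (obj A)"
 have tn: "psh_trans A (Wb b) (pobj k) t"
  unfolding t_def
 proof (rule pre_natI[OF A psh_functor[OF pW b] R])
  show "restrict (\<tau> a) (omap (Wb b) a) \<in> hom set_cat (omap (Wb b) a) (omap (pobj k) a)" if "a \<in> obj A" for a
   using \<tau>(1) that prof_small[OF pW that b] pobj_small[OF k' that] by (intro set_homI) simp_all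
 next
  fix a a' p r assume p: "p \<in> hom A a' a" and "r \<in> omap (Wb b) a"
  have a: "a \<in> obj A" "a' \<in> obj A" using hom_obj[OF A p] by auto
  then have r: "r \<in> omap W (a, b)" using \<open>r \<in> omap (Wb b) a\<close> by simp
  note r' = prof_act[OF pW r p cat_id[OF catB b]] and t1 = \<tau>(1)[OF a(1) r]
  \<comment> \<open>Compatibility of the legs, stripped of the Yoneda coding, is naturality of
    \<tau>.\<close>
  have "em (ja a') (ynt A (pobj k) a' (\<tau> a' (lact B W b a a' p r))) =
   cmp P.RC (ja a') (ja a) k (em (ja a) (ynt A (pobj k) a (\<tau> a r))) (em (ja a') (ynt A (ya a) a' p))"
   using nat[OF p r] \<tau>(2)[OF a(1) r] \<tau>(2)[OF a(2) r'] a p by simp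
  also have "\<dots> = em (ja a') (ynt A (pobj k) a' (mmap (pobj k) a a' p (\<tau> a r)))"
   using P_cmp[of "ja a'" "ja a" k] ynt_nat[OF R a(1) t1] ynt_ya[OF p] a k' ynt_pre[OF R p t1] by (simp add: ya_mor[OF p])
  finally have e: "em (ja a') (ynt A (pobj k) a' (\<tau> a' (lact B W b a a' p r))) =
   em (ja a') (ynt A (pobj k) a' (mmap (pobj k) a a' p (\<tau> a r)))" .
  note y = ynt_nat[OF R a(2) \<tau>(1)[OF a(2) r']] ynt_nat[OF R a(2) pre_act[OF A R p t1]]
  have "ynt A (pobj k) a' (\<tau> a' (lact B W b a a' p r)) = ynt A (pobj k) a' (mmap (pobj k) a a' p (\<tau> a r))"
   by (rule em_eq[OF _ k' _ _ e]) (simp_all only: tagged_simps y a)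
  then have "\<tau> a' (lact B W b a a' p r) = mmap (pobj k) a a' p (\<tau> a r)"
   using ynt_self[OF R a(2) \<tau>(1)[OF a(2) r']] ynt_self[OF R a(2) pre_act[OF A R p t1]] by metis
  then show "restrict (\<tau> a') (omap (Wb b) a') (mmap (Wb b) a a' p r) = mmap (pobj k) a a' p (restrict (\<tau> a) (omap (Wb b) a) r)"
   using p r r' a A by simp
 qed
 have "cmp P.RC (ja a) (jb b) k (em (jb b) t) (em (ja a) (ynt A (Wb b) a m)) = \<phi> a m" if a: "a \<in> obj A" and m: "m \<in> omap W (a, b)" for a m
  using P_cmp[of "ja a" "jb b" k] ynt_W[OF a b m] tn a b k' m ynt_post[OF tn a, of m] \<tau>(2)[OF a m] by (simp add: t_def)
 then show "\<exists>t\<in>hom P.RC (omap YT b) k. \<forall>a\<in>obj A. \<forall>m\<in>omap W (a, b). cmp P.RC (omap YX a) (omap YT b) k t (yu a b m) = \<phi> a m"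
  using em_hom[of "jb b" k t] tn b k' by (intro bexI[of _ "em (jb b) t"]) (simp_all add: yu_def)
next
 fix k b t t' assume k: "k \<in> obj P.RC" and b: "b \<in> obj B" and t: "t \<in> hom P.RC (omap YT b) k" "t' \<in> hom P.RC (omap YT b) k"
  and e: "!!a m. a \<in> obj A ==> m \<in> omap W (a, b) ==> cmp P.RC (omap YX a) (omap YT b) k t (yu a b m) = cmp P.RC (omap YX a) (omap YT b) k t' (yu a b m)"
 have k': "k \<in> tagged" using k by simp
 note R = pobj_functor[OF k']
 obtain \<tau> where \<tau>: "psh_trans A (Wb b) (pobj k) \<tau>" "t = em (jb b) \<tau>" using hom_em[of "jb b" k t] t b k' by auto
 obtain \<tau>' where \<tau>': "psh_trans A (Wb b) (pobj k) \<tau>'" "t' = em (jb b) \<tau>'" using hom_em[of "jb b" k t'] t b k' by auto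
 have "\<tau> = \<tau>'"
 proof (rule pre_nat_eqI[OF A \<tau>(1) \<tau>'(1)])
  fix a m assume a: "a \<in> obj A" and "m \<in> omap (Wb b) a"
  then have m: "m \<in> omap W (a, b)" and m': "m \<in> omap (Wb b) a" by simp_all
  note i = pre_nat_in[OF A \<tau>(1) a m'] pre_nat_in[OF A \<tau>'(1) a m']
  have c: "cmp P.RC (ja a) (jb b) k (em (jb b) \<sigma>) (em (ja a) (ynt A (Wb b) a m)) = em (ja a) (ynt A (pobj k) a (\<sigma> a m))"
   if \<sigma>: "psh_trans A (Wb b) (pobj k) \<sigma>" for \<sigma>
   using P_cmp[of "ja a" "jb b" k] ynt_W[OF a b m] \<sigma> a b k' ynt_post[OF \<sigma> a m'] by simp
  have "em (ja a) (ynt A (pobj k) a (\<tau> a m)) = em (ja a) (ynt A (pobj k) a (\<tau>' a m))"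
   using e[OF a m] a b c[OF \<tau>(1)] c[OF \<tau>'(1)] \<tau>(2) \<tau>'(2) by (simp add: yu_def)
  then have "ynt A (pobj k) a (\<tau> a m) = ynt A (pobj k) a (\<tau>' a m)"
   by (rule em_eq[of "ja a" k, rotated -1]) (use ynt_nat[OF R a i(1)] ynt_nat[OF R a i(2)] a k' in simp_all)
  then show "\<tau> a m = \<tau>' a m" using ynt_self[OF R a i(1)] ynt_self[OF R a i(2)] by metis
 qed
 then show "t = t'" using \<tau> \<tau>' by simp
next
 fix k assume "k \<in> obj P.RC"
 then have "k \<in> tagged" by simp
 then show "(\<exists>a\<in>obj A. omap YX a = k) \<or> (\<exists>b\<in>obj B. omap YT b = k)" unfolding tagged_def by auto
qed

end

theorem absolute_weight_rep:
 assumes "absolute_weight A B W"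
 shows "\<exists>G w. rep_weight A B W G w"
proof -
 interpret presheaf_weight A B W by unfold_locales (use assms in \<open>simp add: absolute_weight_def\<close>)
 show ?thesis by (rule dense_weight.absolute_rep[OF dense assms])
qed

section \<open>Absolute tensors as restrictions along finite-limit-preserving functors\<close>

lemma iso_cmp:
 assumes A: "category A" and f: "is_iso A a b f" and g: "is_iso A b c g"
 shows "is_iso A a c (cmp A a b c g f)"
proof -
 obtain f' where f': "f' \<in> hom A b a" "cmp A a b a f' f = idm A a" "cmp A b a b f f' = idm A b" using f by (rule is_isoD)
 obtain g' where g': "g' \<in> hom A c b" "cmp A b c b g' g = idm A b" "cmp A c b c g g' = idm A c" using g by (rule is_isoD)
 have h: "f \<in> hom A a b" "g \<in> hom A b c" and o: "a \<in> obj A" "c \<in> obj A" using f g unfolding is_iso_def by auto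
 note gf = cat_cmp[OF A h(2,1)] and fg = cat_cmp[OF A f'(1) g'(1)]
 have "cmp A a c a (cmp A c b a f' g') (cmp A a b c g f) = cmp A a b a f' (cmp A a b b (cmp A b c b g' g) f)"
  using cat_assoc[OF A gf g'(1) f'(1)] cat_assoc[OF A h g'(1)] by simp
 moreover have "cmp A c a c (cmp A a b c g f) (cmp A c b a f' g') = cmp A c b c g (cmp A c b b (cmp A b a b f f') g')"
  using cat_assoc[OF A fg h] cat_assoc[OF A g'(1) f'(1) h(1)] by simp
 ultimately show ?thesis unfolding is_iso_def
  using o gf fg f' g' cat_id_left[OF A h(1)] cat_id_left[OF A g'(1)] by auto
qed

lemma nat_iso_trans:
 assumes "naturally_isomorphic A B F G" "naturally_isomorphic A B G H"
 shows "naturally_isomorphic A B F H"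
proof -
 obtain \<alpha> \<beta> where a: "nat_trans A B F G \<alpha>" "!!a. a \<in> obj A ==> is_iso B (omap F a) (omap G a) (\<alpha> a)"
  and b: "nat_trans A B G H \<beta>" "!!a. a \<in> obj A ==> is_iso B (omap G a) (omap H a) (\<beta> a)"
  using assms unfolding naturally_isomorphic_def by blast
 show ?thesis unfolding naturally_isomorphic_def
  by (rule exI[of _ "comp_trans A B F G H \<beta> \<alpha>"])
   (auto intro: comp_nat a b iso_cmp functor_cats(2)[OF nat_functors(1)[OF a(1)]])
qed

lemma nat_iso_refl:
 assumes "is_functor A B F" shows "naturally_isomorphic A B F F"
 by (rule nat_isoI[OF id_nat id_nat])
  (use assms functor_cats[OF assms] functor_obj[OF assms] in \<open>auto intro!: cat_id_left[of B] cat_id\<close>)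

lemma nat_iso_comp:
 assumes "naturally_isomorphic A B F F'" "naturally_isomorphic B C G G'"
 shows "naturally_isomorphic A C (comp_func A G F) (comp_func A G' F')"
proof -
 obtain \<alpha> \<beta> where a: "nat_trans A B F F' \<alpha>" "!!a. a \<in> obj A ==> is_iso B (omap F a) (omap F' a) (\<alpha> a)"
  and b: "nat_trans B C G G' \<beta>" "!!a. a \<in> obj B ==> is_iso C (omap G a) (omap G' a) (\<beta> a)"
  using assms unfolding naturally_isomorphic_def by blast
 note f = nat_functors[OF a(1)] nat_functors[OF b(1)]
 show ?thesis unfolding naturally_isomorphic_def
  by (rule exI[of _ "hcomp_trans A C G G' F F' \<beta> \<alpha>"])
   (auto intro!: hcomp_nat a b iso_cmp functor_cats(2)[OF f(3)] functor_iso[OF f(3)] functor_obj[OF f(2)])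
qed

text \<open>T plays the part of X composed with G. The comparison lives in \<open>tot C\<close>
  because X and T may have different extents.\<close>

definition has_restrictions :: "'v::universe lpcat => bool" where
 "has_restrictions C \<longleftrightarrow> (\<forall>X\<in>lobj C. \<forall>(B :: 'v vcat) G. small_lex_cat B & lex_functor B (ext C X) G \<longrightarrow>
   (\<exists>T\<in>lobj C. ext C T = B & naturally_isomorphic B (tot C) (comp_func B (inc C X) G) (inc C T)))"

text \<open>The weight A(-,G-) is absolute, and \<open>tensor_inv\<close> turns a tensor of X by it
  into an isomorphism between T and X restricted along G.\<close>

lemma absolute_tensored_restrictions:
 fixes C :: "'v::universe lpcat"
 assumes C: "lp_category C" and abs: "absolute_tensored C"
 shows "has_restrictions C"
 unfolding has_restrictions_def
proof (intro ballI allI impI, elim conjE)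
 interpret lpcategory C by unfold_locales (rule C)
 fix X and B :: "'v vcat" and G assume X: "X \<in> lobj C" and B: "small_lex_cat B" and G: "lex_functor B (ext C X) G"
 let ?A = "ext C X" and ?W = "hom_prof (ext C X) B (ext C X) (id_func (ext C X)) G"
 note Gf = lex_functorD[OF G] and catA = ext_cat[OF X] and catB = small_lex_catD(1)[OF B]
 note rw = hom_rep_weight[OF ext_lex[OF X] B G]
 obtain T u where t: "is_tensor C ?A B ?W X T u"
  using abs rep_absolute[OF rw] X unfolding absolute_tensored_def by blast
 interpret rep_weighted C ?A B ?W X T u "omap G" "\<lambda>b. idm ?A (omap G b)"
  by (intro rep_weighted.intro tensor_weighted[OF C t] rw)
 \<comment> \<open>The functor reconstructed from the weight is G itself, as the universal elements
   are identities.\<close>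
 have GF: "mmap R.GF b b' r = mmap G b b' r" if r: "r \<in> hom B b b'" for b b' r
 proof -
  have o: "b \<in> obj B" "b' \<in> obj B" using hom_obj[OF catB r] by auto
  note Gr = functor_hom[OF Gf r] and Go = functor_obj[OF Gf o(1)] functor_obj[OF Gf o(2)]
  have "ract ?A ?W (omap G b) b b' r (idm ?A (omap G b)) =
   lact B ?W b' (omap G b') (omap G b) (mmap G b b' r) (idm ?A (omap G b'))"
   using catA catB r o Gr Go cat_id[OF catA] cat_id[OF catB] functor_id[OF Gf] cat_id_left[OF catA] cat_id_right[OF catA] by simp
  then show ?thesis using r R.cl_act[OF o(2) Gr] by simp
 qed
 have "nat_trans B (tot C) (comp_func B (inc C X) G) (inc C T) (restrict (\<lambda>b. e b) (obj B))"
 proof (rule natI[OF comp_functor[OF Gf inc_functor[OF X]]])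
  show "is_functor B (tot C) (inc C T)" using inc_functor[OF T] eT by simp
  show "e b \<in> hom (tot C) (omap (comp_func B (inc C X) G) b) (omap (inc C T) b)" if "b \<in> obj B" for b
   using e_in[OF that] that functor_obj[OF Gf that] eT by (simp del: tot_hom)
  fix b b' r assume b: "b \<in> obj B" "b' \<in> obj B" and r: "r \<in> hom B b b'"
  show "cmp (tot C) (omap (comp_func B (inc C X) G) b) (omap (comp_func B (inc C X) G) b') (omap (inc C T) b') (e b') (mmap (comp_func B (inc C X) G) b b' r) =
   cmp (tot C) (omap (comp_func B (inc C X) G) b) (omap (inc C T) b) (omap (inc C T) b') (mmap (inc C T) b b' r) (e b)"
   using e_nat[OF r] GF[OF r] b r functor_obj[OF Gf] functor_hom[OF Gf r] X T eT by simp
 qed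
 moreover have "is_iso (tot C) (omap (comp_func B (inc C X) G) b) (omap (inc C T) b) (restrict (\<lambda>b. e b) (obj B) b)" if "b \<in> obj B" for b
  using tensor_inv[OF t that] that functor_obj[OF Gf that] eT by simp
 ultimately show "\<exists>T\<in>lobj C. ext C T = B & naturally_isomorphic B (tot C) (comp_func B (inc C X) G) (inc C T)"
  using T eT unfolding naturally_isomorphic_def by blast
qed

text \<open>An absolute weight is represented by some \<open>GF\<close>. The restriction along it,
  with the unit taking m to its classifying morphism followed by \<sigma>, is a tensor by
  \<open>inv_tensor\<close>.\<close>

lemma restrictions_absolute_tensored:
 assumes C: "lp_category C" and r: "has_restrictions C"
 shows "absolute_tensored C"
 unfolding absolute_tensored_def
proof (intro allI impI, elim conjE)
 interpret lpcategory C by unfold_locales (rule C)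
 fix A B W X assume W: "absolute_weight A B W" and X: "X \<in> lobj C" and eX: "ext C X = A"
 obtain G w where rw: "rep_weight A B W G w" using absolute_weight_rep[OF W] by blast
 interpret R: rep_weight A B W G w by (rule rw)
 obtain T where T: "T \<in> lobj C" "ext C T = B" and "naturally_isomorphic B (tot C) (comp_func B (inc C X) R.GF) (inc C T)"
  using r X eX R.lexB R.GF_lex unfolding has_restrictions_def by blast
 then obtain \<sigma> where n: "nat_trans B (tot C) (comp_func B (inc C X) R.GF) (inc C T) \<sigma>"
  and i: "!!b. b \<in> obj B ==> is_iso (tot C) (vpair X (G b)) (vpair T b) (\<sigma> b)"
  unfolding naturally_isomorphic_def using eX R.G by auto
 let ?K = "tot C"
 note catK = tot_category
 note If = inc_functor[OF X, unfolded eX]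
 have \<sigma>: "\<sigma> b \<in> homv ?K X (G b) T b" if "b \<in> obj B" for b
  using nat_hom[OF n that] that R.G[OF that] eX T by (simp del: tot_hom)
 have \<sigma>n: "cmpv ?K X (G b) X (G b') T b' (\<sigma> b') (mmap (inc C X) (G b) (G b') (mmap R.GF b b' r)) =
   cmpv ?K X (G b) T b T b' (lidm C T (b, b') r) (\<sigma> b)" if r: "r \<in> hom B b b'" for b b' r
  using nat_nat[OF n r] r hom_obj[OF R.catB r] R.G eX T by (simp del: R.GF_simps(2))
 have Ih: "mmap (inc C X) a a' p \<in> homv ?K X a X a'" if "p \<in> hom A a a'" for p a a'
  using functor_hom[OF If that] hom_obj[OF R.catA that] eX by (simp del: tot_hom)
 define s where "s a b m = cmpv ?K X a X (G b) T b (\<sigma> b) (mmap (inc C X) a (G b) (R.cl a b m))" for a b m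
 have s: "s a b m \<in> homv ?K X a T b" if "a \<in> obj A" "b \<in> obj B" "m \<in> omap W (a, b)" for a b m
  unfolding s_def by (rule cat_cmp[OF catK \<sigma>[OF that(2)] Ih[OF R.cl[OF that(2,1,3)]]])
 have sl: "s a' b (lact B W b a a' p m) = cmpv ?K X a' X a T b (s a b m) (mmap (inc C X) a' a p)"
  if p: "p \<in> hom A a' a" and b: "b \<in> obj B" and m: "m \<in> omap W (a, b)" for a a' b p m
 proof -
  note c = R.cl[OF b hom_cod[OF R.catA p] m]
  have "mmap (inc C X) a' (G b) (cmp A a' a (G b) (R.cl a b m) p) =
   cmpv ?K X a' X a X (G b) (mmap (inc C X) a (G b) (R.cl a b m)) (mmap (inc C X) a' a p)"
   using functor_cmp[OF If c p] hom_obj[OF R.catA p] R.G[OF b] eX by simp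
  then show ?thesis unfolding s_def R.cl_cmp[OF b m p] by (simp only: cat_assoc[OF catK Ih[OF p] Ih[OF c] \<sigma>[OF b]])
 qed
 have sr: "s a b' (ract A W a b b' q m) = cmpv ?K X a T b T b' (lidm C T (b, b') q) (s a b m)"
  if q: "q \<in> hom B b b'" and a: "a \<in> obj A" and m: "m \<in> omap W (a, b)" for a b b' q m
 proof -
  have b: "b \<in> obj B" "b' \<in> obj B" using hom_obj[OF R.catB q] by auto
  note c = R.cl[OF b(1) a m] and g = R.GF_hom[OF q]
  have lq: "lidm C T (b, b') q \<in> homv ?K T b T b'" using idm_in[OF T(1)] q b T by simp
  have "mmap (inc C X) a (G b') (cmp A a (G b) (G b') (mmap R.GF b b' q) (R.cl a b m)) =
   cmpv ?K X a X (G b) X (G b') (mmap (inc C X) (G b) (G b') (mmap R.GF b b' q)) (mmap (inc C X) a (G b) (R.cl a b m))"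
   using functor_cmp[OF If g c] a R.G b eX by (simp del: R.GF_simps(2))
  then show ?thesis unfolding s_def R.cl_right[OF q a m]
   by (simp only: cat_assoc[OF catK Ih[OF c] Ih[OF g] \<sigma>[OF b(2)], symmetric] \<sigma>n[OF q] cat_assoc[OF catK Ih[OF c] \<sigma>[OF b(1)] lq])
 qed
 have u: "two_cell A B W (lhom C X T) (mk_cell A B W s)"
 proof (rule cellI[OF R.pW])
  show "is_prof A B (lhom C X T)" using hom_is_prof[OF X T(1)] eX T by simp
  show "s a b m \<in> omap (lhom C X T) (a, b)" if "a \<in> obj A" "b \<in> obj B" "m \<in> omap W (a, b)" for a b m
   using s[OF that] that X T eX by simp
  fix a b a' b' f g m assume f: "f \<in> hom A a' a" and g: "g \<in> hom B b b'" and m: "m \<in> omap W (a, b)"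
  have o: "a \<in> obj A" "a' \<in> obj A" "b \<in> obj B" "b' \<in> obj B" using hom_obj[OF R.catA f] hom_obj[OF R.catB g] by auto
  note m' = prof_act[OF R.pW m f cat_id[OF R.catB o(3)]]
  have "s a' b' (mmap W (a, b) (a', b') (f, g) m) = cmpv ?K X a' T b T b' (lidm C T (b, b') g)
    (cmpv ?K X a' X a T b (s a b m) (mmap (inc C X) a' a f))"
   unfolding prof_split(1)[OF R.pW m f g] sr[OF g o(2) m'] sl[OF f o(3) m] ..
  then show "s a' b' (mmap W (a, b) (a', b') (f, g) m) = mmap (lhom C X T) (a, b) (a', b') (f, g) (s a b m)"
   using act_eq[OF X T(1), of f a' a g b b' "s a b m"] s[OF o(1,3) m] f g o X T eX by simp
 qed
 interpret rep_weighted C A B W X T "mk_cell A B W s" G w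
  by unfold_locales (use u R.W X eX T in simp_all)
 have "is_tensor C A B W X T (mk_cell A B W s)"
 proof (rule inv_tensor)
  fix b assume b: "b \<in> obj B"
  \<comment> \<open>The universal element is classified by the identity, so \<open>e b\<close> is
    \<sigma> b and hence invertible.\<close>
  have "R.cl (G b) b (w b) = idm A (G b)"
   using R.cl_act[OF b cat_id[OF R.catA R.G[OF b]]] prof_id[OF R.pW R.G[OF b] b R.w[OF b]] by simp
  then have "s (G b) b (w b) = \<sigma> b"
   unfolding s_def using functor_id[OF If R.G[OF b]] cat_id_right[OF catK \<sigma>[OF b]] R.G[OF b] eX by simp
  then show "is_iso (tot C) (vpair X (G b)) (vpair T b) (mk_cell A B W s (G b, b) (w b))"
   using i[OF b] R.G[OF b] R.w[OF b] b by simp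
 qed
 then show "\<exists>T u. is_tensor C A B W X T u" by blast
qed

text \<open>Condition (i) on sieves makes X composed with G an object again. The comparison has
  identities of K as components, although they join different pairs.\<close>

lemma Gamma_restrictions:
 fixes C :: "'v::universe parfl"
 assumes "partially_lex_cat C"
 shows "has_restrictions (Gamma_obj C)"
proof -
 interpret parflcat C by unfold_locales (rule assms)
 show ?thesis unfolding has_restrictions_def
 proof (intro ballI allI impI, elim conjE)
  fix x and B :: "'v vcat" and G assume "x \<in> lobj (Gamma_obj C)" and B: "small_lex_cat B" and "lex_functor B (ext (Gamma_obj C) x) G"
  then have x: "x \<in> S" and G: "lex_functor B (dm x) G" by simp_all
  note Gf = lex_functorD[OF G]
  note sv = sieve_comp[OF dom_fn[OF x] B G]
  define t where "t = code (B, comp_func B (fn x) G)"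
  have t: "t \<in> S" "dm t = B" "fn t = comp_func B (fn x) G" using sv unfolding t_def by auto
  note i = G.inc_functor[of x] G.inc_functor[of t]
  have xs: "is_functor B (tot (Gamma_obj C)) (comp_func B (inc (Gamma_obj C) x) G)" "is_functor B (tot (Gamma_obj C)) (inc (Gamma_obj C) t)"
   using comp_functor[OF Gf, of "tot (Gamma_obj C)" "inc (Gamma_obj C) x"] i x t by simp_all
  note [simp] = functor_obj[OF Gf] functor_hom[OF Gf] x t(1,2)
  have f: "is_functor B K (comp_func B (fn x) G)" using fn_functor[OF t(1)] t by simp
  have oK: "omap (fn x) (omap G b) \<in> obj K" if "b \<in> obj B" for b using functor_obj[OF f that] that by simp
  have hK: "mmap (fn x) (omap G b) (omap G b') (mmap G b b' r) \<in> hom K (omap (fn x) (omap G b)) (omap (fn x) (omap G b'))"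
   if "r \<in> hom B b b'" for b b' r using functor_hom[OF f that] hom_obj[OF functor_cats(1)[OF f] that] that by simp
  note [simp] = cat_id_left[OF cat_K hK] cat_id_right[OF cat_K hK]
  have "nat_trans B (tot (Gamma_obj C)) (comp_func B (inc (Gamma_obj C) x) G) (inc (Gamma_obj C) t) (restrict (\<lambda>b. idm K (omap (fn x) (omap G b))) (obj B))"
   by (rule natI[OF xs]) (auto simp: t(3) G_cmp cat_id[OF cat_K oK] hK intro!: cat_id[OF cat_K oK])
  moreover have "nat_trans B (tot (Gamma_obj C)) (inc (Gamma_obj C) t) (comp_func B (inc (Gamma_obj C) x) G) (restrict (\<lambda>b. idm K (omap (fn x) (omap G b))) (obj B))"
   by (rule natI[OF xs(2,1)]) (auto simp: t(3) G_cmp cat_id[OF cat_K oK] hK intro!: cat_id[OF cat_K oK])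
  ultimately have "naturally_isomorphic B (tot (Gamma_obj C)) (comp_func B (inc (Gamma_obj C) x) G) (inc (Gamma_obj C) t)"
   by (rule nat_isoI) (auto simp: t(3) G_cmp G_idm cat_id[OF cat_K oK] cat_id_left[OF cat_K cat_id[OF cat_K oK]] simp del: tot_idm)
  then show "\<exists>T\<in>lobj (Gamma_obj C). ext (Gamma_obj C) T = B &
   naturally_isomorphic B (tot (Gamma_obj C)) (comp_func B (inc (Gamma_obj C) x) G) (inc (Gamma_obj C) T)"
   using t by (intro bexI[of _ t]) simp_all
 qed
qed

section \<open>Invariance under equivalence, and reconstruction from total categories\<close>

lemma totF_inc:
 assumes F: "lp_functor C D F" and X: "X \<in> lobj C"
 shows "comp_func (ext C X) (totF C F) (inc C X) = inc D (lpo F X)"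
proof -
 interpret C: lpcategory C by unfold_locales (rule lpf_cats(1)[OF F])
 interpret D: lpcategory D by unfold_locales (rule lpf_cats(2)[OF F])
 note Y = lpf_obj[OF F X] and e = lpf_ext[OF F X]
 show ?thesis
  by (rule functor_eqI[OF comp_functor[OF C.inc_functor[OF X] totF_functor[OF F]]])
   (use X Y e D.inc_functor[OF Y] in \<open>auto simp: lpf_idm[OF F] C.idm_in\<close>)
qed

lemma iso_totT:
 assumes i: "is_iso (lp_hom_cat C D) F G \<theta>"
 shows "naturally_isomorphic (tot C) (tot D) (totF C F) (totF C G)"
proof -
 obtain \<phi> where p: "\<phi> \<in> hom (lp_hom_cat C D) G F" "cmp (lp_hom_cat C D) F G F \<phi> \<theta> = idm (lp_hom_cat C D) F"
  "cmp (lp_hom_cat C D) G F G \<theta> \<phi> = idm (lp_hom_cat C D) G" using i by (rule is_isoD)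
 have t: "lp_trans C D F G \<theta>" "lp_trans C D G F \<phi>" and F: "lp_functor C D F" "lp_functor C D G" using i p unfolding is_iso_def by simp_all
 have "comp_trans (tot C) (tot D) (totF C F) (totF C G) (totF C F) (totT C \<phi>) (totT C \<theta>) = id_trans (tot C) (tot D) (totF C F)"
  "comp_trans (tot C) (tot D) (totF C G) (totF C F) (totF C G) (totT C \<theta>) (totT C \<phi>) = id_trans (tot C) (tot D) (totF C G)"
  using lp_cmp_trans(2)[OF t] lp_cmp_trans(2)[OF t(2,1)] lp_id_trans(2)[OF F(1)] lp_id_trans(2)[OF F(2)] p by metis+
 from this[THEN fun_cong] show ?thesis
  by (intro nat_isoI[OF totT_nat[OF t(1)] totT_nat[OF t(2)]]) (metis comp_trans_app id_trans_app)+
qed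

text \<open>The restriction is formed in D for the image of X and carried back by g; the invertible
  unit compares X with its image under the round trip.\<close>

lemma restrictions_equivalent:
 fixes C D :: "'v::universe lpcat"
 assumes e: "equivalent_in LexProf_CAT C D" and D: "has_restrictions D"
 shows "has_restrictions C"
proof -
 from e obtain f g \<eta> where f: "lp_functor C D f" and g: "lp_functor D C g"
  and "is_iso (lp_hom_cat C C) (lp_id_functor C) (omap (tcmp LexProf_CAT C D C) (g, f)) \<eta>"
  unfolding equivalent_in_def by auto
 then have \<eta>: "is_iso (lp_hom_cat C C) (lp_id_functor C) (lp_comp_functor C g f) \<eta>" by simp
 interpret C: lpcategory C by unfold_locales (rule lpf_cats(1)[OF f])
 interpret D: lpcategory D by unfold_locales (rule lpf_cats(2)[OF f])
 have n: "naturally_isomorphic (tot C) (tot C) (id_func (tot C)) (comp_func (tot C) (totF D g) (totF C f))"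
  using iso_totT[OF \<eta>] by (simp add: totF_id[OF C.lp] totF_comp[OF f g])
 show ?thesis unfolding has_restrictions_def
 proof (intro ballI allI impI, elim conjE)
  fix X and B :: "'v vcat" and G assume X: "X \<in> lobj C" and B: "small_lex_cat B" and G: "lex_functor B (ext C X) G"
  note Gf = lex_functorD[OF G] and fX = lpf_obj[OF f X] and ef = lpf_ext[OF f X]
  obtain T where T: "T \<in> lobj D" "ext D T = B" and t: "naturally_isomorphic B (tot D) (comp_func B (inc D (lpo f X)) G) (inc D T)"
   using D fX ef B G unfolding has_restrictions_def by (metis (no_types, lifting))
  note iX = C.inc_functor[OF X]
  have "naturally_isomorphic (ext C X) (tot C) (comp_func (ext C X) (id_func (tot C)) (inc C X))
   (comp_func (ext C X) (comp_func (tot C) (totF D g) (totF C f)) (inc C X))"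
   by (rule nat_iso_comp[OF nat_iso_refl[OF iX] n])
  then have "naturally_isomorphic (ext C X) (tot C) (inc C X) (comp_func (ext C X) (totF D g) (inc D (lpo f X)))"
   using comp_func_assoc[OF iX totF_functor[OF f] totF_functor[OF g]] iX by (simp add: totF_inc[OF f X])
  from nat_iso_comp[OF nat_iso_refl[OF Gf] this]
  have "naturally_isomorphic B (tot C) (comp_func B (inc C X) G) (comp_func B (totF D g) (comp_func B (inc D (lpo f X)) G))"
   using comp_func_assoc[OF Gf _ totF_functor[OF g]] D.inc_functor[OF fX] ef by simp
  moreover have "naturally_isomorphic B (tot C) (comp_func B (totF D g) (comp_func B (inc D (lpo f X)) G)) (inc C (lpo g T))"
   using nat_iso_comp[OF t nat_iso_refl[OF totF_functor[OF g]]] totF_inc[OF g T(1)] T(2) by simp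
  ultimately have "naturally_isomorphic B (tot C) (comp_func B (inc C X) G) (inc C (lpo g T))" by (rule nat_iso_trans)
  then show "\<exists>T\<in>lobj C. ext C T = B & naturally_isomorphic B (tot C) (comp_func B (inc C X) G) (inc C T)"
   using lpf_obj[OF g T(1)] lpf_ext[OF g T(1)] T(2) by blast
 qed
qed

text \<open>The sieve on \<open>tot C\<close> generated, up to isomorphism, by the inclusions of the extents; having restrictions
 is exactly closure of this class under precomposition.\<close>

definition gen_parfl :: "'v::universe lpcat => 'v parfl" where
 "gen_parfl C = \<lparr>ucat = tot C, sieve = {(A, Y). \<exists>X\<in>lobj C. ext C X = A & naturally_isomorphic A (tot C) (inc C X) Y}\<rparr>"

lemma gen_parfl_simps [simp]: "ucat (gen_parfl C) = tot C"
 "(A, Y) \<in> sieve (gen_parfl C) \<longleftrightarrow> (\<exists>X\<in>lobj C. ext C X = A & naturally_isomorphic A (tot C) (inc C X) Y)"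
 by (simp_all add: gen_parfl_def)

text \<open>Condition (i) is \<open>has_restrictions\<close>, (ii) is built into the sieve, and
  (iii) holds since every pair (X, i) is a value of the inclusion of X.\<close>

lemma gen_parfl:
 fixes C :: "'v::universe lpcat"
 assumes C: "lp_category C" and r: "has_restrictions C"
 shows "partially_lex_cat (gen_parfl C)"
proof -
 interpret lpcategory C by unfold_locales (rule C)
 have 1: "small_lex_cat A & lex_functor A (tot C) X" if "(A, X) \<in> sieve (gen_parfl C)" for A X
  using that ext_lex lex_iso[OF inc_lex] by auto
 have 2: "(A, comp_func A X G) \<in> sieve (gen_parfl C)"
  if X: "(B, X) \<in> sieve (gen_parfl C)" and A: "small_lex_cat A" and G: "lex_functor A B G" for A B X G
 proof -
  obtain Z where Z: "Z \<in> lobj C" "ext C Z = B" "naturally_isomorphic B (tot C) (inc C Z) X" using X by auto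
  obtain T where T: "T \<in> lobj C" "ext C T = A" "naturally_isomorphic A (tot C) (comp_func A (inc C Z) G) (inc C T)"
   using r Z A G unfolding has_restrictions_def by blast
  show ?thesis
   using nat_iso_trans[OF nat_iso_sym[OF T(3)] nat_iso_comp[OF nat_iso_refl[OF lex_functorD[OF G]] Z(3)]] T by auto
 qed
 have 3: "(A, Y) \<in> sieve (gen_parfl C)" if "(A, X) \<in> sieve (gen_parfl C)" "naturally_isomorphic A (tot C) X Y" for A X Y
  using that nat_iso_trans by fastforce
 have 4: "\<exists>(A, X)\<in>sieve (gen_parfl C). \<exists>a\<in>obj A. omap X a = c" if c: "c \<in> obj (tot C)" for c
 proof -
  obtain X i where X: "c = vpair X i" "X \<in> lobj C" "i \<in> obj (ext C X)" using c by (rule tot_objE)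
  then have "(ext C X, inc C X) \<in> sieve (gen_parfl C)" using nat_iso_refl[OF inc_functor] by auto
  then show ?thesis using X by (intro bexI[of _ "(ext C X, inc C X)"]) auto
 qed
 show ?thesis unfolding partially_lex_cat_def left_exact_sieve_def gen_parfl_simps(1)
  using tot_category tot_locally_small 1 2 3 4 by blast
qed

text \<open>C maps to Gamma by sending X to its inclusion, identically on homs. Conversely, a
  functor in the sieve is replaced by an object whose inclusion is isomorphic to it, and the chosen
  isomorphisms conjugate the homs.\<close>

lemma restrictions_Gamma:
 fixes C :: "'v::universe lpcat"
 assumes C: "lp_category C" and r: "has_restrictions C"
 shows "equivalent_in LexProf_CAT C (Gamma_obj (gen_parfl C))"
proof -
 interpret lpcategory C by unfold_locales (rule C)
 interpret E: parflcat "gen_parfl C" by unfold_locales (rule gen_parfl[OF C r])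
 let ?E = "Gamma_obj (gen_parfl C)" and ?K = "tot C"
 note catK = tot_category
 have sv: "(ext C X, inc C X) \<in> sieve (gen_parfl C)" if "X \<in> lobj C" for X
  using that nat_iso_refl[OF inc_functor] by auto
 define J where "J X = code (ext C X, inc C X)" for X
 have J: "J X \<in> E.S" "E.dm (J X) = ext C X" "E.fn (J X) = inc C X" if "X \<in> lobj C" for X
  unfolding J_def using sv[OF that] E.code_simps[OF sv[OF that]] by (simp_all only: imageI)
 \<comment> \<open>All choices are made at once, so that the object, the isomorphism and its inverse
   belong together.\<close>
 define R where "R x X \<alpha> \<beta> \<longleftrightarrow> X \<in> lobj C & ext C X = E.dm x & nat_trans (E.dm x) ?K (inc C X) (E.fn x) \<alpha> & nat_trans (E.dm x) ?K (E.fn x) (inc C X) \<beta> &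
  (\<forall>i\<in>obj (E.dm x). cmp ?K (omap (inc C X) i) (omap (E.fn x) i) (omap (inc C X) i) (\<beta> i) (\<alpha> i) = idm ?K (omap (inc C X) i) &
   cmp ?K (omap (E.fn x) i) (omap (inc C X) i) (omap (E.fn x) i) (\<alpha> i) (\<beta> i) = idm ?K (omap (E.fn x) i))" for x X \<alpha> \<beta>
 have "\<exists>X \<alpha> \<beta>. R x X \<alpha> \<beta>" if x: "x \<in> E.S" for x
 proof -
  obtain X where "X \<in> lobj C" "ext C X = E.dm x" "naturally_isomorphic (E.dm x) ?K (inc C X) (E.fn x)"
   using E.dom_fn[OF x] unfolding gen_parfl_simps(2) by blast
  then show ?thesis unfolding R_def using nat_iso_inverse by blast
 qed
 then obtain P \<sigma> \<tau> where R: "!!x. x \<in> E.S ==> R x (P x) (\<sigma> x) (\<tau> x)" by metis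
 note R' = R[unfolded R_def]
 have P: "!!x. x \<in> E.S ==> P x \<in> lobj C" "!!x. x \<in> E.S ==> ext C (P x) = E.dm x"
  and \<sigma>: "!!x. x \<in> E.S ==> nat_trans (E.dm x) ?K (inc C (P x)) (E.fn x) (\<sigma> x)"
  and \<tau>: "!!x. x \<in> E.S ==> nat_trans (E.dm x) ?K (E.fn x) (inc C (P x)) (\<tau> x)"
  using R' by blast+
 note \<tau>\<sigma> = R'[THEN conj4, rule_format, THEN conjunct1]
  and \<sigma>\<tau> = R'[THEN conj4, rule_format, THEN conjunct2]
 define pc where "pc x i = vpair (P x) i" for x i
 define pe where "pe x i = omap (E.fn x) i" for x i
 have pI: "omap (inc C (P x)) i = pc x i" if "x \<in> E.S" "i \<in> obj (E.dm x)" for x i using that P unfolding pc_def by simp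
 have sh: "\<sigma> x i \<in> hom ?K (pc x i) (pe x i)" "\<tau> x i \<in> hom ?K (pe x i) (pc x i)" "cmp ?K (pc x i) (pe x i) (pc x i) (\<tau> x i) (\<sigma> x i) = idm ?K (pc x i)"
  "cmp ?K (pe x i) (pc x i) (pe x i) (\<sigma> x i) (\<tau> x i) = idm ?K (pe x i)" "pc x i \<in> obj ?K" "pe x i \<in> obj ?K" if "x \<in> E.S" "i \<in> obj (E.dm x)" for x i
  using nat_hom[OF \<sigma>[OF that(1)] that(2)] nat_hom[OF \<tau>[OF that(1)] that(2)] \<tau>\<sigma>[OF that] \<sigma>\<tau>[OF that] pI[OF that]
   functor_obj[OF E.fn_functor[OF that(1)] that(2)] that P unfolding pe_def pc_def by (simp_all del: tot_hom tot_idm)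
 have \<sigma>n: "cmp ?K (pc x i) (pc x j) (pe x j) (\<sigma> x j) (lidm C (P x) (i, j) p) = cmp ?K (pc x i) (pe x i) (pe x j) (mmap (E.fn x) i j p) (\<sigma> x i)"
  if x: "x \<in> E.S" and p: "p \<in> hom (E.dm x) i j" for x i j p
  using nat_nat[OF \<sigma>[OF x] p] hom_obj[OF E.dom_cat[OF x] p] p x P pI unfolding pe_def by simp
 have pl: "lidm C (P x) (i, j) p \<in> hom ?K (pc x i) (pc x j)" if "x \<in> E.S" "p \<in> hom (E.dm x) i j" for x i j p
  using idm_in[OF P(1)[OF that(1)], of p i j] that P hom_obj[OF E.dom_cat[OF that(1)] that(2)] unfolding pc_def by simp
 define F where "F = mk_lpfunc C J (\<lambda>X Y i j f. f)"
 have F: "lp_functor C ?E F" unfolding F_def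
 proof (rule mk_lpfunc_functor[OF C E.Gamma_lp], goal_cases)
  case (4 X Y Z i j k g f) then show ?case by (simp add: J E.G_cmp)
 qed (auto simp: J)
 \<comment> \<open>Conjugation of h by the chosen isomorphisms.\<close>
 define m where "m x y i j h = cmp ?K (pc x i) (pe y j) (pc y j) (\<tau> y j) (cmp ?K (pc x i) (pe x i) (pe y j) h (\<sigma> x i))" for x y i j h
 have m: "m x y i j h \<in> hom ?K (pc x i) (pc y j)" if "x \<in> E.S" "y \<in> E.S" "i \<in> obj (E.dm x)" "j \<in> obj (E.dm y)" "h \<in> hom ?K (pe x i) (pe y j)" for x y i j h
  unfolding m_def by (intro cat_cmp[OF catK] sh that)
 have m\<sigma>: "cmp ?K (pc x i) (pc y j) (pe y j) (\<sigma> y j) (m x y i j h) = cmp ?K (pc x i) (pe x i) (pe y j) h (\<sigma> x i)"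
  if h: "x \<in> E.S" "y \<in> E.S" "i \<in> obj (E.dm x)" "j \<in> obj (E.dm y)" "h \<in> hom ?K (pe x i) (pe y j)" for x y i j h
 proof -
  note hs = cat_cmp[OF catK h(5) sh(1)[OF h(1,3)]]
  show ?thesis unfolding m_def cat_assoc[OF catK hs sh(2)[OF h(2,4)] sh(1)[OF h(2,4)], symmetric] sh(4)[OF h(2,4)]
   by (rule cat_id_left[OF catK hs])
 qed
 \<comment> \<open>Postcomposition with \<sigma> is injective; preservation of composites and
   identities by m is verified after it, where m turns into precomposition with \<sigma>.\<close>
 have inj: "f = f'" if h: "y \<in> E.S" "j \<in> obj (E.dm y)" "f \<in> hom ?K a (pc y j)" "f' \<in> hom ?K a (pc y j)"
  "cmp ?K a (pc y j) (pe y j) (\<sigma> y j) f = cmp ?K a (pc y j) (pe y j) (\<sigma> y j) f'" for y j f f' a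
 proof -
  have "cmp ?K a (pc y j) (pc y j) (cmp ?K (pc y j) (pe y j) (pc y j) (\<tau> y j) (\<sigma> y j)) f =
   cmp ?K a (pc y j) (pc y j) (cmp ?K (pc y j) (pe y j) (pc y j) (\<tau> y j) (\<sigma> y j)) f'"
   using h(5) by (simp add: cat_assoc[OF catK h(3) sh(1)[OF h(1,2)] sh(2)[OF h(1,2)]] cat_assoc[OF catK h(4) sh(1)[OF h(1,2)] sh(2)[OF h(1,2)]])
  then show ?thesis unfolding sh(3)[OF h(1,2)] using cat_id_left[OF catK h(3)] cat_id_left[OF catK h(4)] by simp
 qed
 define Q where "Q = mk_lpfunc ?E P m"
 have Q: "lp_functor ?E C Q" unfolding Q_def
 proof (rule mk_lpfunc_functor[OF E.Gamma_lp C], goal_cases)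
  case (1 x) then show ?case by (simp add: P)
 next
  case (2 x) then show ?case by (simp add: P)
 next
  case (3 x y i j f) then show ?case using m[of x y i j f] P by (simp add: pc_def pe_def)
 next
  case (4 x y z i j k g f)
  then have o: "x \<in> E.S" "y \<in> E.S" "z \<in> E.S" "i \<in> obj (E.dm x)" "j \<in> obj (E.dm y)" "k \<in> obj (E.dm z)"
   and g: "g \<in> hom ?K (pe y j) (pe z k)" and f: "f \<in> hom ?K (pe x i) (pe y j)" by (simp_all add: pe_def)
  note gf = cat_cmp[OF catK g f] and mf = m[OF o(1,2,4,5) f] and mg = m[OF o(2,3,5,6) g] and sx = sh(1)[OF o(1,4)] and sy = sh(1)[OF o(2,5)] and sz = sh(1)[OF o(3,6)]
  have "m x z i k (cmp ?K (pe x i) (pe y j) (pe z k) g f) = cmp ?K (pc x i) (pc y j) (pc z k) (m y z j k g) (m x y i j f)"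
  proof (rule inj[OF o(3,6) m[OF o(1,3,4,6) gf] cat_cmp[OF catK mg mf]])
   show "cmp ?K (pc x i) (pc z k) (pe z k) (\<sigma> z k) (m x z i k (cmp ?K (pe x i) (pe y j) (pe z k) g f)) =
    cmp ?K (pc x i) (pc z k) (pe z k) (\<sigma> z k) (cmp ?K (pc x i) (pc y j) (pc z k) (m y z j k g) (m x y i j f))"
    unfolding m\<sigma>[OF o(1,3,4,6) gf] cat_assoc[OF catK mf mg sz, symmetric] m\<sigma>[OF o(2,3,5,6) g]
     cat_assoc[OF catK mf sy g] m\<sigma>[OF o(1,2,4,5) f] cat_assoc[OF catK sx f g] ..
  qed
  then show ?case using 4 by (simp add: E.G_cmp pc_def pe_def)
 next
  case (5 x i j p)
  then have x: "x \<in> E.S" and p: "p \<in> hom (E.dm x) i j" by simp_all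
  have o: "i \<in> obj (E.dm x)" "j \<in> obj (E.dm x)" using hom_obj[OF E.dom_cat[OF x] p] by auto
  have fp: "mmap (E.fn x) i j p \<in> hom ?K (pe x i) (pe x j)" using functor_hom[OF E.fn_functor[OF x] p] by (simp add: pe_def)
  have "m x x i j (mmap (E.fn x) i j p) = lidm C (P x) (i, j) p"
   by (rule inj[OF x o(2) m[OF x x o fp] pl[OF x p]]) (simp add: m\<sigma>[OF x x o fp] \<sigma>n[OF x p])
  then show ?case using x p by simp
 qed
 have oE: "p \<in> obj (tot ?E) ==> \<exists>x i. p = vpair x i & x \<in> E.S & i \<in> obj (E.dm x)" for p by (auto elim!: tot_objE)
 have QF: "lp_functor C C (lp_comp_functor C Q F)" and FQ: "lp_functor ?E ?E (lp_comp_functor ?E F Q)"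
  by (rule lp_comp[OF F Q], rule lp_comp[OF Q F])
 have Ql: "lpo Q x = P x" if "x \<in> E.S" for x using that unfolding Q_def by simp
 have Qm: "lpm Q x y (i, j) h = m x y i j h" if "x \<in> E.S" "y \<in> E.S" "i \<in> obj (E.dm x)" "j \<in> obj (E.dm y)" "h \<in> hom ?K (pe x i) (pe y j)" for x y i j h
  using that unfolding Q_def pe_def by simp
 have Fl: "lpo F X = J X" if "X \<in> lobj C" for X using that unfolding F_def by simp
 have Fm: "lpm F X Y (i, j) h = h" if "X \<in> lobj C" "Y \<in> lobj C" "i \<in> obj (ext C X)" "j \<in> obj (ext C Y)" "h \<in> omap (lhom C X Y) (i, j)" for X Y i j h
  using that unfolding F_def by simp
 have isoK: "is_iso ?K (pc x i) (pe x i) (\<sigma> x i)" if "x \<in> E.S" "i \<in> obj (E.dm x)" for x i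
  unfolding is_iso_def using sh[OF that] by blast
 have \<eta>: "\<exists>\<eta>. is_iso (lp_hom_cat C C) (lp_id_functor C) (lp_comp_functor C Q F) \<eta>"
 proof (rule lp_iso[OF lp_id[OF C] QF nat_iso_sym])
  let ?I = "totF C (lp_id_functor C)" and ?QF = "totF C (lp_comp_functor C Q F)"
  have e: "omap ?I (vpair X i) = pe (J X) i" "omap ?QF (vpair X i) = pc (J X) i" "J X \<in> E.S" "i \<in> obj (E.dm (J X))"
   if "X \<in> lobj C" "i \<in> obj (ext C X)" for X i
   using that J[OF that(1)] unfolding pe_def pc_def by (simp_all add: Fl Ql)
  have "nat_trans ?K ?K ?QF ?I (restrict (\<lambda>p. \<sigma> (J (vfst p)) (vsnd p)) (obj ?K))"
  proof (rule natI[OF totF_functor[OF QF] totF_functor[OF lp_id[OF C]]])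
   fix p q f assume "p \<in> obj ?K" "q \<in> obj ?K" and f: "f \<in> hom ?K p q"
   then obtain X i Y j where p: "p = vpair X i" "X \<in> lobj C" "i \<in> obj (ext C X)" and q: "q = vpair Y j" "Y \<in> lobj C" "j \<in> obj (ext C Y)"
    by (meson tot_objE)
   note f' = f[unfolded p(1) q(1)]
   have h: "mmap ?I (vpair X i) (vpair Y j) f = f" "mmap ?QF (vpair X i) (vpair Y j) f = m (J X) (J Y) i j f" "f \<in> hom ?K (pe (J X) i) (pe (J Y) j)"
    using p q f' J[OF p(2)] J[OF q(2)] Qm[of "J X" "J Y" i j f] by (simp_all add: Fl Fm pe_def)
   show "cmp ?K (omap ?QF p) (omap ?QF q) (omap ?I q) (\<sigma> (J (vfst q)) (vsnd q)) (mmap ?QF p q f) =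
    cmp ?K (omap ?QF p) (omap ?I p) (omap ?I q) (mmap ?I p q f) (\<sigma> (J (vfst p)) (vsnd p))"
    using m\<sigma>[OF e(3)[OF p(2,3)] e(3)[OF q(2,3)] e(4)[OF p(2,3)] e(4)[OF q(2,3)] h(3)]
    unfolding p(1) q(1) h(1,2) e(1,2)[OF p(2,3)] e(1,2)[OF q(2,3)] by simp
  qed (auto elim!: tot_objE simp only: e(1,2) vfst_vpair vsnd_vpair intro!: sh(1) e(3,4))
  moreover have "is_iso ?K (omap ?QF p) (omap ?I p) (restrict (\<lambda>p. \<sigma> (J (vfst p)) (vsnd p)) (obj ?K) p)" if p: "p \<in> obj ?K" for p
  proof -
   from p obtain X i where q: "p = vpair X i" "X \<in> lobj C" "i \<in> obj (ext C X)" by (meson tot_objE)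
   show ?thesis using p isoK[OF e(3,4)[OF q(2,3)]] unfolding q(1) e(1,2)[OF q(2,3)] by simp
  qed
  ultimately show "naturally_isomorphic ?K ?K ?QF ?I" unfolding naturally_isomorphic_def by blast
 qed
 have \<epsilon>: "\<exists>\<epsilon>. is_iso (lp_hom_cat ?E ?E) (lp_comp_functor ?E F Q) (lp_id_functor ?E) \<epsilon>"
 proof (rule lp_iso[OF FQ lp_id[OF E.Gamma_lp]])
  let ?I = "totF ?E (lp_id_functor ?E)" and ?FQ = "totF ?E (lp_comp_functor ?E F Q)" and ?L = "tot ?E"
  have e: "omap ?I (vpair x i) = vpair x i" "omap ?FQ (vpair x i) = vpair (J (P x)) i" "vpair x i \<in> obj ?L" "vpair (J (P x)) i \<in> obj ?L"
   "E.ev (vpair x i) = pe x i" "E.ev (vpair (J (P x)) i) = pc x i"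
   if "x \<in> E.S" "i \<in> obj (E.dm x)" for x i
   using that J[OF P(1)[OF that(1)]] P[OF that(1)] unfolding pe_def pc_def by (simp_all add: Fl Ql)
  have G: "homv ?L (J (P x)) i x i = hom ?K (pc x i) (pe x i)" "homv ?L x i (J (P x)) i = hom ?K (pe x i) (pc x i)" if "x \<in> E.S" "i \<in> obj (E.dm x)" for x i
   by (simp_all only: E.G_hom[OF e(4,3)[OF that]] E.G_hom[OF e(3,4)[OF that]] e(5,6)[OF that]) simp_all
  have "nat_trans ?L ?L ?FQ ?I (restrict (\<lambda>p. \<sigma> (vfst p) (vsnd p)) (obj ?L))"
  proof (rule natI[OF totF_functor[OF FQ] totF_functor[OF lp_id[OF E.Gamma_lp]]])
   fix p assume "p \<in> obj ?L"
   then obtain x i where p: "p = vpair x i" "x \<in> E.S" "i \<in> obj (E.dm x)" using oE by blast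
   show "\<sigma> (vfst p) (vsnd p) \<in> hom ?L (omap ?FQ p) (omap ?I p)"
    using sh(1)[OF p(2,3)] G(1)[OF p(2,3)] unfolding p(1) e(1,2)[OF p(2,3)] by (simp del: tot_hom)
  next
   fix p q f assume "p \<in> obj ?L" "q \<in> obj ?L" and f: "f \<in> hom ?L p q"
   then obtain x i y j where p: "p = vpair x i" "x \<in> E.S" "i \<in> obj (E.dm x)" and q: "q = vpair y j" "y \<in> E.S" "j \<in> obj (E.dm y)"
    using oE by meson
   have f': "f \<in> hom ?K (pe x i) (pe y j)" using f p q by (simp add: pe_def)
   note mh = m[OF p(2) q(2) p(3) q(3) f']
   have "m x y i j f \<in> omap (lhom C (P x) (P y)) (i, j)" using mh p q P unfolding pc_def by simp
   then have h: "mmap ?I (vpair x i) (vpair y j) f = f" "mmap ?FQ (vpair x i) (vpair y j) f = m x y i j f"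
    using p q f Qm[OF p(2) q(2) p(3) q(3) f'] P by (simp_all add: Fm Ql)
   note ep = e[OF p(2,3)] and eq = e[OF q(2,3)]
   show "cmp ?L (omap ?FQ p) (omap ?FQ q) (omap ?I q) (\<sigma> (vfst q) (vsnd q)) (mmap ?FQ p q f) =
    cmp ?L (omap ?FQ p) (omap ?I p) (omap ?I q) (mmap ?I p q f) (\<sigma> (vfst p) (vsnd p))"
    using m\<sigma>[OF p(2) q(2) p(3) q(3) f'] mh sh(1)[OF p(2,3)] sh(1)[OF q(2,3)] f'
     E.G_cmp[OF ep(4) eq(4,3), of "\<sigma> y j" "m x y i j f"] E.G_cmp[OF ep(4,3) eq(3), of f "\<sigma> x i"]
    unfolding p(1) q(1) h ep(1,2) eq(1,2) ep(5,6) eq(5,6) by simp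
  qed
  moreover have "is_iso ?L (omap ?FQ p) (omap ?I p) (restrict (\<lambda>p. \<sigma> (vfst p) (vsnd p)) (obj ?L) p)" if p: "p \<in> obj ?L" for p
  proof -
   obtain x i where X: "p = vpair x i" "x \<in> E.S" "i \<in> obj (E.dm x)" using oE[OF p] by blast
   note e' = e[OF X(2,3)] and s = sh[OF X(2,3)] and G' = G[OF X(2,3)]
   show ?thesis
    using p s E.G_cmp[OF e'(4,3,4), of "\<tau> x i" "\<sigma> x i"] E.G_cmp[OF e'(3,4,3), of "\<sigma> x i" "\<tau> x i"] E.G_idm[OF e'(3)] E.G_idm[OF e'(4)] e'(3,4) G'
    unfolding X(1) e'(1,2) e'(5,6) is_iso_def by (auto simp del: tot_idm tot_hom tot_obj)
  qed
  ultimately show "naturally_isomorphic ?L ?L ?FQ ?I" unfolding naturally_isomorphic_def by blast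
 qed
 show ?thesis unfolding equivalent_in_def
  using C E.Gamma_lp F Q \<eta> \<epsilon> by (auto intro!: bexI[of _ F] bexI[of _ Q])
qed

section \<open>Restriction to the absolute-tensored LexProf-categories\<close>

lemma full_sub_simps [simp]:
 "tobj (full_sub K S) = tobj K \<inter> S" "thom (full_sub K S) = thom K" "tid (full_sub K S) = tid K" "tcmp (full_sub K S) = tcmp K"
 by (simp_all add: full_sub_def)

lemma two_category_full_sub:
 assumes "two_category K" shows "two_category (full_sub K S)"
 unfolding two_category_def full_sub_simps
proof (intro conjI, goal_cases)
 note t = assms[unfolded two_category_def]
 { case 1 show ?case using t[THEN conjunct1] by blast }
 note t = t[THEN conjunct2]
 { case 2 show ?case using t[THEN conjunct1] by blast }
 note t = t[THEN conjunct2]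
 { case 3 show ?case using t[THEN conjunct1] by blast }
 note t = t[THEN conjunct2]
 { case 4 show ?case using t[THEN conjunct1] by blast }
 note t = t[THEN conjunct2]
 { case 5 show ?case using t[THEN conjunct1] by blast }
 note t = t[THEN conjunct2]
 { case 6 show ?case using t[THEN conjunct1] by blast }
 { case 7 show ?case using t[THEN conjunct2] by blast }
qed

theorem theorem6p4:
 shows "two_functor PARFL LexProf_CAT
      (Gamma :: ('v::universe parfl, 'v vfunc, 'v => 'v, 'v lpcat, 'v lpfunc, 'v => 'v cell) twofunc)
  & local_equivalence PARFL LexProf_CAT (Gamma :: (_, _, _, 'v lpcat, _, _) twofunc)
  & biessential_image PARFL LexProf_CAT Gamma = {C :: 'v lpcat. lp_category C & absolute_tensored C}
  & biequivalence PARFL (full_sub LexProf_CAT {C. absolute_tensored C})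
     (Gamma :: (_, _, _, 'v lpcat, _, _) twofunc)"
proof (intro conjI)
 let ?G = "Gamma :: ('v parfl, 'v vfunc, 'v => 'v, 'v lpcat, 'v lpfunc, 'v => 'v cell) twofunc"
 let ?L = "full_sub LexProf_CAT {C :: 'v lpcat. absolute_tensored C}"
 show tf: "two_functor PARFL LexProf_CAT ?G" by (rule Gamma_two_functor)
 show le: "local_equivalence PARFL LexProf_CAT ?G" by (rule Gamma_local_equivalence)
 have Ga: "lp_category (Gamma_obj A) & absolute_tensored (Gamma_obj A)" if "partially_lex_cat A" for A :: "'v parfl"
  using restrictions_absolute_tensored[OF _ Gamma_restrictions[OF that]] parflcat.Gamma_lp[OF parflcat.intro[OF that]] by blast
 show bi: "biessential_image PARFL LexProf_CAT ?G = {C. lp_category C & absolute_tensored C}"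
 proof (intro set_eqI iffI)
  fix C :: "'v lpcat" assume "C \<in> biessential_image PARFL LexProf_CAT ?G"
  then obtain A :: "'v parfl" where C: "lp_category C" and A: "partially_lex_cat A" and e: "equivalent_in LexProf_CAT C (Gamma_obj A)"
   unfolding biessential_image_def by auto
  then show "C \<in> {C. lp_category C & absolute_tensored C}"
   using restrictions_absolute_tensored[OF C restrictions_equivalent[OF e Gamma_restrictions[OF A]]] by blast
 next
  fix C :: "'v lpcat" assume "C \<in> {C. lp_category C & absolute_tensored C}"
  then have C: "lp_category C" and r: "has_restrictions C" using absolute_tensored_restrictions by blast+
  show "C \<in> biessential_image PARFL LexProf_CAT ?G"
   unfolding biessential_image_def using C gen_parfl[OF C r] restrictions_Gamma[OF C r] by auto
 qed
 \<comment> \<open>The sub-2-category has the same hom-categories and composition, so it has the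
   same equivalences between its objects.\<close>
 have eq: "equivalent_in ?L C D" if "equivalent_in LexProf_CAT C D" "C \<in> tobj ?L" "D \<in> tobj ?L" for C D
  using that unfolding equivalent_in_def full_sub_simps by blast
 show "biequivalence PARFL ?L ?G"
  unfolding biequivalence_def
 proof (intro conjI)
  show "two_functor PARFL ?L ?G"
   using tf two_category_full_sub[OF two_category_LexProf, of "{C. absolute_tensored C}"] Ga unfolding two_functor_def full_sub_simps by simp
  show "local_equivalence PARFL ?L ?G" using le unfolding local_equivalence_def full_sub_simps .
  show "biessential_image PARFL ?L ?G = tobj ?L"
  proof (intro set_eqI iffI)
   fix C assume C: "C \<in> tobj ?L"
   then obtain A :: "'v parfl" where A: "A \<in> tobj PARFL" "equivalent_in LexProf_CAT C (tfo ?G A)"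
    using bi unfolding biessential_image_def by auto
   then have "equivalent_in ?L C (tfo ?G A)" using C Ga by (intro eq) auto
   then show "C \<in> biessential_image PARFL ?L ?G" unfolding biessential_image_def using A C by blast
  qed (simp add: biessential_image_def)
 qed
qed

end
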